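(* Let $S=\mathbb{H}/G$ be a finite area hyperbolic 2-orbifold, let $\gamma_1,\ldots,\gamma_n$ be disjoint simple closed geodesics on $S$ which together bound a subsurface $M$ of $S$, let $\Gamma=\bigcup_i\gamma_i$ be the boundary of $M$ and $l(\Gamma)=\sum_{i=1}^n l(\gamma_i)$ its total length. Then for almost all $v\in T_1S$ the excursion parameters $\{(t_i,s_i)\}_{i=1}^\infty$ of the geodesic ray $\alpha_v$ into $M$ satisfy $$\lim_{t\to\infty}\frac1t\,\#\{n\mid t_n<t\}=\frac{l(\Gamma)}{\pi\,\mathrm{area}(S)}.$$
   Context: $\mathbb{H}$ is the Poincaré upper half-plane, $G\subset \mathrm{PSL}_2(\mathbb{R})$ is a discrete group, and $S=\mathbb{H}/G$ has finite hyperbolic area. $l(\beta)$ denotes the hyperbolic length of a closed geodesic $\beta$, $\mathrm{area}(T)$ the hyperbolic area of $T\subset S$, and $\#X$ the cardinality of $X$. $T_1S$ is the unit tangent bundle and $G_t$ the geodesic flow on it. "Almost all $v\in T_1S$" is with respect to the flow-invariant Liouville probability measure, whose lift to $T_1\mathbb{H}=\mathbb{H}\times S^1$ is $\frac{1}{2\pi\,\mathrm{area}(S)}\,dA\,d\phi$. That $\gamma_1,\dots,\gamma_n$ bound $M$ means that $M$ is a subsurface with boundary $\Gamma$, lying locally on one side of each $\gamma_i$. For $v\in T_1S$, $\alpha_v:[0,\infty)\to S$ is the unit-speed geodesic ray obtained by projecting the forward orbit $\{G_t(v)\mid t\ge 0\}$ to $S$; $\alpha_v$ also denotes its image. If $\alpha_v$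 intersects $\Gamma$ infinitely often, there is a sequence of pairs of parameter values $\{(t_i,s_i)\}_{i=1}^\infty$ with $t_i<s_i<t_{i+1}$ such that $\alpha_v$ meets $M$ in precisely the arcs of $\alpha_v$ over the parameter intervals from $t_i$ to $s_i$, i.e. $\bigcup_{i=1}^\infty\alpha_v[(t_i,s_i)]=\alpha_v\cap M$. These arcs are the excursions of $\alpha_v$ into $M$, and the pairs $(t_i,s_i)$ are the excursion parameters of $\alpha_v$. (Almost every $v$ has $\alpha_v$ meeting $\Gamma$ infinitely often.) *)

theory Defs
  imports "HOL-Analysis.Analysis" "HOL-Algebra.Coset"
begin

definition quotient_topology :: "'a topology \<Rightarrow> ('a \<Rightarrow> 'b) \<Rightarrow> 'b topology" where
  "quotient_topology X p =
     topology (\<lambda>U. U \<subseteq> p ` topspace X \<and> openin X {x \<in> topspace X. p x \<in> U})"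

lemma openin_quotient_topology:
  "openin (quotient_topology X p) U \<longleftrightarrow>
     U \<subseteq> p ` topspace X \<and> openin X {x \<in> topspace X. p x \<in> U}"
proof -
  have "istopology (\<lambda>U. U \<subseteq> p ` topspace X \<and> openin X {x \<in> topspace X. p x \<in> U})"
    unfolding istopology_def
  proof (intro conjI allI impI)
    fix S T assume "S \<subseteq> p ` topspace X \<and> openin X {x \<in> topspace X. p x \<in> S}"
      "T \<subseteq> p ` topspace X \<and> openin X {x \<in> topspace X. p x \<in> T}"
    moreover have "{x \<in> topspace X. p x \<in> S \<inter> T} =
      {x \<in> topspace X. p x \<in> S} \<inter> {x \<in> topspace X. p x \<in> T}" by auto
    ultimately show "S \<inter> T \<subseteq> p ` topspace X" "openin X {x \<in> topspace X. p x \<in> S \<inter> T}"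
      by auto
  next
    fix K assume K: "\<forall>S\<in>K. S \<subseteq> p ` topspace X \<and> openin X {x \<in> topspace X. p x \<in> S}"
    then show "\<Union>K \<subseteq> p ` topspace X" by auto
    have "{x \<in> topspace X. p x \<in> \<Union>K} = (\<Union>S\<in>K. {x \<in> topspace X. p x \<in> S})" by auto
    then show "openin X {x \<in> topspace X. p x \<in> \<Union>K}" using K by auto
  qed
  then show ?thesis by (simp add: quotient_topology_def)
qed

text \<open>
  The fibres of \<open>p\<close> will be the orbits of a countable group of measure-preserving
  transformations of \<open>M\<close>.  The quotient measure of \<open>A\<close> is then the \<open>M\<close>-measure of the part over
  \<open>A\<close> of any measurable fundamental domain; it is written here as the largest measure of a set
  over \<open>A\<close> that meets every fibre at most once, so that no fundamental domain has to be chosen.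
\<close>
definition quotient_measure :: "'a measure \<Rightarrow> ('a \<Rightarrow> 'b) \<Rightarrow> 'b measure" where
  "quotient_measure M p =
     measure_of (p ` space M) {A. A \<subseteq> p ` space M \<and> p -` A \<inter> space M \<in> sets M}
       (\<lambda>A. SUP B \<in> {B \<in> sets M. B \<subseteq> p -` A \<and> inj_on p B}. emeasure M B)"

lemma sigma_algebra_quotient:
  "sigma_algebra (p ` space M) {A. A \<subseteq> p ` space M \<and> p -` A \<inter> space M \<in> sets M}"
  (is "sigma_algebra _ ?S")
proof -
  have "{} \<in> ?S" by simp
  moreover have "p ` space M - A \<in> ?S" if "A \<in> ?S" for A
  proof -
    have "p -` (p ` space M - A) \<inter> space M = space M - (p -` A \<inter> space M)" by auto
    then show ?thesis using that by auto
  qed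
  moreover have "(\<Union>i. A i) \<in> ?S" if "range A \<subseteq> ?S" for A :: "nat \<Rightarrow> _"
  proof -
    have "p -` (\<Union>i. A i) \<inter> space M = (\<Union>i. p -` A i \<inter> space M)" by auto
    moreover have "(\<Union>i. p -` A i \<inter> space M) \<in> sets M" using that by (intro sets.countable_UN) auto
    ultimately show ?thesis using that by auto
  qed
  ultimately show ?thesis unfolding sigma_algebra_iff2 by auto
qed

lemma space_quotient_measure [simp]: "space (quotient_measure M p) = p ` space M"
  unfolding quotient_measure_def by (rule space_measure_of) auto

lemma sets_quotient_measure:
  "sets (quotient_measure M p) = {A. A \<subseteq> p ` space M \<and> p -` A \<inter> space M \<in> sets M}"
  unfolding quotient_measure_def
  by (subst sets_measure_of) (auto intro!: sigma_algebra.sigma_sets_eq sigma_algebra_quotient)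

lemma emeasure_quotient_measure:
  assumes "A \<in> sets (quotient_measure M p)"
  shows "emeasure (quotient_measure M p) A =
    (SUP B \<in> {B \<in> sets M. B \<subseteq> p -` A \<and> inj_on p B}. emeasure M B)"
proof (rule emeasure_measure_of[OF quotient_measure_def])
  let ?F = "\<lambda>A. {B \<in> sets M. B \<subseteq> p -` A \<and> inj_on p B}"
  let ?\<mu> = "\<lambda>A. SUP B \<in> ?F A. emeasure M B"
  show "positive (sets (quotient_measure M p)) ?\<mu>"
    by (auto simp: positive_def bot_ennreal intro!: antisym SUP_least)
  show "countably_additive (sets (quotient_measure M p)) ?\<mu>"
    unfolding countably_additive_def
  proof (intro allI impI antisym)
    fix A :: "nat \<Rightarrow> _" assume A: "range A \<subseteq> sets (quotient_measure M p)" and d: "disjoint_family A"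
    have m: "p -` A i \<inter> space M \<in> sets M" for i using A by (auto simp: sets_quotient_measure)
    show "?\<mu> (\<Union>i. A i) \<le> (\<Sum>i. ?\<mu> (A i))"
    proof (rule SUP_least)
      fix B assume B: "B \<in> ?F (\<Union>i. A i)"
      let ?B = "\<lambda>i. B \<inter> (p -` A i \<inter> space M)"
      have sB: "?B i \<in> sets M" for i using B m by auto
      have "B = (\<Union>i. ?B i)" using B sets.sets_into_space by fastforce
      moreover have "disjoint_family ?B" using d by (fastforce simp: disjoint_family_on_def)
      ultimately have "emeasure M B = (\<Sum>i. emeasure M (?B i))"
        using sB by (subst suminf_emeasure) auto
      also have "\<dots> \<le> (\<Sum>i. ?\<mu> (A i))"
        using sB B by (intro suminf_le SUP_upper) (auto intro: inj_on_subset)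
      finally show "emeasure M B \<le> (\<Sum>i. ?\<mu> (A i))" .
    qed
    show "(\<Sum>i. ?\<mu> (A i)) \<le> ?\<mu> (\<Union>i. A i)"
    proof -
      have fin: "(\<Sum>i<k. ?\<mu> (A i)) \<le> ?\<mu> (\<Union>i. A i)" for k
      proof -
        have bd: "(\<Sum>i<k. emeasure M (C i)) \<le> ?\<mu> (\<Union>i. A i)" if C: "\<And>i. C i \<in> ?F (A i)" for C
        proof -
          have dC: "disjoint_family C"
            unfolding disjoint_family_on_def
          proof (intro ballI impI)
            fix m n :: nat assume "m \<noteq> n"
            then have "A m \<inter> A n = {}" using d by (auto simp: disjoint_family_on_def)
            then show "C m \<inter> C n = {}" using C[of m] C[of n] by blast
          qed
          have "(\<Sum>i<k. emeasure M (C i)) = emeasure M (\<Union>i<k. C i)"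
          proof (rule sum_emeasure)
            show "C ` {..<k} \<subseteq> sets M" using C by auto
            show "disjoint_family_on C {..<k}"
              using dC by (auto simp: disjoint_family_on_def)
          qed simp
          also have "\<dots> \<le> ?\<mu> (\<Union>i. A i)"
          proof (rule SUP_upper)
            have "inj_on p (\<Union>i<k. C i)"
            proof (rule inj_onI)
              fix x y assume x: "x \<in> (\<Union>i<k. C i)" and y: "y \<in> (\<Union>i<k. C i)" and e: "p x = p y"
              then obtain i j where ij: "x \<in> C i" "y \<in> C j" by auto
              then have "p x \<in> A i" "p y \<in> A j" using C by blast+
              then have "i = j" using d e by (fastforce simp: disjoint_family_on_def)
              then show "x = y" using ij e C[of i] by (auto dest: inj_onD)
            qed
            moreover have "(\<Union>i<k. C i) \<subseteq> p -` (\<Union>i. A i)" using C by blast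
            moreover have "(\<Union>i<k. C i) \<in> sets M" using C by auto
            ultimately show "(\<Union>i<k. C i) \<in> ?F (\<Union>i. A i)" by auto
          qed
          finally show ?thesis .
        qed
        have "(\<Sum>i<j. ?\<mu> (A i)) + (\<Sum>i\<in>{j..<k}. emeasure M (C i)) \<le> ?\<mu> (\<Union>i. A i)"
          if "j \<le> k" "\<And>i. C i \<in> ?F (A i)" for j C
          using that
        proof (induction j arbitrary: C)
          case 0
          then show ?case using bd[of C] by (simp add: atLeast0LessThan)
        next
          case (Suc j)
          have *: "emeasure M b + ((\<Sum>i<j. ?\<mu> (A i)) + (\<Sum>i\<in>{Suc j..<k}. emeasure M (C i)))
              \<le> ?\<mu> (\<Union>i. A i)" if b: "b \<in> ?F (A j)" for b
          proof -
            have "(\<Sum>i<j. ?\<mu> (A i)) + (\<Sum>i\<in>{j..<k}. emeasure M ((C(j:=b)) i)) \<le> ?\<mu> (\<Union>i. A i)"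
              using Suc.prems b by (intro Suc.IH) auto
            moreover have "(\<Sum>i\<in>{j..<k}. emeasure M ((C(j:=b)) i)) =
                emeasure M b + (\<Sum>i\<in>{Suc j..<k}. emeasure M (C i))"
              using Suc.prems(1) by (subst sum.atLeast_Suc_lessThan) auto
            ultimately show ?thesis by (simp add: ac_simps)
          qed
          have "?\<mu> (A j) + ((\<Sum>i<j. ?\<mu> (A i)) + (\<Sum>i\<in>{Suc j..<k}. emeasure M (C i))) =
            (SUP b \<in> ?F (A j). emeasure M b +
               ((\<Sum>i<j. ?\<mu> (A i)) + (\<Sum>i\<in>{Suc j..<k}. emeasure M (C i))))"
          proof -
            have "{} \<in> ?F (A j)" by auto
            then have "?F (A j) \<noteq> {}" by blast
            then show ?thesis by (subst ennreal_SUP_add_left) auto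
          qed
          also have "\<dots> \<le> ?\<mu> (\<Union>i. A i)" using * by (intro SUP_least) auto
          finally show ?case by (simp add: ac_simps)
        qed
        from this[of k "\<lambda>_. {}"] show ?thesis by simp
      qed
      show ?thesis by (rule suminf_le_const[OF summableI fin])
    qed
  qed
qed (use assms in \<open>auto simp: sets_quotient_measure\<close>)

definition SL2R :: "(real^2^2) monoid" where
  "SL2R = \<lparr>carrier = {A. det A = 1}, monoid.mult = (**), one = mat 1\<rparr>"

definition PSL2R :: "(real^2^2) set monoid" where
  "PSL2R = SL2R Mod {mat 1, - mat 1}"

definition PSL2R_topology :: "(real^2^2) set topology" where
  "PSL2R_topology =
     quotient_topology (top_of_set (carrier SL2R)) (\<lambda>A. {mat 1, - mat 1} #>\<^bsub>SL2R\<^esub> A)"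

definition fuchsian_group :: "(real^2^2) set set \<Rightarrow> bool" where
  "fuchsian_group G \<longleftrightarrow>
     subgroup G PSL2R \<and> subtopology PSL2R_topology G = discrete_topology G"

definition upper_half_plane :: "complex set" (\<open>\<H>\<close>) where
  "\<H> = {z. Im z > 0}"

definition mobius :: "real^2^2 \<Rightarrow> complex \<Rightarrow> complex" where
  "mobius A z = (of_real (A$1$1) * z + of_real (A$1$2)) / (of_real (A$2$1) * z + of_real (A$2$2))"

text \<open>
  A unit tangent vector is a pair of its base point \<open>z \<in> \<H>\<close> and its direction \<open>u\<close>, \<open>\<bar>u\<bar> = 1\<close>;
  as a Euclidean vector it is \<open>Im z \<cdot> u\<close>.
\<close>
definition T1H :: "(complex \<times> complex) set" where
  "T1H = \<H> \<times> sphere 0 1"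

definition mobius_T1 :: "real^2^2 \<Rightarrow> complex \<times> complex \<Rightarrow> complex \<times> complex" where
  "mobius_T1 A = (\<lambda>(z, u). (mobius A z, sgn (deriv (mobius A) z) * u))"

text \<open>
  An element of \<open>PSL2R\<close> is a set \<open>{A, - A}\<close> whose two members act in the same way, so
  \<open>\<Union>G\<close> consists of the matrices of the elements of \<open>G\<close>.
\<close>
definition orbit :: "(real^2^2) set set \<Rightarrow> complex \<Rightarrow> complex set" where
  "orbit G z = {mobius A z | A. A \<in> \<Union>G}"

definition orbit_T1 :: "(real^2^2) set set \<Rightarrow> complex \<times> complex \<Rightarrow> (complex \<times> complex) set" where
  "orbit_T1 G v = {mobius_T1 A v | A. A \<in> \<Union>G}"

definition orbifold :: "(real^2^2) set set \<Rightarrow> complex set topology" where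
  "orbifold G = quotient_topology (top_of_set \<H>) (orbit G)"

definition hyp_measure :: "complex measure" where
  "hyp_measure = density (restrict_space lborel \<H>) (\<lambda>z. ennreal (1 / (Im z)\<^sup>2))"

definition area_measure :: "(real^2^2) set set \<Rightarrow> complex set measure" where
  "area_measure G = quotient_measure hyp_measure (orbit G)"

definition orbifold_area :: "(real^2^2) set set \<Rightarrow> real" where
  "orbifold_area G = measure (area_measure G) (topspace (orbifold G))"

definition finite_area :: "(real^2^2) set set \<Rightarrow> bool" where
  "finite_area G \<longleftrightarrow> emeasure (area_measure G) (topspace (orbifold G)) < \<infinity>"

definition circle_measure :: "complex measure" where
  "circle_measure =
     distr (restrict_space lborel {0..<2 * pi}) (restrict_space borel (sphere 0 1)) cis"

text \<open>
  The elements of the space of \<open>liouville G\<close>, i.e. the unit tangent vectors of the orbifold,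
  are the \<open>G\<close>-orbits in \<open>T1H\<close>.
\<close>
definition liouville :: "(real^2^2) set set \<Rightarrow> (complex \<times> complex) set measure" where
  "liouville G = quotient_measure
     (scale_measure (ennreal (1 / (2 * pi * orbifold_area G))) (hyp_measure \<Otimes>\<^sub>M circle_measure))
     (orbit_T1 G)"

definition hyp_dist :: "complex \<Rightarrow> complex \<Rightarrow> real" where
  "hyp_dist z w = arcosh (1 + (cmod (z - w))\<^sup>2 / (2 * Im z * Im w))"

definition geodesic_line :: "(real \<Rightarrow> complex) \<Rightarrow> bool" where
  "geodesic_line c \<longleftrightarrow> range c \<subseteq> \<H> \<and> (\<forall>s t. hyp_dist (c s) (c t) = \<bar>s - t\<bar>)"

definition geodesic_from :: "complex \<times> complex \<Rightarrow> real \<Rightarrow> complex" where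
  "geodesic_from = (\<lambda>(z, u). THE c. geodesic_line c \<and> c 0 = z \<and>
     (c has_vector_derivative Im z *\<^sub>R u) (at 0))"

definition geodesic_flow :: "real \<Rightarrow> complex \<times> complex \<Rightarrow> complex \<times> complex" where
  "geodesic_flow t v =
     (geodesic_from v t, sgn (vector_derivative (geodesic_from v) (at t)))"

text \<open>
  The flow commutes with the action of \<open>PSL2R\<close> and so maps orbits to orbits: for a tangent
  vector \<open>V\<close> of the orbifold, \<open>geodesic_flow t ` V\<close> is again one, and the set of its base
  points is a point of the orbifold.
\<close>
definition geodesic_ray :: "(complex \<times> complex) set \<Rightarrow> real \<Rightarrow> complex set" where
  "geodesic_ray V t = fst ` geodesic_flow t ` V"

text \<open>\<open>\<gamma>\<close> is parametrized by arc length over all of \<open>\<real>\<close> and \<open>l\<close> is its length.\<close>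
definition simple_closed_geodesic ::
    "(real^2^2) set set \<Rightarrow> (real \<Rightarrow> complex set) \<Rightarrow> real \<Rightarrow> bool" where
  "simple_closed_geodesic G \<gamma> l \<longleftrightarrow>
     (\<exists>c. geodesic_line c \<and> \<gamma> = orbit G \<circ> c) \<and>
     l > 0 \<and> (\<forall>t. \<gamma> (t + l) = \<gamma> t) \<and> inj_on \<gamma> {0..<l}"

text \<open>
  The two components of \<open>\<H> - range c\<close> are the sides of the lift \<open>c\<close> of \<open>\<gamma>\<close>: near each point of
  \<open>c\<close>, the preimage of \<open>M\<close> in \<open>\<H>\<close> is one of these sides together with \<open>c\<close> itself.
\<close>
definition locally_on_one_side ::
    "(real^2^2) set set \<Rightarrow> complex set set \<Rightarrow> (real \<Rightarrow> complex set) \<Rightarrow> bool" where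
  "locally_on_one_side G M \<gamma> \<longleftrightarrow>
     (\<forall>c t. geodesic_line c \<and> \<gamma> = orbit G \<circ> c \<longrightarrow>
       (\<exists>C \<in> components (\<H> - range c). \<exists>e>0. \<forall>z \<in> \<H> \<inter> ball (c t) e.
          orbit G z \<in> M \<longleftrightarrow> z \<in> C \<union> range c))"

definition bound_subsurface ::
    "(real^2^2) set set \<Rightarrow> nat \<Rightarrow> (nat \<Rightarrow> real \<Rightarrow> complex set) \<Rightarrow> complex set set \<Rightarrow> bool" where
  "bound_subsurface G n \<gamma> M \<longleftrightarrow>
     closedin (orbifold G) M \<and>
     orbifold G frontier_of M = (\<Union>i<n. range (\<gamma> i)) \<and>
     (\<forall>i<n. locally_on_one_side G M (\<gamma> i))"

definition excursion_parameters ::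
    "complex set set \<Rightarrow> (complex \<times> complex) set \<Rightarrow> (nat \<Rightarrow> real) \<Rightarrow> (nat \<Rightarrow> real) \<Rightarrow> bool" where
  "excursion_parameters M V t s \<longleftrightarrow>
     0 \<le> t 0 \<and> (\<forall>i. t i < s i \<and> s i < t (Suc i)) \<and>
     {r. 0 \<le> r \<and> geodesic_ray V r \<in> M} = (\<Union>i. {t i..s i})"

end

theory Submission
  imports Defs "HOL-Real_Asymp.Real_Asymp"
begin

text \<open>
  Hopf's argument, applied to the number of times a geodesic crosses the lifts of \<open>\<Gamma>\<close> to \<open>\<H>\<close>.
  Parametrize unit tangent vectors by the forward endpoint \<open>y\<close>, a coordinate \<open>x\<close> determined by the
  backward endpoint \<open>y - 1 / x\<close>, and a time \<open>s\<close> along the geodesic. In these coordinates Liouville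
  measure is a multiple of Lebesgue measure and the flow translates \<open>s\<close>.

  Geodesics with the same forward endpoint are asymptotic, and only boundedly many lifts meet a
  segment of bounded hyperbolic length, so their crossing counts up to a given time differ by a
  bounded amount. The forward crossing rate thus depends only on \<open>y\<close> and the backward one only on
  \<open>y - 1 / x\<close>. By the maximal ergodic inequality the upper forward rate is almost nowhere larger than
  the lower backward rate, and by Fubini's theorem both are then almost everywhere equal to one constant.
  This constant is the mean number of crossings in unit time. Unfolding the quotient reduces the mean to the flux
  through a geodesic segment of length \<open>l\<close>, which is \<open>4 * l\<close>, so the mean is \<open>2 * l(\<Gamma>) / (\<pi> * area(S))\<close>.
  As \<open>M\<close> lies on one side of each lift, every crossing is an entrance or an exit, and excursions come
  at half the crossing rate.
\<close>

text \<open>A crossing count is not continuous, so closeness of asymptotic geodesics says nothing by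
  itself. What replaces continuity is that a lift separates \<H>: of two geodesics followed over the
  same time, just one can cross a given lift only if the lift meets one of the two segments joining
  their initial points and their end points. Convergence of averages is never presupposed: on the
  invariant set where the forward upper rate exceeds \<open>b\<close> and the backward lower rate is
  below \<open>a < b\<close>, the maximal inequality for the flow and for its inverse squeezes the
  integral of the count between \<open>b\<close> and \<open>a\<close> times the measure, so the set
  is null.

  The flux 4 l is l times the integral of |sin| over the circle, and 2 pi area(S) is the total mass
  before normalization. Quotients are treated on \<open>T1H\<close> itself: functions on the
  quotient are invariant functions, integrated over a fundamental domain, and unfolding costs a
  factor 2 because \<open>A\<close> and \<open>- A\<close> act alike. Cone points are countable in
  \<H>, hence negligible, and none lies on a lift, since a half turn there would fold a geodesic
  that is injective on its period.\<close>

section \<open>Change of variables for Lebesgue integrals\<close>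

lemma nn_integral_substitution_inj:
  fixes f :: "real \<Rightarrow> ennreal" and g g' :: "real \<Rightarrow> real"
  assumes S: "S \<in> sets borel" and T: "g ` S = T" "T \<in> sets borel"
    and der: "\<And>x. x \<in> S \<Longrightarrow> (g has_field_derivative g' x) (at x)"
    and inj: "inj_on g S"
    and [measurable]: "g \<in> borel_measurable borel" "g' \<in> borel_measurable borel" "f \<in> borel_measurable borel"
  shows "(\<integral>\<^sup>+x. f (g x) * ennreal \<bar>g' x\<bar> * indicator S x \<partial>lborel) = (\<integral>\<^sup>+x. f x * indicator T x \<partial>lborel)"
proof -
  note [measurable] = S T(2)
  define M1 where "M1 = distr (density lborel (\<lambda>x. ennreal \<bar>g' x\<bar> * indicator S x)) borel g"
  define M2 where "M2 = density lborel (\<lambda>x::real. indicator T x :: ennreal)"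
  \<comment> \<open>For measures it suffices to treat indicators of Borel sets. There both sides are
    integrals of real functions, to which the change of variables theorem for absolutely integrable
    functions applies.\<close>
  have "M1 = M2"
  proof (rule measure_eqI)
    show "sets M1 = sets M2" by (simp add: M1_def M2_def)
    fix A assume "A \<in> sets M1"
    then have [measurable]: "A \<in> sets borel" by (simp add: M1_def)
    define h where "h x = indicator S x * (\<bar>g' x\<bar> * indicator A (g x))" for x :: real
    define k where "k x = (indicator T x * indicator A x :: real)" for x :: real
    have [measurable]: "h \<in> borel_measurable borel" "k \<in> borel_measurable borel"
      unfolding h_def k_def by measurable
    have h0: "h x \<ge> 0" and k0: "k x \<ge> 0" for x by (auto simp: h_def k_def)
    have e1: "emeasure M1 A = (\<integral>\<^sup>+x. ennreal (h x) \<partial>lborel)"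
    proof -
      have "emeasure M1 A = (\<integral>\<^sup>+x. ennreal \<bar>g' x\<bar> * indicator S x * indicator (g -` A) x \<partial>lborel)"
        unfolding M1_def using measurable_sets_borel[of g borel A]
        by (subst emeasure_distr) (simp_all add: emeasure_density)
      also have "\<dots> = (\<integral>\<^sup>+x. ennreal (h x) \<partial>lborel)"
        by (intro nn_integral_cong) (auto simp: h_def indicator_def)
      finally show ?thesis .
    qed
    have e2: "emeasure M2 A = (\<integral>\<^sup>+x. ennreal (k x) \<partial>lborel)"
      unfolding M2_def by (subst emeasure_density) (auto simp: k_def indicator_def intro!: nn_integral_cong)
    have cv: "(\<lambda>x. \<bar>g' x\<bar> * indicator A (g x)) absolutely_integrable_on S \<and>
           integral S (\<lambda>x. \<bar>g' x\<bar> * indicator A (g x)) = b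
      \<longleftrightarrow> (indicator A :: real \<Rightarrow> real) absolutely_integrable_on (g ` S) \<and> integral (g ` S) (indicator A :: real \<Rightarrow> real) = b" for b
      using S inj der
      by (intro has_absolute_integral_change_of_variables_1') (auto intro: has_field_derivative_at_within)
    have i1: "(\<lambda>x. \<bar>g' x\<bar> * indicator A (g x)) absolutely_integrable_on S \<longleftrightarrow> integrable lborel h"
      unfolding set_integrable_def by (subst integrable_completion) (auto simp: h_def[abs_def])
    have i2: "(indicator A :: real \<Rightarrow> real) absolutely_integrable_on T \<longleftrightarrow> integrable lborel k"
      unfolding set_integrable_def by (subst integrable_completion) (auto simp: k_def[abs_def])
    have j1: "integral S (\<lambda>x. \<bar>g' x\<bar> * indicator A (g x)) = integral\<^sup>L lborel h" if "integrable lborel h"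
    proof -
      have "integral S (\<lambda>x. \<bar>g' x\<bar> * indicator A (g x)) = (LINT x:S|lebesgue. \<bar>g' x\<bar> * indicator A (g x))"
        using that i1 by (metis set_lebesgue_integral_eq_integral(2))
      also have "\<dots> = integral\<^sup>L lborel h" unfolding set_lebesgue_integral_def
        by (subst integral_completion) (auto simp: h_def[abs_def])
      finally show ?thesis .
    qed
    have j2: "integral T (indicator A :: real \<Rightarrow> real) = integral\<^sup>L lborel k" if "integrable lborel k"
    proof -
      have "integral T (indicator A :: real \<Rightarrow> real) = (LINT x:T|lebesgue. indicator A x)"
        using that i2 by (metis set_lebesgue_integral_eq_integral(2))
      also have "\<dots> = integral\<^sup>L lborel k" unfolding set_lebesgue_integral_def
        by (subst integral_completion) (auto simp: k_def[abs_def])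
      finally show ?thesis .
    qed
    show "emeasure M1 A = emeasure M2 A"
    proof (cases "integrable lborel h")
      case True
      then have "integrable lborel k" and "integral\<^sup>L lborel h = integral\<^sup>L lborel k"
        using cv[of "integral\<^sup>L lborel h"] i1 i2 j1 j2 unfolding T(1) by auto
      then show ?thesis unfolding e1 e2 using True by (subst (1 2) nn_integral_eq_integral) (auto simp: h0 k0)
    next
      \<comment> \<open>The change of variables is an equivalence of integrability, so here both
        sides are infinite.\<close>
      case False
      then have "\<not> integrable lborel k" using cv[of "integral T (indicator A)"] i1 i2 unfolding T(1) by auto
      then show ?thesis using False unfolding e1 e2 integrable_iff_bounded
        by (auto simp: h0 k0 less_top[symmetric])
    qed
  qed
  then have "(\<integral>\<^sup>+x. f x \<partial>M1) = (\<integral>\<^sup>+x. f x \<partial>M2)" by simp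
  moreover have "(\<integral>\<^sup>+x. f x \<partial>M1) = (\<integral>\<^sup>+x. f (g x) * ennreal \<bar>g' x\<bar> * indicator S x \<partial>lborel)"
    unfolding M1_def by (subst nn_integral_distr) (auto simp: nn_integral_density ac_simps)
  moreover have "(\<integral>\<^sup>+x. f x \<partial>M2) = (\<integral>\<^sup>+x. f x * indicator T x \<partial>lborel)"
    unfolding M2_def by (subst nn_integral_density) (auto simp: ac_simps)
  ultimately show ?thesis by simp
qed

lemma lborel_complex: "(lborel :: complex measure) = distr (lborel \<Otimes>\<^sub>M lborel) borel (\<lambda>(a, b). Complex a b)"
proof -
  have m: "(\<lambda>(a, b). Complex a b) \<in> borel_measurable (lborel \<Otimes>\<^sub>M lborel)"
    unfolding Complex_eq by (simp add: split_beta')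
  show ?thesis
  proof (rule lborel_eqI)
    fix l u :: complex assume "\<And>b. b \<in> Basis \<Longrightarrow> l \<bullet> b \<le> u \<bullet> b"
    then have le: "Re l \<le> Re u" "Im l \<le> Im u"
      by (auto simp: Basis_complex_def dest: meta_spec[of _ 1] meta_spec[of _ \<i>])
    have "(\<lambda>(a, b). Complex a b) -` box l u \<inter> space (lborel \<Otimes>\<^sub>M lborel) = {Re l<..<Re u} \<times> {Im l<..<Im u}"
      by (auto simp: box_def Basis_complex_def space_pair_measure)
    then have "emeasure (distr (lborel \<Otimes>\<^sub>M lborel) borel (\<lambda>(a, b). Complex a b)) (box l u)
       = emeasure (lborel \<Otimes>\<^sub>M lborel) ({Re l<..<Re u} \<times> {Im l<..<Im u})"
      using m by (subst emeasure_distr) auto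
    also have "\<dots> = ennreal (Re u - Re l) * ennreal (Im u - Im l)"
      using le by (subst lborel.emeasure_pair_measure_Times) auto
    also have "\<dots> = (\<Prod>b\<in>Basis. (u - l) \<bullet> b)"
      using le by (simp add: Basis_complex_def ennreal_mult)
    finally show "emeasure (distr (lborel \<Otimes>\<^sub>M lborel) borel (\<lambda>(a, b). Complex a b)) (box l u) = (\<Prod>b\<in>Basis. (u - l) \<bullet> b)" .
  qed simp
qed

lemma nn_integral_lborel_complex:
  fixes f :: "complex \<Rightarrow> ennreal"
  assumes [measurable]: "f \<in> borel_measurable borel"
  shows "(\<integral>\<^sup>+z. f z \<partial>lborel) = (\<integral>\<^sup>+a. \<integral>\<^sup>+b. f (Complex a b) \<partial>lborel \<partial>lborel)"
proof -
  have [measurable]: "(\<lambda>(a, b). Complex a b) \<in> borel_measurable (lborel \<Otimes>\<^sub>M lborel)"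
    unfolding Complex_eq by (simp add: split_beta')
  have "(\<integral>\<^sup>+z. f z \<partial>lborel) = (\<integral>\<^sup>+p. f ((\<lambda>(a, b). Complex a b) p) \<partial>(lborel \<Otimes>\<^sub>M lborel))"
    by (subst lborel_complex, subst nn_integral_distr) auto
  also have "\<dots> = (\<integral>\<^sup>+a. \<integral>\<^sup>+b. f (Complex a b) \<partial>lborel \<partial>lborel)"
    by (subst lborel.nn_integral_fst[symmetric]) auto
  finally show ?thesis .
qed

section \<open>The maximal ergodic inequality\<close>

text \<open>The maximum of the Birkhoff sums of lengths 0 to \<open>n\<close>, the empty sum
  included. The recursion gives at once the identity with \<open>T\<close> that holds wherever the
  maximum is positive.\<close>

primrec max_partial_sum :: "('a \<Rightarrow> 'a) \<Rightarrow> ('a \<Rightarrow> real) \<Rightarrow> nat \<Rightarrow> 'a \<Rightarrow> real" where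
  "max_partial_sum T g 0 x = 0"
| "max_partial_sum T g (Suc n) x = max 0 (g x + max_partial_sum T g n (T x))"

lemma max_partial_sum_nonneg: "max_partial_sum T g n x \<ge> 0"
  by (cases n) auto

lemma max_partial_sum_mono: "max_partial_sum T g n x \<le> max_partial_sum T g (Suc n) x"
proof (induction n arbitrary: x)
  case (Suc n)
  show ?case unfolding max_partial_sum.simps(2)[of T g n x] max_partial_sum.simps(2)[of T g "Suc n" x]
    by (intro max.mono add_left_mono Suc.IH) auto
qed simp

lemma birkhoff_sum_Suc:
  fixes f :: "'a \<Rightarrow> real"
  shows "(\<Sum>k<Suc n. f ((T ^^ k) x)) = f x + (\<Sum>k<n. f ((T ^^ k) (T x)))"
  by (subst sum.lessThan_Suc_shift) (simp add: funpow_swap1)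

lemma sum_le_max_partial_sum: "(\<Sum>k<n. g ((T ^^ k) x)) \<le> max_partial_sum T g n x"
proof (induction n arbitrary: x)
  case (Suc n) show ?case unfolding birkhoff_sum_Suc using Suc.IH[of "T x"] by simp
qed simp

text \<open>Garsia's argument: \<open>g \<ge> m\<^sub>n\<^sub>+\<^sub>1 - m\<^sub>n\<^sub>+\<^sub>1 \<circ> T\<close> where \<open>m\<^sub>n\<^sub>+\<^sub>1 > 0\<close>.\<close>

lemma maximal_ergodic:
  assumes fin: "finite_measure M" and T[measurable]: "T \<in> measurable M M" and mpt: "distr M M T = M"
    and f: "integrable M f" and E[measurable]: "E \<in> sets M"
    and inv: "\<And>x. x \<in> space M \<Longrightarrow> T x \<in> E \<longleftrightarrow> x \<in> E"
    and big: "\<And>x. x \<in> E \<Longrightarrow> \<exists>n::nat. (\<Sum>k<n. f ((T ^^ k) x)) > b * real n"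
  shows "b * measure M E \<le> (\<integral>x\<in>E. f x \<partial>M)"
proof -
  interpret finite_measure M by fact
  note [measurable] = borel_measurable_integrable[OF f]
  \<comment> \<open>Cutting down to the invariant set and subtracting \<open>b\<close> reduces the
    claim to a nonnegative integral: from a point of \<open>E\<close> the sums of \<open>g\<close>
    are those of \<open>f\<close> minus \<open>b * n\<close>, and elsewhere they vanish.\<close>
  define g where "g x = indicator E x * (f x - b)" for x
  have g: "integrable M g" unfolding g_def
    using f by (intro integrable_mult_indicator[where 'b=real, simplified]) auto
  then have [measurable]: "g \<in> borel_measurable M" by simp
  let ?m = "max_partial_sum T g"
  have int_T: "integrable M (\<lambda>x. h (T x)) \<and> integral\<^sup>L M (\<lambda>x. h (T x)) = integral\<^sup>L M h" if "integrable M h" for h :: "_ \<Rightarrow> real"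
    using that mpt T by (metis borel_measurable_integrable integrable_distr integral_distr)
  have m: "integrable M (?m n)" for n
  proof (induction n)
    case (Suc n)
    have "integrable M (\<lambda>x. max 0 (g x + ?m n (T x)))"
      using g int_T[OF Suc] by (intro integrable_max) auto
    then show ?case by simp
  qed simp
  then have [measurable]: "?m n \<in> borel_measurable M" for n by blast
  define P where "P n = {x \<in> space M. ?m n x > 0}" for n
  have [measurable]: "P n \<in> sets M" for n unfolding P_def by measurable
  have "0 \<le> (\<integral>x. indicator (P (Suc n)) x * g x \<partial>M)" for n
  proof -
    \<comment> \<open>The integral of \<open>m - m \<circ> T\<close> vanishes because
      \<open>T\<close> preserves the measure.\<close>
    have "0 = (\<integral>x. ?m (Suc n) x - ?m (Suc n) (T x) \<partial>M)"
      using int_T[OF m[of "Suc n"]] by (subst Bochner_Integration.integral_diff[OF m]) (auto simp del: max_partial_sum.simps)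
    also have "\<dots> \<le> (\<integral>x. indicator (P (Suc n)) x * g x \<partial>M)"
    proof (rule integral_mono)
      show "integrable M (\<lambda>x. ?m (Suc n) x - ?m (Suc n) (T x))"
        using m[of "Suc n"] int_T[OF m[of "Suc n"]] by (simp del: max_partial_sum.simps)
      show "integrable M (\<lambda>x. indicator (P (Suc n)) x * g x)"
        using g by (intro integrable_mult_indicator[where 'b=real, simplified]) auto
      fix x assume x: "x \<in> space M"
      show "?m (Suc n) x - ?m (Suc n) (T x) \<le> indicator (P (Suc n)) x * g x"
      proof (cases "?m (Suc n) x > 0")
        case True
        then have "?m (Suc n) x = g x + ?m n (T x)" by (simp split: if_splits add: max_def)
        then show ?thesis using True x max_partial_sum_mono[of T g n "T x"] by (simp add: P_def)
      next
        case False
        then have "?m (Suc n) x = 0" using max_partial_sum_nonneg[of T g "Suc n" x] by linarith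
        then show ?thesis using False max_partial_sum_nonneg[of T g "Suc n" "T x"] by (simp add: P_def)
      qed
    qed
    finally show ?thesis .
  qed
  \<comment> \<open>The sets \<open>P n\<close> increase to the points with some positive sum, which
    include all of \<open>E\<close>. Off \<open>E\<close> the function \<open>g\<close> is zero, so
    the limit is its full integral.\<close>
  moreover have "(\<lambda>n. \<integral>x. indicator (P (Suc n)) x * g x \<partial>M) \<longlonglongrightarrow> (\<integral>x. g x \<partial>M)"
  proof (rule integral_dominated_convergence[where w = "\<lambda>x. \<bar>g x\<bar>"])
    show "AE x in M. (\<lambda>n. indicator (P (Suc n)) x * g x) \<longlonglongrightarrow> g x"
    proof (rule AE_I2)
      fix x assume x: "x \<in> space M"
      show "(\<lambda>n. indicator (P (Suc n)) x * g x) \<longlonglongrightarrow> g x"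
      proof (cases "x \<in> E")
        case False then show ?thesis by (simp add: g_def)
      next
        case True
        then obtain n where n: "(\<Sum>k<n. f ((T ^^ k) x)) > b * real n" using big by blast
        have "(T ^^ k) x \<in> E" for k
          using True inv sets.sets_into_space[OF E] by (induction k) auto
        then have "(\<Sum>k<n. g ((T ^^ k) x)) = (\<Sum>k<n. f ((T ^^ k) x)) - b * real n"
          by (simp add: g_def sum_subtractf)
        then have "?m n x > 0" using n sum_le_max_partial_sum[of g T x n] by linarith
        then have pos: "?m k x > 0" if "k \<ge> n" for k
          using that lift_Suc_mono_le[of "\<lambda>k. ?m k x" n k, OF max_partial_sum_mono] by linarith
        have "\<forall>\<^sub>F k in sequentially. indicator (P (Suc k)) x * g x = g x"
          using eventually_ge_at_top[of n] by eventually_elim (use x pos in \<open>simp add: P_def del: max_partial_sum.simps\<close>)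
        then show ?thesis by (rule tendsto_eventually)
      qed
    qed
  qed (use g in \<open>auto simp: abs_mult indicator_def\<close>)
  ultimately have "0 \<le> (\<integral>x. g x \<partial>M)" by (intro LIMSEQ_le_const) auto
  also have "\<dots> = (\<integral>x. indicator E x * f x - b * indicator E x \<partial>M)" by (simp add: g_def algebra_simps)
  also have "\<dots> = (\<integral>x. indicator E x * f x \<partial>M) - (\<integral>x. b * indicator E x \<partial>M)"
  proof (rule Bochner_Integration.integral_diff)
    show "integrable M (\<lambda>x. indicator E x * f x)"
      using integrable_mult_indicator[OF E f] by simp
    show "integrable M (\<lambda>x. b * indicator E x)"
      by (intro integrable_mult_right integrable_real_indicator E) (simp add: less_top[symmetric])
  qed
  also have "\<dots> = (\<integral>x\<in>E. f x \<partial>M) - b * measure M E"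
    by (simp add: set_lebesgue_integral_def)
  finally show ?thesis by simp
qed

text \<open>\<open>freq_above s b\<close> says \<open>limsup (s n / n) > b\<close>.\<close>

definition freq_above :: "(nat \<Rightarrow> real) \<Rightarrow> real \<Rightarrow> bool" where
  "freq_above s b \<longleftrightarrow> (\<exists>j::nat. \<forall>m. \<exists>n\<ge>m. s n > (b + 1 / Suc j) * real n)"

lemma freq_aboveI:
  assumes "b' > b" "\<And>m. \<exists>n\<ge>m. s n \<ge> b' * real n"
  shows "freq_above s b"
proof -
  obtain j where j: "1 / real (Suc j) < b' - b" using assms(1) nat_approx_posE[of "b' - b"] by auto
  show ?thesis unfolding freq_above_def
  proof (rule exI[of _ j], rule allI)
    fix m
    obtain n where n: "n \<ge> Suc m" "s n \<ge> b' * real n" using assms(2) by blast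
    then have "(b + 1 / Suc j) * real n < b' * real n" using j by (intro mult_strict_right_mono) auto
    then show "\<exists>n\<ge>m. s n > (b + 1 / Suc j) * real n" using n by (intro exI[of _ n] conjI) linarith+
  qed
qed

lemma not_freq_above:
  assumes "\<not> freq_above s b" "b' > b"
  shows "\<forall>\<^sub>F n in sequentially. s n < b' * real n"
  using assms freq_aboveI[of b b' s] unfolding eventually_sequentially by (meson not_le)

text \<open>A bounded error and a shift of the index are negligible against \<open>n\<close>, so
  half of the margin \<open>1 / Suc j\<close> absorbs them once \<open>n\<close> is large.\<close>

lemma freq_above_perturb:
  assumes "freq_above s b" and close: "\<And>n. \<bar>s n - s' (n + k)\<bar> \<le> K"
  shows "freq_above s' b"
proof -
  obtain j where j: "\<forall>m. \<exists>n\<ge>m. s n > (b + 1 / Suc j) * real n" using assms(1) freq_above_def by blast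
  define d where "d = 1 / (2 * real (Suc j))"
  have d: "d > 0" "1 / real (Suc j) = 2 * d" by (auto simp: d_def field_simps)
  show ?thesis
  proof (rule freq_aboveI[of b "b + d"])
    fix m
    obtain n where n: "n \<ge> m + nat \<lceil>(K + \<bar>b + d\<bar> * real k) / d\<rceil>" "s n > (b + 1 / Suc j) * real n" using j by blast
    then have "real n \<ge> (K + \<bar>b + d\<bar> * real k) / d" by linarith
    then have "d * real n \<ge> K + \<bar>b + d\<bar> * real k" using d by (simp add: field_simps)
    moreover have "\<bar>b + d\<bar> * real k \<ge> (b + d) * real k" by (intro mult_right_mono) auto
    moreover have "s n > (b + d) * real n + d * real n" using n(2) unfolding d(2) by (simp add: algebra_simps)
    moreover have "s' (n + k) \<ge> s n - K" using close[of n] by linarith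
    ultimately have "s' (n + k) \<ge> (b + d) * real (n + k)" by (simp add: algebra_simps)
    then show "\<exists>n\<ge>m. s' n \<ge> (b + d) * real n" using n(1) by (intro exI[of _ "n + k"]) auto
  qed (use d in simp)
qed

lemma freq_above_perturb_rev:
  assumes "freq_above s' b" and close: "\<And>n. \<bar>s n - s' (n + k)\<bar> \<le> K"
  shows "freq_above s b"
proof -
  obtain j where j: "\<forall>m. \<exists>n\<ge>m. s' n > (b + 1 / Suc j) * real n" using assms(1) freq_above_def by blast
  define d where "d = 1 / (2 * real (Suc j))"
  have d: "d > 0" "1 / real (Suc j) = 2 * d" by (auto simp: d_def field_simps)
  show ?thesis
  proof (rule freq_aboveI[of b "b + d"])
    fix m
    obtain n' where n': "n' \<ge> m + k + nat \<lceil>(K + \<bar>b + d\<bar> * real k) / d\<rceil>" "s' n' > (b + 1 / Suc j) * real n'" using j by blast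
    define n where "n = n' - k"
    have nn: "n' = n + k" "n \<ge> m" "n \<ge> nat \<lceil>(K + \<bar>b + d\<bar> * real k) / d\<rceil>" using n'(1) unfolding n_def by linarith+
    then have "real n \<ge> (K + \<bar>b + d\<bar> * real k) / d" by linarith
    then have "d * real n \<ge> K + \<bar>b + d\<bar> * real k" using d by (simp add: field_simps)
    moreover have "\<bar>b + d\<bar> * real k \<ge> - (b + d) * real k" by (intro mult_right_mono) auto
    moreover have "s' n' > (b + d) * real n + (b + d) * real k + d * real n + d * real k"
      using n'(2) unfolding d(2) nn(1) by (simp add: algebra_simps)
    moreover have "d * real k \<ge> 0" using d by simp
    moreover have "s n \<ge> s' n' - K" unfolding nn(1) using close[of n] by linarith
    ultimately have "s n \<ge> (b + d) * real n" by (simp add: algebra_simps)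
    then show "\<exists>n\<ge>m. s n \<ge> (b + d) * real n" using nn(2) by blast
  qed (use d in simp)
qed

lemma freq_above_cong:
  assumes "\<And>n. \<bar>s n - s' (n + k)\<bar> \<le> K"
  shows "freq_above s b \<longleftrightarrow> freq_above s' b"
  using assms freq_above_perturb freq_above_perturb_rev by blast

lemma freq_above_uminus_cong:
  assumes "\<And>n. \<bar>s n - s' (n + k)\<bar> \<le> K"
  shows "freq_above (\<lambda>n. - s n) b \<longleftrightarrow> freq_above (\<lambda>n. - s' n) b"
  by (rule freq_above_cong[where k = k and K = K]) (use assms in \<open>simp add: abs_minus_commute\<close>)

lemma freq_aboveD: "freq_above s b \<Longrightarrow> \<exists>n. s n > b * real n"
proof -
  assume "freq_above s b"
  then obtain j where "\<forall>m. \<exists>n\<ge>m. s n > (b + 1 / Suc j) * real n" using freq_above_def by blast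
  then obtain n where "s n > (b + 1 / Suc j) * real n" by blast
  moreover have "(b + 1 / Suc j) * real n \<ge> b * real n" by (intro mult_right_mono) auto
  ultimately show ?thesis by (intro exI[of _ n]) linarith
qed

lemma measurable_freq_above [measurable (raw)]:
  assumes [measurable]: "\<And>n. (\<lambda>x. s x n) \<in> borel_measurable M"
  shows "Measurable.pred M (\<lambda>x. freq_above (s x) b)"
  unfolding freq_above_def by measurable

section \<open>Invertible transformations preserving a finite measure\<close>

locale invertible_mpt = finite_measure M for M :: "'a measure" +
  fixes T T' :: "'a \<Rightarrow> 'a"
  assumes T [measurable]: "T \<in> measurable M M" and T' [measurable]: "T' \<in> measurable M M"
    and mpt: "distr M M T = M"
    and inv: "\<And>x. x \<in> space M \<Longrightarrow> T (T' x) = x" "\<And>x. x \<in> space M \<Longrightarrow> T' (T x) = x"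
begin

lemma mpt': "distr M M T' = M"
proof -
  have "distr M M T' = distr (distr M M T) M T'" by (simp add: mpt)
  also have "\<dots> = distr M M (\<lambda>x. T' (T x))" by (subst distr_distr) (auto simp: comp_def)
  also have "\<dots> = distr M M (\<lambda>x. x)" by (intro distr_cong) (auto simp: inv)
  finally show ?thesis by simp
qed

text \<open>With \<open>f' = f \<circ> T'\<close> the backward sums become Birkhoff sums of
  \<open>T'\<close>, so the maximal inequality applies to \<open>f\<close> with \<open>T\<close> and
  to \<open>- f'\<close> with \<open>T'\<close> on one and the same set. One step of
  \<open>T\<close> changes each sum by one term, which makes this set invariant, and the two bounds
  give \<open>(b - a) * measure M E \<le> 0\<close>.\<close>

lemma two_sided_null:
  assumes f: "integrable M f" and ab: "a < b"
  shows "AE x in M. \<not> (freq_above (\<lambda>n. \<Sum>k<n. f ((T ^^ k) x)) b \<and>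
      freq_above (\<lambda>n. - (\<Sum>k<n. f ((T' ^^ Suc k) x))) (- a))"
proof -
  note [measurable] = borel_measurable_integrable[OF f]
  define f' where "f' x = f (T' x)" for x
  have [measurable]: "f' \<in> borel_measurable M" unfolding f'_def by measurable
  let ?S = "\<lambda>x n. \<Sum>k<n. f ((T ^^ k) x)" and ?S' = "\<lambda>x n. \<Sum>k<n. f' ((T' ^^ k) x)"
  have f': "integrable M f'" unfolding f'_def using f mpt' T' by (metis integrable_distr)
  define E where "E = {x \<in> space M. freq_above (?S x) b \<and> freq_above (\<lambda>n. - ?S' x n) (- a)}"
  have E[measurable]: "E \<in> sets M" unfolding E_def by measurable
  have shift1: "\<bar>?S (T x) n - ?S x (n + 1)\<bar> \<le> \<bar>f x\<bar>" for x n
    using birkhoff_sum_Suc[of f T x n] by simp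
  have shift2: "\<bar>?S' (T' x) n - ?S' x (n + 1)\<bar> \<le> \<bar>f' x\<bar>" for x n
    using birkhoff_sum_Suc[of f' T' x n] by simp
  have invE: "T x \<in> E \<longleftrightarrow> x \<in> E" if x: "x \<in> space M" for x
  proof -
    have "T x \<in> space M" using measurable_space[OF T x] .
    moreover have "freq_above (?S (T x)) b = freq_above (?S x) b" by (rule freq_above_cong[where k = 1 and K = "\<bar>f x\<bar>"]) (rule shift1)
    moreover have "freq_above (\<lambda>n. - ?S' x n) (- a) = freq_above (\<lambda>n. - ?S' (T x) n) (- a)"
      using freq_above_uminus_cong[where k = 1 and K = "\<bar>f' (T x)\<bar>" and s = "?S' (T' (T x))" and s' = "?S' (T x)", OF shift2[of "T x"]] x
      by (simp only: inv)
    ultimately show ?thesis using x by (simp add: E_def)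
  qed
  have invE': "T' x \<in> E \<longleftrightarrow> x \<in> E" if x: "x \<in> space M" for x
    using invE[of "T' x"] x inv measurable_space[OF T' x] by auto
  have "b * measure M E \<le> (\<integral>x\<in>E. f x \<partial>M)"
    by (rule maximal_ergodic[OF finite_measure_axioms T mpt f E invE]) (auto simp: E_def intro: freq_aboveD)
  moreover have "- a * measure M E \<le> (\<integral>x\<in>E. - f' x \<partial>M)"
    by (rule maximal_ergodic[OF finite_measure_axioms T' mpt' _ E invE'])
       (use f' in \<open>auto simp: E_def sum_negf dest!: freq_aboveD\<close>)
  moreover have "(\<integral>x\<in>E. f' x \<partial>M) = (\<integral>x\<in>E. f x \<partial>M)"
  proof -
    have "(\<integral>x\<in>E. f x \<partial>M) = (\<integral>x. indicator E x * f x \<partial>(distr M M T'))"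
      by (simp add: set_lebesgue_integral_def mpt')
    also have "\<dots> = (\<integral>x. indicator E (T' x) * f (T' x) \<partial>M)" by (subst integral_distr) auto
    also have "\<dots> = (\<integral>x\<in>E. f' x \<partial>M)" unfolding set_lebesgue_integral_def f'_def
      by (intro Bochner_Integration.integral_cong) (auto simp: indicator_def invE')
    finally show ?thesis by simp
  qed
  moreover have "(\<integral>x\<in>E. - f' x \<partial>M) = - (\<integral>x\<in>E. f' x \<partial>M)" by (simp add: set_lebesgue_integral_def)
  ultimately have "(b - a) * measure M E \<le> 0" by (simp add: algebra_simps)
  then have "measure M E = 0" using ab by (simp add: mult_le_0_iff) (metis measure_nonneg order_antisym)
  then have "E \<in> null_sets M" by (simp add: null_setsI emeasure_eq_measure)
  then have "AE x in M. x \<notin> E" by (rule AE_not_in)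
  then show ?thesis by (rule AE_mp) (auto intro!: AE_I2 simp: E_def f'_def funpow_swap1)
qed

text \<open>A level exceeded by the upper rate almost everywhere is at most the mean. Applied to the
  crossing count and to its negative, this identifies the constant rate with the mean without a
  pointwise ergodic theorem.\<close>

lemma mean_ge:
  assumes f: "integrable M f" and ae: "AE x in M. freq_above (\<lambda>n. \<Sum>k<n. f ((T ^^ k) x)) b"
  shows "b * measure M (space M) \<le> (\<integral>x. f x \<partial>M)"
proof -
  note [measurable] = borel_measurable_integrable[OF f]
  let ?S = "\<lambda>x n. \<Sum>k<n. f ((T ^^ k) x)"
  define E where "E = {x \<in> space M. freq_above (?S x) b}"
  have E[measurable]: "E \<in> sets M" unfolding E_def by measurable
  have shift1: "\<bar>?S (T x) n - ?S x (n + 1)\<bar> \<le> \<bar>f x\<bar>" for x n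
    using birkhoff_sum_Suc[of f T x n] by simp
  have invE: "T x \<in> E \<longleftrightarrow> x \<in> E" if x: "x \<in> space M" for x
    using x measurable_space[OF T x] freq_above_cong[where k = 1 and K = "\<bar>f x\<bar>" and s = "?S (T x)" and s' = "?S x", OF shift1]
    by (simp add: E_def)
  have "b * measure M E \<le> (\<integral>x\<in>E. f x \<partial>M)"
    by (rule maximal_ergodic[OF finite_measure_axioms T mpt f E invE]) (auto simp: E_def intro: freq_aboveD)
  moreover have "AE x in M. x \<in> E" using ae by (rule AE_mp) (auto intro!: AE_I2 simp: E_def)
  then have "measure M E = measure M (space M)" "(\<integral>x\<in>E. f x \<partial>M) = (\<integral>x. f x \<partial>M)"
    unfolding set_lebesgue_integral_def
    by (auto intro!: measure_eq_AE integral_cong_AE elim!: AE_mp)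
  ultimately show ?thesis by simp
qed

end

section \<open>Moebius transformations\<close>

text \<open>The automorphy factor: a cocycle by \<open>mden_mult\<close>, with
  \<open>1 / (mden A z)\<^sup>2\<close> as derivative of the Moebius map. Its modulus controls
  heights and its argument the rotation of tangent vectors.\<close>

definition mden :: "real^2^2 \<Rightarrow> complex \<Rightarrow> complex" where
  "mden A z = of_real (A$2$1) * z + of_real (A$2$2)"

definition mat2 :: "real \<Rightarrow> real \<Rightarrow> real \<Rightarrow> real \<Rightarrow> real^2^2" where
  "mat2 a b c d = vector [vector [a, b], vector [c, d]]"

text \<open>The adjugate, which is the inverse for determinant 1. It is polynomial in the entries
  and involutive without hypotheses.\<close>

definition adj2 :: "real^2^2 \<Rightarrow> real^2^2" where
  "adj2 A = mat2 (A$2$2) (- A$1$2) (- A$2$1) (A$1$1)"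

lemma mat2_nth [simp]:
  "mat2 a b c d $ 1 $ 1 = a" "mat2 a b c d $ 1 $ 2 = b" "mat2 a b c d $ 2 $ 1 = c" "mat2 a b c d $ 2 $ 2 = d"
  by (auto simp: mat2_def)

lemma mat2_eqI: "A = B" if "A$1$1 = B$1$1" "A$1$2 = B$1$2" "A$2$1 = B$2$1" "A$2$2 = B$2$2" for A B :: "real^2^2"
  using that by (simp add: vec_eq_iff forall_2)

lemma matrix_mult_2_nth:
  fixes A B :: "real^2^2"
  shows "(A ** B) $ i $ j = A$i$1 * B$1$j + A$i$2 * B$2$j"
  by (simp add: matrix_matrix_mult_def sum_2)

lemma det_adj2 [simp]: "det (adj2 A) = det A"
  by (simp add: det_2 adj2_def)

lemma adj2_adj2 [simp]: "adj2 (adj2 A) = A"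
  by (rule mat2_eqI) (auto simp: adj2_def)

lemma adj2_mult: "det A = 1 \<Longrightarrow> adj2 A ** A = mat 1" "det A = 1 \<Longrightarrow> A ** adj2 A = mat 1"
  by (rule mat2_eqI; simp add: matrix_mult_2_nth adj2_def mat_def det_2 algebra_simps)+

lemma det_mult_1: "det A = 1 \<Longrightarrow> det B = 1 \<Longrightarrow> det (A ** B) = 1" for A B :: "real^2^2"
  by (simp add: det_mul)

lemma mobius_eq: "mobius A z = (of_real (A$1$1) * z + of_real (A$1$2)) / mden A z"
  by (simp add: mobius_def mden_def)

lemma mden_nonzero:
  assumes "det A = 1" "z \<in> \<H>" shows "mden A z \<noteq> 0"
proof
  assume 0: "mden A z = 0"
  then have "Im (mden A z) = 0" "Re (mden A z) = 0" by auto
  then have "A$2$1 = 0" "A$2$2 = 0" using assms(2) by (auto simp: mden_def upper_half_plane_def)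
  then show False using assms(1) by (simp add: det_2)
qed

lemma Im_mobius:
  assumes "det A = 1" "z \<in> \<H>" shows "Im (mobius A z) = Im z / (cmod (mden A z))\<^sup>2"
proof -
  have "Im (mobius A z) = Im ((of_real (A$1$1) * z + of_real (A$1$2)) * cnj (mden A z)) / (cmod (mden A z))\<^sup>2"
    unfolding mobius_eq by (simp add: complex_div_cnj[of _ "mden A z"] Im_divide_of_real)
  also have "Im ((of_real (A$1$1) * z + of_real (A$1$2)) * cnj (mden A z)) = Im z * det A"
    by (simp add: mden_def det_2 algebra_simps)
  finally show ?thesis using assms by simp
qed

lemma mobius_in_H [simp]: "det A = 1 \<Longrightarrow> z \<in> \<H> \<Longrightarrow> mobius A z \<in> \<H>"
  using Im_mobius[of A z] mden_nonzero[of A z] by (auto simp: upper_half_plane_def)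

lemma mden_mult:
  assumes "det A = 1" "det B = 1" "z \<in> \<H>"
  shows "mden (A ** B) z = mden A (mobius B z) * mden B z"
  using mden_nonzero[OF assms(2,3)] unfolding mobius_eq mden_def[of A] mden_def[of "A ** B"] matrix_mult_2_nth
  by (simp add: divide_simps) (simp add: mden_def algebra_simps)

lemma mobius_mult:
  assumes "det A = 1" "det B = 1" "z \<in> \<H>"
  shows "mobius (A ** B) z = mobius A (mobius B z)"
proof -
  have B: "mden B z \<noteq> 0" using assms mden_nonzero by blast
  have "mobius (A ** B) z * mden (A ** B) z = (of_real (A$1$1) * mobius B z + of_real (A$1$2)) * mden B z"
    using B mden_nonzero[OF det_mult_1[OF assms(1,2)] assms(3)]
    unfolding mobius_eq[of "A ** B"] mobius_eq[of B] matrix_mult_2_nth by (simp add: field_simps) (simp add: mden_def algebra_simps)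
  also have "\<dots> = mobius A (mobius B z) * mden (A ** B) z"
    using mden_nonzero[OF assms(1) mobius_in_H[OF assms(2,3)]]
    unfolding mobius_eq[of A] mden_mult[OF assms] by simp
  finally show ?thesis using mden_nonzero[OF det_mult_1[OF assms(1,2)] assms(3)] by simp
qed

lemma mobius_one [simp]: "mobius (mat 1) z = z" by (simp add: mobius_def mat_def)

lemma mobius_uminus [simp]: "mobius (- A) z = mobius A z"
proof -
  have "mobius (- A) z = (- (of_real (A$1$1) * z + of_real (A$1$2))) / (- (of_real (A$2$1) * z + of_real (A$2$2)))"
    unfolding mobius_def by (simp add: algebra_simps)
  then show ?thesis by (simp only: mobius_def minus_divide_divide)
qed

lemma mobius_adj2 [simp]:
  "det A = 1 \<Longrightarrow> z \<in> \<H> \<Longrightarrow> mobius (adj2 A) (mobius A z) = z"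
  "det A = 1 \<Longrightarrow> z \<in> \<H> \<Longrightarrow> mobius A (mobius (adj2 A) z) = z"
  by (simp_all add: mobius_mult[symmetric] adj2_mult)

lemma mobius_diff:
  assumes "det A = 1" "z \<in> \<H>" "w \<in> \<H>"
  shows "mobius A z - mobius A w = (z - w) / (mden A z * mden A w)"
proof -
  have "(mobius A z - mobius A w) * (mden A z * mden A w)
    = (of_real (A$1$1) * z + of_real (A$1$2)) * mden A w - (of_real (A$1$1) * w + of_real (A$1$2)) * mden A z"
    using mden_nonzero[OF assms(1,2)] mden_nonzero[OF assms(1,3)] unfolding mobius_eq by (simp add: field_simps)
  also have "\<dots> = (z - w) * of_real (det A)" by (simp add: mden_def det_2 algebra_simps)
  finally show ?thesis using assms mden_nonzero[OF assms(1,2)] mden_nonzero[OF assms(1,3)] by (simp add: field_simps)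
qed

lemma mobius_deriv:
  assumes "det A = 1" "z \<in> \<H>"
  shows "(mobius A has_field_derivative 1 / (mden A z)\<^sup>2) (at z)"
proof -
  have n: "of_real (A$2$1) * z + of_real (A$2$2) \<noteq> 0" using mden_nonzero[OF assms] by (simp add: mden_def)
  have d: "of_real (A$1$1) * of_real (A$2$2) - of_real (A$1$2) * of_real (A$2$1) = (1 :: complex)"
    using assms(1) unfolding det_2 by (metis of_real_1 of_real_diff of_real_mult)
  show ?thesis unfolding mobius_def[abs_def] mden_def
    by (rule derivative_eq_intros refl n | (use n d in \<open>simp add: power2_eq_square divide_simps\<close>; algebra))+
qed

lemma mobius_T1_eq:
  assumes "det A = 1" "z \<in> \<H>"
  shows "mobius_T1 A (z, u) = (mobius A z, sgn (1 / (mden A z)\<^sup>2) * u)"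
  by (simp add: mobius_T1_def DERIV_imp_deriv[OF mobius_deriv[OF assms]])

lemma T1H_iff: "(z, u) \<in> T1H \<longleftrightarrow> Im z > 0 \<and> cmod u = 1"
  by (simp add: T1H_def upper_half_plane_def)

lemma mobius_T1_in [simp]: "det A = 1 \<Longrightarrow> v \<in> T1H \<Longrightarrow> mobius_T1 A v \<in> T1H"
  using mden_nonzero[of A "fst v"]
  by (cases v) (auto simp: mobius_T1_eq T1H_def norm_mult norm_divide norm_sgn)

lemma mobius_T1_fst: "fst (mobius_T1 A v) = mobius A (fst v)"
  by (cases v) (simp add: mobius_T1_def)

lemma mobius_T1_mult:
  assumes "det A = 1" "det B = 1" "v \<in> T1H"
  shows "mobius_T1 (A ** B) v = mobius_T1 A (mobius_T1 B v)"
proof -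
  obtain z u where v: "v = (z, u)" "z \<in> \<H>" using assms(3) by (auto simp: T1H_def)
  show ?thesis unfolding v(1) using assms v(2)
    by (simp add: mobius_T1_eq det_mult_1 mobius_mult mden_mult power_mult_distrib sgn_mult[symmetric] mult.assoc[symmetric])
qed

lemma mobius_T1_one [simp]: "v \<in> T1H \<Longrightarrow> mobius_T1 (mat 1) v = v"
  by (cases v) (simp add: T1H_def mobius_T1_eq det_I, simp add: mden_def mat_def)

lemma mobius_T1_uminus [simp]: "mobius_T1 (- A) v = mobius_T1 A v"
proof -
  have "mobius (- A) = mobius A" by (rule ext) simp
  then show ?thesis by (cases v) (simp add: mobius_T1_def)
qed

lemma mobius_T1_adj2 [simp]:
  "det A = 1 \<Longrightarrow> v \<in> T1H \<Longrightarrow> mobius_T1 (adj2 A) (mobius_T1 A v) = v"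
  "det A = 1 \<Longrightarrow> v \<in> T1H \<Longrightarrow> mobius_T1 A (mobius_T1 (adj2 A) v) = v"
  by (simp_all add: mobius_T1_mult[symmetric] adj2_mult)

section \<open>Geodesics\<close>

text \<open>This is \<open>2 * (cosh d - 1)\<close> for the hyperbolic distance \<open>d\<close>.
  Being rational in the coordinates, it keeps the computations with geodesics algebraic.\<close>

definition hdelta :: "complex \<Rightarrow> complex \<Rightarrow> real" where
  "hdelta z w = (cmod (z - w))\<^sup>2 / (Im z * Im w)"

lemma hdelta_mobius:
  assumes "det A = 1" "z \<in> \<H>" "w \<in> \<H>"
  shows "hdelta (mobius A z) (mobius A w) = hdelta z w"
proof -
  have "cmod (mden A z) \<noteq> 0" "cmod (mden A w) \<noteq> 0" using mden_nonzero assms by auto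
  then show ?thesis using assms
    by (simp add: hdelta_def mobius_diff Im_mobius norm_divide norm_mult power_divide power_mult_distrib field_simps)
qed

lemma hyp_dist_eq_hdelta: "hyp_dist z w = arcosh (1 + hdelta z w / 2)"
  by (simp add: hyp_dist_def hdelta_def mult.commute[of 2] mult.assoc)

lemma hdelta_nonneg: "z \<in> \<H> \<Longrightarrow> w \<in> \<H> \<Longrightarrow> hdelta z w \<ge> 0"
  by (auto simp: hdelta_def upper_half_plane_def)

lemma hyp_dist_eq_iff:
  assumes "z \<in> \<H>" "w \<in> \<H>"
  shows "hyp_dist z w = \<bar>t\<bar> \<longleftrightarrow> 1 + hdelta z w / 2 = cosh t"
proof
  assume "hyp_dist z w = \<bar>t\<bar>"
  then have "cosh (arcosh (1 + hdelta z w / 2)) = cosh \<bar>t\<bar>" by (simp only: hyp_dist_eq_hdelta)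
  then show "1 + hdelta z w / 2 = cosh t" using hdelta_nonneg[OF assms] by simp
next
  assume "1 + hdelta z w / 2 = cosh t"
  then have "hyp_dist z w = arcosh (cosh \<bar>t\<bar>)" by (simp add: hyp_dist_eq_hdelta)
  then show "hyp_dist z w = \<bar>t\<bar>" using arcosh_cosh_real[of "\<bar>t\<bar>"] by simp
qed

lemma geodesic_line_iff:
  "geodesic_line c \<longleftrightarrow> range c \<subseteq> \<H> \<and> (\<forall>s t. 1 + hdelta (c s) (c t) / 2 = cosh (s - t))"
  unfolding geodesic_line_def using hyp_dist_eq_iff by (metis rangeI subset_iff)

text \<open>The inverse of the height, normalized to 1 at time 0. The inverse height is a coordinate
  of the hyperboloid model, hence a combination of \<open>cosh\<close> and \<open>sinh\<close> along
  a geodesic, and its initial slope is \<open>- Im u\<close>.\<close>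

definition gden :: "complex \<Rightarrow> real \<Rightarrow> real" where
  "gden u t = cosh t - Im u * sinh t"

definition gpoint :: "complex \<Rightarrow> complex \<Rightarrow> real \<Rightarrow> complex" where
  "gpoint z u t = Complex (Re z + Im z * Re u * sinh t / gden u t) (Im z / gden u t)"

text \<open>Unlike the point, the direction after time \<open>t\<close> does not depend on \<open>z\<close>.\<close>

definition gdir :: "complex \<Rightarrow> real \<Rightarrow> complex" where
  "gdir u t = Complex (Re u / gden u t) ((Im u * cosh t - sinh t) / gden u t)"

definition gflow :: "real \<Rightarrow> complex \<times> complex \<Rightarrow> complex \<times> complex" where
  "gflow t v = (gpoint (fst v) (snd v) t, gdir (snd v) t)"

lemma gden_pos:
  assumes "cmod u = 1" shows "gden u t > 0"
proof -
  have "Im u * sinh t \<le> \<bar>Im u\<bar> * \<bar>sinh t\<bar>" by (metis abs_ge_self abs_mult)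
  also have "\<dots> \<le> 1 * \<bar>sinh t\<bar>" using abs_Im_le_cmod[of u] assms by (intro mult_right_mono) auto
  also have "\<dots> < cosh t" using sinh_less_cosh_real[of t] sinh_less_cosh_real[of "- t"] by (auto simp: abs_if)
  finally show ?thesis by (simp add: gden_def)
qed

lemma unit_sq: "cmod u = 1 \<Longrightarrow> (Re u)\<^sup>2 + (Im u)\<^sup>2 = 1"
  using cmod_power2[of u] by simp

lemma cmod_gdir:
  assumes "cmod u = 1" shows "cmod (gdir u t) = 1"
proof -
  have D: "gden u t > 0" by (rule gden_pos[OF assms])
  have "(Re u)\<^sup>2 + (Im u * cosh t - sinh t)\<^sup>2 = (gden u t)\<^sup>2"
    using unit_sq[OF assms] cosh_square_eq[of t] unfolding gden_def by algebra
  then have "(cmod (gdir u t))\<^sup>2 = 1" using D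
    by (simp add: cmod_power2 gdir_def power_divide add_divide_distrib[symmetric])
  then show ?thesis by (simp add: power2_eq_1_iff) (metis norm_ge_zero not_one_le_zero order_trans neg_0_le_iff_le zero_le_one)
qed

lemma gflow_in [simp]: "v \<in> T1H \<Longrightarrow> gflow t v \<in> T1H"
  using gden_pos cmod_gdir by (cases v) (auto simp: T1H_iff gflow_def gpoint_def)

lemma gpoint_in: "(z, u) \<in> T1H \<Longrightarrow> gpoint z u t \<in> \<H>"
  using gflow_in[of "(z, u)" t] by (simp add: gflow_def T1H_def)

text \<open>Normalized inverse heights multiply along the flow. With this cocycle identity the group
  law of the flow reduces to addition formulas.\<close>

lemma gden_gdir:
  assumes "cmod u = 1" shows "gden (gdir u t) s * gden u t = gden u (s + t)"
proof -
  have "gden u t \<noteq> 0" using gden_pos[OF assms, of t] by simp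
  then have "(x - y / gden u t * w) * gden u t = x * gden u t - y * w" for x y w by (simp add: field_simps)
  then have "gden (gdir u t) s * gden u t = cosh s * gden u t - (Im u * cosh t - sinh t) * sinh s"
    unfolding gden_def[of "gdir u t"] by (simp add: gdir_def)
  then show ?thesis by (simp add: gden_def cosh_add sinh_add algebra_simps)
qed

lemma gflow_add:
  assumes "v \<in> T1H" shows "gflow s (gflow t v) = gflow (s + t) v"
proof -
  obtain z u where v: "v = (z, u)" "Im z > 0" "cmod u = 1" using assms by (cases v) (auto simp: T1H_iff)
  define D where "D = gden u t"
  define E where "E = gden (gdir u t) s"
  have D: "D > 0" and E: "E > 0" using gden_pos v cmod_gdir by (auto simp: D_def E_def)
  have DE: "gden u (s + t) = E * D" using gden_gdir[OF v(3), of t s] by (simp add: D_def E_def)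
  have D': "cosh t - Im u * sinh t = D" by (simp add: D_def gden_def)
  have E': "cosh s * D - (Im u * cosh t - sinh t) * sinh s = E * D"
    unfolding DE[symmetric] by (simp add: gden_def D_def cosh_add sinh_add algebra_simps)
  have p: "cosh t ^ 2 = sinh t ^ 2 + 1" by (rule cosh_square_eq)
  have 1: "Re z + Im z * Re u * sinh t / D + Im z / D * (Re u / D) * sinh s / E = Re z + Im z * Re u * sinh (s + t) / (E * D)"
  proof -
    have "sinh t * E * D + sinh s = sinh (s + t) * D" unfolding sinh_add using E' D' p by algebra
    then have "sinh t / D + sinh s / (D * D * E) = sinh (s + t) / (E * D)"
      using D E by (simp add: divide_simps) (simp add: algebra_simps)
    then have "Im z * Re u * (sinh t / D + sinh s / (D * D * E)) = Im z * Re u * (sinh (s + t) / (E * D))" by simp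
    then show ?thesis by (simp add: algebra_simps)
  qed
  have 2: "((Im u * cosh t - sinh t) / D * cosh s - sinh s) / E = (Im u * cosh (s + t) - sinh (s + t)) / (E * D)"
    using D E D' by (simp add: divide_simps) (auto simp: cosh_add sinh_add algebra_simps)
  show ?thesis unfolding v(1) gflow_def fst_conv snd_conv gpoint_def gdir_def[of "gdir u t"] gdir_def[of u "s + t"]
      DE E_def[symmetric] D_def[symmetric]
    using 1 2 by (simp add: gdir_def D_def[symmetric] mult.commute)
qed

lemma gflow_0 [simp]: "gflow 0 v = v"
  by (cases v) (simp add: gflow_def gpoint_def gdir_def gden_def)

lemma geodesic_line_gpoint:
  assumes "(z, u) \<in> T1H" shows "geodesic_line (gpoint z u)"
  unfolding geodesic_line_iff
proof (intro conjI allI)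
  show "range (gpoint z u) \<subseteq> \<H>" using gpoint_in[OF assms] by auto
  fix s t
  have v: "Im z > 0" "cmod u = 1" using assms by (auto simp: T1H_iff)
  define D where "D = gden u s"
  define E where "E = gden u t"
  have D: "D > 0" and E: "E > 0" using gden_pos v by (auto simp: D_def E_def)
  have D': "D = cosh s - Im u * sinh s" and E': "E = cosh t - Im u * sinh t" by (auto simp: D_def E_def gden_def)
  have key: "(Re u)\<^sup>2 * (sinh s * E - sinh t * D)\<^sup>2 + (E - D)\<^sup>2 = 2 * (cosh (s - t) - 1) * (D * E)"
    using cosh_square_eq[of t] cosh_square_eq[of s] unit_sq[OF v(2)] unfolding D' E' cosh_diff by algebra
  have "(cmod (gpoint z u s - gpoint z u t))\<^sup>2 = (Im z)\<^sup>2 * ((Re u)\<^sup>2 * (sinh s / D - sinh t / E)\<^sup>2 + (1 / D - 1 / E)\<^sup>2)"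
    by (simp add: cmod_power2 gpoint_def D_def E_def) (simp add: algebra_simps power2_eq_square)
  also have "\<dots> = (Im z)\<^sup>2 * ((Re u)\<^sup>2 * (sinh s * E - sinh t * D)\<^sup>2 + (E - D)\<^sup>2) / (D * E)\<^sup>2"
  proof -
    have "sinh s / D - sinh t / E = (sinh s * E - sinh t * D) / (D * E)" "1 / D - 1 / E = (E - D) / (D * E)"
      using D E by (auto simp: field_simps)
    then show ?thesis by (simp add: power_divide add_divide_distrib distrib_left)
  qed
  also have "\<dots> = (Im z)\<^sup>2 * (2 * (cosh (s - t) - 1)) / (D * E)"
    unfolding key using D E by (simp add: power2_eq_square field_simps)
  finally show "1 + hdelta (gpoint z u s) (gpoint z u t) / 2 = cosh (s - t)"
    using D E v unfolding hdelta_def by (simp add: gpoint_def D_def[symmetric] E_def[symmetric] power2_eq_square field_simps)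
qed

text \<open>For the Lorentzian form \<open>p * r - q\<^sup>2\<close> the vector
  \<open>(p, q, r)\<close> is timelike, so the form is definite on its orthogonal complement and a
  null vector in the complement vanishes.\<close>

lemma minkowski_orthogonal_null:
  fixes p q r d1 d2 d3 :: real
  assumes "p * r - q\<^sup>2 = 1" "p > 0" "d1 * r + d3 * p = 2 * d2 * q" "d1 * d3 = d2\<^sup>2"
  shows "d1 = 0" "d2 = 0" "d3 = 0"
proof -
  have "d1\<^sup>2 + (d1 * q - d2 * p)\<^sup>2 = 0"
    using assms by algebra
  then show "d1 = 0" by (simp add: sum_power2_eq_zero_iff)
  then show "d2 = 0" using assms by simp
  then show "d3 = 0" using assms \<open>d1 = 0\<close> by simp
qed

text \<open>In the hyperboloid model, with \<open>P(z) = (1, Re z, \<bar>z\<bar>\<^sup>2) / Im z\<close>, the points of a geodesic have a Gram matrix of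
  rank two, so \<open>P\<close> moves in a plane.\<close>

lemma geodesic_line_imp_gpoint:
  assumes c: "geodesic_line c"
  obtains u where "(c 0, u) \<in> T1H" "c = gpoint (c 0) u"
proof -
  have H: "Im (c t) > 0" for t using c by (auto simp: geodesic_line_iff upper_half_plane_def)
  define p where "p t = 1 / Im (c t)" for t
  define q where "q t = Re (c t) / Im (c t)" for t
  define r where "r t = ((Re (c t))\<^sup>2 + (Im (c t))\<^sup>2) / Im (c t)" for t
  have p0: "p t > 0" for t using H by (simp add: p_def)
  have pr: "p t * r t - (q t)\<^sup>2 = 1" for t
    using H[of t] by (simp add: p_def q_def r_def power2_eq_square field_simps)
  have form: "p s * r t + r s * p t - 2 * q s * q t = 2 * cosh (s - t)" for s t
  proof -
    have "1 + hdelta (c s) (c t) / 2 = cosh (s - t)" using c by (simp add: geodesic_line_iff)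
    moreover have "hdelta (c s) (c t) = p s * r t + r s * p t - 2 * q s * q t - 2"
      using H[of s] H[of t] unfolding hdelta_def cmod_power2 p_def q_def r_def
      by (simp add: divide_simps) (simp add: power2_eq_square algebra_simps)
    ultimately show ?thesis by argo
  qed
  \<comment> \<open>The coefficients with which every combination of \<open>cosh\<close> and
    \<open>sinh\<close> is recovered from its values at times 0 and 1.\<close>
  define A where "A t = sinh (1 - t) / sinh 1" for t :: real
  define B where "B t = sinh t / sinh 1" for t :: real
  have s1: "sinh (1::real) \<noteq> 0" by simp
  have lin: "p t = A t * p 0 + B t * p 1 \<and> q t = A t * q 0 + B t * q 1 \<and> r t = A t * r 0 + B t * r 1" for t
  proof -
    \<comment> \<open>The error of the interpolation is orthogonal to \<open>P(0)\<close>,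
      \<open>P(1)\<close> and \<open>P(t)\<close>, hence to itself. Being null and orthogonal to the
      timelike \<open>P(0)\<close>, it vanishes.\<close>
    define d1 where "d1 = p t - A t * p 0 - B t * p 1"
    define d2 where "d2 = q t - A t * q 0 - B t * q 1"
    define d3 where "d3 = r t - A t * r 0 - B t * r 1"
    have e0: "cosh t = A t + B t * cosh 1"
      using s1 cosh_square_eq[of "1::real"] by (simp add: A_def B_def sinh_diff field_simps)
    have e1: "cosh (t - 1) = A t * cosh 1 + B t"
      using s1 cosh_square_eq[of "1::real"]
      by (simp add: A_def B_def sinh_diff cosh_diff field_simps) algebra
    have ett: "1 = A t * cosh t + B t * cosh (t - 1)"
      using s1 cosh_square_eq[of "1::real"] cosh_square_eq[of t]
      by (simp add: A_def B_def sinh_diff cosh_diff field_simps) algebra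
    have f: "p 0 * r t + r 0 * p t - 2 * q 0 * q t = 2 * cosh t" "p 1 * r t + r 1 * p t - 2 * q 1 * q t = 2 * cosh (t - 1)"
      "p 0 * r 1 + r 0 * p 1 - 2 * q 0 * q 1 = 2 * cosh 1"
      using form[of 0 t] form[of 1 t] form[of 0 1] cosh_minus[of "t - 1"] by (auto simp del: cosh_minus)
    have o0: "d1 * r 0 + d3 * p 0 = 2 * d2 * q 0"
      unfolding d1_def d2_def d3_def using f pr[of 0] e0 by algebra
    have o1: "d1 * r 1 + d3 * p 1 = 2 * d2 * q 1"
      unfolding d1_def d2_def d3_def using f pr[of 1] e1 by algebra
    have ot: "d1 * r t + d3 * p t = 2 * d2 * q t"
      unfolding d1_def d2_def d3_def using f pr[of t] ett by algebra
    have "d1 * d3 + d3 * d1 = 2 * d2 * d2"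
      using o0 o1 ot unfolding d1_def d2_def d3_def by algebra
    then have "d1 * d3 = d2\<^sup>2" by (simp add: power2_eq_square)
    from minkowski_orthogonal_null[OF pr[of 0] p0[of 0] o0 this] show ?thesis
      by (auto simp: d1_def d2_def d3_def)
  qed
  define K1 where "K1 = (p 1 - p 0 * cosh 1) / sinh 1"
  define K2 where "K2 = (q 1 - q 0 * cosh 1) / sinh 1"
  define K3 where "K3 = (r 1 - r 0 * cosh 1) / sinh 1"
  have P: "p t = p 0 * cosh t + K1 * sinh t" and Q: "q t = q 0 * cosh t + K2 * sinh t"
    and R: "r t = r 0 * cosh t + K3 * sinh t" for t
    using lin[of t] s1 by (auto simp: A_def B_def K1_def K2_def K3_def sinh_diff field_simps)
  define a where "a = Re (c 0)"
  define b where "b = Im (c 0)"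
  have b: "b > 0" using H by (simp add: b_def)
  have v0: "p 0 * b = 1" "q 0 * b = a" "r 0 * b = a\<^sup>2 + b\<^sup>2" using b by (auto simp: p_def q_def r_def a_def b_def)
  have k3: "p 0 * K3 + r 0 * K1 = 2 * q 0 * K2"
  proof -
    have "p 0 * r 1 + r 0 * p 1 - 2 * q 0 * q 1 = 2 * cosh 1" using form[of 0 1] by simp
    then have "(p 0 * K3 + r 0 * K1 - 2 * q 0 * K2) * sinh 1 = 0"
      unfolding P[of 1] Q[of 1] R[of 1] using pr[of 0] by algebra
    then show ?thesis using s1 by simp
  qed
  have kk: "K1 * K3 - K2\<^sup>2 = - 1"
  proof -
    have "(K1 * K3 - K2\<^sup>2 + 1) * (sinh 1)\<^sup>2 = 0"
      using pr[of 1] pr[of 0] k3 cosh_square_eq[of "1::real"] unfolding P[of 1] Q[of 1] R[of 1] by algebra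
    then show ?thesis using s1 by simp
  qed
  \<comment> \<open>\<open>(K1, K2, K3)\<close> is the velocity of \<open>P\<close> at time 0.
    Differentiating \<open>Re = q / p\<close> and \<open>Im = 1 / p\<close> and dividing by the
    height yields the direction.\<close>
  define u where "u = Complex (K2 - a * K1) (- b * K1)"
  have "(K2 - a * K1)\<^sup>2 + (b * K1)\<^sup>2 = 1"
  proof -
    have "K3 = 2 * a * K2 - (a\<^sup>2 + b\<^sup>2) * K1" using k3 v0 b by algebra
    then show ?thesis using kk by algebra
  qed
  then have "(cmod u)\<^sup>2 = 1" by (simp add: cmod_power2 u_def)
  then have u: "cmod u = 1" by (simp add: power2_eq_1_iff) (metis norm_ge_zero not_one_le_zero order_trans neg_0_le_iff_le zero_le_one)
  show ?thesis
  proof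
    show T: "(c 0, u) \<in> T1H" using u H by (simp add: T1H_iff)
    show "c = gpoint (c 0) u"
    proof (rule ext)
      fix t
      have D: "gden u t > 0" using gden_pos[OF u] .
      have Db: "gden u t = b * p t" unfolding P[of t] gden_def using v0 by (simp add: u_def algebra_simps)
      have "Im (c t) = b / gden u t" unfolding Db using b H[of t] by (simp add: p_def)
      moreover have "Re (c t) = a + b * Re u * sinh t / gden u t"
      proof -
        have "Re (c t) * p t = q t" by (simp add: p_def q_def)
        then have "Re (c t) * gden u t = b * q t" unfolding Db by (simp add: algebra_simps)
        also have "\<dots> = a * gden u t + b * Re u * sinh t" unfolding Db P[of t] Q[of t] using v0
          by (simp add: u_def) algebra
        finally show ?thesis using D by (simp add: field_simps)
      qed
      ultimately show "c t = gpoint (c 0) u t"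
        by (auto simp: complex_eq_iff gpoint_def a_def b_def)
    qed
  qed
qed

lemma gpoint_has_vector_derivative:
  assumes "cmod u = 1"
  shows "(gpoint z u has_vector_derivative Im (gpoint z u t) *\<^sub>R gdir u t) (at t)"
proof -
  have D: "gden u t > 0" by (rule gden_pos[OF assms])
  have dD: "(gden u has_field_derivative sinh t - Im u * cosh t) (at t)"
    unfolding gden_def[abs_def] by (auto intro!: derivative_eq_intros)
  have "((\<lambda>t. Re z + Im z * Re u * sinh t / gden u t) has_field_derivative
      (Im z * Re u * cosh t * gden u t - Im z * Re u * sinh t * (sinh t - Im u * cosh t)) / (gden u t * gden u t)) (at t)"
    using D by (auto intro!: derivative_eq_intros dD)
  moreover have "Im z * Re u * cosh t * gden u t - Im z * Re u * sinh t * (sinh t - Im u * cosh t) = Im z * Re u"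
    unfolding gden_def using cosh_square_eq[of t] by algebra
  moreover have "((\<lambda>t. Im z / gden u t) has_field_derivative
      (0 * gden u t - Im z * (sinh t - Im u * cosh t)) / (gden u t * gden u t)) (at t)"
    using D by (auto intro!: derivative_eq_intros dD)
  moreover have "(0 * gden u t - Im z * (sinh t - Im u * cosh t)) / (gden u t * gden u t) = Im z / gden u t * ((Im u * cosh t - sinh t) / gden u t)"
    by (simp add: algebra_simps diff_divide_distrib)
  ultimately show ?thesis unfolding has_vector_derivative_complex_iff gpoint_def gdir_def
    by (simp only: complex.sel scaleR_complex.sel times_divide_eq_right times_divide_eq_left divide_divide_eq_left real_scaleR_def)
qed

lemma gdir_0 [simp]: "gdir u 0 = u" and gpoint_0 [simp]: "gpoint z u 0 = z"
  by (simp_all add: gdir_def gpoint_def gden_def)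

lemma geodesic_line_unique:
  assumes "geodesic_line c" "(z, u) \<in> T1H" "c 0 = z" "(c has_vector_derivative Im z *\<^sub>R u) (at 0)"
  shows "c = gpoint z u"
proof -
  obtain w where w: "(c 0, w) \<in> T1H" "c = gpoint (c 0) w" using assms(1) by (rule geodesic_line_imp_gpoint)
  have "(c has_vector_derivative Im (gpoint (c 0) w 0) *\<^sub>R gdir w 0) (at 0)"
    using w gpoint_has_vector_derivative by (metis T1H_iff)
  then have "Im z *\<^sub>R u = Im z *\<^sub>R w"
    using vector_derivative_unique_at[OF assms(4)] assms(3) by simp
  then show ?thesis using w assms(2,3) by (simp add: T1H_iff)
qed

lemma geodesic_from_eq:
  assumes "(z, u) \<in> T1H" shows "geodesic_from (z, u) = gpoint z u"
  unfolding geodesic_from_def prod.case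
proof (rule the_equality)
  show "geodesic_line (gpoint z u) \<and> gpoint z u 0 = z \<and> (gpoint z u has_vector_derivative Im z *\<^sub>R u) (at 0)"
    using geodesic_line_gpoint[OF assms] gpoint_has_vector_derivative[of u z 0] assms by (simp add: T1H_iff)
qed (use geodesic_line_unique[OF _ assms] in blast)

lemma geodesic_flow_eq:
  assumes "v \<in> T1H" shows "geodesic_flow t v = gflow t v"
proof -
  obtain z u where v: "v = (z, u)" "Im z > 0" "cmod u = 1" using assms by (cases v) (auto simp: T1H_iff)
  have "vector_derivative (gpoint z u) (at t) = Im (gpoint z u t) *\<^sub>R gdir u t"
    using gpoint_has_vector_derivative[OF v(3)] by (rule vector_derivative_at)
  moreover have "Im (gpoint z u t) > 0" using gpoint_in[of z u t] v by (simp add: T1H_iff upper_half_plane_def)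
  ultimately show ?thesis using assms cmod_gdir[OF v(3), of t] unfolding v(1)
    by (simp add: geodesic_flow_def geodesic_from_eq gflow_def sgn_div_norm)
qed

lemma mobius_has_vector_derivative:
  assumes "det A = 1" "c t \<in> \<H>" "cmod w = 1" "(c has_vector_derivative Im (c t) *\<^sub>R w) (at t)"
  shows "((\<lambda>t. mobius A (c t)) has_vector_derivative
    Im (mobius A (c t)) *\<^sub>R (sgn (1 / (mden A (c t))\<^sup>2) * w)) (at t)"
proof -
  have "((mobius A \<circ> c) has_vector_derivative (Im (c t) *\<^sub>R w) * (1 / (mden A (c t))\<^sup>2)) (at t)"
    by (rule field_vector_diff_chain_at[OF assms(4) mobius_deriv[OF assms(1,2)]])
  moreover have "(Im (c t) *\<^sub>R w) * (1 / (mden A (c t))\<^sup>2) = Im (mobius A (c t)) *\<^sub>R (sgn (1 / (mden A (c t))\<^sup>2) * w)"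
    using mden_nonzero[OF assms(1,2)]
    by (simp add: Im_mobius[OF assms(1,2)] sgn_div_norm norm_divide norm_power scaleR_conv_of_real)
  ultimately show ?thesis by (simp add: comp_def)
qed

lemma geodesic_line_mobius:
  assumes "det A = 1" "geodesic_line c" shows "geodesic_line (\<lambda>t. mobius A (c t))"
  using assms by (auto simp: geodesic_line_iff image_subset_iff hdelta_mobius)

lemma gpoint_mobius:
  assumes "det A = 1" "(z, u) \<in> T1H"
  shows "mobius A (gpoint z u t) = gpoint (mobius A z) (sgn (1 / (mden A z)\<^sup>2) * u) t"
proof -
  have z: "z \<in> \<H>" "cmod u = 1" using assms(2) by (auto simp: T1H_def)
  have "(\<lambda>t. mobius A (gpoint z u t)) = gpoint (mobius A z) (sgn (1 / (mden A z)\<^sup>2) * u)"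
  proof (rule geodesic_line_unique)
    show "geodesic_line (\<lambda>t. mobius A (gpoint z u t))"
      by (intro geodesic_line_mobius assms geodesic_line_gpoint)
    show "(mobius A z, sgn (1 / (mden A z)\<^sup>2) * u) \<in> T1H"
      using mobius_T1_in[OF assms] by (simp add: mobius_T1_eq[OF assms(1) z(1)])
    show "((\<lambda>t. mobius A (gpoint z u t)) has_vector_derivative Im (mobius A z) *\<^sub>R (sgn (1 / (mden A z)\<^sup>2) * u)) (at 0)"
      using mobius_has_vector_derivative[of A "gpoint z u" 0 u] assms(1) z gpoint_has_vector_derivative[of u z 0] by simp
  qed simp
  then show ?thesis by metis
qed

lemma gflow_mobius:
  assumes "det A = 1" "v \<in> T1H"
  shows "gflow t (mobius_T1 A v) = mobius_T1 A (gflow t v)"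
proof -
  obtain z u where v: "v = (z, u)" "z \<in> \<H>" "cmod u = 1" using assms(2) by (auto simp: T1H_def)
  define w where "w = sgn (1 / (mden A z)\<^sup>2) * u"
  have w: "mobius_T1 A v = (mobius A z, w)" using mobius_T1_eq[OF assms(1) v(2)] by (simp add: v w_def)
  then have wT: "(mobius A z, w) \<in> T1H" using mobius_T1_in[OF assms] by simp
  then have w1: "cmod w = 1" by (simp add: T1H_def)
  have p: "(\<lambda>t. mobius A (gpoint z u t)) = gpoint (mobius A z) w"
    using gpoint_mobius[OF assms(1), of z u] assms(2) v by (auto simp: w_def)
  have H: "gpoint z u t \<in> \<H>" using gpoint_in assms(2) v by blast
  have "((\<lambda>t. mobius A (gpoint z u t)) has_vector_derivative
    Im (mobius A (gpoint z u t)) *\<^sub>R (sgn (1 / (mden A (gpoint z u t))\<^sup>2) * gdir u t)) (at t)"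
    using mobius_has_vector_derivative[of A "gpoint z u" t "gdir u t"] assms(1) H cmod_gdir v gpoint_has_vector_derivative
    by blast
  then have "Im (mobius A (gpoint z u t)) *\<^sub>R (sgn (1 / (mden A (gpoint z u t))\<^sup>2) * gdir u t)
      = Im (gpoint (mobius A z) w t) *\<^sub>R gdir w t"
    using gpoint_has_vector_derivative[OF w1, of "mobius A z" t] vector_derivative_unique_at unfolding p by blast
  moreover have "mobius A (gpoint z u t) = gpoint (mobius A z) w t" using p by metis
  moreover have "Im (mobius A (gpoint z u t)) > 0" using mobius_in_H[OF assms(1) H] by (simp add: upper_half_plane_def)
  ultimately have "sgn (1 / (mden A (gpoint z u t))\<^sup>2) * gdir u t = gdir w t" by simp
  then show ?thesis using w p[THEN fun_cong, of t] unfolding v(1)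
    by (simp add: gflow_def mobius_T1_eq[OF assms(1) H])
qed

lemma SL2_transitive:
  assumes "v \<in> T1H" obtains B where "det B = 1" "mobius_T1 B (\<i>, \<i>) = v"
proof -
  obtain z u where v: "v = (z, u)" "Im z > 0" "cmod u = 1" using assms by (cases v) (auto simp: T1H_iff)
  obtain \<phi> where \<phi>: "u = cis \<phi>" using v(3) by (metis cis_Arg mult_1 norm_zero rcis_cmod_Arg rcis_def of_real_1)
  \<comment> \<open>A rotation matrix of angle \<theta> turns tangent vectors at the fixed point
    \<i> by twice that angle, here from \<open>pi / 2\<close>, the angle of the upward vector, to
    \<phi>. The matrix \<open>B\<close> is this rotation followed by the affine map that takes \<i>
    to \<open>z\<close>.\<close>
  define \<theta> where "\<theta> = (pi / 2 - \<phi>) / 2"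
  define r where "r = sqrt (Im z)"
  have r: "r > 0" "r * r = Im z" using v by (auto simp: r_def)
  define B where "B = mat2 (r * cos \<theta> + Re z / r * sin \<theta>) (- r * sin \<theta> + Re z / r * cos \<theta>) (sin \<theta> / r) (cos \<theta> / r)"
  have d: "det B = 1"
  proof -
    have p: "cos \<theta> * cos \<theta> + sin \<theta> * sin \<theta> = 1" by (simp add: power2_eq_square[symmetric])
    show ?thesis using r(1) by (simp add: det_2 B_def divide_simps) (use p in algebra)
  qed
  have iH: "\<i> \<in> \<H>" by (simp add: upper_half_plane_def)
  have den: "mden B \<i> = cis \<theta> / r"
    by (auto simp: mden_def B_def complex_eq_iff)
  have num: "of_real (B$1$1) * \<i> + of_real (B$1$2) = (r * \<i> + Re z / r) * cis \<theta>"
    by (auto simp: B_def complex_eq_iff algebra_simps)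
  have "(N * e) / (e / of_real r) = N * of_real r" if "e \<noteq> 0" for N e :: complex
    using that r(1) by simp
  then have "mobius B \<i> = (r * \<i> + Re z / r) * r"
    unfolding mobius_eq num den by simp
  also have "\<dots> = z" using r by (auto simp: complex_eq_iff algebra_simps)
  finally have m: "mobius B \<i> = z" .
  have "(cis \<theta>)\<^sup>2 * cis (- (2 * \<theta>)) = 1" by (simp add: power2_eq_square cis_mult)
  then have "1 / (mden B \<i>)\<^sup>2 = of_real (r\<^sup>2) * cis (- (2 * \<theta>))"
    unfolding den using r(1) by (simp add: power_divide divide_eq_eq mult.assoc mult.commute)
  then have "sgn (1 / (mden B \<i>)\<^sup>2) = of_real (sgn (r\<^sup>2)) * cis (- (2 * \<theta>))"
    by (simp only: sgn_mult sgn_of_real sgn_cis)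
  then have "sgn (1 / (mden B \<i>)\<^sup>2) * \<i> = cis (- (2 * \<theta>)) * cis (pi / 2)" using r(1) by simp
  also have "\<dots> = u" unfolding cis_mult \<phi> by (simp add: \<theta>_def diff_divide_distrib)
  finally have "sgn (1 / (mden B \<i>)\<^sup>2) * \<i> = u" .
  then show ?thesis using that[of B] d m mobius_T1_eq[OF d iH, of \<i>] v by simp
qed

lemma gflow_i: "gflow t (\<i>, \<i>) = (\<i> * exp t, \<i>)"
proof -
  have "1 / gden \<i> t = exp t" "(1 * cosh t - sinh t) / gden \<i> t = 1"
    by (simp_all add: gden_def cosh_minus_sinh exp_minus inverse_eq_divide)
  then show ?thesis by (simp add: gflow_def gpoint_def gdir_def complex_eq_iff)
qed

text \<open>The image under \<open>B\<close> of the imaginary axis with its unit speed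
  parametrization. Every geodesic line has this form, so lines can be handled as matrices, on which
  the group acts by multiplication.\<close>

definition gline :: "real^2^2 \<Rightarrow> real \<Rightarrow> complex" where
  "gline B t = mobius B (\<i> * exp t)"

lemma iexp_in_H [simp]: "\<i> * complex_of_real (exp t) \<in> \<H>"
  by (simp add: upper_half_plane_def)

lemma gline_in_H [simp]: "det B = 1 \<Longrightarrow> gline B t \<in> \<H>" by (simp add: gline_def)

lemma gflow_gline: "det B = 1 \<Longrightarrow> fst (gflow t (mobius_T1 B (\<i>, \<i>))) = gline B t"
  by (subst gflow_mobius) (auto simp: T1H_iff mobius_T1_fst gflow_i gline_def)

lemma geodesic_line_imp_gline:
  assumes "geodesic_line c" obtains B where "det B = 1" "c = gline B"
proof -
  obtain u where u: "(c 0, u) \<in> T1H" "c = gpoint (c 0) u" using assms by (rule geodesic_line_imp_gpoint)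
  obtain B where B: "det B = 1" "mobius_T1 B (\<i>, \<i>) = (c 0, u)" using SL2_transitive[OF u(1)] .
  have "c t = gline B t" for t
    using gflow_gline[OF B(1), of t] u(2) unfolding B(2) by (simp add: gflow_def)
  then show ?thesis using that[of B] B by blast
qed

lemma geodesic_line_gline: "det B = 1 \<Longrightarrow> geodesic_line (gline B)"
proof -
  assume B: "det B = 1"
  obtain z u where zu: "mobius_T1 B (\<i>, \<i>) = (z, u)" by fastforce
  then have "(z, u) \<in> T1H" using mobius_T1_in[OF B, of "(\<i>, \<i>)"] by (simp add: T1H_iff)
  moreover have "gline B = gpoint z u" using gflow_gline[OF B] zu by (simp add: gflow_def fun_eq_iff)
  ultimately show ?thesis using geodesic_line_gpoint by simp
qed

lemma gline_mult: "det A = 1 \<Longrightarrow> det B = 1 \<Longrightarrow> gline (A ** B) t = mobius A (gline B t)"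
  by (simp add: gline_def mobius_mult)

text \<open>The sign of \<open>gside B z\<close> tells on which side of the line of \<open>B\<close> the point \<open>z\<close> lies.\<close>

definition gside :: "real^2^2 \<Rightarrow> complex \<Rightarrow> real" where
  "gside B z = Re (mobius (adj2 B) z)"

lemma gside_zero_iff:
  assumes "det B = 1" "z \<in> \<H>" shows "gside B z = 0 \<longleftrightarrow> z \<in> range (gline B)"
proof
  assume 0: "gside B z = 0"
  define w where "w = mobius (adj2 B) z"
  have "Im w > 0" using mobius_in_H[of "adj2 B" z] assms by (simp add: upper_half_plane_def w_def)
  then have "w = \<i> * complex_of_real (exp (ln (Im w)))" using 0
    by (auto simp: complex_eq_iff gside_def w_def exp_of_real)
  moreover have "mobius B w = z" using assms by (simp add: w_def)
  ultimately show "z \<in> range (gline B)" unfolding gline_def by (metis rangeI)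
qed (use assms in \<open>auto simp: gside_def gline_def exp_of_real\<close>)

lemma continuous_on_mobius: "det A = 1 \<Longrightarrow> continuous_on \<H> (mobius A)"
  using mobius_deriv by (meson DERIV_continuous continuous_at_imp_continuous_on)

lemma continuous_on_gside: "det B = 1 \<Longrightarrow> continuous_on \<H> (gside B)"
  unfolding gside_def by (intro continuous_intros continuous_on_mobius) simp

lemma sinh_form:
  fixes a b :: real
  assumes "a * cosh t0 + b * sinh t0 = 0"
  shows "a * cosh t + b * sinh t = (a * sinh t0 + b * cosh t0) * sinh (t - t0)"
proof -
  have "cosh t0 ^ 2 = sinh t0 ^ 2 + 1" by (rule cosh_square_eq)
  then show ?thesis unfolding sinh_diff using assms by algebra
qed

lemma gside_gflow:
  assumes "det B = 1" "v \<in> T1H"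
  obtains a b D where "\<And>t. D t > 0" "\<And>t. gside B (fst (gflow t v)) = (a * cosh t + b * sinh t) / (D t :: real)"
proof -
  obtain z u where zu: "mobius_T1 (adj2 B) v = (z, u)" by fastforce
  then have T: "(z, u) \<in> T1H" using mobius_T1_in[of "adj2 B" v] assms by simp
  then have D: "gden u t > 0" for t using gden_pos by (simp add: T1H_iff)
  have "gside B (fst (gflow t v)) = Re (gpoint z u t)" for t
  proof -
    have "mobius (adj2 B) (fst (gflow t v)) = fst (gflow t (z, u))"
      using gflow_mobius[of "adj2 B" v t] assms zu by (simp add: mobius_T1_fst[symmetric])
    then show ?thesis by (simp add: gside_def gflow_def)
  qed
  also have "Re (gpoint z u t) = (Re z * cosh t + (Im z * Re u - Re z * Im u) * sinh t) / gden u t" for t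
    using D[of t] by (simp add: gpoint_def gden_def field_simps)
  finally show ?thesis using that[of "gden u"] D by blast
qed

text \<open>Up to a positive denominator the side function is a combination of \<open>cosh\<close>
  and \<open>sinh\<close>, and such a combination vanishing at \<open>t0\<close> is a multiple of
  \<open>sinh (t - t0)\<close>. So a geodesic not contained in a line meets it at most once, and
  changes sides there.\<close>

lemma gside_crossing:
  assumes "det B = 1" "v \<in> T1H" "gside B (fst (gflow t0 v)) = 0"
  shows "(\<forall>t. gside B (fst (gflow t v)) = 0) \<or>
    (\<exists>k D. k \<noteq> 0 \<and> (\<forall>t. D t > 0) \<and> (\<forall>t. gside B (fst (gflow t v)) = k * sinh (t - t0) / (D t :: real)))"
proof -
  obtain a b D where D: "\<And>t. D t > 0" "\<And>t. gside B (fst (gflow t v)) = (a * cosh t + b * sinh t) / (D t :: real)"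
    using gside_gflow[OF assms(1,2)] by metis
  have "a * cosh t0 + b * sinh t0 = 0" using D(1)[of t0] assms(3) by (simp add: D(2))
  from sinh_form[OF this] have "gside B (fst (gflow t v)) = (a * sinh t0 + b * cosh t0) * sinh (t - t0) / D t" for t
    by (simp add: D(2))
  then show ?thesis using D(1) by (cases "a * sinh t0 + b * cosh t0 = 0") auto
qed

lemma connected_gside:
  assumes "det B = 1" shows "connected {z \<in> \<H>. gside B z > 0}" "connected {z \<in> \<H>. gside B z < 0}"
proof -
  have im: "{z \<in> \<H>. P (gside B z)} = mobius B ` {z. P (Re z) \<and> Im z > 0}" for P :: "real \<Rightarrow> bool"
  proof (rule Set.set_eqI, rule iffI)
    fix z assume z: "z \<in> {z \<in> \<H>. P (gside B z)}"
    then have "Im (mobius (adj2 B) z) > 0" using mobius_in_H[of "adj2 B" z] assms by (simp add: upper_half_plane_def)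
    then show "z \<in> mobius B ` {z. P (Re z) \<and> Im z > 0}"
      using z assms by (intro image_eqI[of _ _ "mobius (adj2 B) z"]) (auto simp: gside_def)
  next
    fix z assume "z \<in> mobius B ` {z. P (Re z) \<and> Im z > 0}"
    then obtain w where "P (Re w)" "w \<in> \<H>" "z = mobius B w" by (auto simp: upper_half_plane_def)
    then show "z \<in> {z \<in> \<H>. P (gside B z)}" using assms by (simp add: gside_def)
  qed
  have conn: "connected (mobius B ` X)" if "convex X" "X \<subseteq> \<H>" for X
    by (rule connected_continuous_image[OF continuous_on_subset[OF continuous_on_mobius[OF assms] that(2)] convex_connected[OF that(1)]])
  have "convex {z. Re z > 0 \<and> Im z > 0}" "convex {z. Re z < 0 \<and> Im z > 0}"
    by (auto simp: convex_halfspace_Re_gt convex_halfspace_Re_lt convex_halfspace_Im_gt Collect_conj_eq intro!: convex_Int)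
  then show "connected {z \<in> \<H>. gside B z > 0}" "connected {z \<in> \<H>. gside B z < 0}"
    unfolding im[of "\<lambda>x. x > 0"] im[of "\<lambda>x. x < 0"] by (auto intro!: conn simp: upper_half_plane_def)
qed

text \<open>Each of the two open half-planes is connected, and a connected set avoiding the line
  cannot contain both signs of \<open>gside\<close>. This translates the components in
  \<open>locally_on_one_side\<close> into signs.\<close>

lemma components_gline:
  assumes B: "det B = 1" and C: "C \<in> components (\<H> - range (gline B))"
  shows "C = {z \<in> \<H>. gside B z > 0} \<or> C = {z \<in> \<H>. gside B z < 0}"
proof -
  let ?P = "{z \<in> \<H>. gside B z > 0}" and ?N = "{z \<in> \<H>. gside B z < 0}"
  have un: "\<H> - range (gline B) = ?P \<union> ?N" using gside_zero_iff[OF B] by fastforce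
  have sub: "C \<subseteq> ?P \<union> ?N" "C \<noteq> {}" "connected C" using C un in_components_subset in_components_nonempty in_components_connected by metis+
  have cont: "continuous_on C (gside B)"
    by (rule continuous_on_subset[OF continuous_on_gside[OF B]]) (use sub in auto)
  have conn: "connected (gside B ` C)" using connected_continuous_image[OF cont sub(3)] .
  have max: "X \<subseteq> C" if "connected X" "X \<inter> C \<noteq> {}" "X \<subseteq> ?P \<union> ?N" for X
    using components_maximal[OF C that(1)] that(2,3) un by auto
  have no: "\<not> (x \<in> C \<inter> ?P \<and> y \<in> C \<inter> ?N)" for x y
  proof
    assume xy: "x \<in> C \<inter> ?P \<and> y \<in> C \<inter> ?N"
    then have "0 \<in> gside B ` C"
      using connectedD_interval[OF conn, of "gside B y" "gside B x" 0] by auto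
    then show False using sub by force
  qed
  obtain x where x: "x \<in> C" using sub by blast
  then consider "x \<in> ?P" | "x \<in> ?N" using sub by blast
  then show ?thesis
  proof cases
    case 1
    then have "?P \<subseteq> C" using max[of ?P] connected_gside(1)[OF B] x by blast
    moreover have "C \<subseteq> ?P" using no[of x] 1 x sub by blast
    ultimately show ?thesis by blast
  next
    case 2
    then have "?N \<subseteq> C" using max[of ?N] connected_gside(2)[OF B] x by blast
    moreover have "C \<subseteq> ?N" using no[of _ x] 2 x sub by blast
    ultimately show ?thesis by blast
  qed
qed

section \<open>Liouville measure in horocyclic coordinates\<close>

definition lam :: "(complex \<times> complex) measure" where
  "lam = hyp_measure \<Otimes>\<^sub>M circle_measure"

lemma borel_measurable_Complex [measurable (raw)]:
  fixes f g :: "'a \<Rightarrow> real"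
  assumes [measurable]: "f \<in> borel_measurable M" "g \<in> borel_measurable M"
  shows "(\<lambda>x. Complex (f x) (g x)) \<in> borel_measurable M"
  unfolding Complex_eq by measurable

lemma H_borel [measurable]: "\<H> \<in> sets borel"
  unfolding upper_half_plane_def by measurable

lemma sphere_borel [measurable]: "sphere (0::complex) 1 \<in> sets borel"
  by (intro borel_closed) simp

lemma T1H_borel [measurable]: "T1H \<in> sets borel"
  unfolding T1H_def borel_prod[symmetric] by (intro pair_measureI) measurable

lemma space_hyp: "space hyp_measure = \<H>" and sets_hyp: "sets hyp_measure = sets (restrict_space borel \<H>)"
  by (simp_all add: hyp_measure_def space_restrict_space sets_restrict_space)

lemma sets_circle: "sets circle_measure = sets (restrict_space borel (sphere 0 1))"
  and space_circle: "space circle_measure = sphere 0 1"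
  by (simp_all add: circle_measure_def space_restrict_space)

lemma space_lam [simp]: "space lam = T1H"
  by (simp add: lam_def space_pair_measure space_hyp space_circle T1H_def)

lemma lam_ident: "(\<lambda>v. v) \<in> measurable lam borel"
proof -
  have 1: "(\<lambda>z. z) \<in> measurable hyp_measure borel"
    by (subst measurable_cong_sets[OF sets_hyp refl]) (rule measurable_restrict_space1, simp)
  have 2: "(\<lambda>z. z) \<in> measurable circle_measure borel"
    by (subst measurable_cong_sets[OF sets_circle refl]) (rule measurable_restrict_space1, simp)
  have "(\<lambda>v. (fst v, snd v)) \<in> measurable lam (borel \<Otimes>\<^sub>M borel)"
    unfolding lam_def
    by (intro measurable_Pair measurable_compose[OF measurable_fst 1] measurable_compose[OF measurable_snd 2])
  then show ?thesis by (simp add: borel_prod)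
qed

lemma lam_measurable_borel: "f \<in> measurable borel N \<Longrightarrow> f \<in> measurable lam N"
  by (rule measurable_compose[OF lam_ident])

lemma sets_lam: "A \<in> sets lam \<longleftrightarrow> A \<subseteq> T1H \<and> A \<in> sets borel"
proof
  assume A: "A \<in> sets lam"
  have "sets lam \<subseteq> sets borel"
    unfolding lam_def sets_pair_measure
  proof (rule sets.sigma_sets_subset')
    show "{a \<times> b |a b. a \<in> sets hyp_measure \<and> b \<in> sets circle_measure} \<subseteq> sets borel"
    proof safe
      fix a b assume "a \<in> sets hyp_measure" "b \<in> sets circle_measure"
      then have "a \<in> sets borel" "b \<in> sets borel" by (auto simp: sets_hyp sets_circle sets_restrict_space_iff)
      then show "a \<times> b \<in> sets borel" unfolding borel_prod[symmetric] by (rule pair_measureI)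
    qed
    show "space hyp_measure \<times> space circle_measure \<in> sets borel"
      using T1H_borel by (simp add: space_hyp space_circle T1H_def)
  qed
  then show "A \<subseteq> T1H \<and> A \<in> sets borel" using A sets.sets_into_space[OF A] by auto
next
  assume A: "A \<subseteq> T1H \<and> A \<in> sets borel"
  then have "(\<lambda>v. v) -` A \<inter> space lam \<in> sets lam" using lam_ident by (meson measurable_sets)
  then show "A \<in> sets lam" using A by (simp add: Int_absorb2)
qed

lemma measurable_lam_extend:
  assumes f: "f \<in> borel_measurable lam"
  shows "(\<lambda>v. if v \<in> T1H then f v else (0::ennreal)) \<in> borel_measurable borel"
proof -
  have "sets lam = sets (restrict_space borel T1H)"
    using sets_lam by (auto simp: sets_restrict_space_iff)
  then have "f \<in> borel_measurable (restrict_space borel T1H)" using f measurable_cong_sets by blast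
  then show ?thesis by (subst (asm) measurable_restrict_space_iff[where c = 0]) auto
qed

text \<open>Stereographic parametrization of the unit circle without the point \<i>. In the
  coordinates of \<open>psi\<close>, the parameter is the slope \<open>x / exp s\<close>.\<close>

definition circ :: "real \<Rightarrow> complex" where
  "circ r = Complex (2 * r / (1 + r\<^sup>2)) ((r\<^sup>2 - 1) / (1 + r\<^sup>2))"

text \<open>
  \<open>psi y x s = (y - 1 / w, \<i> * cnj w / w)\<close> with \<open>w = x + \<i> * exp s\<close>: the image under \<open>w \<mapsto> y - 1 / w\<close>,
  which sends \<open>\<infinity>\<close> to \<open>y\<close>, of the upward unit vector at \<open>w\<close>.
\<close>

definition psi :: "real \<Rightarrow> real \<Rightarrow> real \<Rightarrow> complex \<times> complex" where
  "psi y x s = (Complex (y - x / (x\<^sup>2 + exp (2 * s))) (exp s / (x\<^sup>2 + exp (2 * s))),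
     Complex (2 * x * exp s / (x\<^sup>2 + exp (2 * s))) ((x\<^sup>2 - exp (2 * s)) / (x\<^sup>2 + exp (2 * s))))"

lemma circ_measurable [measurable]: "circ \<in> borel_measurable borel"
  unfolding circ_def[abs_def] by measurable

lemma cmod_circ: "cmod (circ r) = 1"
proof -
  have "1 + r\<^sup>2 \<noteq> 0" by (smt (verit) zero_le_power2)
  then have "(2 * r / (1 + r\<^sup>2))\<^sup>2 + ((r\<^sup>2 - 1) / (1 + r\<^sup>2))\<^sup>2 = 1"
    by (simp add: power_divide add_divide_distrib[symmetric] divide_eq_eq) algebra
  then show ?thesis by (simp add: circ_def cmod_def)
qed

lemma psi_circ: "psi y x s = (Complex (y - x / (x\<^sup>2 + exp (2 * s))) (exp s / (x\<^sup>2 + exp (2 * s))), circ (x / exp s))"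
proof -
  have "exp (2 * s) = (exp s)\<^sup>2" by (simp add: exp_double)
  moreover have "(2 * (x / h)) / (1 + (x / h)\<^sup>2) = 2 * x * h / (x\<^sup>2 + h\<^sup>2)"
    "((x / h)\<^sup>2 - 1) / (1 + (x / h)\<^sup>2) = (x\<^sup>2 - h\<^sup>2) / (x\<^sup>2 + h\<^sup>2)" if "h > 0" for h
  proof -
    have "x\<^sup>2 + h\<^sup>2 > 0" "1 + (x / h)\<^sup>2 > 0" using that by (auto intro: add_nonneg_pos add_pos_nonneg)
    moreover have e: "1 + (x / h)\<^sup>2 = (x\<^sup>2 + h\<^sup>2) / h\<^sup>2" "(x / h)\<^sup>2 - 1 = (x\<^sup>2 - h\<^sup>2) / h\<^sup>2"
      using that by (auto simp: field_simps)
    moreover have "2 * (x / h) = (2 * x * h) / h\<^sup>2" using that by (simp add: power2_eq_square)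
    moreover have "(a / h\<^sup>2) / (b / h\<^sup>2) = a / b" for a b using that by simp
    ultimately show "(2 * (x / h)) / (1 + (x / h)\<^sup>2) = 2 * x * h / (x\<^sup>2 + h\<^sup>2)"
      "((x / h)\<^sup>2 - 1) / (1 + (x / h)\<^sup>2) = (x\<^sup>2 - h\<^sup>2) / (x\<^sup>2 + h\<^sup>2)"
      unfolding e by (simp_all only:)
  qed
  ultimately show ?thesis by (simp add: psi_def circ_def)
qed

lemma psi_n_pos: "x\<^sup>2 + exp (2 * s) > (0::real)"
  by (intro add_nonneg_pos) auto

lemma psi_in [simp]: "psi y x s \<in> T1H"
  unfolding psi_circ T1H_iff using psi_n_pos by (simp add: cmod_circ)

text \<open>The angle of \<open>circ r\<close> is \<open>2 * arctan r - pi / 2\<close>, and it is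
  negative exactly for \<open>r < 1\<close>, where a full turn brings it into the interval used by
  \<open>circle_measure\<close>. The parameter 1 would give the angle 0, and \<open>pi / 2\<close>
  corresponds to infinite \<open>r\<close>.\<close>

lemma circle_measure_param_range:
  "(\<lambda>r. 2 * arctan r - pi / 2 + (if r < 1 then 2 * pi else 0)) ` (UNIV - {1}) = {0<..<2 * pi} - {pi / 2}"
proof (rule Set.set_eqI, rule iffI)
  fix \<phi> assume "\<phi> \<in> (\<lambda>r. 2 * arctan r - pi / 2 + (if r < 1 then 2 * pi else 0)) ` (UNIV - {1})"
  then obtain r where r: "r \<noteq> 1" "\<phi> = 2 * arctan r - pi / 2 + (if r < 1 then 2 * pi else 0)" by auto
  have "r < 1 \<longleftrightarrow> arctan r < pi / 4" "1 < r \<longleftrightarrow> pi / 4 < arctan r" using arctan_less_iff[of r 1] arctan_less_iff[of 1 r] by (simp_all add: arctan_one)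
  then show "\<phi> \<in> {0<..<2 * pi} - {pi / 2}" using r arctan_bounded[of r] by (auto split: if_splits)
next
  fix \<phi> assume \<phi>: "\<phi> \<in> {0<..<2 * pi} - {pi / 2}"
  show "\<phi> \<in> (\<lambda>r. 2 * arctan r - pi / 2 + (if r < 1 then 2 * pi else 0)) ` (UNIV - {1})"
  proof (cases "\<phi> < pi / 2")
    case True
    define r where "r = tan ((\<phi> + pi / 2) / 2)"
    have a: "arctan r = (\<phi> + pi / 2) / 2" unfolding r_def using True \<phi> by (intro arctan_tan) auto
    then have "1 < r" using arctan_less_iff[of 1 r] \<phi> by (simp add: arctan_one)
    then show ?thesis using a by (intro image_eqI[of _ _ r]) (auto simp: field_simps)
  next
    case False
    define r where "r = tan ((\<phi> + pi / 2) / 2 - pi)"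
    have a: "arctan r = (\<phi> + pi / 2) / 2 - pi" unfolding r_def using False \<phi> pi_gt_zero by (intro arctan_tan) (auto simp: field_simps)
    then have "r < 1" using arctan_less_iff[of r 1] \<phi> by (simp add: arctan_one)
    then show ?thesis using a by (intro image_eqI[of _ _ r]) (auto simp: field_simps)
  qed
qed

lemma nn_integral_circle:
  assumes [measurable]: "f \<in> borel_measurable borel"
  shows "(\<integral>\<^sup>+u. f u \<partial>circle_measure) = (\<integral>\<^sup>+r. f (circ r) * ennreal (2 / (1 + r\<^sup>2)) \<partial>lborel)"
proof -
  let ?g = "\<lambda>r. 2 * arctan r - pi / 2 + (if r < 1 then 2 * pi else 0)"
  let ?S = "UNIV - {1::real}" and ?T = "{0<..<2 * pi} - {pi / 2 :: real}"
  have cis_m [measurable]: "cis \<in> borel_measurable borel"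
    by (intro borel_measurable_continuous_onI continuous_intros)
  have [measurable]: "arctan \<in> borel_measurable borel"
    by (intro borel_measurable_continuous_onI continuous_intros)
  have "cis \<in> measurable (restrict_space lborel {0..<2 * pi}) (restrict_space borel (sphere 0 1))"
    by (intro measurable_restrict_space2 measurable_restrict_space1) auto
  then have "(\<integral>\<^sup>+u. f u \<partial>circle_measure) = (\<integral>\<^sup>+\<phi>. f (cis \<phi>) \<partial>restrict_space lborel {0..<2 * pi})"
    unfolding circle_measure_def by (subst nn_integral_distr) (auto intro: measurable_restrict_space1)
  also have "\<dots> = (\<integral>\<^sup>+\<phi>. f (cis \<phi>) * indicator {0..<2 * pi} \<phi> \<partial>lborel)"
    by (subst nn_integral_restrict_space) auto
  also have "\<dots> = (\<integral>\<^sup>+\<phi>. f (cis \<phi>) * indicator ?T \<phi> \<partial>lborel)"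
  proof (rule nn_integral_cong_AE)
    have "AE \<phi> in lborel. \<phi> \<noteq> 0 \<and> \<phi> \<noteq> pi / 2" using AE_lborel_singleton[of 0] AE_lborel_singleton[of "pi / 2"] by auto
    then show "AE \<phi> in lborel. f (cis \<phi>) * indicator {0..<2 * pi} \<phi> = f (cis \<phi>) * indicator ?T \<phi>"
      by eventually_elim (auto simp: indicator_def)
  qed
  also have "\<dots> = (\<integral>\<^sup>+r. f (cis (?g r)) * ennreal \<bar>2 / (1 + r\<^sup>2)\<bar> * indicator ?S r \<partial>lborel)"
  proof (rule nn_integral_substitution_inj[symmetric])
    show "?g ` ?S = ?T" by (rule circle_measure_param_range)
    fix r assume r: "r \<in> ?S"
    have d: "((\<lambda>r. 2 * arctan r - pi / 2 + c) has_field_derivative 2 / (1 + r\<^sup>2)) (at r)" for c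
      by (auto intro!: derivative_eq_intros simp: inverse_eq_divide)
    show "(?g has_field_derivative 2 / (1 + r\<^sup>2)) (at r)"
    proof (cases "r < 1")
      case True
      show ?thesis by (rule has_field_derivative_transform_within_open[OF d[of "2 * pi"], of "{..<1}"]) (use True in auto)
    next
      case False
      show ?thesis by (rule has_field_derivative_transform_within_open[OF d[of 0], of "{1<..}"]) (use False r in auto)
    qed
  next
    show "inj_on ?g ?S"
    proof (rule inj_onI)
      fix r t assume "?g r = ?g t"
      then have "arctan r = arctan t" using arctan_bounded[of r] arctan_bounded[of t] by (auto split: if_splits)
      then show "r = t" by (metis tan_arctan)
    qed
  qed measurable
  also have "\<dots> = (\<integral>\<^sup>+r. f (circ r) * ennreal (2 / (1 + r\<^sup>2)) \<partial>lborel)"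
  proof (rule nn_integral_cong_AE)
    have "cis (?g r) = circ r" for r
    proof -
      have s: "sqrt (1 + r\<^sup>2) * sqrt (1 + r\<^sup>2) = 1 + r\<^sup>2" by (smt (verit) real_sqrt_mult_self zero_le_power2)
      have p: "1 + r\<^sup>2 \<noteq> 0" by (smt (verit) zero_le_power2)
      have c: "cis (?g r) = cis (2 * arctan r - pi / 2)"
        by (auto simp: complex_eq_iff cos_add sin_add)
      have "cos (2 * arctan r - pi / 2) = 2 * r / (1 + r\<^sup>2)"
        by (simp add: cos_diff sin_double sin_arctan cos_arctan s)
      moreover have "sin (2 * arctan r - pi / 2) = (r\<^sup>2 - 1) / (1 + r\<^sup>2)"
      proof -
        have "sin (2 * arctan r - pi / 2) = - cos (2 * arctan r)" by (simp add: sin_diff)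
        also have "\<dots> = (sin (arctan r))\<^sup>2 - (cos (arctan r))\<^sup>2" by (simp add: cos_double)
        also have "\<dots> = (r\<^sup>2 - 1) / (1 + r\<^sup>2)"
          by (simp add: sin_arctan cos_arctan power_divide diff_divide_distrib)
        finally show ?thesis .
      qed
      ultimately show ?thesis unfolding c by (simp add: circ_def complex_eq_iff)
    qed
    moreover have "\<bar>2 / (1 + r\<^sup>2)\<bar> = 2 / (1 + r\<^sup>2)" for r :: real by (smt (verit) divide_nonneg_nonneg zero_le_power2)
    ultimately have "f (cis (?g r)) * ennreal \<bar>2 / (1 + r\<^sup>2)\<bar> * indicator ?S r = f (circ r) * ennreal (2 / (1 + r\<^sup>2))"
      if "r \<noteq> 1" for r using that by simp
    with AE_lborel_singleton[of 1]
    show "AE r in lborel. f (cis (?g r)) * ennreal \<bar>2 / (1 + r\<^sup>2)\<bar> * indicator ?S r = f (circ r) * ennreal (2 / (1 + r\<^sup>2))"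
      by (rule eventually_mono)
  qed
  finally show ?thesis .
qed

lemma circle_measure_total: "emeasure circle_measure (sphere 0 1) = ennreal (2 * pi)"
proof -
  have cis_m [measurable]: "cis \<in> borel_measurable borel"
    by (intro borel_measurable_continuous_onI continuous_intros)
  have "cis \<in> measurable (restrict_space lborel {0..<2 * pi}) (restrict_space borel (sphere 0 1))"
    by (intro measurable_restrict_space2 measurable_restrict_space1) auto
  moreover have "cis -` sphere 0 1 \<inter> {0..<2 * pi} = {0..<2 * pi}" by auto
  ultimately show ?thesis unfolding circle_measure_def
    by (subst emeasure_distr) (auto simp: sets_restrict_space_iff space_restrict_space emeasure_restrict_space)
qed

interpretation circle: finite_measure circle_measure
  by (rule finite_measureI) (simp add: space_circle circle_measure_total)

lemma nn_integral_hyp: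
  assumes [measurable]: "f \<in> borel_measurable borel"
  shows "(\<integral>\<^sup>+z. f z \<partial>hyp_measure) = (\<integral>\<^sup>+a. \<integral>\<^sup>+b. f (Complex a b) * ennreal (1 / b\<^sup>2) * indicator {0<..} b \<partial>lborel \<partial>lborel)"
proof -
  have "(\<integral>\<^sup>+z. f z \<partial>hyp_measure) = (\<integral>\<^sup>+z. ennreal (1 / (Im z)\<^sup>2) * f z * indicator \<H> z \<partial>lborel)"
    unfolding hyp_measure_def
    by (subst nn_integral_density) (auto intro!: measurable_restrict_space1 simp: nn_integral_restrict_space)
  also have "\<dots> = (\<integral>\<^sup>+a. \<integral>\<^sup>+b. ennreal (1 / (Im (Complex a b))\<^sup>2) * f (Complex a b) * indicator \<H> (Complex a b) \<partial>lborel \<partial>lborel)"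
    by (rule nn_integral_lborel_complex) measurable
  also have "\<dots> = (\<integral>\<^sup>+a. \<integral>\<^sup>+b. f (Complex a b) * ennreal (1 / b\<^sup>2) * indicator {0<..} b \<partial>lborel \<partial>lborel)"
    by (intro nn_integral_cong) (auto simp: indicator_def upper_half_plane_def mult.commute)
  finally show ?thesis .
qed

lemma fubini3:
  fixes f :: "real \<Rightarrow> real \<Rightarrow> ennreal"
  assumes [measurable]: "(\<lambda>(x, y). f x y) \<in> borel_measurable (borel \<Otimes>\<^sub>M borel)"
  shows "(\<integral>\<^sup>+x. \<integral>\<^sup>+y. f x y \<partial>lborel \<partial>lborel) = (\<integral>\<^sup>+y. \<integral>\<^sup>+x. f x y \<partial>lborel \<partial>lborel)"
  by (rule lborel_pair.Fubini') (simp add: measurable_lborel1 cong: measurable_cong_sets)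

text \<open>With \<open>w = h * (r + \<i>)\<close> and \<open>k = 1 + r\<^sup>2\<close>, the height
  of \<open>- 1 / w\<close> is \<open>1 / (h * k)\<close>. The hyperbolic density turns into
  \<open>k\<close> in the variable \<open>h\<close> and cancels the circle density
  \<open>2 / k\<close> up to the constant 2.\<close>

lemma subst_height:
  fixes F :: "real \<Rightarrow> ennreal"
  assumes [measurable]: "F \<in> borel_measurable borel" and k: "k > 0"
  shows "(\<integral>\<^sup>+b. F b * ennreal (2 / k) * ennreal (1 / b\<^sup>2) * indicator {0<..} b \<partial>lborel)
    = (\<integral>\<^sup>+h. 2 * F (1 / (h * k)) * indicator {0<..} h \<partial>lborel)"
proof -
  have "(\<integral>\<^sup>+b. F b * ennreal (2 / k) * ennreal (1 / b\<^sup>2) * indicator {0<..} b \<partial>lborel)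
    = (\<integral>\<^sup>+h. (F (1 / (h * k)) * ennreal (2 / k) * ennreal (1 / (1 / (h * k))\<^sup>2)) * ennreal \<bar>- 1 / (h\<^sup>2 * k)\<bar> * indicator {0<..} h \<partial>lborel)"
  proof (rule nn_integral_substitution_inj[symmetric])
    show "(\<lambda>h. 1 / (h * k)) ` {0<..} = {0<..}"
    proof (rule Set.set_eqI, rule iffI)
      fix b :: real assume "b \<in> {0<..}"
      then show "b \<in> (\<lambda>h. 1 / (h * k)) ` {0<..}" using k by (intro image_eqI[of _ _ "1 / (b * k)"]) auto
    qed (use k in auto)
    show "((\<lambda>h. 1 / (h * k)) has_field_derivative - 1 / (h\<^sup>2 * k)) (at h)" if "h \<in> {0<..}" for h
      using that k by (auto intro!: derivative_eq_intros simp: power2_eq_square field_simps)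
    show "inj_on (\<lambda>h. 1 / (h * k)) {0<..}" using k by (auto simp: inj_on_def)
  qed measurable
  also have "\<dots> = (\<integral>\<^sup>+h. 2 * F (1 / (h * k)) * indicator {0<..} h \<partial>lborel)"
  proof (rule nn_integral_cong)
    fix h :: real
    show "(F (1 / (h * k)) * ennreal (2 / k) * ennreal (1 / (1 / (h * k))\<^sup>2)) * ennreal \<bar>- 1 / (h\<^sup>2 * k)\<bar> * indicator {0<..} h
      = 2 * F (1 / (h * k)) * indicator {0<..} h"
    proof (cases "h > 0")
      case True
      have em: "ennreal a * ennreal b * ennreal c = ennreal (a * b * c)" if "a \<ge> 0" "b \<ge> 0" "c \<ge> 0" for a b c
        using that by (simp add: ennreal_mult)
      have "ennreal (2 / k) * ennreal (1 / (1 / (h * k))\<^sup>2) * ennreal \<bar>- 1 / (h\<^sup>2 * k)\<bar> = ennreal (2 / k * (1 / (1 / (h * k))\<^sup>2) * \<bar>- 1 / (h\<^sup>2 * k)\<bar>)"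
        using k by (intro em) auto
      also have "2 / k * (1 / (1 / (h * k))\<^sup>2) * \<bar>- 1 / (h\<^sup>2 * k)\<bar> = 2"
        using True k by (simp add: power2_eq_square field_simps)
      finally have fin: "ennreal (2 / k) * ennreal (1 / (1 / (h * k))\<^sup>2) * ennreal \<bar>- 1 / (h\<^sup>2 * k)\<bar> = 2" by simp
      have "a * p * q * t = (p * q * t) * a" for a p q t :: ennreal by (simp add: ac_simps)
      then show ?thesis using True unfolding fin[symmetric] by simp
    qed simp
  qed
  finally show ?thesis .
qed

lemma subst_exp:
  fixes F :: "real \<Rightarrow> ennreal"
  assumes [measurable]: "F \<in> borel_measurable borel"
  shows "(\<integral>\<^sup>+h. F h * indicator {0<..} h \<partial>lborel) = (\<integral>\<^sup>+s. F (exp s) * ennreal (exp s) \<partial>lborel)"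
proof -
  have r: "range exp = ({0<..} :: real set)"
  proof (rule Set.set_eqI, rule iffI)
    fix b :: real assume "b \<in> {0<..}" then show "b \<in> range exp" by (intro range_eqI[of _ _ "ln b"]) auto
  qed auto
  have "(\<integral>\<^sup>+s. F (exp s) * ennreal \<bar>exp s\<bar> * indicator UNIV s \<partial>lborel) = (\<integral>\<^sup>+h. F h * indicator {0<..} h \<partial>lborel)"
    by (rule nn_integral_substitution_inj) (use r in \<open>auto intro!: derivative_eq_intros simp: inj_on_def\<close>)
  then show ?thesis by simp
qed

text \<open>The direction \<open>r\<close> is fixed, the height is replaced by \<open>h\<close>, and
  the real part is translated to the forward endpoint \<open>y\<close>. Then
  \<open>h = exp s\<close> contributes \<open>exp s\<close>, which the final rescaling
  \<open>x = r * exp s\<close> cancels, so only the factor 2 survives. Measurability of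
  \<open>F\<close> is assumed in composed form, once for each of the spaces on which an exchange of
  integrals takes place.\<close>

lemma horocyclic_substitution:
  fixes F :: "real \<Rightarrow> real \<Rightarrow> real \<Rightarrow> ennreal"
  assumes F [measurable (raw)]: "\<And>(N :: (real \<times> real) measure) a b c. a \<in> borel_measurable N \<Longrightarrow> b \<in> borel_measurable N \<Longrightarrow>
    c \<in> borel_measurable N \<Longrightarrow> (\<lambda>x. F (a x) (b x) (c x)) \<in> borel_measurable N"
    "\<And>(N :: ((real \<times> real) \<times> real) measure) a b c. a \<in> borel_measurable N \<Longrightarrow> b \<in> borel_measurable N \<Longrightarrow>
    c \<in> borel_measurable N \<Longrightarrow> (\<lambda>x. F (a x) (b x) (c x)) \<in> borel_measurable N"
    "\<And>(N :: real measure) a b c. a \<in> borel_measurable N \<Longrightarrow> b \<in> borel_measurable N \<Longrightarrow>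
    c \<in> borel_measurable N \<Longrightarrow> (\<lambda>x. F (a x) (b x) (c x)) \<in> borel_measurable N"
  shows "(\<integral>\<^sup>+a. \<integral>\<^sup>+b. (\<integral>\<^sup>+r. F a b r * ennreal (2 / (1 + r\<^sup>2)) \<partial>lborel) * ennreal (1 / b\<^sup>2) * indicator {0<..} b \<partial>lborel \<partial>lborel)
    = 2 * (\<integral>\<^sup>+y. \<integral>\<^sup>+x. \<integral>\<^sup>+s. F (y - x / (x\<^sup>2 + exp (2 * s))) (exp s / (x\<^sup>2 + exp (2 * s))) (x / exp s) \<partial>lborel \<partial>lborel \<partial>lborel)"
    (is "?L = _")
proof -
  let ?U = "indicator {0<..} :: real \<Rightarrow> ennreal"
  define F2 where "F2 a h r = 2 * F a (1 / (h * (1 + r\<^sup>2))) r * ?U h" for a h r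
  define F3 where "F3 y h r = F2 (y - r / (h * (1 + r\<^sup>2))) h r" for y h r
  define F4 where "F4 y h r = 2 * F (y - r / (h * (1 + r\<^sup>2))) (1 / (h * (1 + r\<^sup>2))) r" for y h r
  note [measurable] = measurable_lborel1
  have "?L = (\<integral>\<^sup>+a. \<integral>\<^sup>+b. \<integral>\<^sup>+r. F a b r * ennreal (2 / (1 + r\<^sup>2)) * ennreal (1 / b\<^sup>2) * ?U b \<partial>lborel \<partial>lborel \<partial>lborel)"
    by (intro nn_integral_cong) (simp add: nn_integral_multc)
  also have "\<dots> = (\<integral>\<^sup>+a. \<integral>\<^sup>+r. \<integral>\<^sup>+b. F a b r * ennreal (2 / (1 + r\<^sup>2)) * ennreal (1 / b\<^sup>2) * ?U b \<partial>lborel \<partial>lborel \<partial>lborel)"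
    by (rule nn_integral_cong, rule fubini3) measurable
  also have "\<dots> = (\<integral>\<^sup>+a. \<integral>\<^sup>+r. \<integral>\<^sup>+h. F2 a h r \<partial>lborel \<partial>lborel \<partial>lborel)"
  proof (rule nn_integral_cong, rule nn_integral_cong)
    fix a r :: real
    have "(\<lambda>b. F a b r) \<in> borel_measurable borel" by measurable
    moreover have "1 + r\<^sup>2 > 0" by (simp add: add_pos_nonneg)
    ultimately show "(\<integral>\<^sup>+b. F a b r * ennreal (2 / (1 + r\<^sup>2)) * ennreal (1 / b\<^sup>2) * ?U b \<partial>lborel) = (\<integral>\<^sup>+h. F2 a h r \<partial>lborel)"
      unfolding F2_def by (rule subst_height)
  qed
  also have "\<dots> = (\<integral>\<^sup>+r. \<integral>\<^sup>+a. \<integral>\<^sup>+h. F2 a h r \<partial>lborel \<partial>lborel \<partial>lborel)"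
    unfolding F2_def by (rule fubini3) measurable
  also have "\<dots> = (\<integral>\<^sup>+r. \<integral>\<^sup>+h. \<integral>\<^sup>+a. F2 a h r \<partial>lborel \<partial>lborel \<partial>lborel)"
    unfolding F2_def by (rule nn_integral_cong, rule fubini3) measurable
  also have "\<dots> = (\<integral>\<^sup>+r. \<integral>\<^sup>+h. \<integral>\<^sup>+y. F3 y h r \<partial>lborel \<partial>lborel \<partial>lborel)"
  proof (rule nn_integral_cong, rule nn_integral_cong)
    fix r h :: real
    have "(\<lambda>a. F2 a h r) \<in> borel_measurable borel" unfolding F2_def by measurable
    from nn_integral_real_affine[OF this, of 1 "- (r / (h * (1 + r\<^sup>2)))"]
    show "(\<integral>\<^sup>+a. F2 a h r \<partial>lborel) = (\<integral>\<^sup>+y. F3 y h r \<partial>lborel)"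
      by (simp add: F3_def)
  qed
  also have "\<dots> = (\<integral>\<^sup>+r. \<integral>\<^sup>+y. \<integral>\<^sup>+h. F3 y h r \<partial>lborel \<partial>lborel \<partial>lborel)"
    unfolding F3_def F2_def by (rule nn_integral_cong, rule fubini3) measurable
  also have "\<dots> = (\<integral>\<^sup>+y. \<integral>\<^sup>+r. \<integral>\<^sup>+h. F3 y h r \<partial>lborel \<partial>lborel \<partial>lborel)"
    unfolding F3_def F2_def by (rule fubini3) measurable
  also have "\<dots> = (\<integral>\<^sup>+y. \<integral>\<^sup>+h. \<integral>\<^sup>+r. F3 y h r \<partial>lborel \<partial>lborel \<partial>lborel)"
    unfolding F3_def F2_def by (rule nn_integral_cong, rule fubini3) measurable
  also have "\<dots> = (\<integral>\<^sup>+y. \<integral>\<^sup>+h. (\<integral>\<^sup>+r. F4 y h r \<partial>lborel) * ?U h \<partial>lborel \<partial>lborel)"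
    unfolding F3_def F2_def F4_def by (intro nn_integral_cong) (simp add: nn_integral_multc)
  also have "\<dots> = (\<integral>\<^sup>+y. \<integral>\<^sup>+s. (\<integral>\<^sup>+r. F4 y (exp s) r \<partial>lborel) * ennreal (exp s) \<partial>lborel \<partial>lborel)"
  proof (rule nn_integral_cong)
    fix y :: real
    have "(\<lambda>h. \<integral>\<^sup>+r. F4 y h r \<partial>lborel) \<in> borel_measurable borel" unfolding F4_def by measurable
    then show "(\<integral>\<^sup>+h. (\<integral>\<^sup>+r. F4 y h r \<partial>lborel) * ?U h \<partial>lborel) = (\<integral>\<^sup>+s. (\<integral>\<^sup>+r. F4 y (exp s) r \<partial>lborel) * ennreal (exp s) \<partial>lborel)"
      by (rule subst_exp)
  qed
  also have "\<dots> = (\<integral>\<^sup>+y. \<integral>\<^sup>+s. \<integral>\<^sup>+x. 2 * F (y - x / (x\<^sup>2 + exp (2 * s))) (exp s / (x\<^sup>2 + exp (2 * s))) (x / exp s) \<partial>lborel \<partial>lborel \<partial>lborel)"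
  proof (rule nn_integral_cong, rule nn_integral_cong)
    fix y s :: real
    have m: "(\<lambda>r. F4 y (exp s) r) \<in> borel_measurable borel" unfolding F4_def by measurable
    have "F4 y (exp s) (x / exp s) = 2 * F (y - x / (x\<^sup>2 + exp (2 * s))) (exp s / (x\<^sup>2 + exp (2 * s))) (x / exp s)" for x
    proof -
      have e: "exp (2 * s) = (exp s)\<^sup>2" by (simp add: exp_double)
      have "h * (1 + (x / h)\<^sup>2) = (x\<^sup>2 + h\<^sup>2) / h" if "h > 0" for h using that by (simp add: power2_eq_square field_simps)
      then have "exp s * (1 + (x / exp s)\<^sup>2) = (x\<^sup>2 + exp (2 * s)) / exp s" unfolding e by simp
      then show ?thesis unfolding F4_def by simp
    qed
    moreover have "(\<integral>\<^sup>+r. F4 y (exp s) r \<partial>lborel) = ennreal \<bar>1 / exp s\<bar> * (\<integral>\<^sup>+x. F4 y (exp s) (0 + (1 / exp s) * x) \<partial>lborel)"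
      by (rule nn_integral_real_affine[OF m]) simp
    moreover have "ennreal (exp s) * ennreal \<bar>1 / exp s\<bar> = 1" by (simp add: ennreal_mult[symmetric])
    ultimately show "(\<integral>\<^sup>+r. F4 y (exp s) r \<partial>lborel) * ennreal (exp s)
      = (\<integral>\<^sup>+x. 2 * F (y - x / (x\<^sup>2 + exp (2 * s))) (exp s / (x\<^sup>2 + exp (2 * s))) (x / exp s) \<partial>lborel)"
      by (simp only: mult.commute[of _ "ennreal (exp s)"] mult.assoc[symmetric]) simp
  qed
  also have "\<dots> = (\<integral>\<^sup>+y. \<integral>\<^sup>+x. \<integral>\<^sup>+s. 2 * F (y - x / (x\<^sup>2 + exp (2 * s))) (exp s / (x\<^sup>2 + exp (2 * s))) (x / exp s) \<partial>lborel \<partial>lborel \<partial>lborel)"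
    by (rule nn_integral_cong, rule fubini3) measurable
  also have "\<dots> = 2 * (\<integral>\<^sup>+y. \<integral>\<^sup>+x. \<integral>\<^sup>+s. F (y - x / (x\<^sup>2 + exp (2 * s))) (exp s / (x\<^sup>2 + exp (2 * s))) (x / exp s) \<partial>lborel \<partial>lborel \<partial>lborel)"
    by (simp add: nn_integral_cmult)
  finally show ?thesis .
qed

lemma measurable_pair_arg:
  fixes f :: "complex \<times> complex \<Rightarrow> ennreal"
  assumes "f \<in> borel_measurable borel" "g \<in> borel_measurable N" "h \<in> borel_measurable N"
  shows "(\<lambda>x. f (g x, h x)) \<in> borel_measurable N"
  by (rule measurable_compose[OF borel_measurable_Pair[OF assms(2,3)] assms(1)])

lemma nn_integral_lam_borel:
  assumes f: "f \<in> borel_measurable borel"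
  shows "(\<integral>\<^sup>+v. f v \<partial>lam) = 2 * (\<integral>\<^sup>+y. \<integral>\<^sup>+x. \<integral>\<^sup>+s. f (psi y x s) \<partial>lborel \<partial>lborel \<partial>lborel)"
proof -
  have "f \<in> borel_measurable (hyp_measure \<Otimes>\<^sub>M circle_measure)" using lam_measurable_borel[OF f] by (simp add: lam_def)
  then have "(\<integral>\<^sup>+v. f v \<partial>lam) = (\<integral>\<^sup>+z. \<integral>\<^sup>+u. f (z, u) \<partial>circle_measure \<partial>hyp_measure)"
    unfolding lam_def by (rule circle.nn_integral_fst[symmetric])
  also have "\<dots> = (\<integral>\<^sup>+z. \<integral>\<^sup>+r. f (z, circ r) * ennreal (2 / (1 + r\<^sup>2)) \<partial>lborel \<partial>hyp_measure)"
    by (intro nn_integral_cong nn_integral_circle measurable_pair_arg[OF f]) simp_all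
  also have "\<dots> = (\<integral>\<^sup>+a. \<integral>\<^sup>+b. (\<integral>\<^sup>+r. f (Complex a b, circ r) * ennreal (2 / (1 + r\<^sup>2)) \<partial>lborel) * ennreal (1 / b\<^sup>2) * indicator {0<..} b \<partial>lborel \<partial>lborel)"
  proof (rule nn_integral_hyp)
    have [measurable]: "(\<lambda>x. f (fst x, circ (snd x))) \<in> borel_measurable (borel \<Otimes>\<^sub>M borel)"
      by (rule measurable_pair_arg[OF f]) measurable
    show "(\<lambda>z. \<integral>\<^sup>+r. f (z, circ r) * ennreal (2 / (1 + r\<^sup>2)) \<partial>lborel) \<in> borel_measurable borel"
      by (rule lborel.borel_measurable_nn_integral) (simp add: split_beta', measurable)
  qed
  also have "\<dots> = 2 * (\<integral>\<^sup>+y. \<integral>\<^sup>+x. \<integral>\<^sup>+s. f (psi y x s) \<partial>lborel \<partial>lborel \<partial>lborel)"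
    unfolding psi_circ
    by (rule horocyclic_substitution[where F = "\<lambda>a b r. f (Complex a b, circ r)"]; rule measurable_pair_arg[OF f]; measurable)
  finally show ?thesis .
qed

lemma nn_integral_lam:
  assumes "f \<in> borel_measurable lam"
  shows "(\<integral>\<^sup>+v. f v \<partial>lam) = 2 * (\<integral>\<^sup>+y. \<integral>\<^sup>+x. \<integral>\<^sup>+s. f (psi y x s) \<partial>lborel \<partial>lborel \<partial>lborel)"
proof -
  let ?f = "\<lambda>v. if v \<in> T1H then f v else 0"
  have "(\<integral>\<^sup>+v. f v \<partial>lam) = (\<integral>\<^sup>+v. ?f v \<partial>lam)" by (rule nn_integral_cong) auto
  also have "\<dots> = 2 * (\<integral>\<^sup>+y. \<integral>\<^sup>+x. \<integral>\<^sup>+s. ?f (psi y x s) \<partial>lborel \<partial>lborel \<partial>lborel)"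
    by (rule nn_integral_lam_borel[OF measurable_lam_extend[OF assms]])
  finally show ?thesis by simp
qed

lemma psi_measurable [measurable (raw)]:
  assumes [measurable]: "a \<in> borel_measurable N" "b \<in> borel_measurable N" "c \<in> borel_measurable N"
  shows "(\<lambda>x. psi (a x) (b x) (c x)) \<in> borel_measurable N"
  unfolding psi_circ by (intro borel_measurable_Pair) measurable

lemma psi_measurable_lam [measurable (raw)]:
  assumes [measurable]: "a \<in> borel_measurable N" "b \<in> borel_measurable N" "c \<in> borel_measurable N"
  shows "(\<lambda>x. psi (a x) (b x) (c x)) \<in> measurable N lam"
proof (rule measurableI)
  fix A assume "A \<in> sets lam"
  then have "A \<in> sets borel" by (simp add: sets_lam)
  then show "(\<lambda>x. psi (a x) (b x) (c x)) -` A \<inter> space N \<in> sets N" by (rule measurable_sets[OF psi_measurable[OF assms]])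
qed simp

text \<open>Exceptional sets become iterated null sets. With the forward endpoint outermost and the
  time innermost, a property depending only on endpoints loses its innermost quantifier.\<close>

lemma AE_lam_iff:
  assumes "{v \<in> T1H. P v} \<in> sets lam"
  shows "(AE v in lam. P v) \<longleftrightarrow> (AE y in lborel. AE x in lborel. AE s in lborel. P (psi y x s))"
proof -
  let ?N = "T1H - {v \<in> T1H. P v}"
  have N: "?N \<in> sets lam" using assms sets.compl_sets[of _ lam] by (metis space_lam)
  then have [measurable]: "indicator ?N \<in> borel_measurable lam" by (rule borel_measurable_indicator)
  note [measurable] = measurable_compose[OF psi_measurable_lam, of _ _ _ _ "indicator ?N :: _ \<Rightarrow> ennreal"]
  have "(AE v in lam. P v) \<longleftrightarrow> (\<integral>\<^sup>+v. indicator ?N v \<partial>lam) = 0"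
    by (subst nn_integral_0_iff_AE) (auto simp: indicator_def intro!: AE_cong)
  also have "\<dots> \<longleftrightarrow> (\<integral>\<^sup>+y. \<integral>\<^sup>+x. \<integral>\<^sup>+s. indicator ?N (psi y x s) \<partial>lborel \<partial>lborel \<partial>lborel) = (0::ennreal)"
    by (subst nn_integral_lam) auto
  also have "\<dots> \<longleftrightarrow> (AE y in lborel. AE x in lborel. AE s in lborel. indicator ?N (psi y x s) = (0::ennreal))"
    by (simp add: nn_integral_0_iff_AE)
  also have "\<dots> \<longleftrightarrow> (AE y in lborel. AE x in lborel. AE s in lborel. P (psi y x s))"
    by (simp add: indicator_def)
  finally show ?thesis .
qed

lemma psi_complex: "psi y x s = (of_real y - 1 / Complex x (exp s), \<i> / (sgn (Complex x (exp s)))\<^sup>2)"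
proof -
  define w where "w = Complex x (exp s)"
  define n where "n = x\<^sup>2 + exp (2 * s)"
  have n: "n > 0" unfolding n_def by (rule psi_n_pos)
  have e: "exp (2 * s) = exp s * exp s" "exp (s * 2) = exp s * exp s" by (simp_all add: exp_double power2_eq_square mult.commute[of s])
  have nw: "(cmod w)\<^sup>2 = n" unfolding w_def cmod_power2 n_def e(1) complex.sel by (simp add: power2_eq_square)
  have w0: "w \<noteq> 0" by (simp add: w_def complex_eq_iff)
  have 1: "1 / w = cnj w / of_real n" by (simp add: complex_div_cnj[of 1 w] nw)
  have "(sgn w)\<^sup>2 = w\<^sup>2 / of_real n"
    unfolding nw[symmetric] sgn_eq by (simp add: power_divide)
  then have "\<i> / (sgn w)\<^sup>2 = \<i> * of_real n * (1 / w)\<^sup>2" by (simp add: power_divide)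
  also have "\<dots> = \<i> * (cnj w)\<^sup>2 / of_real n" unfolding 1 using n by (simp add: power2_eq_square)
  also have "\<dots> = Complex (2 * x * exp s / n) ((x\<^sup>2 - exp (2 * s)) / n)"
    by (simp add: complex_eq_iff w_def power2_eq_square e algebra_simps diff_divide_distrib)
  finally show ?thesis unfolding psi_def w_def[symmetric] n_def[symmetric] 1
    by (simp add: complex_eq_iff w_def)
qed

lemma gflow_psi: "gflow t (psi y x s) = psi y x (s + t)"
proof -
  define h where "h = exp s"
  define E where "E = exp t"
  define n where "n = x\<^sup>2 + h\<^sup>2"
  define N where "N = x\<^sup>2 + h\<^sup>2 * E\<^sup>2"
  have pos: "h > 0" "E > 0" "n > 0" "N > 0" by (auto simp: h_def E_def n_def N_def intro!: add_nonneg_pos)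
  have e: "exp s = h" "exp (2 * s) = h\<^sup>2" "exp (s + t) = h * E" "exp (2 * (s + t)) = h\<^sup>2 * E\<^sup>2"
    by (simp_all add: h_def E_def exp_add exp_double distrib_left)
  have c: "cosh t = (E + 1 / E) / 2" "sinh t = (E - 1 / E) / 2"
    by (simp_all add: cosh_field_def sinh_field_def E_def exp_minus inverse_eq_divide)
  define u where "u = Complex (2 * x * h / n) ((x\<^sup>2 - h\<^sup>2) / n)"
  have D: "gden u t = N / (n * E)"
    using pos unfolding gden_def c u_def by (simp add: field_simps) (simp add: n_def N_def algebra_simps power2_eq_square)
  have 1: "y - x / n + h / n * (2 * x * h / n) * sinh t / (N / (n * E)) = y - x / N"
    using pos unfolding c by (simp add: field_simps) (simp add: n_def N_def algebra_simps power2_eq_square)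
  have 2: "((x\<^sup>2 - h\<^sup>2) / n * cosh t - sinh t) / (N / (n * E)) = (x\<^sup>2 - h\<^sup>2 * E\<^sup>2) / N"
    using pos unfolding c by (simp add: field_simps) (simp add: n_def algebra_simps power2_eq_square)
  have 3: "h / n / (N / (n * E)) = h * E / N" "2 * x * h / n / (N / (n * E)) = 2 * x * (h * E) / N"
    using pos by (simp_all add: field_simps)
  have p1: "psi y x s = (Complex (y - x / n) (h / n), u)" by (simp add: psi_def e n_def u_def)
  have p2: "psi y x (s + t) = (Complex (y - x / N) (h * E / N), Complex (2 * x * (h * E) / N) ((x\<^sup>2 - h\<^sup>2 * E\<^sup>2) / N))"
    unfolding psi_def e by (simp add: N_def)
  show ?thesis unfolding p1 p2 gflow_def fst_conv snd_conv gpoint_def gdir_def D complex.sel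
    using 1 2 3 by (simp add: u_def)
qed

lemma sgn_sq_divide: "sgn (1 / (w / z)\<^sup>2) = (sgn z)\<^sup>2 / (sgn w)\<^sup>2" for w z :: complex
  by (simp add: sgn_eq power_divide norm_divide norm_power)

text \<open>The maps \<open>w \<mapsto> y - 1 / w\<close> followed by \<open>A\<close>, and
  \<open>w \<mapsto> A y - 1 / w\<close>, both send infinity to \<open>A y\<close>, so they differ
  by an affine map, namely \<open>w \<mapsto> k\<^sup>2 * w - c * k\<close> with
  \<open>k = c * y + d\<close>. Affine maps of positive slope preserve upward vectors.\<close>

lemma mobius_psi:
  fixes y :: real
  assumes A: "det A = 1" and k: "A$2$1 * y + A$2$2 \<noteq> 0"
  shows "mobius_T1 A (psi y x s) = psi ((A$1$1 * y + A$1$2) / (A$2$1 * y + A$2$2))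
    ((A$2$1 * y + A$2$2)\<^sup>2 * x - A$2$1 * (A$2$1 * y + A$2$2)) (s + 2 * ln \<bar>A$2$1 * y + A$2$2\<bar>)"
proof -
  define k where "k = A$2$1 * y + A$2$2"
  define c where "c = A$2$1"
  define m where "m = A$1$1 * y + A$1$2"
  have k0: "k \<noteq> 0" using assms by (simp add: k_def)
  have ak: "A$1$1 * k = c * m + 1" using A by (simp add: det_2 k_def c_def m_def algebra_simps)
  define w where "w = Complex x (exp s)"
  define w' where "w' = Complex (k\<^sup>2 * x - c * k) (exp (s + 2 * ln \<bar>k\<bar>))"
  have "exp (2 * ln \<bar>k\<bar>) = k\<^sup>2" using k0 by (simp add: exp_double)
  then have w': "w' = of_real (k\<^sup>2) * w - of_real (c * k)" by (simp add: w'_def w_def complex_eq_iff exp_add mult.commute)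
  have w0: "w \<noteq> 0" "w' \<noteq> 0" by (auto simp: w_def w'_def complex_eq_iff)
  define z where "z = of_real y - 1 / w"
  have zH: "z \<in> \<H>" using psi_in[of y x s] unfolding psi_complex by (simp add: T1H_def z_def w_def)
  have kw: "of_real k * w - of_real c = w' / of_real k" using k0 by (simp add: w' field_simps power2_eq_square)
  have den: "mden A z = w' / (of_real k * w)"
  proof -
    have "mden A z = (of_real k * w - of_real c) / w"
      using w0 by (simp add: mden_def z_def k_def c_def field_simps)
    then show ?thesis unfolding kw by simp
  qed
  have "mobius A z = of_real (m / k) - 1 / w'"
  proof -
    have num: "of_real (A$1$1) * z + of_real (A$1$2) = (of_real m * w - of_real (A$1$1)) / w"
      using w0 by (simp add: z_def m_def field_simps)
    have "mobius A z = (of_real m * w - of_real (A$1$1)) * of_real k / w'"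
      unfolding mobius_eq num den using w0 by (simp add: field_simps)
    also have "(of_real m * w - of_real (A$1$1)) * of_real k = of_real m * w' / of_real k - (1::complex)"
    proof -
      have "(of_real m * w - of_real (A$1$1)) * of_real k = of_real m * (of_real k * w) - of_real (A$1$1 * k)"
        by (simp add: algebra_simps)
      also have "\<dots> = of_real m * (of_real k * w - of_real c) - 1"
        unfolding ak by (simp add: algebra_simps)
      finally show ?thesis unfolding kw by simp
    qed
    finally show ?thesis using w0 k0 by (simp add: diff_divide_distrib)
  qed
  moreover have "sgn (1 / (mden A z)\<^sup>2) * (\<i> / (sgn w)\<^sup>2) = \<i> / (sgn w')\<^sup>2"
  proof -
    have "sgn w \<noteq> 0" "sgn w' \<noteq> 0" using w0 by (auto simp: sgn_zero_iff)
    moreover have "(sgn (of_real k * w))\<^sup>2 = (sgn w)\<^sup>2"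
      using k0 by (simp add: sgn_mult sgn_of_real power_mult_distrib sgn_if)
    ultimately show ?thesis unfolding den sgn_sq_divide by simp
  qed
  ultimately show ?thesis
    unfolding psi_complex[of y] w_def[symmetric] z_def[symmetric] mobius_T1_eq[OF A zH] psi_complex[of "_ / _"]
      k_def[symmetric] unfolding c_def[symmetric] m_def[symmetric] unfolding w'_def[symmetric] by simp
qed

section \<open>Time reversal and asymptotic geodesics\<close>

definition flip :: "complex \<times> complex \<Rightarrow> complex \<times> complex" where
  "flip v = (fst v, - snd v)"

lemma flip_in [simp]: "v \<in> T1H \<Longrightarrow> flip v \<in> T1H"
  by (cases v) (simp add: flip_def T1H_iff)

lemma gflow_flip: "fst (gflow t (flip v)) = fst (gflow (- t) v)"
  by (simp add: gflow_def flip_def gpoint_def gden_def)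

text \<open>Reversal exchanges the endpoints \<open>y\<close> and \<open>y - 1 / x\<close>, which
  forces the new second coordinate to be \<open>- x\<close>, and it turns time around. The constant
  \<open>ln (x\<^sup>2)\<close> comes from equating the heights of the base points.\<close>

lemma flip_psi:
  assumes "x \<noteq> 0" shows "flip (psi y x s) = psi (y - 1 / x) (- x) (ln (x\<^sup>2) - s)"
proof -
  define h where "h = exp s"
  have h: "h > 0" by (simp add: h_def)
  have e: "exp s = h" "exp (ln (x\<^sup>2) - s) = x\<^sup>2 / h" "exp (2 * s) = h\<^sup>2" "exp (2 * (ln (x\<^sup>2) - s)) = (x\<^sup>2)\<^sup>2 / h\<^sup>2"
    using assms by (simp_all add: exp_diff h_def exp_double right_diff_distrib)
  have p: "x\<^sup>2 + h\<^sup>2 > 0" using h by (simp add: add_nonneg_pos)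
  have q: "(- x)\<^sup>2 + (x\<^sup>2)\<^sup>2 / h\<^sup>2 = x\<^sup>2 * (x\<^sup>2 + h\<^sup>2) / h\<^sup>2"
    using h by (simp add: field_simps power2_eq_square)
  have "x * h\<^sup>2 / (x\<^sup>2 * (x\<^sup>2 + h\<^sup>2)) = 1 / x - x / (x\<^sup>2 + h\<^sup>2)"
  proof -
    have "1 / x - x / P = (P - x * x) / (x * P)" if "P > 0" for P using that assms by (simp add: field_simps)
    from this[OF p] show ?thesis using assms by (simp add: power2_eq_square)
  qed
  moreover have "x\<^sup>2 / h / (x\<^sup>2 * (x\<^sup>2 + h\<^sup>2) / h\<^sup>2) = h / (x\<^sup>2 + h\<^sup>2)" using p assms h by (simp add: power2_eq_square)
  moreover have "2 * - x * (x\<^sup>2 / h) / (x\<^sup>2 * (x\<^sup>2 + h\<^sup>2) / h\<^sup>2) = - (2 * x * h / (x\<^sup>2 + h\<^sup>2))"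
    using p assms h by (simp add: power2_eq_square)
  moreover have "((- x)\<^sup>2 - (x\<^sup>2)\<^sup>2 / h\<^sup>2) / (x\<^sup>2 * (x\<^sup>2 + h\<^sup>2) / h\<^sup>2) = - ((x\<^sup>2 - h\<^sup>2) / (x\<^sup>2 + h\<^sup>2))"
  proof -
    have "(- x)\<^sup>2 - (x\<^sup>2)\<^sup>2 / h\<^sup>2 = x\<^sup>2 * (h\<^sup>2 - x\<^sup>2) / h\<^sup>2" using h by (simp add: field_simps power2_eq_square)
    then show ?thesis using p assms h by (simp add: minus_divide_left)
  qed
  ultimately show ?thesis unfolding psi_def e q by (simp add: flip_def complex_eq_iff)
qed

lemma fst_psi: "fst (psi y x s) = mobius (mat2 y (- 1) 1 0) (Complex x (exp s))"
proof -
  have "Complex x (exp s) \<noteq> 0" by (simp add: complex_eq_iff)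
  then show ?thesis unfolding psi_complex by (simp add: mobius_def field_simps)
qed

text \<open>Moving the common endpoint to infinity makes both geodesics vertical. The flow then
  scales both heights by the same factor, so the vertical part of \<open>hdelta\<close> is constant
  and the horizontal part decreases.\<close>

lemma hdelta_psi_flow:
  assumes "t \<ge> 0"
  shows "hdelta (fst (gflow t (psi y x s))) (fst (gflow t (psi y x' s'))) \<le> hdelta (fst (psi y x s)) (fst (psi y x' s'))"
proof -
  have d: "hdelta (fst (psi y x s)) (fst (psi y x' s')) = (x - x')\<^sup>2 / exp (s + s') + (exp s - exp s')\<^sup>2 / exp (s + s')" for s s'
    unfolding fst_psi
    by (subst hdelta_mobius) (auto simp: det_2 upper_half_plane_def hdelta_def cmod_power2 exp_add add_divide_distrib)
  have "(x - x')\<^sup>2 / exp ((s + t) + (s' + t)) \<le> (x - x')\<^sup>2 / exp (s + s')"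
    using assms by (intro divide_left_mono) auto
  moreover have "(exp (s + t) - exp (s' + t))\<^sup>2 / exp ((s + t) + (s' + t)) = (exp s - exp s')\<^sup>2 / exp (s + s')"
  proof -
    have "exp (s + t) - exp (s' + t) = exp t * (exp s - exp s')" by (simp add: exp_add algebra_simps)
    moreover have "exp ((s + t) + (s' + t)) = (exp t)\<^sup>2 * exp (s + s')" by (simp add: exp_add exp_double)
    ultimately show ?thesis by (simp only: power_mult_distrib) simp
  qed
  ultimately show ?thesis unfolding gflow_psi d by linarith
qed

section \<open>Invariance of Liouville measure\<close>

lemma measurable_into_lam:
  assumes "f \<in> borel_measurable N" "\<And>x. x \<in> space N \<Longrightarrow> f x \<in> T1H"
  shows "f \<in> measurable N lam"
proof (rule measurableI)
  fix A assume "A \<in> sets lam"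
  then have "A \<in> sets borel" by (simp add: sets_lam)
  then show "f -` A \<inter> space N \<in> sets N" by (rule measurable_sets[OF assms(1)])
qed (use assms in simp)

lemma measurable_fst_lam [measurable]: "fst \<in> borel_measurable lam" and measurable_snd_lam [measurable]: "snd \<in> borel_measurable lam"
  by (rule lam_measurable_borel, unfold borel_prod[symmetric], measurable)+

lemma measurable_gflow [measurable]: "gflow t \<in> measurable lam lam"
  unfolding gflow_def[abs_def] gpoint_def gdir_def gden_def
  by (rule measurable_into_lam, (intro borel_measurable_Pair; measurable))
     (use gflow_in in \<open>simp add: gflow_def gpoint_def gdir_def gden_def\<close>)

lemma measurable_mobius_T1 [measurable]:
  assumes "det A = 1" shows "mobius_T1 A \<in> measurable lam lam"
proof (rule measurable_into_lam)
  have [measurable]: "(sgn :: complex \<Rightarrow> complex) \<in> borel_measurable borel"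
    unfolding sgn_div_norm by measurable
  have "(\<lambda>v. (mobius A (fst v), sgn (1 / (mden A (fst v))\<^sup>2) * snd v)) \<in> borel_measurable lam"
    unfolding mobius_def mden_def by (intro borel_measurable_Pair; measurable)
  then show "mobius_T1 A \<in> borel_measurable lam"
    by (rule measurable_cong[THEN iffD1, rotated]) (use mobius_T1_eq[OF assms] in \<open>auto simp: T1H_def\<close>)
qed (use assms in simp)

lemma distr_lamI:
  assumes T: "T \<in> measurable lam lam"
    and eq: "\<And>f. f \<in> borel_measurable lam \<Longrightarrow> (\<integral>\<^sup>+v. f (T v) \<partial>lam) = (\<integral>\<^sup>+v. f v \<partial>lam)"
  shows "distr lam lam T = lam"
proof (rule measure_eqI)
  fix A assume "A \<in> sets (distr lam lam T)"
  then have A: "A \<in> sets lam" by simp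
  have "emeasure (distr lam lam T) A = (\<integral>\<^sup>+v. indicator A v \<partial>distr lam lam T)" using A by simp
  also have "\<dots> = (\<integral>\<^sup>+v. indicator A (T v) \<partial>lam)" using A T by (subst nn_integral_distr) auto
  also have "\<dots> = (\<integral>\<^sup>+v. indicator A v \<partial>lam)" using A by (intro eq) auto
  finally show "emeasure (distr lam lam T) A = emeasure lam A" using A by simp
qed simp

lemma measurable_comp_psi:
  assumes "f \<in> borel_measurable lam" "a \<in> borel_measurable N" "b \<in> borel_measurable N" "c \<in> borel_measurable N"
  shows "(\<lambda>x. f (psi (a x) (b x) (c x))) \<in> borel_measurable N"
  by (rule measurable_compose[OF psi_measurable_lam[OF assms(2-4)] assms(1)])

lemma distr_lam_gflow: "distr lam lam (gflow t) = lam"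
proof (rule distr_lamI)
  fix f :: "_ \<Rightarrow> ennreal" assume f: "f \<in> borel_measurable lam"
  have "(\<integral>\<^sup>+s. f (psi y x (s + t)) \<partial>lborel) = (\<integral>\<^sup>+s. f (psi y x s) \<partial>lborel)" for x y
  proof -
    have "(\<lambda>s. f (psi y x s)) \<in> borel_measurable borel" by (rule measurable_comp_psi[OF f]) auto
    from nn_integral_real_affine[OF this, of 1 t] show ?thesis by (simp add: add.commute)
  qed
  moreover have "(\<lambda>v. f (gflow t v)) \<in> borel_measurable lam" using f by measurable
  ultimately show "(\<integral>\<^sup>+v. f (gflow t v) \<partial>lam) = (\<integral>\<^sup>+v. f v \<partial>lam)"
    using f by (simp add: nn_integral_lam gflow_psi)
qed measurable

lemma AE_affine_nonzero:
  assumes "c \<noteq> 0 \<or> d \<noteq> 0" shows "AE y in lborel. c * y + d \<noteq> (0::real)"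
proof -
  have "{y. c * y + d = 0} \<subseteq> {- d / c}" if "c \<noteq> 0" using that by (auto simp: field_simps add_eq_0_iff)
  then show ?thesis using assms AE_lborel_singleton[of "- d / c"]
    by (cases "c = 0") (auto elim!: eventually_mono)
qed

lemma nn_integral_mobius_real:
  fixes A :: "real^2^2" and H :: "real \<Rightarrow> ennreal"
  assumes A: "det A = 1" and [measurable]: "H \<in> borel_measurable borel"
  shows "(\<integral>\<^sup>+y. H ((A$1$1 * y + A$1$2) / (A$2$1 * y + A$2$2)) * ennreal (1 / (A$2$1 * y + A$2$2)\<^sup>2) \<partial>lborel) = (\<integral>\<^sup>+y. H y \<partial>lborel)"
proof -
  define a b c d where "a = A$1$1" and "b = A$1$2" and "c = A$2$1" and "d = A$2$2"
  have det: "a * d - b * c = 1" using A by (simp add: det_2 a_def b_def c_def d_def)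
  let ?g = "\<lambda>y. (a * y + b) / (c * y + d)" and ?S = "{y. c * y + d \<noteq> 0}" and ?T = "{y. - c * y + a \<noteq> 0}"
  have nz: "c \<noteq> 0 \<or> d \<noteq> 0" "- c \<noteq> 0 \<or> a \<noteq> 0" using det by auto
  have inv: "- c * ?g y + a = 1 / (c * y + d)" "(d * ?g y - b) / (- c * ?g y + a) = y" if "c * y + d \<noteq> 0" for y
  proof -
    have e: "- c * ?g y + a = (a * d - b * c) / (c * y + d)" using that by (simp add: field_simps)
    then show 1: "- c * ?g y + a = 1 / (c * y + d)" unfolding det .
    have "d * ?g y - b = y * (a * d - b * c) / (c * y + d)" using that by (simp add: field_simps)
    then show "(d * ?g y - b) / (- c * ?g y + a) = y" unfolding 1 det using that by simp
  qed
  have img: "?g ` ?S = ?T"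
  proof (intro equalityI subsetI)
    fix w assume "w \<in> ?g ` ?S" then show "w \<in> ?T" using inv(1) by force
  next
    fix w assume w: "w \<in> ?T"
    define y where "y = (d * w - b) / (- c * w + a)"
    have cw: "- c * w + a \<noteq> 0" using w by simp
    have den: "c * y + d = (a * d - b * c) / (- c * w + a)" using cw unfolding y_def by (simp add: field_simps)
    have "a * y + b = w * (a * d - b * c) / (- c * w + a)" using cw unfolding y_def by (simp add: field_simps)
    then have "?g y = w" "c * y + d \<noteq> 0" unfolding den det using cw by auto
    then show "w \<in> ?g ` ?S" by force
  qed
  have "(\<integral>\<^sup>+y. H (?g y) * ennreal \<bar>1 / (c * y + d)\<^sup>2\<bar> * indicator ?S y \<partial>lborel) = (\<integral>\<^sup>+y. H y * indicator ?T y \<partial>lborel)"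
  proof (rule nn_integral_substitution_inj[OF _ img])
    fix y assume y: "y \<in> ?S"
    then have n: "c * y + d \<noteq> 0" by simp
    have "(?g has_field_derivative (a * (c * y + d) - (a * y + b) * c) / ((c * y + d) * (c * y + d))) (at y)"
      using n by (auto intro!: derivative_eq_intros)
    moreover have "a * (c * y + d) - (a * y + b) * c = 1" using det by (simp add: algebra_simps)
    ultimately show "(?g has_field_derivative 1 / (c * y + d)\<^sup>2) (at y)" by (simp add: power2_eq_square)
  next
    show "inj_on ?g ?S" using inv(2) by (intro inj_on_inverseI[of _ "\<lambda>w. (d * w - b) / (- c * w + a)"]) auto
  qed measurable
  moreover have "(\<integral>\<^sup>+y. H (?g y) * ennreal \<bar>1 / (c * y + d)\<^sup>2\<bar> * indicator ?S y \<partial>lborel) = (\<integral>\<^sup>+y. H (?g y) * ennreal (1 / (c * y + d)\<^sup>2) \<partial>lborel)"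
    using AE_affine_nonzero[OF nz(1)] by (intro nn_integral_cong_AE) (auto elim!: eventually_mono)
  moreover have "(\<integral>\<^sup>+y. H y * indicator ?T y \<partial>lborel) = (\<integral>\<^sup>+y. H y \<partial>lborel)"
    using AE_affine_nonzero[OF nz(2)] by (intro nn_integral_cong_AE) (auto elim!: eventually_mono)
  ultimately show ?thesis by (simp add: a_def b_def c_def d_def)
qed

text \<open>In the formula of \<open>mobius_psi\<close> the Jacobians in \<open>y\<close>,
  \<open>x\<close> and \<open>s\<close> are \<open>1 / k\<^sup>2\<close>, \<open>k\<^sup>2\<close>
  and 1, with product 1.\<close>

lemma distr_lam_mobius:
  assumes A: "det A = 1" shows "distr lam lam (mobius_T1 A) = lam"
proof (rule distr_lamI)
  show "mobius_T1 A \<in> measurable lam lam" using measurable_mobius_T1[OF A] .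
  fix f :: "_ \<Rightarrow> ennreal" assume f: "f \<in> borel_measurable lam"
  define H where "H y = (\<integral>\<^sup>+x. \<integral>\<^sup>+s. f (psi y x s) \<partial>lborel \<partial>lborel)" for y
  have m2: "(\<lambda>x. \<integral>\<^sup>+s. f (psi (a x) (b x) s) \<partial>lborel) \<in> borel_measurable N"
    if [measurable]: "a \<in> borel_measurable N" "b \<in> borel_measurable N" for a b and N :: "real measure"
    by (rule lborel.borel_measurable_nn_integral) (auto simp: split_beta' intro!: measurable_comp_psi[OF f])
  have H: "H \<in> borel_measurable borel"
    unfolding H_def by (intro lborel.borel_measurable_nn_integral, simp add: split_beta',
      intro lborel.borel_measurable_nn_integral) (auto simp: split_beta' intro!: measurable_comp_psi[OF f])
  let ?k = "\<lambda>y. A$2$1 * y + A$2$2"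
  have inner: "(\<integral>\<^sup>+x. \<integral>\<^sup>+s. f (mobius_T1 A (psi y x s)) \<partial>lborel \<partial>lborel) = H ((A$1$1 * y + A$1$2) / ?k y) * ennreal (1 / (?k y)\<^sup>2)"
    if k: "?k y \<noteq> 0" for y
  proof -
    let ?y = "(A$1$1 * y + A$1$2) / ?k y"
    have m1: "(\<lambda>s. f (psi ?y x s)) \<in> borel_measurable borel" for x by (rule measurable_comp_psi[OF f]) auto
    define K where "K x = (\<integral>\<^sup>+s. f (psi ?y x s) \<partial>lborel)" for x
    have K: "K \<in> borel_measurable borel" unfolding K_def by (rule m2) auto
    have "(\<integral>\<^sup>+s. f (mobius_T1 A (psi y x s)) \<partial>lborel) = K (- (A$2$1 * ?k y) + (?k y)\<^sup>2 * x)" for x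
      unfolding mobius_psi[OF A k] K_def
      using nn_integral_real_affine[OF m1, of 1 "(?k y)\<^sup>2 * x - A$2$1 * ?k y" "2 * ln \<bar>?k y\<bar>"]
      by (simp add: add.commute)
    moreover have "(\<integral>\<^sup>+x. K x \<partial>lborel) = ennreal \<bar>(?k y)\<^sup>2\<bar> * (\<integral>\<^sup>+x. K (- (A$2$1 * ?k y) + (?k y)\<^sup>2 * x) \<partial>lborel)"
      by (rule nn_integral_real_affine[OF K]) (use k in simp)
    moreover have "ennreal (1 / (?k y)\<^sup>2) * ennreal \<bar>(?k y)\<^sup>2\<bar> = 1" using k by (simp add: ennreal_mult[symmetric])
    ultimately show ?thesis unfolding H_def K_def[symmetric]
      by (simp only: mult.commute[of _ "ennreal (1 / _)"] mult.assoc[symmetric]) simp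
  qed
  have nz: "A$2$1 \<noteq> 0 \<or> A$2$2 \<noteq> 0" using A by (auto simp: det_2)
  have "(\<integral>\<^sup>+v. f (mobius_T1 A v) \<partial>lam) = 2 * (\<integral>\<^sup>+y. \<integral>\<^sup>+x. \<integral>\<^sup>+s. f (mobius_T1 A (psi y x s)) \<partial>lborel \<partial>lborel \<partial>lborel)"
    by (rule nn_integral_lam) (use measurable_compose[OF measurable_mobius_T1[OF A] f] in simp)
  also have "(\<integral>\<^sup>+y. \<integral>\<^sup>+x. \<integral>\<^sup>+s. f (mobius_T1 A (psi y x s)) \<partial>lborel \<partial>lborel \<partial>lborel)
    = (\<integral>\<^sup>+y. H ((A$1$1 * y + A$1$2) / ?k y) * ennreal (1 / (?k y)\<^sup>2) \<partial>lborel)"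
    using AE_affine_nonzero[OF nz] inner by (intro nn_integral_cong_AE) (auto elim!: eventually_mono)
  also have "\<dots> = (\<integral>\<^sup>+y. H y \<partial>lborel)" by (rule nn_integral_mobius_real[OF A H])
  finally show "(\<integral>\<^sup>+v. f (mobius_T1 A v) \<partial>lam) = (\<integral>\<^sup>+v. f v \<partial>lam)"
    using nn_integral_lam[OF f] by (simp add: H_def)
qed

section \<open>The flux through a geodesic segment\<close>

text \<open>Both intervals are half open, so that unit times and periods of a closed geodesic fit
  together without counting a crossing twice.\<close>

definition flux_set :: "(real \<Rightarrow> complex) \<Rightarrow> real \<Rightarrow> (complex \<times> complex) set" where
  "flux_set c l = {v \<in> T1H. \<exists>t\<in>{0..<1}. \<exists>r\<in>{0..<l}. fst (gflow t v) = c r}"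

lemma half_open_Union: "{0..<l::real} = (\<Union>n. {0..l - 1 / Suc n})"
proof (intro equalityI subsetI)
  fix x assume x: "x \<in> {0..<l}"
  then obtain n where "1 / real (Suc n) < l - x" using nat_approx_posE[of "l - x"] by auto
  then have "x \<in> {0..l - 1 / Suc n}" using x by simp
  then show "x \<in> (\<Union>n. {0..l - 1 / Suc n})" by blast
next
  fix x assume "x \<in> (\<Union>n. {0..l - 1 / Suc n})"
  then obtain n where "0 \<le> x" "x \<le> l - 1 / Suc n" by auto
  moreover have "1 / real (Suc n) > 0" by simp
  ultimately have "x < l" by linarith
  then show "x \<in> {0..<l}" using \<open>0 \<le> x\<close> by simp
qed

text \<open>Flowing back from the points of the arc exhibits the set as a continuous image of two
  half-open intervals times the circle, hence as a countable union of compact sets.\<close>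

lemma flux_set_measurable:
  assumes c: "continuous_on UNIV c" "range c \<subseteq> \<H>"
  shows "flux_set c l \<in> sets lam"
proof -
  define \<Phi> where "\<Phi> p = gflow (- fst p) (c (fst (snd p)), snd (snd p))" for p
  define K where "K n m = {0..1 - 1 / Suc n} \<times> {0..l - 1 / Suc m} \<times> sphere (0::complex) 1" for n m :: nat
  have T: "(c r, u) \<in> T1H" if "u \<in> sphere 0 1" for r u using c that by (auto simp: T1H_def)
  have cont: "continuous_on (UNIV \<times> UNIV \<times> sphere 0 1) \<Phi>"
  proof -
    have [continuous_intros]: "continuous_on (UNIV \<times> UNIV \<times> sphere 0 1) (\<lambda>p. c (fst (snd p)))"
      by (rule continuous_on_compose2[OF c(1)]) (auto intro!: continuous_intros)
    have "cosh t - Im u * sinh t \<noteq> 0" if "cmod u = 1" for u t using gden_pos[OF that, of t] by (simp add: gden_def)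
    then show ?thesis unfolding \<Phi>_def gflow_def gpoint_def gdir_def Complex_eq fst_conv snd_conv gden_def
      by (intro continuous_intros) (auto simp del: cosh_minus sinh_minus simp: mem_Times_iff)
  qed
  have "compact (\<Phi> ` K n m)" for n m
    by (intro compact_continuous_image continuous_on_subset[OF cont]) (auto simp: K_def intro!: compact_Times)
  then have [measurable]: "\<Phi> ` K n m \<in> sets borel" for n m by (intro borel_closed compact_imp_closed)
  have "flux_set c l = (\<Union>n. \<Union>m. \<Phi> ` K n m)"
  proof (intro equalityI subsetI)
    fix v assume "v \<in> flux_set c l"
    then obtain t r where v: "v \<in> T1H" and tr: "t \<in> {0..<1}" "r \<in> {0..<l}" "fst (gflow t v) = c r" by (auto simp: flux_set_def)
    obtain n m where "t \<in> {0..1 - 1 / Suc n}" "r \<in> {0..l - 1 / Suc m}"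
      using tr(1,2) unfolding half_open_Union[of 1] half_open_Union[of l] by blast
    moreover have "snd (gflow t v) \<in> sphere 0 1" using gflow_in[OF v, of t] by (auto simp: T1H_def)
    moreover have "\<Phi> (t, r, snd (gflow t v)) = v"
      using gflow_add[OF v, of "- t" t] by (simp add: \<Phi>_def tr(3)[symmetric])
    ultimately show "v \<in> (\<Union>n. \<Union>m. \<Phi> ` K n m)" unfolding K_def by (intro UN_I[of n] UN_I[of m] image_eqI[of _ _ "(t, r, snd (gflow t v))"]) auto
  next
    fix v assume "v \<in> (\<Union>n. \<Union>m. \<Phi> ` K n m)"
    then obtain n m t r u where h: "t \<in> {0..1 - 1 / Suc n}" "r \<in> {0..l - 1 / Suc m}" "u \<in> sphere 0 1" "v = gflow (- t) (c r, u)"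
      unfolding K_def \<Phi>_def by auto
    have "t \<in> {0..<1}" "r \<in> {0..<l}" using h(1,2) unfolding half_open_Union[of 1] half_open_Union[of l] by blast+
    moreover have "fst (gflow t v) = c r" unfolding h(4) gflow_add[OF T[OF h(3)]] by simp
    moreover have "v \<in> T1H" unfolding h(4) by (rule gflow_in[OF T[OF h(3)]])
    ultimately show "v \<in> flux_set c l" unfolding flux_set_def by blast
  qed
  moreover have "flux_set c l \<subseteq> T1H" by (auto simp: flux_set_def)
  ultimately show ?thesis by (simp add: sets_lam)
qed

lemma continuous_gline: "det B = 1 \<Longrightarrow> continuous_on UNIV (gline B)"
  unfolding gline_def[abs_def]
  by (rule continuous_on_compose2[OF continuous_on_mobius]) (auto intro!: continuous_intros)

lemma flux_set_gline: 
  assumes "det B = 1" shows "emeasure lam (flux_set (gline B) l) = emeasure lam (flux_set (gline (mat 1)) l)"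
proof -
  have "flux_set (gline (mat 1)) l = mobius_T1 B -` flux_set (gline B) l \<inter> space lam"
  proof (intro Set.set_eqI iffI)
    fix v assume v: "v \<in> mobius_T1 B -` flux_set (gline B) l \<inter> space lam"
    then obtain t r where tr: "v \<in> T1H" "t\<in>{0..<1}" "r\<in>{0..<l}" "mobius B (fst (gflow t v)) = mobius B (gline (mat 1) r)"
      using assms by (auto simp: flux_set_def gflow_mobius mobius_T1_fst gline_def)
    have "fst (gflow t v) \<in> \<H>" using gflow_in[OF tr(1), of t] by (auto simp: T1H_def)
    moreover have "gline (mat 1) r \<in> \<H>" by simp
    ultimately have "fst (gflow t v) = gline (mat 1) r"
      using tr(4) mobius_adj2(1)[OF assms] by metis
    then show "v \<in> flux_set (gline (mat 1)) l" using tr unfolding flux_set_def by blast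
  next
    fix v assume "v \<in> flux_set (gline (mat 1)) l"
    then obtain t r where tr: "v \<in> T1H" "t\<in>{0..<1}" "r\<in>{0..<l}" "fst (gflow t v) = gline (mat 1) r"
      by (auto simp: flux_set_def)
    then have "fst (gflow t (mobius_T1 B v)) = gline B r"
      by (simp add: gflow_mobius assms mobius_T1_fst gline_def)
    then show "v \<in> mobius_T1 B -` flux_set (gline B) l \<inter> space lam"
      using tr mobius_T1_in[OF assms tr(1)] unfolding flux_set_def space_lam by blast
  qed
  also have "emeasure lam \<dots> = emeasure (distr lam lam (mobius_T1 B)) (flux_set (gline B) l)"
    by (rule emeasure_distr[symmetric, OF measurable_mobius_T1[OF assms] flux_set_measurable[OF continuous_gline[OF assms]]])
       (use assms in auto)
  finally show ?thesis by (simp add: distr_lam_mobius[OF assms])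
qed

text \<open>A geodesic with endpoints \<open>y\<close> and \<open>y - 1 / x\<close> of opposite
  signs meets the imaginary axis at a height whose square is minus their product,
  \<open>y / x - y\<^sup>2\<close>. It does so at the parameter
  \<open>ln (x / y - x\<^sup>2) / 2\<close>, which must lie in the unit interval starting at
  \<open>s\<close>.\<close>

lemma psi_in_flux_axis:
  assumes "x \<noteq> 0" "y \<noteq> 0"
  shows "psi y x s \<in> flux_set (gline (mat 1)) l \<longleftrightarrow>
    y / x - y\<^sup>2 \<in> {1..<exp (2 * l)} \<and> s \<in> {ln (x / y - x\<^sup>2) / 2 - 1 <.. ln (x / y - x\<^sup>2) / 2}"
    (is "?L \<longleftrightarrow> ?P \<in> _ \<and> s \<in> {ln ?Q / 2 - 1 <.. _}")
proof -
  have QP: "?Q = ?P * (x / y)\<^sup>2" using assms by (simp add: field_simps power2_eq_square)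
  have eq: "fst (gflow t (psi y x s)) = gline (mat 1) r \<longleftrightarrow>
      x\<^sup>2 + exp (2 * (s + t)) = x / y \<and> exp (s + t) * y / x = exp r" for t r
  proof -
    have n: "x\<^sup>2 + exp (2 * (s + t)) > 0" by (rule psi_n_pos)
    have "fst (gflow t (psi y x s)) = gline (mat 1) r \<longleftrightarrow>
      y = x / (x\<^sup>2 + exp (2 * (s + t))) \<and> exp (s + t) / (x\<^sup>2 + exp (2 * (s + t))) = exp r"
      unfolding gflow_psi by (auto simp: psi_def gline_def complex_eq_iff)
    also have "\<dots> \<longleftrightarrow> x\<^sup>2 + exp (2 * (s + t)) = x / y \<and> exp (s + t) / (x\<^sup>2 + exp (2 * (s + t))) = exp r"
    proof -
      have "y = x / n \<longleftrightarrow> n = x / y" if "n \<noteq> 0" for n using that assms by (auto simp: field_simps)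
      then show ?thesis using n by (metis less_irrefl)
    qed
    finally show ?thesis by auto
  qed
  show ?thesis
  proof
    assume ?L
    then obtain t r where tr: "t \<in> {0..<1}" "r \<in> {0..<l}" "x\<^sup>2 + exp (2 * (s + t)) = x / y" "exp (s + t) * y / x = exp r"
      unfolding flux_set_def by (auto simp: eq)
    have q: "exp (2 * (s + t)) = ?Q" using tr(3) by simp
    then have "ln ?Q = 2 * (s + t)" by (metis ln_exp)
    then have 1: "s \<in> {ln ?Q / 2 - 1 <.. ln ?Q / 2}" using tr(1) by (auto simp: add_divide_distrib)
    have "exp (2 * r) = (exp r)\<^sup>2" by (simp add: exp_double)
    also have "\<dots> = exp (2 * (s + t)) * (y / x)\<^sup>2" unfolding tr(4)[symmetric] exp_double by (simp add: power_mult_distrib power_divide)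
    also have "\<dots> = ?P" unfolding q QP using assms by (simp add: power_divide)
    finally have "exp (2 * r) = ?P" .
    moreover have "exp (2 * 0) \<le> exp (2 * r)" "exp (2 * r) < exp (2 * l)" using tr(2) by (auto simp del: mult_zero_right)
    ultimately show "?P \<in> {1..<exp (2 * l)} \<and> s \<in> {ln ?Q / 2 - 1 <.. ln ?Q / 2}" using 1 by simp
  next
    assume R: "?P \<in> {1..<exp (2 * l)} \<and> s \<in> {ln ?Q / 2 - 1 <.. ln ?Q / 2}"
    then have P: "?P > 0" by auto
    then have Q: "?Q > 0" unfolding QP using assms by simp
    define t where "t = ln ?Q / 2 - s"
    define r where "r = ln ?P / 2"
    have t: "t \<in> {0..<1}" using R by (auto simp: t_def)
    have e: "exp (2 * (s + t)) = ?Q" using Q by (simp add: t_def)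
    have "ln 1 \<le> ln ?P" using R P by (subst ln_le_cancel_iff) auto
    moreover have "ln ?P < 2 * l" using R P by (metis atLeastLessThan_iff exp_gt_zero ln_exp ln_less_cancel_iff)
    ultimately have r: "r \<in> {0..<l}" by (simp add: r_def)
    have "y / x > 0" using P by (smt (verit) zero_le_power2)
    then have pos: "exp (s + t) * y / x > 0" by (metis exp_gt_zero mult_pos_pos times_divide_eq_right)
    have "(exp (s + t) * y / x)\<^sup>2 = exp (2 * (s + t)) * (y / x)\<^sup>2" unfolding exp_double by (simp add: power_mult_distrib power_divide)
    also have "\<dots> = ?P" unfolding e QP using assms by (simp add: power_divide)
    also have "\<dots> = (exp r)\<^sup>2" using P by (simp add: r_def exp_double[symmetric])
    finally have "exp (s + t) * y / x = exp r" using pos by (simp add: power2_eq_iff) (smt (verit) exp_gt_zero)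
    moreover have "x\<^sup>2 + exp (2 * (s + t)) = x / y" unfolding e by simp
    ultimately have "fst (gflow t (psi y x s)) = gline (mat 1) r" by (simp add: eq)
    then show ?L using t r psi_in[of y x s] unfolding flux_set_def by blast
  qed
qed

lemma flux_slice:
  fixes y E :: real
  assumes "y > 0" "E > 1"
  shows "{x. x \<noteq> 0 \<and> y / x - y\<^sup>2 \<in> {1..<E}} = {y / (E + y\<^sup>2)<..y / (1 + y\<^sup>2)}"
proof -
  have p: "1 + y\<^sup>2 > 0" "E + y\<^sup>2 > 0" using assms by (auto simp: add_pos_nonneg)
  have a: "y / x - y\<^sup>2 \<in> {1..<E} \<longleftrightarrow> x \<in> {y / (E + y\<^sup>2)<..y / (1 + y\<^sup>2)}" if "x > 0" for x
    using that p by (auto simp: field_simps)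
  have b: "\<not> y / x - y\<^sup>2 \<in> {1..<E}" if "x < 0" for x
  proof -
    have "y / x - y\<^sup>2 < 1" using that assms divide_pos_neg[of y x] zero_le_power2[of y] by linarith
    then show ?thesis by simp
  qed
  have c: "x > 0" if "x \<in> {y / (E + y\<^sup>2)<..y / (1 + y\<^sup>2)}" for x
    using that assms p by (metis divide_pos_pos greaterThanAtMost_iff less_trans)
  show ?thesis
  proof (rule Set.set_eqI)
    fix x
    show "x \<in> {x. x \<noteq> 0 \<and> y / x - y\<^sup>2 \<in> {1..<E}} \<longleftrightarrow> x \<in> {y / (E + y\<^sup>2)<..y / (1 + y\<^sup>2)}"
      unfolding mem_Collect_eq using a[of x] b[of x] c[of x] by (metis less_irrefl neq_iff)
  qed
qed

text \<open>The slices in \<open>s\<close> have length 1 and those in \<open>x\<close> have length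
  \<open>w \<bar>y\<bar>\<close>. The integral of \<open>w\<close> over a half-line is
  \<open>l\<close>, each sign of \<open>y\<close> contributes once, and the factor 2 of
  \<open>nn_integral_lam\<close> makes \<open>4 * l\<close>.\<close>

lemma emeasure_flux_axis:
  assumes l: "l > 0"
  shows "emeasure lam (flux_set (gline (mat 1)) l) = ennreal (4 * l)"
proof -
  let ?B = "flux_set (gline (mat 1)) l"
  define E where "E = exp (2 * l)"
  have E: "E > 1" using l by (simp add: E_def)
  have B: "?B \<in> sets lam" by (intro flux_set_measurable continuous_gline) (auto simp: det_I)
  have s_int: "(\<integral>\<^sup>+s. indicator ?B (psi y x s) \<partial>lborel) = indicator {x. x \<noteq> 0 \<and> y / x - y\<^sup>2 \<in> {1..<E}} x"
    if "x \<noteq> 0" "y \<noteq> 0" for x y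
  proof -
    have "(\<integral>\<^sup>+s. indicator ?B (psi y x s) \<partial>lborel)
      = (\<integral>\<^sup>+s. indicator {x. x \<noteq> 0 \<and> y / x - y\<^sup>2 \<in> {1..<E}} x * indicator {ln (x / y - x\<^sup>2) / 2 - 1 <.. ln (x / y - x\<^sup>2) / 2} s \<partial>lborel)"
      using that by (intro nn_integral_cong) (auto simp: indicator_def psi_in_flux_axis E_def)
    also have "\<dots> = indicator {x. x \<noteq> 0 \<and> y / x - y\<^sup>2 \<in> {1..<E}} x"
      by (subst nn_integral_cmult_indicator) auto
    finally show ?thesis .
  qed
  define w where "w y = y / (1 + y\<^sup>2) - y / (E + y\<^sup>2)" for y :: real
  have [measurable]: "w \<in> borel_measurable borel" unfolding w_def by measurable
  have x_pos: "(\<integral>\<^sup>+x. indicator {x. x \<noteq> 0 \<and> y / x - y\<^sup>2 \<in> {1..<E}} x \<partial>lborel) = ennreal (w y)" if "y > 0" for y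
  proof -
    have "y / (E + y\<^sup>2) \<le> y / (1 + y\<^sup>2)" using that E by (intro divide_left_mono mult_pos_pos) (auto simp: add_pos_nonneg)
    then show ?thesis unfolding flux_slice[OF that E] by (simp add: w_def)
  qed
  have x_neg: "(\<integral>\<^sup>+x. indicator {x. x \<noteq> 0 \<and> y / x - y\<^sup>2 \<in> {1..<E}} x \<partial>lborel) = ennreal (w (- y))" if "y < 0" for y
  proof -
    have "(\<integral>\<^sup>+x. indicator {x. x \<noteq> 0 \<and> y / x - y\<^sup>2 \<in> {1..<E}} x \<partial>lborel)
      = ennreal \<bar>-1\<bar> * (\<integral>\<^sup>+x. indicator {x. x \<noteq> 0 \<and> y / x - y\<^sup>2 \<in> {1..<E}} (0 + (-1) * x) \<partial>lborel)"
      by (rule nn_integral_real_affine) auto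
    also have "\<dots> = (\<integral>\<^sup>+x. indicator {x. x \<noteq> 0 \<and> (- y) / x - (- y)\<^sup>2 \<in> {1..<E}} x \<partial>lborel)"
    proof -
      have "indicator {x. x \<noteq> 0 \<and> y / x - y\<^sup>2 \<in> {1..<E}} (0 + (-1) * x)
        = (indicator {x. x \<noteq> 0 \<and> (- y) / x - (- y)\<^sup>2 \<in> {1..<E}} x :: ennreal)" for x
        by (simp add: indicator_def)
      then show ?thesis by simp
    qed
    finally show ?thesis using x_pos[of "- y"] that by simp
  qed
  \<comment> \<open>The primitive \<open>(ln (1 + y\<^sup>2) - ln (E + y\<^sup>2)) / 2\<close> rises
    from \<open>- l\<close> at 0 to 0 at infinity, since \<open>E = exp (2 * l)\<close>.\<close>
  have w_int: "(\<integral>\<^sup>+y. ennreal (w y) * indicator {0..} y \<partial>lborel) = ennreal l"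
  proof -
    have wnn: "0 \<le> w y" if "0 \<le> y" for y
    proof -
      have "y / (E + y\<^sup>2) \<le> y / (1 + y\<^sup>2)" using that E by (intro divide_left_mono mult_pos_pos) (auto simp: add_pos_nonneg)
      then show ?thesis by (simp add: w_def)
    qed
    have p: "1 + y\<^sup>2 > 0" "E + y\<^sup>2 > 0" for y :: real using E by (auto simp: add_pos_nonneg)
    have "((\<lambda>y::real. (ln (1 + y\<^sup>2) - ln (E + y\<^sup>2)) / 2) \<longlongrightarrow> 0) at_top"
      using E by real_asymp
    then have "(\<integral>\<^sup>+y. ennreal (w y) * indicator {0..} y \<partial>lborel) = 0 - (ln (1 + 0\<^sup>2) - ln (E + 0\<^sup>2)) / 2"
    proof (rule nn_integral_FTC_atLeast[rotated 3])
      show "((\<lambda>y. (ln (1 + y\<^sup>2) - ln (E + y\<^sup>2)) / 2) has_real_derivative w y) (at y)" for y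
        using p[of y] by (auto intro!: derivative_eq_intros simp: w_def mult.commute)
    qed (use wnn in auto)
    then show ?thesis by (simp add: E_def)
  qed
  have "emeasure lam ?B = (\<integral>\<^sup>+v. indicator ?B v \<partial>lam)" using B by simp
  also have "\<dots> = 2 * (\<integral>\<^sup>+y. \<integral>\<^sup>+x. \<integral>\<^sup>+s. indicator ?B (psi y x s) \<partial>lborel \<partial>lborel \<partial>lborel)"
    by (rule nn_integral_lam) (use B in auto)
  also have "(\<integral>\<^sup>+y. \<integral>\<^sup>+x. \<integral>\<^sup>+s. indicator ?B (psi y x s) \<partial>lborel \<partial>lborel \<partial>lborel)
      = (\<integral>\<^sup>+y. ennreal (w y) * indicator {0..} y + ennreal (w (- y)) * indicator {..0} y \<partial>lborel)"
  proof (rule nn_integral_cong_AE)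
    have "(\<integral>\<^sup>+x. \<integral>\<^sup>+s. indicator ?B (psi y x s) \<partial>lborel \<partial>lborel) = ennreal (w y) * indicator {0..} y + ennreal (w (- y)) * indicator {..0} y"
      if y: "y \<noteq> 0" for y
    proof -
      have "(\<integral>\<^sup>+x. \<integral>\<^sup>+s. indicator ?B (psi y x s) \<partial>lborel \<partial>lborel)
        = (\<integral>\<^sup>+x. indicator {x. x \<noteq> 0 \<and> y / x - y\<^sup>2 \<in> {1..<E}} x \<partial>lborel)"
        using AE_lborel_singleton[of 0] s_int y by (intro nn_integral_cong_AE) (auto elim!: eventually_mono)
      also have "\<dots> = ennreal (w y) * indicator {0..} y + ennreal (w (- y)) * indicator {..0} y"
        using x_pos[of y] x_neg[of y] y by (cases "y > 0") auto
      finally show ?thesis .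
    qed
    then show "AE y in lborel. (\<integral>\<^sup>+x. \<integral>\<^sup>+s. indicator ?B (psi y x s) \<partial>lborel \<partial>lborel)
       = ennreal (w y) * indicator {0..} y + ennreal (w (- y)) * indicator {..0} y"
      using AE_lborel_singleton[of 0] by (auto elim!: eventually_mono)
  qed
  also have "\<dots> = ennreal l + (\<integral>\<^sup>+y. ennreal (w (- y)) * indicator {..0} y \<partial>lborel)"
    by (subst nn_integral_add) (auto simp: w_int)
  also have "(\<integral>\<^sup>+y. ennreal (w (- y)) * indicator {..0} y \<partial>lborel) = ennreal l"
  proof -
    have "(\<integral>\<^sup>+y. ennreal (w y) * indicator {0..} y \<partial>lborel) = ennreal \<bar>-1\<bar> * (\<integral>\<^sup>+y. ennreal (w (0 + (-1) * y)) * indicator {0..} (0 + (-1) * y) \<partial>lborel)"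
      by (rule nn_integral_real_affine) auto
    then show ?thesis unfolding w_int by (simp add: indicator_def)
  qed
  also have "2 * (ennreal l + ennreal l) = ennreal (4 * l)"
  proof -
    have "2 * (ennreal l + ennreal l) = ennreal 2 * ennreal (l + l)" using l by (simp add: ennreal_plus[symmetric] del: ennreal_plus)
    also have "\<dots> = ennreal (2 * (l + l))" using l by (subst ennreal_mult) auto
    finally show ?thesis by simp
  qed
  finally show ?thesis .
qed

lemma emeasure_flux_set:
  assumes "det B = 1" "l > 0" shows "emeasure lam (flux_set (gline B) l) = ennreal (4 * l)"
  using flux_set_gline[OF assms(1)] emeasure_flux_axis[OF assms(2)] by simp

section \<open>Fuchsian groups\<close>

abbreviation (input) "Zpm \<equiv> {mat 1, - mat 1 :: real^2^2}"

lemma uminus_mult_2: "(- A) ** B = - (A ** B)" "A ** (- B) = - (A ** B)" for A B :: "real^2^2"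
  by (rule mat2_eqI; simp add: matrix_mult_2_nth)+

lemma SL2R_simps [simp]: "carrier SL2R = {A. det A = 1}" "monoid.mult SL2R = (**)" "one SL2R = mat 1"
  by (simp_all add: SL2R_def)

lemma group_SL2R: "group SL2R"
proof (rule groupI)
  fix A assume "A \<in> carrier SL2R"
  then show "\<exists>B\<in>carrier SL2R. B \<otimes>\<^bsub>SL2R\<^esub> A = \<one>\<^bsub>SL2R\<^esub>"
    using adj2_mult(1)[of A] by (intro bexI[of _ "adj2 A"]) auto
qed (auto simp: det_mult_1 det_I matrix_mul_assoc)

lemma inv_SL2R: "det A = 1 \<Longrightarrow> inv\<^bsub>SL2R\<^esub> A = adj2 A"
  using group.inv_equality[OF group_SL2R, of "adj2 A" A] by (simp add: adj2_mult)

lemma det_uminus_2 [simp]: "det (- A) = det A" for A :: "real^2^2"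
  by (simp add: det_2)

lemma coset_SL2R: "Zpm #>\<^bsub>SL2R\<^esub> A = {A, - A}"
  by (auto simp: r_coset_def uminus_mult_2)

lemma normal_Zpm: "Zpm \<lhd> SL2R"
proof -
  interpret group SL2R by (rule group_SL2R)
  have "subgroup Zpm SL2R"
  proof (rule subgroupI)
    fix A assume "A \<in> Zpm"
    moreover have "adj2 (mat 1) = mat 1" "adj2 (- mat 1) = - mat 1"
      by (rule mat2_eqI; simp add: adj2_def mat_def)+
    ultimately show "inv\<^bsub>SL2R\<^esub> A \<in> Zpm" by (auto simp: inv_SL2R det_I)
  qed (auto simp: det_I uminus_mult_2)
  then show ?thesis
    by (rule normalI) (auto simp: r_coset_def l_coset_def uminus_mult_2)
qed

lemma carrier_PSL2R: "carrier PSL2R = {{A, - A} | A. det A = 1}"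
  unfolding PSL2R_def carrier_FactGroup coset_SL2R by auto

locale fuchsian =
  fixes G :: "(real^2^2) set set"
  assumes fuchsian: "fuchsian_group G"
begin

text \<open>The preimage of the group in SL(2, R). Calculating with matrices avoids cosets, at the
  price that every sum over the group is doubled.\<close>

definition Gam :: "(real^2^2) set" where "Gam = \<Union>G"

lemma subgroup_G: "subgroup G PSL2R" using fuchsian by (simp add: fuchsian_group_def)

lemma G_elem: "X \<in> G \<Longrightarrow> \<exists>A. det A = 1 \<and> X = {A, - A}"
  using subgroup.subset[OF subgroup_G] by (auto simp: carrier_PSL2R)

lemma Gam_elem:
  assumes "A \<in> Gam" shows "det A = 1" "{A, - A} \<in> G"
proof -
  obtain X where X: "X \<in> G" "A \<in> X" using assms by (auto simp: Gam_def)
  obtain B where B: "det B = 1" "X = {B, - B}" using G_elem[OF X(1)] by blast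
  show "det A = 1" using X B by auto
  have "{A, - A} = {B, - B}" using X(2) B(2) by auto
  then show "{A, - A} \<in> G" using X B by simp
qed

lemma Gam_det [simp]: "A \<in> Gam \<Longrightarrow> det A = 1" by (rule Gam_elem(1))

lemma Gam_uminus: "A \<in> Gam \<Longrightarrow> - A \<in> Gam" using Gam_elem(2) unfolding Gam_def by blast

lemma Gam_mult: 
  assumes "A \<in> Gam" "B \<in> Gam" shows "A ** B \<in> Gam"
proof -
  have "{A, - A} \<otimes>\<^bsub>PSL2R\<^esub> {B, - B} \<in> G"
    using Gam_elem[OF assms(1)] Gam_elem[OF assms(2)] by (intro subgroup.m_closed[OF subgroup_G])
  moreover have "A ** B \<in> {A, - A} \<otimes>\<^bsub>PSL2R\<^esub> {B, - B}" by (auto simp: PSL2R_def set_mult_def)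
  ultimately show ?thesis unfolding Gam_def by blast
qed

lemma Gam_one: "mat 1 \<in> Gam"
  using subgroup.one_closed[OF subgroup_G] by (auto simp: PSL2R_def Gam_def)

lemma Gam_adj2:
  assumes "A \<in> Gam" shows "adj2 A \<in> Gam"
proof -
  have A: "{A, - A} \<in> G" "det A = 1" using Gam_elem[OF assms] by auto
  then have "{A, - A} \<in> carrier (SL2R Mod Zpm)" using subgroup.subset[OF subgroup_G] by (auto simp: PSL2R_def)
  then have "inv\<^bsub>PSL2R\<^esub> {A, - A} = set_inv\<^bsub>SL2R\<^esub> {A, - A}"
    unfolding PSL2R_def by (rule normal.inv_FactGroup[OF normal_Zpm])
  then have "adj2 A \<in> inv\<^bsub>PSL2R\<^esub> {A, - A}" using inv_SL2R[OF A(2)] by (auto simp: SET_INV_def)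
  moreover have "inv\<^bsub>PSL2R\<^esub> {A, - A} \<in> G" using A subgroup.m_inv_closed[OF subgroup_G] by blast
  ultimately show ?thesis unfolding Gam_def by blast
qed

lemma Gam_discrete: "\<exists>e>0. \<forall>A\<in>Gam. norm (A - mat 1) < e \<longrightarrow> A = mat 1"
proof -
  have Z: "Zpm \<in> G" using subgroup.one_closed[OF subgroup_G] by (simp add: PSL2R_def)
  have "openin (discrete_topology G) {Zpm}" using Z by simp
  then have "openin (subtopology PSL2R_topology G) {Zpm}" using fuchsian by (simp add: fuchsian_group_def)
  then obtain T where T: "openin PSL2R_topology T" "{Zpm} = T \<inter> G" by (auto simp: openin_subtopology)
  have "openin (top_of_set (carrier SL2R)) {A \<in> carrier SL2R. Zpm #>\<^bsub>SL2R\<^esub> A \<in> T}"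
    using T(1) by (simp add: PSL2R_topology_def openin_quotient_topology)
  then obtain U where U: "open U" "{A. det A = 1 \<and> {A, - A} \<in> T} = {A. det A = 1} \<inter> U"
    unfolding openin_open coset_SL2R by auto
  have "mat 1 \<in> {A :: real^2^2. det A = 1 \<and> {A, - A} \<in> T}" using T(2) by (auto simp: det_I)
  then have "mat 1 \<in> U" using U by blast
  then obtain e where e: "e > 0" "ball (mat 1) e \<subseteq> U" using U(1) open_contains_ball by metis
  show ?thesis
  proof (intro exI[of _ "min e 1"] conjI ballI impI)
    \<comment> \<open>The radius is at most 1 because \<open>- mat 1\<close> represents the same
      element as \<open>mat 1\<close> and must be excluded; their difference has an entry of
      absolute value 2.\<close>
    fix A assume A: "A \<in> Gam" "norm (A - mat 1) < min e 1"
    then have "A \<in> U" using e by (auto simp: dist_norm norm_minus_commute)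
    then have "A \<in> {A. det A = 1} \<inter> U" using A by simp
    then have "{A, - A} \<in> T" unfolding U(2)[symmetric] by simp
    then have "{A, - A} \<in> T \<inter> G" using Gam_elem(2)[OF A(1)] by (rule IntI)
    then have "{A, - A} = Zpm" unfolding T(2)[symmetric] by (rule singletonD)
    then have "A = mat 1 \<or> A = - mat 1" by (auto simp: doubleton_eq_iff)
    moreover have "A \<noteq> - mat 1"
    proof
      assume "A = - mat 1"
      then have "\<bar>(A - mat 1) $ 1 $ 1\<bar> = 2" by (simp add: mat_def)
      moreover have "\<bar>(A - mat 1) $ 1 $ 1\<bar> \<le> norm (A - mat 1)"
        by (metis component_le_norm_cart Finite_Cartesian_Product.norm_nth_le order_trans)
      ultimately show False using A(2) by auto
    qed
    ultimately show "A = mat 1" by blast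
  qed (use e in auto)
qed

lemma abs_nth_le_norm: "\<bar>A $ i $ j\<bar> \<le> norm (A :: real^2^2)"
  by (metis component_le_norm_cart Finite_Cartesian_Product.norm_nth_le order_trans)

lemma norm_le_entries:
  fixes A :: "real^2^2" assumes "\<And>i j. \<bar>A $ i $ j\<bar> \<le> R" shows "norm A \<le> 4 * R"
proof -
  have "norm A \<le> norm (A $ 1) + norm (A $ 2)" unfolding norm_vec_def by (rule order_trans[OF L2_set_le_sum]) (auto simp: sum_2)
  moreover have "norm (A $ i) \<le> 2 * R" for i
    using norm_le_l1_cart[of "A $ i"] assms[of i 1] assms[of i 2] by (simp add: sum_2)
  ultimately show ?thesis by (smt (verit))
qed

text \<open>For two matrices with entries bounded by \<open>R\<close>, the product
  \<open>adj2 A ** B\<close> is within a multiple of \<open>norm (B - A)\<close> of the identity. By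
  discreteness such matrices are uniformly separated, whereas an infinite bounded set would have a
  limit point.\<close>

lemma Gam_finite: "finite {A \<in> Gam. \<forall>i j. \<bar>A $ i $ j\<bar> \<le> R}" (is "finite ?S")
proof (rule ccontr)
  assume inf: "infinite ?S"
  obtain e where e: "e > 0" "\<And>A. A \<in> Gam \<Longrightarrow> norm (A - mat 1) < e \<Longrightarrow> A = mat 1" using Gam_discrete by blast
  define d where "d = e / (16 * (\<bar>R\<bar> + 1))"
  have d: "d > 0" using e by (simp add: d_def)
  have sep: "A = B" if AB: "A \<in> ?S" "B \<in> ?S" "norm (B - A) < d" for A B
  proof -
    have A1: "det A = 1" using AB by simp
    have ent: "\<bar>adj2 A $ i $ j\<bar> \<le> \<bar>R\<bar>" for i j
    proof -
      have "\<bar>A $ k $ m\<bar> \<le> R" for k m using AB(1) by simp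
      then have "\<bar>A $ k $ m\<bar> \<le> \<bar>R\<bar>" for k m by (meson abs_ge_self order_trans)
      then have "\<forall>i j. \<bar>adj2 A $ i $ j\<bar> \<le> \<bar>R\<bar>" unfolding forall_2 adj2_def by simp
      then show ?thesis by blast
    qed
    have "adj2 A ** B - mat 1 = adj2 A ** (B - A)"
      unfolding adj2_mult(1)[OF A1, symmetric] by (rule mat2_eqI) (simp_all add: matrix_mult_2_nth algebra_simps)
    moreover have "\<bar>(adj2 A ** (B - A)) $ i $ j\<bar> \<le> 2 * (\<bar>R\<bar> * d)" for i j
    proof -
      have t: "\<bar>adj2 A $ i $ k * (B - A) $ k $ j\<bar> \<le> \<bar>R\<bar> * d" for k
        unfolding abs_mult using ent abs_nth_le_norm[of "B - A" k j] AB(3) by (intro mult_mono) auto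
      have "\<bar>adj2 A $ i $ 1 * (B - A) $ 1 $ j\<bar> + \<bar>adj2 A $ i $ 2 * (B - A) $ 2 $ j\<bar> \<le> 2 * (\<bar>R\<bar> * d)" using t[of 1] t[of 2] by linarith
      then show ?thesis unfolding matrix_mult_2_nth by linarith
    qed
    ultimately have "norm (adj2 A ** B - mat 1) \<le> 4 * (2 * (\<bar>R\<bar> * d))" using norm_le_entries by metis
    also have "\<dots> < e"
    proof -
      have "8 * \<bar>R\<bar> * e < e * (16 * (\<bar>R\<bar> + 1))"
      proof -
        have "e * (16 * (\<bar>R\<bar> + 1)) - 8 * \<bar>R\<bar> * e = 8 * \<bar>R\<bar> * e + 16 * e" by (simp add: algebra_simps)
        moreover have "8 * \<bar>R\<bar> * e \<ge> 0" using e by simp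
        ultimately show ?thesis using e by linarith
      qed
      moreover have "4 * (2 * (\<bar>R\<bar> * d)) = 8 * \<bar>R\<bar> * e / (16 * (\<bar>R\<bar> + 1))" by (simp add: d_def)
      ultimately show ?thesis by (simp add: pos_divide_less_eq add_nonneg_pos)
    qed
    finally have "adj2 A ** B = mat 1" using e(2) AB Gam_mult Gam_adj2 by blast
    then have "A ** (adj2 A ** B) = A" by simp
    then show "A = B" by (simp add: matrix_mul_assoc adj2_mult(2)[OF A1])
  qed
  have "?S \<subseteq> cball 0 (4 * R)" using norm_le_entries by auto
  then obtain x where x: "x islimpt ?S"
    using inf compact_cball[of "0 :: real^2^2" "4 * R"] unfolding compact_eq_Bolzano_Weierstrass by blast
  then have lim: "\<exists>A\<in>?S. A \<noteq> x \<and> dist A x < r" if "r > 0" for r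
    using that unfolding islimpt_approachable by blast
  obtain A where A: "A \<in> ?S" "A \<noteq> x" "dist A x < d / 2" using lim[of "d / 2"] d by (meson half_gt_zero)
  have "min (d / 2) (dist A x) > 0" using d A(2) by simp
  then obtain B where B: "B \<in> ?S" "B \<noteq> x" "dist B x < min (d / 2) (dist A x)" using lim by meson
  have "dist A x < d / 2" "dist B x < d / 2" using A B by auto
  then have "dist B A < d" using dist_triangle_half_r[of x B d A] by (simp add: dist_commute)
  then have "A = B" using sep[OF A(1) B(1)] by (simp add: dist_norm)
  then show False using B(3) by simp
qed

lemma countable_Gam: "countable Gam"
proof -
  have "Gam \<subseteq> (\<Union>n::nat. {A \<in> Gam. \<forall>i j. \<bar>A $ i $ j\<bar> \<le> real n})"
  proof
    fix A assume A: "A \<in> Gam"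
    obtain n :: nat where "norm A \<le> real n" using real_arch_simple by blast
    then have "\<forall>i j. \<bar>A $ i $ j\<bar> \<le> real n" using abs_nth_le_norm[of A] order_trans by blast
    then show "A \<in> (\<Union>n::nat. {A \<in> Gam. \<forall>i j. \<bar>A $ i $ j\<bar> \<le> real n})" using A by blast
  qed
  moreover have "countable (\<Union>n::nat. {A \<in> Gam. \<forall>i j. \<bar>A $ i $ j\<bar> \<le> real n})"
    by (rule countable_UN) (auto intro: countable_finite Gam_finite)
  ultimately show ?thesis by (rule countable_subset)
qed

lemma compact_H_bounds:
  assumes "compact K" "K \<subseteq> \<H>"
  obtains m M where "m > 0" "M > 0" "\<And>z. z \<in> K \<Longrightarrow> m \<le> Im z \<and> cmod z \<le> M"
proof (cases "K = {}")
  case True then show ?thesis using that[of 1 1] by simp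
next
  case False
  obtain z0 where z0: "z0 \<in> K" "\<And>z. z \<in> K \<Longrightarrow> Im z0 \<le> Im z"
    using continuous_attains_inf[OF assms(1) False continuous_on_Im[OF continuous_on_id]] by blast
  obtain B where B: "B > 0" "\<And>z. z \<in> K \<Longrightarrow> cmod z \<le> B" using compact_imp_bounded[OF assms(1)] bounded_pos by metis
  show ?thesis using that[of "Im z0" B] z0 B assms(2) by (auto simp: upper_half_plane_def)
qed

text \<open>By \<open>Im_mobius\<close> the heights of \<open>z\<close> and of its image determine
  the modulus of the denominator \<open>c * z + d\<close>, and then the image determines that of the
  numerator. A real linear form in \<open>z\<close> of bounded modulus has bounded coefficients once
  the height of \<open>z\<close> is bounded below, so all entries are bounded.\<close>

lemma properly_discontinuous:
  assumes K: "compact K" "K \<subseteq> \<H>" and L: "compact L" "L \<subseteq> \<H>"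
  shows "finite {A \<in> Gam. \<exists>z\<in>K. mobius A z \<in> L}"
proof -
  obtain m M where mM: "m > 0" "M > 0" "\<And>z. z \<in> K \<union> L \<Longrightarrow> m \<le> Im z \<and> cmod z \<le> M"
    using compact_H_bounds[of "K \<union> L"] K L compact_Un by (metis Un_least)
  define Q where "Q = sqrt (M / m)"
  define R where "R = max (max (M * Q / m) (M * Q + M * Q / m * M)) (max (Q / m) (Q + Q / m * M))"
  have Q0: "Q \<ge> 0" using mM by (simp add: Q_def)
  have ent: "\<forall>i j. \<bar>A $ i $ j\<bar> \<le> R" if A: "A \<in> Gam" "z \<in> K" "mobius A z \<in> L" for A z
  proof -
    have z: "z \<in> \<H>" "m \<le> Im z" "cmod z \<le> M" using that mM K by auto
    have w: "m \<le> Im (mobius A z)" "cmod (mobius A z) \<le> M" using that mM by auto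
    have bnd: "\<bar>p\<bar> \<le> C / m \<and> \<bar>q\<bar> \<le> C + C / m * M" if "cmod (of_real p * z + of_real q) \<le> C" for p q C
    proof -
      have "\<bar>p\<bar> * m \<le> \<bar>p\<bar> * Im z" using z by (intro mult_left_mono) auto
      also have "\<dots> = \<bar>Im (of_real p * z + of_real q)\<bar>" using z by (simp add: abs_mult upper_half_plane_def)
      also have "\<dots> \<le> C" using abs_Im_le_cmod that order_trans by blast
      finally have p: "\<bar>p\<bar> \<le> C / m" using mM by (simp add: field_simps)
      have "\<bar>q\<bar> = cmod ((of_real p * z + of_real q) - of_real p * z)" by simp
      also have "\<dots> \<le> C + \<bar>p\<bar> * cmod z" using norm_triangle_ineq4[of "of_real p * z + of_real q" "of_real p * z"] that by (simp add: norm_mult)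
      also have "\<bar>p\<bar> * cmod z \<le> C / m * M" using p z by (intro mult_mono) auto
      finally show ?thesis using p by simp
    qed
    have dnz: "cmod (mden A z) > 0" using mden_nonzero[of A z] A z by simp
    have "(cmod (mden A z))\<^sup>2 = Im z / Im (mobius A z)" using A z dnz
      by (simp add: Im_mobius) (simp add: upper_half_plane_def)
    also have "\<dots> \<le> M / m" using z w mM abs_Im_le_cmod[of z] by (intro frac_le) (auto simp: upper_half_plane_def)
    finally have den: "cmod (mden A z) \<le> Q" unfolding Q_def by (rule real_le_rsqrt)
    have "cmod (of_real (A$1$1) * z + of_real (A$1$2)) = cmod (mobius A z) * cmod (mden A z)"
      using dnz by (simp add: mobius_eq norm_divide)
    also have "\<dots> \<le> M * Q" using w den mM Q0 by (intro mult_mono) auto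
    finally have "\<bar>A$1$1\<bar> \<le> M * Q / m \<and> \<bar>A$1$2\<bar> \<le> M * Q + M * Q / m * M" by (rule bnd)
    moreover have "\<bar>A$2$1\<bar> \<le> Q / m \<and> \<bar>A$2$2\<bar> \<le> Q + Q / m * M" using den unfolding mden_def by (rule bnd)
    ultimately show ?thesis unfolding forall_2 R_def by linarith
  qed
  have "{A \<in> Gam. \<exists>z\<in>K. mobius A z \<in> L} \<subseteq> {A \<in> Gam. \<forall>i j. \<bar>A $ i $ j\<bar> \<le> R}" using ent by blast
  then show ?thesis using Gam_finite finite_subset by blast
qed

definition regular_points :: "complex set" where
  "regular_points = {z \<in> \<H>. \<forall>A\<in>Gam. mobius A z = z \<longrightarrow> A \<in> Zpm}"

text \<open>A fixed point is a root of \<open>c * z\<^sup>2 + (d - a) * z - b\<close>, a polynomial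
  that vanishes identically only for \<open>mat 1\<close> and its negative, and there are countably
  many matrices.\<close>

lemma countable_irregular: "countable (\<H> - regular_points)"
proof -
  have "finite {z \<in> \<H>. mobius A z = z}" if A: "A \<in> Gam" "A \<notin> Zpm" for A
  proof -
    let ?p = "[:- of_real (A$1$2), of_real (A$2$2 - A$1$1), of_real (A$2$1):] :: complex poly"
    have det: "A$1$1 * A$2$2 - A$1$2 * A$2$1 = 1" using A(1) Gam_det[of A] by (simp add: det_2)
    have "?p \<noteq> 0"
    proof
      assume "?p = 0"
      then have "A$1$2 = 0" "A$2$1 = 0" "A$2$2 = A$1$1" by (auto simp del: of_real_diff)
      then have "A$1$1 = 1 \<or> A$1$1 = -1" using det by (simp add: square_eq_1_iff)
      then have "A = mat 1 \<or> A = - mat 1" using \<open>A$1$2 = 0\<close> \<open>A$2$1 = 0\<close> \<open>A$2$2 = A$1$1\<close>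
        by (auto intro!: mat2_eqI simp: mat_def)
      then show False using A by blast
    qed
    then have "finite {z. poly ?p z = 0}" by (rule poly_roots_finite)
    moreover have "poly ?p z = 0" if "z \<in> \<H>" "mobius A z = z" for z
    proof -
      have "of_real (A$1$1) * z + of_real (A$1$2) = z * mden A z"
        using that A mden_nonzero[of A z] by (simp add: mobius_eq divide_eq_eq)
      then show ?thesis by (simp add: mden_def algebra_simps)
    qed
    ultimately show ?thesis by (elim finite_subset[rotated]) auto
  qed
  then have "countable (\<Union>A\<in>Gam - Zpm. {z \<in> \<H>. mobius A z = z})"
    by (intro countable_UN countable_Diff[OF countable_Gam]) (auto intro: countable_finite)
  then show ?thesis by (rule countable_subset[rotated]) (auto simp: regular_points_def)
qed

lemma regular_borel [measurable]: "regular_points \<in> sets borel"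
proof -
  have "regular_points = \<H> - (\<H> - regular_points)" by (auto simp: regular_points_def)
  moreover have "\<H> - regular_points \<in> sets borel" by (intro sets.countable[OF _ countable_irregular]) auto
  ultimately show ?thesis by (metis H_borel sets.Diff)
qed

lemma regular_mobius:
  assumes z: "z \<in> regular_points" and A: "A \<in> Gam" shows "mobius A z \<in> regular_points"
  unfolding regular_points_def
proof (intro CollectI conjI ballI impI)
  have zH: "z \<in> \<H>" using z by (simp add: regular_points_def)
  then show "mobius A z \<in> \<H>" using A by simp
  fix B assume B: "B \<in> Gam" "mobius B (mobius A z) = mobius A z"
  have "mobius (adj2 A ** (B ** A)) z = mobius (adj2 A) (mobius A z)"
    using zH A B Gam_det[OF A] Gam_det[OF B(1)] by (simp add: mobius_mult det_mult_1)
  then have "mobius (adj2 A ** (B ** A)) z = z" using zH A by simp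
  moreover have "adj2 A ** (B ** A) \<in> Gam" using A B by (intro Gam_mult Gam_adj2)
  ultimately have "adj2 A ** (B ** A) \<in> Zpm" using z by (auto simp: regular_points_def)
  then have "A ** (adj2 A ** (B ** A)) \<in> {A, - A}" by (auto simp: uminus_mult_2)
  then have "B ** A \<in> {A, - A}" using adj2_mult(2)[OF Gam_det[OF A]] by (simp add: matrix_mul_assoc)
  then have "(B ** A) ** adj2 A \<in> Zpm" using adj2_mult(2)[OF Gam_det[OF A]] by (auto simp: uminus_mult_2)
  then show "B \<in> Zpm" using adj2_mult(2)[OF Gam_det[OF A]] by (simp flip: matrix_mul_assoc)
qed

lemma two_translates:
  assumes z: "z \<in> regular_points" and AB: "A \<in> Gam" "B \<in> Gam" "mobius A z = mobius B z"
  shows "B \<in> {A, - A}"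
proof -
  have zH: "z \<in> \<H>" using z by (simp add: regular_points_def)
  have "mobius (adj2 A ** B) z = z" using AB zH Gam_det[OF AB(1)] Gam_det[OF AB(2)]
    by (simp add: mobius_mult AB(3)[symmetric])
  then have "adj2 A ** B \<in> Zpm" using z Gam_mult[OF Gam_adj2[OF AB(1)] AB(2)] by (auto simp: regular_points_def)
  then have "A ** (adj2 A ** B) \<in> {A, - A}" by (auto simp: uminus_mult_2)
  then show ?thesis using adj2_mult(2)[OF Gam_det[OF AB(1)]] by (simp add: matrix_mul_assoc)
qed

section \<open>A Borel fundamental domain\<close>

lemma open_H: "open \<H>" unfolding upper_half_plane_def by (rule open_halfspace_Im_gt)

text \<open>Proper discontinuity leaves finitely many matrices to avoid. Each of them moves
  \<open>z\<close>, hence moves every sufficiently small ball around \<open>z\<close> off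
  itself.\<close>

lemma small_ball:
  assumes z: "z \<in> regular_points"
  shows "\<exists>e>0. \<forall>w\<in>ball z e \<inter> \<H>. \<forall>A\<in>Gam. mobius A w \<in> ball z e \<longrightarrow> A \<in> Zpm"
proof -
  have zH: "z \<in> \<H>" using z by (simp add: regular_points_def)
  then obtain e0 where e0: "e0 > 0" "cball z e0 \<subseteq> \<H>" using open_H open_contains_cball by metis
  define S where "S = {A \<in> Gam. \<exists>w\<in>cball z e0. mobius A w \<in> cball z e0} - Zpm"
  have S: "finite S" unfolding S_def using properly_discontinuous[OF compact_cball e0(2) compact_cball e0(2)] by blast
  have "\<forall>\<^sub>F e in at_right 0. \<forall>w\<in>ball z e \<inter> \<H>. mobius A w \<notin> ball z e" if A: "A \<in> S" for A
  proof -
    have Az: "mobius A z \<noteq> z" "det A = 1" using A z by (auto simp: S_def regular_points_def)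
    define d where "d = dist (mobius A z) z / 2"
    have d: "d > 0" using Az by (simp add: d_def)
    have "continuous (at z) (mobius A)" using mobius_deriv[OF Az(2) zH] DERIV_isCont by blast
    then obtain e1 where e1: "e1 > 0" "\<And>w. dist w z < e1 \<Longrightarrow> dist (mobius A w) (mobius A z) < d"
      using d unfolding continuous_at_eps_delta by blast
    show ?thesis
      unfolding eventually_at_right_field
    proof (intro exI[of _ "min e1 d"] conjI allI impI ballI notI)
      fix e w assume e: "0 < e" "e < min e1 d" "w \<in> ball z e \<inter> \<H>" "mobius A w \<in> ball z e"
      then have "dist (mobius A w) (mobius A z) < d" "dist (mobius A w) z < d"
        using e1(2)[of w] by (auto simp: dist_commute)
      then have "dist (mobius A z) z < 2 * d" using dist_triangle[of "mobius A z" z "mobius A w"] by (simp add: dist_commute)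
      then show False by (simp add: d_def)
    qed (use e1 d in auto)
  qed
  then have "\<forall>\<^sub>F e in at_right 0. \<forall>A\<in>S. \<forall>w\<in>ball z e \<inter> \<H>. mobius A w \<notin> ball z e"
    using S by (simp add: eventually_ball_finite)
  moreover have "\<forall>\<^sub>F e in at_right 0. 0 < e \<and> e < e0" using e0 eventually_at_right_real[of 0 e0] by simp
  ultimately have "\<forall>\<^sub>F e in at_right (0::real). (\<forall>A\<in>S. \<forall>w\<in>ball z e \<inter> \<H>. mobius A w \<notin> ball z e) \<and> 0 < e \<and> e < e0"
    by eventually_elim auto
  then obtain e where e: "\<forall>A\<in>S. \<forall>w\<in>ball z e \<inter> \<H>. mobius A w \<notin> ball z e" "0 < e" "e < e0"
    using eventually_happens'[OF trivial_limit_at_right_real] by blast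
  have "A \<in> Zpm" if "w \<in> ball z e \<inter> \<H>" "A \<in> Gam" "mobius A w \<in> ball z e" for A w
  proof (rule ccontr)
    assume "A \<notin> Zpm"
    moreover have "w \<in> cball z e0" "mobius A w \<in> cball z e0" using that e(3) by auto
    ultimately have "A \<in> S" using that(2) unfolding S_def by blast
    then show False using e(1) that by blast
  qed
  then show ?thesis using e(2) by blast
qed

lemma mobius_borel [measurable]: "mobius A \<in> borel_measurable borel"
  unfolding mobius_def[abs_def] by measurable

text \<open>Countably many basic open sets that inject into the quotient cover the regular points.
  From each of them the orbits already met by an earlier set are removed, so every regular orbit is
  kept exactly in the first set that it meets.\<close>

lemma exists_fundamental_domain:
  "\<exists>D. D \<in> sets borel \<and> D \<subseteq> regular_points \<and> (\<forall>z\<in>D. \<forall>A\<in>Gam. mobius A z \<in> D \<longrightarrow> A \<in> Zpm) \<and>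
    (\<forall>z\<in>regular_points. \<exists>A\<in>Gam. mobius A z \<in> D)"
proof -
  obtain \<B> :: "complex set set" where \<B>: "countable \<B>" "topological_basis \<B>" using ex_countable_basis by blast
  \<comment> \<open>The empty set is added only so that the family is nonempty and can be
    enumerated.\<close>
  define \<U> where "\<U> = insert {} {U \<in> \<B>. \<forall>w\<in>U \<inter> \<H>. \<forall>A\<in>Gam. mobius A w \<in> U \<longrightarrow> A \<in> Zpm}"
  define U where "U = from_nat_into \<U>"
  have \<U>: "countable \<U>" "\<U> \<noteq> {}" using \<B> by (auto simp: \<U>_def)
  then have rU: "range U = \<U>" unfolding U_def by (intro range_from_nat_into) auto
  have inj: "A \<in> Zpm" if "w \<in> U n" "w \<in> \<H>" "A \<in> Gam" "mobius A w \<in> U n" for w n A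
  proof -
    have "U n \<in> \<U>" using rU by blast
    then show ?thesis using that unfolding \<U>_def by blast
  qed
  have [measurable]: "U n \<in> sets borel" for n
  proof -
    have "U n \<in> \<U>" using rU by blast
    then have "open (U n)" unfolding \<U>_def using topological_basis_open[OF \<B>(2)] by auto
    then show ?thesis by simp
  qed
  have cover: "\<exists>n. z \<in> U n" if z: "z \<in> regular_points" for z
  proof -
    obtain e where e: "e > 0" "\<forall>w\<in>ball z e \<inter> \<H>. \<forall>A\<in>Gam. mobius A w \<in> ball z e \<longrightarrow> A \<in> Zpm" using small_ball[OF z] by blast
    obtain V where V: "V \<in> \<B>" "z \<in> V" "V \<subseteq> ball z e"
      using topological_basisE[OF \<B>(2) open_ball[of z e], of z] e(1) by auto
    then have "V \<in> \<U>" using e(2) unfolding \<U>_def by blast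
    then show ?thesis using rU V by (metis rangeE)
  qed
  define E where "E n = U n \<inter> regular_points - (\<Union>k<n. \<Union>A\<in>Gam. {z. mobius A z \<in> U k})" for n
  have [measurable]: "E n \<in> sets borel" for n
  proof -
    have "{z. mobius A z \<in> U k} \<in> sets borel" for A k using measurable_sets[OF mobius_borel, of "U k" A] by (simp add: vimage_def)
    then show ?thesis unfolding E_def using countable_Gam by (intro sets.Diff sets.Int sets.finite_UN sets.countable_UN') auto
  qed
  show ?thesis
  proof (intro exI[of _ "\<Union>n. E n"] conjI ballI impI)
    show "(\<Union>n. E n) \<in> sets borel" by measurable
    show "(\<Union>n. E n) \<subseteq> regular_points" by (auto simp: E_def)
  next
    fix z A assume z: "z \<in> (\<Union>n. E n)" and A: "A \<in> Gam" "mobius A z \<in> (\<Union>n. E n)"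
    then obtain n m where nm: "z \<in> E n" "mobius A z \<in> E m" by blast
    have zH: "z \<in> \<H>" using nm by (simp add: E_def regular_points_def)
    have "\<not> m < n" using nm A(1) unfolding E_def by blast
    moreover have "\<not> n < m"
    proof
      assume "n < m"
      moreover have "mobius (adj2 A) (mobius A z) \<in> U n" using nm zH A by (simp add: E_def)
      ultimately show False using nm(2) Gam_adj2[OF A(1)] unfolding E_def by blast
    qed
    ultimately have "m = n" by simp
    then show "A \<in> Zpm" using inj[of z n A] nm A zH unfolding E_def by blast
  next
    fix z assume z: "z \<in> regular_points"
    define P where "P n \<longleftrightarrow> (\<exists>A\<in>Gam. mobius A z \<in> U n)" for n
    have zH: "z \<in> \<H>" using z by (simp add: regular_points_def)
    have "\<exists>n. P n" using cover[OF z] Gam_one unfolding P_def by force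
    then obtain n where n: "P n" "\<And>k. k < n \<Longrightarrow> \<not> P k" using exists_least_iff[of P] by blast
    then obtain A where A: "A \<in> Gam" "mobius A z \<in> U n" unfolding P_def by blast
    have "mobius A z \<in> E n"
      unfolding E_def
    proof (intro DiffI IntI A regular_mobius[OF z A(1)] notI)
      assume "mobius A z \<in> (\<Union>k<n. \<Union>B\<in>Gam. {z. mobius B z \<in> U k})"
      then obtain k B where kB: "k < n" "B \<in> Gam" "mobius B (mobius A z) \<in> U k" by blast
      then have "mobius (B ** A) z \<in> U k" using zH A by (simp add: mobius_mult)
      then have "P k" using Gam_mult[OF kB(2) A(1)] unfolding P_def by blast
      then show False using n(2) kB(1) by blast
    qed
    then show "\<exists>A\<in>Gam. mobius A z \<in> (\<Union>n. E n)" using A(1) by blast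
  qed
qed

definition fdom :: "complex set" where
  "fdom = (SOME D. D \<in> sets borel \<and> D \<subseteq> regular_points \<and> (\<forall>z\<in>D. \<forall>A\<in>Gam. mobius A z \<in> D \<longrightarrow> A \<in> Zpm) \<and>
    (\<forall>z\<in>regular_points. \<exists>A\<in>Gam. mobius A z \<in> D))"

lemma fdom:
  shows fdom_borel [measurable]: "fdom \<in> sets borel" and fdom_regular: "fdom \<subseteq> regular_points"
    and fdom_inj: "\<And>z A. z \<in> fdom \<Longrightarrow> A \<in> Gam \<Longrightarrow> mobius A z \<in> fdom \<Longrightarrow> A \<in> Zpm"
    and fdom_cover: "\<And>z. z \<in> regular_points \<Longrightarrow> \<exists>A\<in>Gam. mobius A z \<in> fdom"
  using someI_ex[OF exists_fundamental_domain] unfolding fdom_def[symmetric] by blast+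

end

lemma nn_integral_mpt:
  assumes "T \<in> measurable M M" "distr M M T = M" "f \<in> borel_measurable M"
  shows "(\<integral>\<^sup>+v. f (T v) \<partial>M) = (\<integral>\<^sup>+v. f v \<partial>M)"
proof -
  have "(\<integral>\<^sup>+v. f v \<partial>distr M M T) = (\<integral>\<^sup>+v. f (T v) \<partial>M)"
    by (rule nn_integral_distr[OF assms(1)]) (use assms(3) in simp)
  then show ?thesis by (simp only: assms(2))
qed

context fuchsian
begin

section \<open>Unfolding over a fundamental domain\<close>

definition Fdom :: "(complex \<times> complex) set" where
  "Fdom = fdom \<times> sphere 0 1"

lemma Fdom_lam [measurable]: "Fdom \<in> sets lam"
proof -
  have "Fdom \<in> sets borel" unfolding Fdom_def borel_prod[symmetric] by (intro pair_measureI) measurable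
  moreover have "Fdom \<subseteq> T1H" using fdom_regular by (auto simp: Fdom_def T1H_def regular_points_def)
  ultimately show ?thesis by (simp add: sets_lam)
qed

text \<open>For fixed \<open>x\<close> and \<open>s\<close> the base point moves horizontally, hence
  injectively, with \<open>y\<close>, so only countably many \<open>y\<close> lead to a cone point.
  The integration over \<open>y\<close> is therefore moved innermost.\<close>

lemma AE_regular: "AE v in lam. fst v \<in> regular_points"
proof -
  have "{v \<in> T1H. fst v \<in> regular_points} = regular_points \<times> sphere 0 1"
    by (auto simp: T1H_def regular_points_def)
  moreover have "regular_points \<times> sphere (0::complex) 1 \<in> sets borel"
    unfolding borel_prod[symmetric] by (intro pair_measureI) measurable
  ultimately have m: "{v \<in> T1H. fst v \<in> regular_points} \<in> sets lam" by (auto simp: sets_lam)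
  have "AE y in lborel. fst (psi y x s) \<in> regular_points" for x s
  proof -
    let ?g = "\<lambda>y. fst (psi y x s)"
    have inj: "inj ?g" by (auto simp: inj_on_def psi_def)
    have "countable (?g -` (\<H> - regular_points))"
      using countable_image_inj_on[of ?g "?g -` (\<H> - regular_points)"]
        countable_subset[OF image_vimage_subset countable_irregular] inj_on_subset[OF inj] by blast
    then have "?g -` (\<H> - regular_points) \<in> null_sets lborel" by (rule countable_imp_null_set_lborel)
    then have "AE y in lborel. y \<notin> ?g -` (\<H> - regular_points)" by (rule AE_not_in)
    then show ?thesis
    proof (rule eventually_mono)
      fix y assume "y \<notin> ?g -` (\<H> - regular_points)"
      moreover have "?g y \<in> \<H>" using psi_in[of y x s] by (auto simp: T1H_def)
      ultimately show "?g y \<in> regular_points" by simp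
    qed
  qed note ae = this
  have mb: "{v. fst v \<in> regular_points} \<in> sets (borel :: (complex \<times> complex) measure)"
  proof -
    have "fst \<in> borel_measurable (borel :: (complex \<times> complex) measure)"
      by (intro borel_measurable_continuous_onI continuous_intros)
    from measurable_sets[OF this regular_borel] show ?thesis by (simp add: vimage_def)
  qed
  have mc: "{v. fst v \<notin> regular_points} \<in> sets (borel :: (complex \<times> complex) measure)"
  proof -
    have "{v. fst v \<notin> regular_points} = UNIV - {v :: complex \<times> complex. fst v \<in> regular_points}" by auto
    then show ?thesis using sets.compl_sets[OF mb] by simp
  qed
  have ind: "(\<integral>\<^sup>+v. indicator {v :: complex \<times> complex. fst v \<notin> regular_points} v \<partial>lam) = 0"
  proof -
    let ?I = "\<lambda>v. indicator {v :: complex \<times> complex. fst v \<notin> regular_points} v :: ennreal"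
    have I [measurable]: "?I \<in> borel_measurable borel" by (intro borel_measurable_indicator mc)
    have "(\<integral>\<^sup>+v. ?I v \<partial>lam) = 2 * (\<integral>\<^sup>+y. \<integral>\<^sup>+x. \<integral>\<^sup>+s. ?I (psi y x s) \<partial>lborel \<partial>lborel \<partial>lborel)"
      by (rule nn_integral_lam_borel[OF I])
    also have "(\<integral>\<^sup>+y. \<integral>\<^sup>+x. \<integral>\<^sup>+s. ?I (psi y x s) \<partial>lborel \<partial>lborel \<partial>lborel)
      = (\<integral>\<^sup>+x. \<integral>\<^sup>+y. \<integral>\<^sup>+s. ?I (psi y x s) \<partial>lborel \<partial>lborel \<partial>lborel)"
      by (rule fubini3) (simp add: split_beta', measurable)
    also have "\<dots> = (\<integral>\<^sup>+x. \<integral>\<^sup>+s. \<integral>\<^sup>+y. ?I (psi y x s) \<partial>lborel \<partial>lborel \<partial>lborel)"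
      by (rule nn_integral_cong, rule fubini3) (simp add: split_beta', measurable)
    also have "\<dots> = (\<integral>\<^sup>+x. \<integral>\<^sup>+s. 0 \<partial>(lborel :: real measure) \<partial>(lborel :: real measure))"
    proof (rule nn_integral_cong, rule nn_integral_cong)
      fix x s :: real
      have "(\<integral>\<^sup>+y. ?I (psi y x s) \<partial>lborel) = (\<integral>\<^sup>+y. 0 \<partial>(lborel :: real measure))"
        using ae[of x s] by (intro nn_integral_cong_AE) (auto elim!: eventually_mono)
      then show "(\<integral>\<^sup>+y. ?I (psi y x s) \<partial>lborel) = 0" by simp
    qed
    finally show ?thesis by simp
  qed
  have "indicator {v :: complex \<times> complex. fst v \<notin> regular_points} \<in> borel_measurable (lam)"
    by (intro lam_measurable_borel borel_measurable_indicator mc)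
  from nn_integral_0_iff_AE[OF this] ind show ?thesis by (simp add: indicator_def)
qed

lemma nn_integral_mobius_inv:
  assumes "det A = 1" "f \<in> borel_measurable lam"
  shows "(\<integral>\<^sup>+v. f (mobius_T1 A v) \<partial>lam) = (\<integral>\<^sup>+v. f v \<partial>lam)"
  by (rule nn_integral_mpt[OF measurable_mobius_T1[OF assms(1)] distr_lam_mobius[OF assms(1)] assms(2)])

lemma nn_integral_gflow_inv:
  assumes "f \<in> borel_measurable lam"
  shows "(\<integral>\<^sup>+v. f (gflow t v) \<partial>lam) = (\<integral>\<^sup>+v. f v \<partial>lam)"
  by (rule nn_integral_mpt[OF measurable_gflow distr_lam_gflow assms])

lemma AE_gflow:
  assumes "AE v in lam. P v" shows "AE v in lam. P (gflow t v)"
  by (rule AE_distrD[OF measurable_gflow]) (use assms in \<open>simp only: distr_lam_gflow\<close>)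

lemma one_ne_uminus [simp]: "mat 1 \<noteq> - (mat 1 :: real^2^2)"
proof
  assume "mat 1 = - (mat 1 :: real^2^2)"
  then have "(mat 1 :: real^2^2) $ 1 $ 1 = - ((mat 1 :: real^2^2) $ 1 $ 1)" by (metis vector_uminus_component)
  then show False by (simp add: mat_def)
qed

lemma Gam_ne_uminus:
  assumes "A \<in> Gam" shows "A \<noteq> - A"
proof
  assume eq: "A = - A"
  have "A $ i $ j = 0" for i j using arg_cong[OF eq, of "\<lambda>M. M $ i $ j"] by simp
  then show False using Gam_det[OF assms] by (simp add: det_2)
qed

lemma count_Fdom:
  assumes "v \<in> T1H" "fst v \<in> regular_points"
  shows "(\<integral>\<^sup>+A. indicator Fdom (mobius_T1 A v) \<partial>count_space Gam) = 2"
proof -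
  obtain A where A: "A \<in> Gam" "mobius A (fst v) \<in> fdom" using fdom_cover[OF assms(2)] by blast
  have F: "mobius_T1 B v \<in> Fdom \<longleftrightarrow> mobius B (fst v) \<in> fdom" if "B \<in> Gam" for B
    using mobius_T1_in[of B v] that assms(1) by (auto simp: Fdom_def mem_Times_iff mobius_T1_fst T1H_def)
  have "mobius_T1 B v \<in> Fdom \<longleftrightarrow> B \<in> {A, - A}" if B: "B \<in> Gam" for B
  proof
    assume "mobius_T1 B v \<in> Fdom"
    then have b: "mobius B (fst v) \<in> fdom" using F B by blast
    have zH: "fst v \<in> \<H>" using assms by (auto simp: regular_points_def)
    have "mobius (B ** adj2 A) (mobius A (fst v)) = mobius B (fst v)"
      using zH A B by (simp add: mobius_mult)
    then have "B ** adj2 A \<in> Zpm" using fdom_inj[OF A(2), of "B ** adj2 A"] b A B Gam_mult Gam_adj2 by metis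
    then have "(B ** adj2 A) ** A \<in> {A, - A}" by (auto simp: uminus_mult_2)
    then show "B \<in> {A, - A}" using adj2_mult(1)[OF Gam_det[OF A(1)]] by (simp flip: matrix_mul_assoc)
  next
    assume "B \<in> {A, - A}" then show "mobius_T1 B v \<in> Fdom" using F[OF B] A by auto
  qed
  then have "(\<integral>\<^sup>+B. indicator Fdom (mobius_T1 B v) \<partial>count_space Gam) = (\<integral>\<^sup>+B. indicator {A, - A} B \<partial>count_space Gam)"
    by (intro nn_integral_cong) (auto simp: indicator_def)
  also have "\<dots> = emeasure (count_space Gam) {A, - A}"
    using A Gam_uminus by (intro nn_integral_indicator) auto
  also have "\<dots> = 2" using A Gam_uminus Gam_ne_uminus[OF A(1)] by (subst emeasure_count_space_finite) auto
  finally show ?thesis .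
qed

text \<open>By \<open>count_Fdom\<close> the translates of \<open>indicator Fdom\<close> sum to 2
  almost everywhere. Inserting this sum, exchanging sum and integral, substituting in each term by
  invariance of \<open>lam\<close> and replacing \<open>A\<close> by its inverse moves the group sum
  onto \<open>g\<close>.\<close>

lemma unfolding_lam:
  assumes g: "g \<in> borel_measurable lam"
  shows "(\<integral>\<^sup>+v. (\<integral>\<^sup>+A. g (mobius_T1 A v) \<partial>count_space Gam) * indicator Fdom v \<partial>lam) = 2 * (\<integral>\<^sup>+v. g v \<partial>lam)"
proof -
  have m: "(\<lambda>v. g (mobius_T1 A v)) \<in> borel_measurable lam" if "A \<in> Gam" for A
    using measurable_compose[OF measurable_mobius_T1 g] that by simp
  have F: "indicator Fdom \<in> borel_measurable lam" by (intro borel_measurable_indicator Fdom_lam)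
  have mF: "(\<lambda>v. indicator Fdom (mobius_T1 A v) :: ennreal) \<in> borel_measurable lam" if "A \<in> Gam" for A
    using measurable_compose[OF measurable_mobius_T1 F] that by simp
  have "2 * (\<integral>\<^sup>+v. g v \<partial>lam) = (\<integral>\<^sup>+v. g v * 2 \<partial>lam)"
    using g by (subst mult.commute) (simp add: nn_integral_multc)
  also have "\<dots> = (\<integral>\<^sup>+v. g v * (\<integral>\<^sup>+A. indicator Fdom (mobius_T1 A v) \<partial>count_space Gam) \<partial>lam)"
  proof (rule nn_integral_cong_AE)
    show "AE v in lam. g v * 2 = g v * (\<integral>\<^sup>+A. indicator Fdom (mobius_T1 A v) \<partial>count_space Gam)"
      using AE_regular AE_space by eventually_elim (simp add: count_Fdom)
  qed
  also have "\<dots> = (\<integral>\<^sup>+v. \<integral>\<^sup>+A. g v * indicator Fdom (mobius_T1 A v) \<partial>count_space Gam \<partial>lam)"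
    by (intro nn_integral_cong) (simp add: nn_integral_cmult)
  also have "\<dots> = (\<integral>\<^sup>+A. \<integral>\<^sup>+v. g v * indicator Fdom (mobius_T1 A v) \<partial>lam \<partial>count_space Gam)"
    by (rule nn_integral_count_space_nn_integral[OF countable_Gam]) (use g mF in measurable)
  also have "\<dots> = (\<integral>\<^sup>+A. \<integral>\<^sup>+v. g (mobius_T1 (adj2 A) v) * indicator Fdom v \<partial>lam \<partial>count_space Gam)"
  proof (rule nn_integral_cong)
    fix A assume "A \<in> space (count_space Gam)"
    then have A: "A \<in> Gam" by simp
    have mm: "(\<lambda>v. g v * indicator Fdom (mobius_T1 A v)) \<in> borel_measurable lam" using g mF[OF A] by measurable
    have "(\<integral>\<^sup>+v. g v * indicator Fdom (mobius_T1 A v) \<partial>lam)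
      = (\<integral>\<^sup>+v. g (mobius_T1 (adj2 A) v) * indicator Fdom (mobius_T1 A (mobius_T1 (adj2 A) v)) \<partial>lam)"
      using nn_integral_mobius_inv[OF _ mm, of "adj2 A"] A by simp
    also have "\<dots> = (\<integral>\<^sup>+v. g (mobius_T1 (adj2 A) v) * indicator Fdom v \<partial>lam)"
      using A by (intro nn_integral_cong) simp
    finally show "(\<integral>\<^sup>+v. g v * indicator Fdom (mobius_T1 A v) \<partial>lam) = (\<integral>\<^sup>+v. g (mobius_T1 (adj2 A) v) * indicator Fdom v \<partial>lam)" .
  qed
  also have "\<dots> = (\<integral>\<^sup>+A. \<integral>\<^sup>+v. g (mobius_T1 A v) * indicator Fdom v \<partial>lam \<partial>count_space Gam)"
  proof (rule nn_integral_bij_count_space)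
    show "bij_betw adj2 Gam Gam"
      by (rule bij_betw_byWitness[of _ adj2]) (auto intro: Gam_adj2)
  qed
  also have "\<dots> = (\<integral>\<^sup>+v. \<integral>\<^sup>+A. g (mobius_T1 A v) * indicator Fdom v \<partial>count_space Gam \<partial>lam)"
    by (rule nn_integral_count_space_nn_integral[OF countable_Gam, symmetric]) (use m F in measurable)
  also have "\<dots> = (\<integral>\<^sup>+v. (\<integral>\<^sup>+A. g (mobius_T1 A v) \<partial>count_space Gam) * indicator Fdom v \<partial>lam)"
    by (intro nn_integral_cong) (simp add: nn_integral_multc)
  finally show ?thesis by simp
qed

section \<open>The area of the orbifold\<close>

lemma orbit_Gam: "orbit G z = {mobius A z | A. A \<in> Gam}"
  by (simp add: orbit_def Gam_def)

lemma orbit_refl: "z \<in> orbit G z"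
  using Gam_one by (force simp: orbit_Gam)

lemma orbit_mobius:
  assumes "A \<in> Gam" "z \<in> \<H>" shows "orbit G (mobius A z) = orbit G z"
proof (rule Set.set_eqI, rule iffI)
  fix w assume "w \<in> orbit G (mobius A z)"
  then obtain B where B: "B \<in> Gam" "w = mobius B (mobius A z)" by (auto simp: orbit_Gam)
  then have "w = mobius (B ** A) z" using assms by (simp add: mobius_mult)
  then show "w \<in> orbit G z" using Gam_mult[OF B(1) assms(1)] by (auto simp: orbit_Gam)
next
  fix w assume "w \<in> orbit G z"
  then obtain B where B: "B \<in> Gam" "w = mobius B z" by (auto simp: orbit_Gam)
  then have "w = mobius (B ** adj2 A) (mobius A z)" using assms by (simp add: mobius_mult)
  then show "w \<in> orbit G (mobius A z)" using Gam_mult[OF B(1) Gam_adj2[OF assms(1)]] by (auto simp: orbit_Gam)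
qed

lemma orbit_eq_iff:
  assumes "z \<in> \<H>" shows "orbit G z = orbit G w \<longleftrightarrow> (\<exists>A\<in>Gam. w = mobius A z)"
proof
  assume "orbit G z = orbit G w"
  then have "w \<in> orbit G z" using orbit_refl by simp
  then show "\<exists>A\<in>Gam. w = mobius A z" by (auto simp: orbit_Gam)
qed (use orbit_mobius assms in auto)

lemma emeasure_lam_Times:
  assumes "B \<in> sets hyp_measure"
  shows "B \<times> sphere 0 1 \<in> sets lam" "emeasure lam (B \<times> sphere 0 1) = emeasure hyp_measure B * ennreal (2 * pi)"
proof -
  have s: "sphere 0 1 \<in> sets circle_measure" using sets.top[of circle_measure] by (simp add: space_circle)
  show "B \<times> sphere 0 1 \<in> sets lam" unfolding lam_def using assms s by (rule pair_measureI)
  show "emeasure lam (B \<times> sphere 0 1) = emeasure hyp_measure B * ennreal (2 * pi)"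
    unfolding lam_def circle_measure_total[symmetric] by (rule circle.emeasure_pair_measure_Times[OF assms s])
qed

lemma fdom_hyp: "fdom \<in> sets hyp_measure"
  using fdom_regular fdom_borel by (auto simp: sets_hyp sets_restrict_space_iff regular_points_def)

lemma emeasure_lam_Fdom: "emeasure lam Fdom = emeasure hyp_measure fdom * ennreal (2 * pi)"
  unfolding Fdom_def by (rule emeasure_lam_Times(2)[OF fdom_hyp])

text \<open>Unfolding is applied to the indicator of the section. An orbit of a regular point meets
  the section at most once, hence for at most two matrices, so the group sum never exceeds 2 on the
  fundamental domain. Thus \<open>fdom\<close> attains the supremum that defines the quotient
  measure.\<close>

lemma section_le_fdom:
  assumes B: "B \<in> sets hyp_measure" and inj: "inj_on (orbit G) B"
  shows "emeasure hyp_measure B \<le> emeasure hyp_measure fdom"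
proof -
  let ?B = "B \<times> sphere (0::complex) 1"
  have BH: "B \<subseteq> \<H>" using sets.sets_into_space[OF B] by (simp add: space_hyp)
  have mB: "indicator ?B \<in> borel_measurable lam" using emeasure_lam_Times(1)[OF B] by (intro borel_measurable_indicator)
  have "2 * emeasure lam ?B = 2 * (\<integral>\<^sup>+v. indicator ?B v \<partial>lam)" using emeasure_lam_Times(1)[OF B] by simp
  also have "\<dots> = (\<integral>\<^sup>+v. (\<integral>\<^sup>+A. indicator ?B (mobius_T1 A v) \<partial>count_space Gam) * indicator Fdom v \<partial>lam)"
    using unfolding_lam[OF mB] by simp
  also have "\<dots> \<le> (\<integral>\<^sup>+v. 2 * indicator Fdom v \<partial>lam)"
  proof (rule nn_integral_mono)
    fix v assume "v \<in> space lam"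
    show "(\<integral>\<^sup>+A. indicator ?B (mobius_T1 A v) \<partial>count_space Gam) * indicator Fdom v \<le> 2 * indicator Fdom v"
    proof (cases "v \<in> Fdom")
      case True
      then have z: "fst v \<in> regular_points" using fdom_regular by (auto simp: Fdom_def)
      then have zH: "fst v \<in> \<H>" by (simp add: regular_points_def)
      have "(\<integral>\<^sup>+A. indicator ?B (mobius_T1 A v) \<partial>count_space Gam) \<le> 2"
      proof (cases "\<exists>A\<in>Gam. mobius_T1 A v \<in> ?B")
        case True
        then obtain A where A: "A \<in> Gam" "mobius A (fst v) \<in> B" by (metis mem_Times_iff mobius_T1_fst)
        have "C \<in> {A, - A}" if C: "C \<in> Gam" "mobius_T1 C v \<in> ?B" for C
        proof -
          have c: "mobius C (fst v) \<in> B" using C by (metis mem_Times_iff mobius_T1_fst)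
          have "orbit G (mobius A (fst v)) = orbit G (mobius C (fst v))" using orbit_mobius A C zH by simp
          then have "mobius A (fst v) = mobius C (fst v)" using inj A(2) c by (auto dest: inj_onD)
          then show ?thesis using two_translates[OF z A(1) C(1)] by blast
        qed
        then have "(\<integral>\<^sup>+C. indicator ?B (mobius_T1 C v) \<partial>count_space Gam) \<le> (\<integral>\<^sup>+C. indicator {A, - A} C \<partial>count_space Gam)"
          by (intro nn_integral_mono) (auto simp: indicator_def)
        also have "\<dots> = emeasure (count_space Gam) {A, - A}"
          using A Gam_uminus by (intro nn_integral_indicator) auto
        also have "\<dots> = 2" using A Gam_uminus Gam_ne_uminus[OF A(1)] by (subst emeasure_count_space_finite) auto
        finally show ?thesis .
      next
        case False
        then have "(\<integral>\<^sup>+C. indicator ?B (mobius_T1 C v) \<partial>count_space Gam) = (\<integral>\<^sup>+C. 0 \<partial>count_space Gam)"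
          by (intro nn_integral_cong) (metis indicator_simps(2) space_count_space)
        then show ?thesis by simp
      qed
      then show ?thesis using True by simp
    qed simp
  qed
  also have "\<dots> = 2 * emeasure lam Fdom" by (rule nn_integral_cmult_indicator[OF Fdom_lam])
  finally have le: "2 * (emeasure hyp_measure B * ennreal (2 * pi)) \<le> 2 * (emeasure hyp_measure fdom * ennreal (2 * pi))"
    unfolding emeasure_lam_Fdom emeasure_lam_Times(2)[OF B] .
  have "\<not> 2 * pi \<le> 0" by (simp add: not_le)
  then have "ennreal (2 * pi) \<noteq> 0" "ennreal (2 * pi) \<noteq> top_class.top" by (simp_all only: ennreal_eq_0_iff ennreal_neq_top not_False_eq_True)
  then show ?thesis using le
    by (simp add: ennreal_mult_le_mult_iff mult.commute[of _ "ennreal _"])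
qed

lemma topspace_orbifold: "topspace (orbifold G) = orbit G ` \<H>"
proof -
  have "openin (orbifold G) (orbit G ` \<H>)"
  proof -
    have "{z \<in> topspace (top_of_set \<H>). orbit G z \<in> orbit G ` \<H>} = \<H>" by auto
    then show ?thesis unfolding orbifold_def openin_quotient_topology by simp
  qed
  moreover have "U \<subseteq> orbit G ` \<H>" if "openin (orbifold G) U" for U
    using that unfolding orbifold_def openin_quotient_topology by auto
  ultimately show ?thesis by (metis openin_subset openin_topspace subset_antisym)
qed

lemma emeasure_area: "emeasure (area_measure G) (topspace (orbifold G)) = emeasure hyp_measure fdom"
proof -
  have s: "orbit G ` \<H> \<in> sets (quotient_measure hyp_measure (orbit G))"
    using sets.top[of "quotient_measure hyp_measure (orbit G)"] by (simp add: space_hyp)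
  have sub: "B \<subseteq> orbit G -` orbit G ` \<H>" if "B \<in> sets hyp_measure" for B
    using sets.sets_into_space[OF that] by (auto simp: space_hyp)
  have "inj_on (orbit G) fdom"
  proof (rule inj_onI)
    fix z w assume zw: "z \<in> fdom" "w \<in> fdom" "orbit G z = orbit G w"
    have zH: "z \<in> \<H>" using zw fdom_regular by (auto simp: regular_points_def)
    obtain A where A: "A \<in> Gam" "w = mobius A z" using zw orbit_eq_iff[OF zH] by blast
    then have "A \<in> Zpm" using fdom_inj zw by blast
    then show "z = w" using A(2) by auto
  qed
  then have "emeasure hyp_measure fdom \<le> (SUP B \<in> {B \<in> sets hyp_measure. B \<subseteq> orbit G -` orbit G ` \<H> \<and> inj_on (orbit G) B}. emeasure hyp_measure B)"
    using fdom_hyp sub by (intro SUP_upper) auto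
  moreover have "(SUP B \<in> {B \<in> sets hyp_measure. B \<subseteq> orbit G -` orbit G ` \<H> \<and> inj_on (orbit G) B}. emeasure hyp_measure B) \<le> emeasure hyp_measure fdom"
    using section_le_fdom by (intro SUP_least) auto
  ultimately show ?thesis unfolding topspace_orbifold area_measure_def emeasure_quotient_measure[OF s] by simp
qed

section \<open>The invariant measure on the sigma-algebra of invariant sets\<close>

definition inv_sets :: "(complex \<times> complex) set set" where
  "inv_sets = {E \<in> sets lam. \<forall>A\<in>Gam. \<forall>v\<in>T1H. mobius_T1 A v \<in> E \<longleftrightarrow> v \<in> E}"

text \<open>Liouville measure of the quotient, before normalization, as a measure on the \<open>G\<close>-invariant subsets of \<open>T1H\<close>.\<close>

definition nu :: "(complex \<times> complex) measure" where
  "nu = distr (density lam (indicator Fdom)) (sigma T1H inv_sets) (\<lambda>v. v)"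

lemma inv_sets_sigma: "sigma_algebra T1H inv_sets"
proof -
  have "T1H \<in> sets lam" using sets.top[of lam] by simp
  then show ?thesis
    unfolding sigma_algebra_iff2 inv_sets_def
    by (auto intro: sets.countable_UN simp: sets_lam)
qed

lemma space_nu [simp]: "space nu = T1H" and sets_nu: "sets nu = inv_sets"
  using sigma_algebra.sigma_sets_eq[OF inv_sets_sigma] sigma_algebra.axioms
  by (auto simp: nu_def inv_sets_def sets_lam space_measure_of_conv sets_measure_of_conv)

lemma nu_ident: "(\<lambda>v. v) \<in> measurable (density lam (indicator Fdom)) (sigma T1H inv_sets)"
proof (rule measurableI)
  fix E assume "E \<in> sets (sigma T1H inv_sets)"
  then have "E \<in> inv_sets" using sets_nu by (simp add: nu_def)
  then show "(\<lambda>v. v) -` E \<inter> space (density lam (indicator Fdom)) \<in> sets (density lam (indicator Fdom))"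
    by (auto simp: inv_sets_def sets_lam)
qed (simp add: space_measure_of_conv inv_sets_def sets_lam Collect_subset)

lemma measurable_nuI:
  assumes f: "f \<in> measurable lam N" and inv: "\<And>A v. A \<in> Gam \<Longrightarrow> v \<in> T1H \<Longrightarrow> f (mobius_T1 A v) = f v"
  shows "f \<in> measurable nu N"
proof (rule measurableI)
  fix E assume E: "E \<in> sets N"
  have "f -` E \<inter> T1H \<in> sets lam" using measurable_sets[OF f E] by simp
  then have "f -` E \<inter> T1H \<in> inv_sets" using inv by (auto simp: inv_sets_def)
  then show "f -` E \<inter> space nu \<in> sets nu" by (simp add: sets_nu)
qed (use measurable_space[OF f] in simp)

lemma nu_measurable_lam:
  assumes "f \<in> measurable nu N" shows "f \<in> measurable lam N"
  using assms unfolding measurable_def by (auto simp: sets_nu inv_sets_def)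

lemma nn_integral_nu:
  assumes "f \<in> borel_measurable nu"
  shows "(\<integral>\<^sup>+v. f v \<partial>nu) = (\<integral>\<^sup>+v. f v * indicator Fdom v \<partial>lam)"
proof -
  have f: "f \<in> borel_measurable (sigma T1H inv_sets)" using assms by (simp add: nu_def)
  have "(\<integral>\<^sup>+v. f v \<partial>nu) = (\<integral>\<^sup>+v. f v \<partial>density lam (indicator Fdom))"
    unfolding nu_def by (rule nn_integral_distr[OF nu_ident]) (use f in \<open>simp\<close>)
  also have "\<dots> = (\<integral>\<^sup>+v. indicator Fdom v * f v \<partial>lam)"
    by (rule nn_integral_density) (use nu_measurable_lam[OF assms] Fdom_lam in auto)
  finally show ?thesis by (simp add: mult.commute)
qed

text \<open>The fundamental domain can be traded for any other way of spreading an invariant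
  function over its orbits: only the group sum of \<open>g\<close> matters.\<close>

lemma nn_integral_nu_unfold:
  assumes f: "f \<in> borel_measurable nu" and g: "g \<in> borel_measurable lam"
    and eq: "AE v in lam. 2 * f v = (\<integral>\<^sup>+A. g (mobius_T1 A v) \<partial>count_space Gam)"
  shows "(\<integral>\<^sup>+v. f v \<partial>nu) = (\<integral>\<^sup>+v. g v \<partial>lam)"
proof -
  have fl: "f \<in> borel_measurable lam" by (rule nu_measurable_lam[OF f])
  have "2 * (\<integral>\<^sup>+v. f v \<partial>nu) = (\<integral>\<^sup>+v. 2 * (f v * indicator Fdom v) \<partial>lam)"
    unfolding nn_integral_nu[OF f] using fl Fdom_lam by (subst nn_integral_cmult) auto
  also have "\<dots> = (\<integral>\<^sup>+v. (\<integral>\<^sup>+A. g (mobius_T1 A v) \<partial>count_space Gam) * indicator Fdom v \<partial>lam)"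
    using eq by (intro nn_integral_cong_AE) (auto simp: mult.assoc[symmetric] elim!: eventually_mono)
  also have "\<dots> = 2 * (\<integral>\<^sup>+v. g v \<partial>lam)" by (rule unfolding_lam[OF g])
  finally have "2 * (\<integral>\<^sup>+v. f v \<partial>nu) = 2 * (\<integral>\<^sup>+v. g v \<partial>lam)" .
  then show ?thesis by (simp add: ennreal_mult_cancel_left)
qed

lemma gflow_measurable_nu [measurable]: "gflow t \<in> measurable nu nu"
proof (rule measurableI)
  fix E assume "E \<in> sets nu"
  then have E: "E \<in> sets lam" "\<And>A v. A \<in> Gam \<Longrightarrow> v \<in> T1H \<Longrightarrow> mobius_T1 A v \<in> E \<longleftrightarrow> v \<in> E" by (auto simp: sets_nu inv_sets_def)
  have "gflow t -` E \<inter> T1H \<in> sets lam" using measurable_sets[OF measurable_gflow E(1), of t] by simp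
  then show "gflow t -` E \<inter> space nu \<in> sets nu"
    unfolding sets_nu inv_sets_def using E(2) by (auto simp: gflow_mobius)
qed simp

text \<open>The flow commutes with the group but moves \<open>Fdom\<close>. Its image under the flow
  again contains one point of almost every orbit, so integrals of invariant functions over the two
  domains agree.\<close>

lemma distr_nu_gflow: "distr nu nu (gflow t) = nu"
proof (rule measure_eqI)
  fix E assume "E \<in> sets (distr nu nu (gflow t))"
  then have En: "E \<in> sets nu" by simp
  then have E: "E \<in> sets lam" "\<And>A v. A \<in> Gam \<Longrightarrow> v \<in> T1H \<Longrightarrow> mobius_T1 A v \<in> E \<longleftrightarrow> v \<in> E" by (auto simp: sets_nu inv_sets_def)
  define g where "g v = indicator E v * (indicator Fdom (gflow (- t) v) :: ennreal)" for v
  have F: "indicator Fdom \<in> borel_measurable lam" by (intro borel_measurable_indicator Fdom_lam)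
  have mF: "(\<lambda>v. indicator Fdom (gflow (- t) v) :: ennreal) \<in> borel_measurable lam"
    by (rule measurable_compose[OF measurable_gflow F])
  have mE: "indicator E \<in> borel_measurable lam" by (intro borel_measurable_indicator E)
  have g: "g \<in> borel_measurable lam" unfolding g_def using mE mF by measurable
  have mEn: "(indicator E :: _ \<Rightarrow> ennreal) \<in> borel_measurable nu" by (intro borel_measurable_indicator En)
  have "emeasure (distr nu nu (gflow t)) E = (\<integral>\<^sup>+v. indicator E v \<partial>distr nu nu (gflow t))" using En by simp
  also have "\<dots> = (\<integral>\<^sup>+v. indicator E (gflow t v) \<partial>nu)"
    by (rule nn_integral_distr[OF gflow_measurable_nu]) (use mEn in simp)
  also have "\<dots> = (\<integral>\<^sup>+v. indicator E (gflow t v) * indicator Fdom v \<partial>lam)"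
    by (rule nn_integral_nu) (rule measurable_compose[OF gflow_measurable_nu mEn])
  also have "\<dots> = (\<integral>\<^sup>+v. g (gflow t v) \<partial>lam)"
    by (intro nn_integral_cong) (simp add: g_def gflow_add)
  also have "\<dots> = (\<integral>\<^sup>+v. g v \<partial>lam)" by (rule nn_integral_gflow_inv[OF g])
  also have "\<dots> = (\<integral>\<^sup>+v. indicator E v \<partial>nu)"
  proof (rule nn_integral_nu_unfold[symmetric, OF mEn g])
    have "AE v in lam. fst (gflow (- t) v) \<in> regular_points" by (rule AE_gflow[OF AE_regular])
    then show "AE v in lam. 2 * indicator E v = (\<integral>\<^sup>+A. g (mobius_T1 A v) \<partial>count_space Gam)"
      using AE_space
    proof eventually_elim
      case (elim v)
      then have v: "v \<in> T1H" by simp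
      have "(\<integral>\<^sup>+A. g (mobius_T1 A v) \<partial>count_space Gam)
        = (\<integral>\<^sup>+A. indicator E v * indicator Fdom (mobius_T1 A (gflow (- t) v)) \<partial>count_space Gam)"
        using E(2) v by (intro nn_integral_cong) (simp add: g_def gflow_mobius indicator_def)
      also have "\<dots> = indicator E v * 2"
        using count_Fdom[OF gflow_in[OF v] elim(1)] by (simp add: nn_integral_cmult)
      finally show ?case by (simp add: mult.commute)
    qed
  qed
  also have "\<dots> = emeasure nu E" using En by simp
  finally show "emeasure (distr nu nu (gflow t)) E = emeasure nu E" .
qed simp

text \<open>The exceptional set is invariant, so if it is null in the fundamental domain its group
  sum vanishes almost everywhere there, and unfolding makes it null in \<open>T1H\<close>.\<close>

lemma null_nu_imp_null_lam:
  assumes "AE v in nu. P v" "{v \<in> T1H. P v} \<in> sets nu"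
  shows "AE v in lam. P v"
proof -
  let ?N = "T1H - {v \<in> T1H. P v}"
  have N: "?N \<in> sets nu" using assms(2) sets.compl_sets[of _ nu] by (metis space_nu)
  then have Nl: "?N \<in> sets lam" "\<And>A v. A \<in> Gam \<Longrightarrow> v \<in> T1H \<Longrightarrow> mobius_T1 A v \<in> ?N \<longleftrightarrow> v \<in> ?N" by (auto simp: sets_nu inv_sets_def)
  have mN: "indicator ?N \<in> borel_measurable lam" by (intro borel_measurable_indicator Nl)
  have "AE v in nu. v \<notin> ?N" using assms(1) by (auto elim: eventually_mono)
  then have 0: "emeasure nu ?N = 0" using AE_iff_null_sets[OF N] null_setsD1 by blast
  have "(\<integral>\<^sup>+v. indicator ?N v * indicator Fdom v \<partial>lam) = (\<integral>\<^sup>+v. indicator ?N v \<partial>nu)"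
    by (rule nn_integral_nu[symmetric]) (intro borel_measurable_indicator N)
  also have "\<dots> = 0" using 0 N by simp
  finally have 1: "(\<integral>\<^sup>+v. indicator ?N v * indicator Fdom v \<partial>lam) = 0" .
  have "AE v in lam. indicator ?N v * indicator Fdom v = (0::ennreal)"
  proof -
    have "(\<lambda>v. indicator ?N v * indicator Fdom v :: ennreal) \<in> borel_measurable lam"
      by (intro borel_measurable_times_ennreal mN borel_measurable_indicator Fdom_lam)
    from nn_integral_0_iff_AE[OF this] 1 show ?thesis by simp
  qed
  then have "AE v in lam. (\<integral>\<^sup>+A. indicator ?N (mobius_T1 A v) \<partial>count_space Gam) * indicator Fdom v = 0"
    using AE_space
  proof eventually_elim
    case (elim v)
    show ?case
    proof (cases "v \<in> Fdom")
      case True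
      then have "v \<notin> ?N" using elim(1) by (auto simp: indicator_def split: if_splits)
      then have "mobius_T1 A v \<notin> ?N" if "A \<in> Gam" for A using Nl(2)[OF that, of v] elim(2) by simp
      then have "(\<integral>\<^sup>+A. indicator ?N (mobius_T1 A v) \<partial>count_space Gam) = (\<integral>\<^sup>+A. 0 \<partial>count_space Gam)"
        by (intro nn_integral_cong) (simp only: indicator_simps space_count_space not_False_eq_True)
      then show ?thesis by simp
    qed simp
  qed
  then have "(\<integral>\<^sup>+v. (\<integral>\<^sup>+A. indicator ?N (mobius_T1 A v) \<partial>count_space Gam) * indicator Fdom v \<partial>lam) = (\<integral>\<^sup>+v. 0 \<partial>lam)"
    by (rule nn_integral_cong_AE)
  then have "2 * (\<integral>\<^sup>+v. indicator ?N v \<partial>lam) = 0" unfolding unfolding_lam[OF mN] by simp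
  then have "emeasure lam ?N = 0" using Nl(1) by simp
  then have "AE v in lam. v \<notin> ?N" using Nl(1) by (intro AE_not_in) (simp add: null_sets_def)
  then show ?thesis using AE_space by eventually_elim auto
qed

lemma AE_lam_imp_nu:
  assumes "AE v in lam. P v" "{v \<in> T1H. P v} \<in> sets nu"
  shows "AE v in nu. P v"
proof -
  let ?N = "T1H - {v \<in> T1H. P v}"
  have N: "?N \<in> sets nu" using assms(2) sets.compl_sets[of _ nu] by (metis space_nu)
  have "emeasure nu ?N = (\<integral>\<^sup>+v. indicator ?N v \<partial>nu)" using N by simp
  also have "\<dots> = (\<integral>\<^sup>+v. indicator ?N v * indicator Fdom v \<partial>lam)"
    by (rule nn_integral_nu) (intro borel_measurable_indicator N)
  also have "\<dots> = (\<integral>\<^sup>+v. 0 \<partial>lam)"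
    using assms(1) by (intro nn_integral_cong_AE) (auto elim!: eventually_mono simp: indicator_def)
  finally have "emeasure nu ?N = 0" by simp
  then have "AE v in nu. v \<notin> ?N" using N by (intro AE_not_in) (simp add: null_sets_def)
  then show ?thesis using AE_space by eventually_elim auto
qed

text \<open>A null set containing the exceptional vectors is saturated by the countable group, so
  that its image in the quotient has a known measurable preimage. Every section over the image lies
  in this null set, and the supremum defining the quotient measure is 0.\<close>

lemma AE_liouvilleI:
  assumes "AE v in lam. P (orbit_T1 G v)"
  shows "AE V in liouville G. P V"
proof -
  obtain N0 where N0: "{v \<in> space lam. \<not> P (orbit_T1 G v)} \<subseteq> N0" "N0 \<in> null_sets lam"
    using assms by (auto elim!: AE_E simp: null_sets_def)
  define N where "N = (\<Union>A\<in>Gam. mobius_T1 A -` N0 \<inter> T1H)"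
  have "mobius_T1 A -` N0 \<inter> T1H \<in> null_sets lam" if "A \<in> Gam" for A
  proof -
    have s: "mobius_T1 A -` N0 \<inter> space lam \<in> sets lam"
      using N0(2) that by (intro measurable_sets[OF measurable_mobius_T1]) auto
    have "emeasure lam (mobius_T1 A -` N0 \<inter> space lam) = emeasure (distr lam lam (mobius_T1 A)) N0"
      using N0(2) that by (intro emeasure_distr[symmetric] measurable_mobius_T1) auto
    then show ?thesis using s N0(2) that by (simp add: distr_lam_mobius null_sets_def)
  qed
  then have N: "N \<in> null_sets lam" unfolding N_def by (intro null_sets_UN' countable_Gam) auto
  have T1: "orbit_T1 G v = {mobius_T1 A v | A. A \<in> Gam}" for v by (simp add: orbit_T1_def Gam_def)
  have inv: "w \<in> N" if eq: "orbit_T1 G w = orbit_T1 G v" and vN: "v \<in> N" and w: "w \<in> T1H" and v: "v \<in> T1H" for v w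
  proof -
    obtain A where A: "A \<in> Gam" "mobius_T1 A v \<in> N0" using vN by (auto simp: N_def)
    have "v \<in> orbit_T1 G v" using Gam_one mobius_T1_one[OF v] by (force simp: T1)
    then obtain B where B: "B \<in> Gam" "v = mobius_T1 B w" using eq by (auto simp: T1)
    then have "mobius_T1 (A ** B) w \<in> N0" using A w by (simp add: mobius_T1_mult)
    then show ?thesis using Gam_mult[OF A(1) B(1)] w by (auto simp: N_def)
  qed
  let ?\<mu> = "scale_measure (ennreal (1 / (2 * pi * orbifold_area G))) (hyp_measure \<Otimes>\<^sub>M circle_measure)"
  have \<mu>: "space ?\<mu> = T1H" "sets ?\<mu> = sets lam" using space_lam by (simp_all add: space_scale_measure lam_def)
  let ?Q = "orbit_T1 G ` N"
  have NT: "N \<subseteq> T1H" by (auto simp: N_def)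
  have pre: "orbit_T1 G -` ?Q \<inter> T1H = N" using inv NT by blast
  have Q: "?Q \<in> sets (liouville G)"
    unfolding liouville_def sets_quotient_measure \<mu> using pre N NT by auto
  have "emeasure (liouville G) ?Q = (SUP B \<in> {B \<in> sets ?\<mu>. B \<subseteq> orbit_T1 G -` ?Q \<and> inj_on (orbit_T1 G) B}. emeasure ?\<mu> B)"
    using Q unfolding liouville_def by (rule emeasure_quotient_measure)
  also have "\<dots> \<le> 0"
  proof (rule SUP_least)
    fix B assume B: "B \<in> {B \<in> sets ?\<mu>. B \<subseteq> orbit_T1 G -` ?Q \<and> inj_on (orbit_T1 G) B}"
    then have "B \<in> sets lam" "B \<subseteq> N" using \<mu> pre sets.sets_into_space[of B ?\<mu>] by auto
    then have "emeasure lam B = 0" using N by (metis emeasure_mono null_setsD1 null_setsD2 le_zero_eq)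
    then show "emeasure ?\<mu> B \<le> 0" by (simp add: emeasure_scale_measure lam_def)
  qed
  finally have "?Q \<in> null_sets (liouville G)" using Q by (simp add: null_sets_def)
  moreover have "{V \<in> space (liouville G). \<not> P V} \<subseteq> ?Q"
  proof
    fix V assume "V \<in> {V \<in> space (liouville G). \<not> P V}"
    then obtain v where v: "v \<in> T1H" "V = orbit_T1 G v" "\<not> P V" by (auto simp: liouville_def \<mu>)
    then have "v \<in> N0" using N0(1) by auto
    then have "v \<in> N" using Gam_one v(1) mobius_T1_one[OF v(1)] by (force simp: N_def)
    then show "V \<in> ?Q" using v by blast
  qed
  ultimately show ?thesis by (rule AE_I')
qed

end

section \<open>Lifts of the boundary\<close>

lemma fixes_two_axis_points:
  fixes p q :: real
  assumes A: "det A = 1" and pq: "p > 0" "q > 0" "p \<noteq> q"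
    and fx: "mobius A (\<i> * of_real p) = \<i> * of_real p" "mobius A (\<i> * of_real q) = \<i> * of_real q"
  shows "A \<in> Zpm"
proof -
  have eq: "A$1$1 = A$2$2 \<and> A$1$2 = - (A$2$1 * r\<^sup>2)" if r: "r > 0" "mobius A (\<i> * of_real r) = \<i> * of_real r" for r :: real
  proof -
    have "\<i> * of_real r \<in> \<H>" using r by (simp add: upper_half_plane_def)
    from mden_nonzero[OF A this] have "of_real (A$1$1) * (\<i> * of_real r) + of_real (A$1$2) = \<i> * of_real r * mden A (\<i> * of_real r)"
      using r(2) by (simp add: mobius_eq divide_eq_eq)
    then have "A$1$2 = - (r * (A$2$1 * r))" "A$1$1 * r = r * A$2$2" by (auto simp: mden_def complex_eq_iff)
    then show ?thesis using r by (simp add: power2_eq_square)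
  qed
  have e: "A$1$1 = A$2$2" "A$1$2 = - (A$2$1 * p\<^sup>2)" "A$1$2 = - (A$2$1 * q\<^sup>2)"
    using eq[OF pq(1) fx(1)] eq[OF pq(2) fx(2)] by auto
  then have "A$2$1 * (p\<^sup>2 - q\<^sup>2) = 0" by (simp only: right_diff_distrib)
  moreover have "p\<^sup>2 \<noteq> q\<^sup>2" using pq by (simp add: power2_eq_iff)
  ultimately have c: "A$2$1 = 0" by simp
  then have b: "A$1$2 = 0" using e by simp
  have "A$1$1 * A$1$1 = 1" using A c e by (simp add: det_2)
  then have "A$1$1 = 1 \<or> A$1$1 = -1" by (simp add: square_eq_1_iff)
  then have "A = mat 1 \<or> A = - mat 1" using b c e(1) by (auto intro!: mat2_eqI simp: mat_def)
  then show ?thesis by blast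
qed

text \<open>Distances along either line are differences of parameters, so the parametrizations can
  differ only by the reflection in \<open>t\<close>.\<close>

lemma geodesic_line_same_range:
  assumes "geodesic_line c" "geodesic_line d" "c t = d t" "range c \<subseteq> range d"
  shows "c s = d s \<or> c s = d (2 * t - s)"
proof -
  obtain r where r: "c s = d r" using assms(4) by blast
  have "\<bar>s - t\<bar> = hyp_dist (c s) (c t)" using assms(1) by (simp add: geodesic_line_def)
  also have "\<dots> = \<bar>r - t\<bar>" using assms(2,3) r by (simp add: geodesic_line_def)
  finally have "r = s \<or> r = 2 * t - s" by (auto simp: abs_if split: if_splits)
  then show ?thesis using r by blast
qed

lemma gline_eq_gflow:
  assumes "det B = 1" shows "gline B t = fst (gflow t (mobius_T1 B (\<i>, \<i>)))" "mobius_T1 B (\<i>, \<i>) \<in> T1H"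
  using gflow_gline[OF assms] mobius_T1_in[OF assms, of "(\<i>, \<i>)"] by (simp_all add: T1H_iff)

lemma isCont_gflow_point:
  assumes "v \<in> T1H" shows "isCont (\<lambda>t. fst (gflow t v)) t"
proof -
  obtain z u where v: "v = (z, u)" "cmod u = 1" using assms by (cases v) (auto simp: T1H_iff)
  show ?thesis unfolding v(1) gflow_def using gpoint_has_vector_derivative[OF v(2), of z t]
    by (simp add: has_vector_derivative_continuous)
qed

locale subsurface = fuchsian +
  fixes n :: nat and \<gamma> :: "nat \<Rightarrow> real \<Rightarrow> complex set" and l :: "nat \<Rightarrow> real" and M :: "complex set set"
  assumes fin_area: "finite_area G" and n1: "n \<ge> 1"
    and scg: "\<And>i. i < n \<Longrightarrow> simple_closed_geodesic G (\<gamma> i) (l i)"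
    and disj: "disjoint_family_on (\<lambda>i. range (\<gamma> i)) {..<n}"
    and bound: "bound_subsurface G n \<gamma> M"
begin

definition Cm :: "nat \<Rightarrow> real^2^2" where
  "Cm i = (SOME B. det B = 1 \<and> \<gamma> i = orbit G \<circ> gline B)"

lemma Cm:
  assumes "i < n" shows "det (Cm i) = 1" "\<gamma> i t = orbit G (gline (Cm i) t)"
proof -
  obtain c where c: "geodesic_line c" "\<gamma> i = orbit G \<circ> c" using scg[OF assms] by (auto simp: simple_closed_geodesic_def)
  then have "\<exists>B. det B = 1 \<and> \<gamma> i = orbit G \<circ> gline B" by (metis geodesic_line_imp_gline)
  then have "det (Cm i) = 1 \<and> \<gamma> i = orbit G \<circ> gline (Cm i)" unfolding Cm_def by (rule someI_ex)
  then show "det (Cm i) = 1" "\<gamma> i t = orbit G (gline (Cm i) t)" by auto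
qed

lemma l_pos: "i < n \<Longrightarrow> l i > 0"
  using scg by (simp add: simple_closed_geodesic_def)

lemma \<gamma>_period: "i < n \<Longrightarrow> \<gamma> i (t + of_int k * l i) = \<gamma> i t"
proof (induction k arbitrary: t rule: int_induct[of _ 0])
  case (step1 k)
  have p: "\<gamma> i (t + l i) = \<gamma> i t" for t using scg[OF step1.prems] by (simp add: simple_closed_geodesic_def)
  have "\<gamma> i (t + of_int (k + 1) * l i) = \<gamma> i (t + of_int k * l i + l i)" by (simp add: algebra_simps)
  then show ?case using p step1 by simp
next
  case (step2 k)
  have p: "\<gamma> i (t + l i) = \<gamma> i t" for t using scg[OF step2.prems] by (simp add: simple_closed_geodesic_def)
  have "\<gamma> i (t + of_int (k - 1) * l i + l i) = \<gamma> i (t + of_int k * l i)" by (simp add: algebra_simps)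
  then show ?case using p step2 by simp
qed simp

lemma \<gamma>_reduce:
  assumes "i < n" obtains r k where "r \<in> {0..<l i}" "\<gamma> i t = \<gamma> i r" "t = r + of_int k * l i"
proof -
  define k where "k = \<lfloor>t / l i\<rfloor>"
  define r where "r = t - of_int k * l i"
  have L: "l i > 0" using l_pos[OF assms] .
  have "of_int k \<le> t / l i" "t / l i < of_int k + 1" by (auto simp: k_def)
  then have "of_int k * l i \<le> t" "t < (of_int k + 1) * l i" using L by (auto simp: field_simps)
  then have "r \<in> {0..<l i}" by (auto simp: r_def algebra_simps)
  moreover have t: "t = r + of_int k * l i" by (simp add: r_def)
  moreover have "\<gamma> i t = \<gamma> i r" using \<gamma>_period[OF assms] unfolding t .
  ultimately show ?thesis using that by blast
qed

lemma \<gamma>_inj: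
  assumes "i < n" "\<gamma> i s = \<gamma> i t" obtains k :: int where "s - t = of_int k * l i"
proof -
  obtain r k where r: "r \<in> {0..<l i}" "\<gamma> i s = \<gamma> i r" "s = r + of_int k * l i" using \<gamma>_reduce[OF assms(1)] by metis
  obtain r' k' where r': "r' \<in> {0..<l i}" "\<gamma> i t = \<gamma> i r'" "t = r' + of_int k' * l i" using \<gamma>_reduce[OF assms(1)] by metis
  have "inj_on (\<gamma> i) {0..<l i}" using scg[OF assms(1)] by (simp add: simple_closed_geodesic_def)
  then have "r = r'" using r r' assms(2) by (auto dest: inj_onD)
  then have "s - t = of_int (k - k') * l i" using r r' by (simp add: algebra_simps)
  then show ?thesis using that by blast
qed

definition lifts :: "(real^2^2) set" where
  "lifts = {A ** Cm i | A i. A \<in> Gam \<and> i < n}"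

lemma lifts_det [simp]: "B \<in> lifts \<Longrightarrow> det B = 1"
  using Cm by (auto simp: lifts_def det_mult_1)

lemma lifts_orbit:
  assumes "B \<in> lifts" obtains i where "i < n" "\<And>t. \<gamma> i t = orbit G (gline B t)"
proof -
  obtain A i where A: "A \<in> Gam" "i < n" "B = A ** Cm i" using assms by (auto simp: lifts_def)
  have "\<gamma> i t = orbit G (gline B t)" for t
    using A Cm[OF A(2)] by (simp add: gline_mult orbit_mobius)
  then show ?thesis using that A by blast
qed

lemma lifts_mult: "A \<in> Gam \<Longrightarrow> B \<in> lifts \<Longrightarrow> A ** B \<in> lifts"
proof -
  assume A: "A \<in> Gam" and "B \<in> lifts"
  then obtain A' i where A': "A' \<in> Gam" "i < n" "B = A' ** Cm i" by (auto simp: lifts_def)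
  then have "A ** B = (A ** A') ** Cm i" by (simp add: matrix_mul_assoc)
  then show ?thesis using Gam_mult[OF A A'(1)] A' unfolding lifts_def by blast
qed

lemma countable_lifts: "countable lifts"
proof -
  have "lifts = (\<Union>i<n. (\<lambda>A. A ** Cm i) ` Gam)" by (auto simp: lifts_def)
  then show ?thesis using countable_Gam by simp
qed

definition walls :: "complex set" where
  "walls = {z \<in> \<H>. orbit G z \<in> (\<Union>i<n. range (\<gamma> i))}"

lemma walls_lift: "z \<in> walls \<longleftrightarrow> (\<exists>B\<in>lifts. z \<in> range (gline B))"
proof
  assume "z \<in> walls"
  then obtain i t where i: "z \<in> \<H>" "i < n" "orbit G z = \<gamma> i t" by (auto simp: walls_def)
  then have "orbit G (gline (Cm i) t) = orbit G z" using Cm by simp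
  then obtain A where A: "A \<in> Gam" "z = mobius A (gline (Cm i) t)"
    using orbit_eq_iff[of "gline (Cm i) t" z] Cm(1)[OF i(2)] by auto
  then have "z = gline (A ** Cm i) t" using Cm(1)[OF i(2)] by (simp add: gline_mult)
  then show "\<exists>B\<in>lifts. z \<in> range (gline B)" using A i unfolding lifts_def by blast
next
  assume "\<exists>B\<in>lifts. z \<in> range (gline B)"
  then obtain B t where B: "B \<in> lifts" "z = gline B t" by blast
  obtain i where "i < n" "\<And>t. \<gamma> i t = orbit G (gline B t)" using lifts_orbit[OF B(1)] by metis
  then show "z \<in> walls" using B by (auto simp: walls_def)
qed

lemma walls_mobius:
  assumes "A \<in> Gam" "z \<in> \<H>" shows "mobius A z \<in> walls \<longleftrightarrow> z \<in> walls"
  using assms by (simp add: walls_def orbit_mobius)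

definition Mt :: "complex set" where "Mt = {z \<in> \<H>. orbit G z \<in> M}"

text \<open>The sign may depend on \<open>t\<close>, since the side is prescribed only near each
  single point.\<close>

lemma local_side:
  assumes "B \<in> lifts"
  shows "\<exists>\<sigma>\<in>{1, -1}. \<exists>e>0. \<forall>z\<in>\<H> \<inter> ball (gline B t) e. z \<in> Mt \<longleftrightarrow> \<sigma> * gside B z \<ge> 0"
proof -
  obtain i where i: "i < n" "\<And>t. \<gamma> i t = orbit G (gline B t)" using lifts_orbit[OF assms] by metis
  have d: "det B = 1" using assms by simp
  have "locally_on_one_side G M (\<gamma> i)" using bound i(1) by (simp add: bound_subsurface_def)
  moreover have "geodesic_line (gline B) \<and> \<gamma> i = orbit G \<circ> gline B"
    using geodesic_line_gline[OF d] i(2) by auto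
  ultimately obtain C e where C: "C \<in> components (\<H> - range (gline B))" "e > 0"
    "\<And>z. z \<in> \<H> \<inter> ball (gline B t) e \<Longrightarrow> orbit G z \<in> M \<longleftrightarrow> z \<in> C \<union> range (gline B)"
    unfolding locally_on_one_side_def by metis
  have L: "z \<in> range (gline B) \<longleftrightarrow> gside B z = 0" if "z \<in> \<H>" for z using gside_zero_iff[OF d that] by simp
  from components_gline[OF d C(1)] show ?thesis
  proof
    assume "C = {z \<in> \<H>. gside B z > 0}"
    then have "z \<in> Mt \<longleftrightarrow> 1 * gside B z \<ge> 0" if "z \<in> \<H> \<inter> ball (gline B t) e" for z
      using C(3)[OF that] that L[of z] by (auto simp: Mt_def)
    then show ?thesis using C(2) by blast
  next
    assume "C = {z \<in> \<H>. gside B z < 0}"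
    then have "z \<in> Mt \<longleftrightarrow> (-1) * gside B z \<ge> 0" if "z \<in> \<H> \<inter> ball (gline B t) e" for z
      using C(3)[OF that] that L[of z] by (auto simp: Mt_def)
    then show ?thesis using C(2) by blast
  qed
qed

lemma isCont_mobius: "det A = 1 \<Longrightarrow> z \<in> \<H> \<Longrightarrow> isCont (mobius A) z"
  using mobius_deriv DERIV_isCont by blast

lemma isCont_gside: "det B = 1 \<Longrightarrow> z \<in> \<H> \<Longrightarrow> isCont (gside B) z"
  unfolding gside_def[abs_def] using isCont_mobius[of "adj2 B" z] by (auto intro: continuous_intros)

lemma both_sides_near:
  assumes B: "det B = 1" and U: "open U" "gline B s \<in> U" and \<sigma>: "\<sigma> \<in> {1, - 1 :: real}"
  shows "\<exists>z\<in>U \<inter> \<H>. \<sigma> * gside B z < 0"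
proof -
  define g where "g h = mobius B (of_real (- \<sigma> * h) + \<i> * exp s)" for h :: real
  have H: "of_real (- \<sigma> * h) + \<i> * exp s \<in> \<H>" for h :: real by (simp add: upper_half_plane_def)
  have "isCont g 0"
    unfolding g_def by (rule isCont_o2[where g = "mobius B"], intro continuous_intros, rule isCont_mobius[OF B H])
  moreover have "g 0 = gline B s" by (simp add: g_def gline_def)
  ultimately have "(g \<longlongrightarrow> gline B s) (at 0)" by (simp add: isCont_def)
  then have "\<forall>\<^sub>F h in at 0. g h \<in> U" using U by (simp add: tendsto_def)
  then have "\<forall>\<^sub>F h in at_right 0. g h \<in> U" by (simp add: eventually_at_split)
  then have "\<forall>\<^sub>F h in at_right 0. g h \<in> U \<and> 0 < h" using eventually_at_right_less[of 0] by eventually_elim simp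
  then obtain h where h: "g h \<in> U" "0 < h" using eventually_happens'[OF trivial_limit_at_right_real] by blast
  have "gside B (g h) = - \<sigma> * h" using B H by (simp add: gside_def g_def)
  then have "\<sigma> * gside B (g h) < 0" using \<sigma> h by auto
  moreover have "g h \<in> \<H>" unfolding g_def using B H by simp
  ultimately show ?thesis using h by blast
qed

text \<open>Near a common point \<open>Mt\<close> is a closed half-plane of \<open>B\<close> and
  also one of \<open>B'\<close>. A nearby point of the line of \<open>B'\<close> off the line of
  \<open>B\<close> would be interior to \<open>Mt\<close> by the first description and a boundary
  point by the second. So \<open>gside B\<close> vanishes along a piece of the other line, and by
  \<open>gside_crossing\<close> along all of it. This covers lifts of the same boundary geodesic and
  of different ones alike.\<close>

lemma wall_unique_aux:
  assumes B: "B \<in> lifts" and B': "B' \<in> lifts" and eq: "gline B t = gline B' t'"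
  shows "range (gline B') \<subseteq> range (gline B)"
proof -
  have d: "det B = 1" "det B' = 1" using B B' by auto
  define p where "p = gline B t"
  obtain \<sigma> e where \<sigma>: "\<sigma> \<in> {1, -1}" "e > 0" "\<And>z. z \<in> \<H> \<inter> ball p e \<Longrightarrow> z \<in> Mt \<longleftrightarrow> \<sigma> * gside B z \<ge> 0"
    using local_side[OF B, of t] unfolding p_def by blast
  obtain \<sigma>' e' where \<sigma>': "\<sigma>' \<in> {1, -1}" "e' > 0" "\<And>z. z \<in> \<H> \<inter> ball p e' \<Longrightarrow> z \<in> Mt \<longleftrightarrow> \<sigma>' * gside B' z \<ge> 0"
    using local_side[OF B', of t'] unfolding p_def eq by blast
  define U where "U = ball p (min e e')"
  have U: "open U" "U \<subseteq> ball p e" "U \<subseteq> ball p e'" by (auto simp: U_def)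
  have zero: "gside B (gline B' s) = 0" if s: "gline B' s \<in> U" for s
  proof (rule ccontr)
    define q where "q = gline B' s"
    assume "gside B (gline B' s) \<noteq> 0"
    then have nz: "gside B q \<noteq> 0" by (simp add: q_def)
    have qH: "q \<in> \<H>" using d by (simp add: q_def)
    have qU: "q \<in> U" using s by (simp add: q_def)
    have "gside B' q = 0" using gside_zero_iff[OF d(2) qH] by (simp add: q_def)
    then have "q \<in> Mt" using \<sigma>'(3)[of q] qH qU U by auto
    then have "\<sigma> * gside B q \<ge> 0" using \<sigma>(3)[of q] qH qU U by auto
    then have pos: "\<sigma> * gside B q > 0" using nz \<sigma>(1) by (auto simp: less_le)
    have "isCont (\<lambda>z. \<sigma> * gside B z) q" by (intro continuous_intros isCont_gside d qH)
    then have "\<forall>\<^sub>F z in at q. \<sigma> * gside B z > 0" unfolding isCont_def using pos by (rule order_tendstoD(1))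
    then have "\<forall>\<^sub>F z in nhds q. \<sigma> * gside B z > 0" using pos by (simp add: eventually_nhds_conv_at)
    then obtain V where V: "open V" "q \<in> V" "\<And>z. z \<in> V \<Longrightarrow> \<sigma> * gside B z > 0" unfolding eventually_nhds by blast
    have "open (U \<inter> V)" "gline B' s \<in> U \<inter> V" using U V qU by (auto simp: q_def)
    from both_sides_near[OF d(2) this \<sigma>'(1)] obtain z where z: "z \<in> U \<inter> V" "z \<in> \<H>" "\<sigma>' * gside B' z < 0" by blast
    have "z \<in> Mt" using \<sigma>(3)[of z] V(3)[of z] z U by force
    then show False using \<sigma>'(3)[of z] z U by force
  qed
  have T: "mobius_T1 B' (\<i>, \<i>) \<in> T1H" by (rule gline_eq_gflow(2)[OF d(2)])
  have "gline B' t' \<in> U" using eq \<sigma>(2) \<sigma>'(2) by (simp add: U_def p_def)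
  then have z0: "gside B (gline B' t') = 0" by (rule zero)
  have "gline B' = (\<lambda>t. fst (gflow t (mobius_T1 B' (\<i>, \<i>))))" using gline_eq_gflow(1)[OF d(2)] by (rule ext)
  then have "isCont (gline B') t'" using isCont_gflow_point[OF T] by simp
  then have "\<forall>\<^sub>F s in at t'. gline B' s \<in> U"
    using \<open>gline B' t' \<in> U\<close> U(1) by (simp add: isCont_def tendsto_def)
  then obtain s where s: "s \<noteq> t'" "gline B' s \<in> U"
    by (metis (mono_tags, lifting) eventually_at_filter eventually_conj eventually_happens' at_neq_bot eventually_neq_at_within)
  then have zs: "gside B (gline B' s) = 0" by (simp add: zero)
  have "\<forall>t. gside B (gline B' t) = 0"
    using gside_crossing[OF d(1) T z0[unfolded gline_eq_gflow(1)[OF d(2)]]] unfolding gline_eq_gflow(1)[OF d(2), symmetric]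
  proof
    assume "\<exists>k D. k \<noteq> 0 \<and> (\<forall>t. 0 < D t) \<and> (\<forall>t. gside B (gline B' t) = k * sinh (t - t') / D t)"
    then obtain k and D :: "real \<Rightarrow> real" where kD: "k \<noteq> 0" "0 < D s" "gside B (gline B' s) = k * sinh (s - t') / D s" by blast
    then have "sinh (s - t') = 0" using zs by simp
    then show ?thesis using s(1) by simp
  qed
  then show ?thesis using gside_zero_iff[OF d(1)] d(2) by auto
qed

lemma wall_unique:
  assumes "B \<in> lifts" "B' \<in> lifts" "z \<in> range (gline B)" "z \<in> range (gline B')"
  shows "range (gline B) = range (gline B')"
  using wall_unique_aux[OF assms(1,2)] wall_unique_aux[OF assms(2,1)] assms(3,4) by (metis rangeE subset_antisym)

text \<open>An element fixing a point of a lift maps the lift to itself, so along it the element is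
  the identity or a reflection. A reflection would identify two points of the closed geodesic at
  parameter distance less than the period. An element fixing two points of the line is then
  conjugated to the imaginary axis.\<close>

lemma wall_stabilizer:
  assumes B: "B \<in> lifts" and A: "A \<in> Gam" and fx: "mobius A (gline B t) = gline B t"
  shows "A \<in> Zpm"
proof -
  have d: "det B = 1" "det A = 1" using A B by auto
  have AB: "A ** B \<in> lifts" using lifts_mult[OF A B] .
  have g: "gline (A ** B) s = mobius A (gline B s)" for s using d by (simp add: gline_mult)
  have r: "range (gline (A ** B)) \<subseteq> range (gline B)"
    using wall_unique_aux[OF B AB, of t t] fx g by simp
  obtain i where i: "i < n" "\<And>t. \<gamma> i t = orbit G (gline B t)" using lifts_orbit[OF B] by metis
  \<comment> \<open>The reflected parameter is \<open>t - l i / 4\<close>; the two differ by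
    \<open>l i / 2\<close>, which is no integral multiple of the period.\<close>
  define s where "s = t + l i / 4"
  have L: "l i > 0" using l_pos[OF i(1)] .
  have "gline (A ** B) s = gline B s \<or> gline (A ** B) s = gline B (2 * t - s)"
    using geodesic_line_same_range[OF geodesic_line_gline geodesic_line_gline, of "A ** B" B t s] d r fx g
    by (simp add: det_mult_1)
  moreover have "gline (A ** B) s \<noteq> gline B (2 * t - s)"
  proof
    assume "gline (A ** B) s = gline B (2 * t - s)"
    then have "orbit G (mobius A (gline B s)) = orbit G (gline B (2 * t - s))" using g by simp
    then have "\<gamma> i s = \<gamma> i (2 * t - s)" using i A d by (simp add: orbit_mobius)
    then obtain k :: int where "s - (2 * t - s) = of_int k * l i" using \<gamma>_inj[OF i(1)] by blast
    then have "l i / 2 = of_int k * l i" by (simp add: s_def)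
    then have "of_int (2 * k) = (1 :: real)" using L by (simp add: field_simps)
    then have "2 * k = 1" by linarith
    then show False by presburger
  qed
  ultimately have fs: "mobius A (gline B s) = gline B s" using g by simp
  define A' where "A' = adj2 B ** A ** B"
  have d': "det A' = 1" using d by (simp add: A'_def det_mult_1)
  have ax: "mobius A' (\<i> * exp r) = \<i> * exp r" if "mobius A (gline B r) = gline B r" for r
  proof -
    have H: "\<i> * complex_of_real (exp r) \<in> \<H>" by simp
    have "mobius A' (\<i> * exp r) = mobius (adj2 B ** A) (mobius B (\<i> * exp r))"
      unfolding A'_def by (rule mobius_mult[OF _ d(1) H]) (simp add: det_mult_1 d)
    also have "\<dots> = mobius (adj2 B) (mobius A (mobius B (\<i> * exp r)))"
      by (rule mobius_mult) (use d H in auto)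
    also have "\<dots> = \<i> * exp r" using that d(1) H by (simp add: gline_def)
    finally show ?thesis .
  qed
  have "exp s \<noteq> exp t" using L by (simp add: s_def)
  then have "A' \<in> Zpm"
    using fixes_two_axis_points[OF d', of "exp s" "exp t"] ax[OF fs] ax[OF fx] by simp
  then have "B ** A' ** adj2 B \<in> Zpm" using adj2_mult[OF d(1)] by (auto simp: uminus_mult_2)
  moreover have "B ** A' ** adj2 B = (B ** adj2 B) ** A ** (B ** adj2 B)" by (simp add: A'_def matrix_mul_assoc)
  ultimately show ?thesis using adj2_mult(2)[OF d(1)] by simp
qed

section \<open>Local finiteness of the lifts\<close>

text \<open>Lifts as point sets, since counting crossings must identify the many matrices in
  \<open>lifts\<close> that describe one line.\<close>

definition walllines :: "complex set set" where
  "walllines = (\<lambda>B. range (gline B)) ` lifts"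

text \<open>One period of each chosen lift: a compact set whose translates cover all walls.\<close>

definition base_arcs :: "complex set" where
  "base_arcs = (\<Union>i<n. gline (Cm i) ` {0..l i})"

lemma compact_base_arcs: "compact base_arcs" and base_arcs_H: "base_arcs \<subseteq> \<H>"
proof -
  show "compact base_arcs" unfolding base_arcs_def
    by (intro compact_UN compact_continuous_image continuous_on_subset[OF continuous_gline] Cm(1)) auto
  show "base_arcs \<subseteq> \<H>" using Cm(1) by (auto simp: base_arcs_def)
qed

lemma wall_point_base:
  assumes B: "B \<in> lifts"
  obtains A i r where "A \<in> Gam" "i < n" "r \<in> {0..<l i}" "gline B s = gline (A ** Cm i) r" "gline B s = mobius A (gline (Cm i) r)"
proof -
  obtain i where i: "i < n" "\<And>t. \<gamma> i t = orbit G (gline B t)" using lifts_orbit[OF B] by metis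
  obtain r k where r: "r \<in> {0..<l i}" "\<gamma> i s = \<gamma> i r" using \<gamma>_reduce[OF i(1), of s] by metis
  then have "orbit G (gline (Cm i) r) = orbit G (gline B s)" using i Cm(2)[OF i(1)] by simp
  then obtain A where A: "A \<in> Gam" "gline B s = mobius A (gline (Cm i) r)"
    using orbit_eq_iff[of "gline (Cm i) r" "gline B s"] Cm(1)[OF i(1)] by auto
  then show ?thesis using that[of A i r] i r Cm(1)[OF i(1)] by (simp add: gline_mult)
qed

text \<open>A wall point in \<open>K\<close> is a translate of a point of the compact
  \<open>base_arcs\<close>, so proper discontinuity admits finitely many group elements, and by
  \<open>wall_unique\<close> the element and the index determine the line.\<close>

lemma finite_walllines:
  assumes K: "compact K" "K \<subseteq> \<H>"
  shows "finite {L \<in> walllines. L \<inter> K \<noteq> {}}"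
proof -
  let ?S = "{A \<in> Gam. \<exists>z\<in>base_arcs. mobius A z \<in> K}"
  have "finite ?S" by (rule properly_discontinuous[OF compact_base_arcs base_arcs_H K])
  moreover have "{L \<in> walllines. L \<inter> K \<noteq> {}} \<subseteq> (\<lambda>(A, i). range (gline (A ** Cm i))) ` (?S \<times> {..<n})"
  proof
    fix L assume "L \<in> {L \<in> walllines. L \<inter> K \<noteq> {}}"
    then obtain B s where B: "B \<in> lifts" "L = range (gline B)" "gline B s \<in> K" by (auto simp: walllines_def)
    obtain A i r where A: "A \<in> Gam" "i < n" "r \<in> {0..<l i}" "gline B s = gline (A ** Cm i) r" "gline B s = mobius A (gline (Cm i) r)"
      using wall_point_base[OF B(1)] by metis
    have "A ** Cm i \<in> lifts" using A unfolding lifts_def by blast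
    then have "L = range (gline (A ** Cm i))" using wall_unique[OF B(1)] A(4) B(2) by (metis rangeI)
    moreover have "gline (Cm i) r \<in> base_arcs" using A unfolding base_arcs_def by fastforce
    then have "A \<in> ?S" using A(1,5) B(3) by force
    ultimately show "L \<in> (\<lambda>(A, i). range (gline (A ** Cm i))) ` (?S \<times> {..<n})" using A(2) by force
  qed
  ultimately show ?thesis by (meson finite_SigmaI finite_imageI finite_lessThan finite_subset)
qed

text \<open>The bound gives \<open>(Im z - Im k)\<^sup>2 \<le> R' * (Im z * Im k)\<close>, which
  confines the quotient of the heights between \<open>1 / (4 * R')\<close> and
  \<open>4 * R'\<close>. With both heights bounded, \<open>hdelta\<close> bounds the Euclidean
  distance as well.\<close>

lemma hdelta_nbhd_compact:
  assumes K: "compact K" "K \<subseteq> \<H>"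
  obtains Q where "compact Q" "Q \<subseteq> \<H>" "\<And>z k. k \<in> K \<Longrightarrow> z \<in> \<H> \<Longrightarrow> hdelta z k \<le> R \<Longrightarrow> z \<in> Q"
proof -
  obtain m N where mN: "m > 0" "N > 0" "\<And>z. z \<in> K \<Longrightarrow> m \<le> Im z \<and> cmod z \<le> N" using compact_H_bounds[OF K] by metis
  define R' where "R' = max R 1"
  have R': "R' \<ge> 1" "R \<le> R'" by (auto simp: R'_def)
  define hi where "hi = 4 * R' * N"
  define lo where "lo = m / (4 * R')"
  define Q where "Q = {z. lo \<le> Im z} \<inter> cball 0 (N + sqrt (R' * hi * N))"
  have lo: "lo > 0" using mN R' by (simp add: lo_def)
  have "closed {z. lo \<le> Im z}" by (rule closed_halfspace_Im_ge)
  then have "compact Q" unfolding Q_def using compact_Int_closed compact_cball by (metis inf_commute)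
  moreover have "Q \<subseteq> \<H>" using lo by (auto simp: Q_def upper_half_plane_def)
  moreover have "z \<in> Q" if k: "k \<in> K" and z: "z \<in> \<H>" and h: "hdelta z k \<le> R" for z k
  proof -
    have pos: "Im k > 0" "Im z > 0" using k z K by (auto simp: upper_half_plane_def)
    have kN: "m \<le> Im k" "cmod k \<le> N" "Im k \<le> N" using mN(3)[OF k] abs_Im_le_cmod[of k] by auto
    have "(cmod (z - k))\<^sup>2 \<le> R * (Im z * Im k)" using h pos by (simp add: hdelta_def divide_le_eq)
    also have "\<dots> \<le> R' * (Im z * Im k)" using R' pos by (intro mult_right_mono) auto
    finally have d: "(cmod (z - k))\<^sup>2 \<le> R' * (Im z * Im k)" .
    have "(Im z - Im k)\<^sup>2 \<le> (cmod (z - k))\<^sup>2" by (simp add: cmod_power2)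
    then have I: "(Im z - Im k)\<^sup>2 \<le> R' * (Im z * Im k)" using d by linarith
    have up: "Im z \<le> hi"
    proof (cases "Im z \<le> 2 * Im k")
      case True
      have "2 * Im k \<le> hi" 
      proof -
        have "N \<le> R' * N" using mN R' by simp
        then show ?thesis unfolding hi_def using kN mN by linarith
      qed
      then show ?thesis using True by simp
    next
      case False
      then have "(Im z / 2)\<^sup>2 \<le> (Im z - Im k)\<^sup>2" using pos by (intro power_mono) auto
      then have "Im z * Im z \<le> Im z * (4 * R' * Im k)" using I by (simp add: power2_eq_square algebra_simps)
      then have "Im z \<le> 4 * R' * Im k" using pos by simp
      also have "\<dots> \<le> hi" unfolding hi_def using kN R' by (intro mult_left_mono) auto
      finally show ?thesis .
    qed
    have low: "lo \<le> Im z"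
    proof (cases "Im z \<ge> Im k / 2")
      case True
      have "lo \<le> m / 2" unfolding lo_def using mN R' by (intro divide_left_mono) auto
      then show ?thesis using True kN by linarith
    next
      case False
      then have "(Im k / 2)\<^sup>2 \<le> (Im k - Im z)\<^sup>2" using pos by (intro power_mono) auto
      then have "Im k * Im k \<le> Im k * (4 * R' * Im z)" using I by (simp add: power2_eq_square algebra_simps)
      then have "Im k \<le> 4 * R' * Im z" using pos by simp
      then show ?thesis unfolding lo_def using kN R' by (simp add: divide_le_eq algebra_simps)
    qed
    have "(cmod (z - k))\<^sup>2 \<le> R' * hi * N"
    proof -
      have "R' * (Im z * Im k) \<le> R' * (hi * N)" using up kN R' pos by (intro mult_left_mono mult_mono) auto
      then show ?thesis using d by (simp add: mult.assoc)
    qed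
    then have "cmod (z - k) \<le> sqrt (R' * hi * N)" by (rule real_le_rsqrt)
    then have "cmod z \<le> N + sqrt (R' * hi * N)" using norm_triangle_sub[of z k] kN by linarith
    then show ?thesis using low by (simp add: Q_def)
  qed
  ultimately show ?thesis using that by blast
qed

lemma convex_H: "convex \<H>" unfolding upper_half_plane_def by (rule convex_halfspace_Im_gt)

text \<open>Euclidean segments can stand in for hyperbolic ones. At the fraction \<tau> of the way
  from \<open>p\<close>, the squared distance is multiplied by \<tau> squared while the height is
  still at least \<tau> times that of \<open>q\<close>.\<close>

lemma hdelta_segment:
  assumes "p \<in> \<H>" "q \<in> \<H>" "w \<in> closed_segment p q"
  shows "w \<in> \<H>" "hdelta p w \<le> hdelta p q"
proof -
  show wH: "w \<in> \<H>" using convex_H assms by (meson closed_segment_subset subsetD)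
  obtain \<tau> where \<tau>: "0 \<le> \<tau>" "\<tau> \<le> 1" "w = (1 - \<tau>) *\<^sub>R p + \<tau> *\<^sub>R q" using assms(3) by (auto simp: in_segment)
  have pos: "Im p > 0" "Im q > 0" "Im w > 0" using assms wH by (auto simp: upper_half_plane_def)
  have pw: "p - w = \<tau> *\<^sub>R (p - q)" unfolding \<tau>(3) by (simp add: algebra_simps scaleR_diff_left)
  have Iw: "\<tau> * Im q \<le> Im w" unfolding \<tau>(3) using \<tau> pos by simp
  have "(cmod (p - w))\<^sup>2 * (Im p * Im q) \<le> (cmod (p - q))\<^sup>2 * (Im p * Im w)"
  proof -
    have "(cmod (p - w))\<^sup>2 = \<tau> * \<tau> * (cmod (p - q))\<^sup>2" unfolding pw using \<tau> by (simp add: power_mult_distrib power2_eq_square)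
    also have "\<dots> \<le> \<tau> * (cmod (p - q))\<^sup>2" using \<tau> by (intro mult_right_mono) (auto simp: mult_left_le)
    finally have "(cmod (p - w))\<^sup>2 * (Im p * Im q) \<le> \<tau> * (cmod (p - q))\<^sup>2 * (Im p * Im q)" using pos by (intro mult_right_mono) auto
    also have "\<dots> = (cmod (p - q))\<^sup>2 * Im p * (\<tau> * Im q)" by simp
    also have "\<dots> \<le> (cmod (p - q))\<^sup>2 * Im p * Im w" using Iw pos by (intro mult_left_mono) auto
    finally show ?thesis by (simp add: mult.assoc)
  qed
  then show "hdelta p w \<le> hdelta p q" unfolding hdelta_def using pos by (simp add: divide_simps mult.commute mult.left_commute)
qed

text \<open>If a segment meets a wall, a group element moves a point of it into
  \<open>base_arcs\<close>, and then the whole segment lies in one compact set depending only on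
  \<open>R\<close>. The bound is therefore uniform although the orbifold need not be
  compact.\<close>

lemma uniform_walllines:
  "\<exists>K. \<forall>p\<in>\<H>. \<forall>q\<in>\<H>. hdelta p q \<le> R \<longrightarrow>
    finite {L \<in> walllines. L \<inter> closed_segment p q \<noteq> {}} \<and> card {L \<in> walllines. L \<inter> closed_segment p q \<noteq> {}} \<le> K"
proof -
  obtain Q1 where Q1: "compact Q1" "Q1 \<subseteq> \<H>" "\<And>z k. k \<in> base_arcs \<Longrightarrow> z \<in> \<H> \<Longrightarrow> hdelta z k \<le> R \<Longrightarrow> z \<in> Q1"
    using hdelta_nbhd_compact[OF compact_base_arcs base_arcs_H, of R] by metis
  obtain Q2 where Q2: "compact Q2" "Q2 \<subseteq> \<H>" "\<And>z k. k \<in> Q1 \<Longrightarrow> z \<in> \<H> \<Longrightarrow> hdelta z k \<le> R \<Longrightarrow> z \<in> Q2"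
    using hdelta_nbhd_compact[OF Q1(1,2), of R] by metis
  let ?T = "{L \<in> walllines. L \<inter> Q2 \<noteq> {}}"
  have finT: "finite ?T" by (rule finite_walllines[OF Q2(1,2)])
  show ?thesis
  proof (intro exI[of _ "card ?T"] ballI impI)
    fix p q assume pq: "p \<in> \<H>" "q \<in> \<H>" "hdelta p q \<le> R"
    let ?S = "{L \<in> walllines. L \<inter> closed_segment p q \<noteq> {}}"
    have "compact (closed_segment p q)" "closed_segment p q \<subseteq> \<H>"
      using hdelta_segment(1)[OF pq(1,2)] by auto
    then have finS: "finite ?S" by (rule finite_walllines)
    show "finite ?S \<and> card ?S \<le> card ?T"
    proof (cases "?S = {}")
      case False
      then obtain B s where B: "B \<in> lifts" "gline B s \<in> closed_segment p q" by (auto simp: walllines_def)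
      obtain A i r where A: "A \<in> Gam" "i < n" "r \<in> {0..<l i}" "gline B s = mobius A (gline (Cm i) r)"
        using wall_point_base[OF B(1)] by metis
      define k where "k = gline (Cm i) r"
      have k: "k \<in> base_arcs" using A unfolding base_arcs_def k_def by fastforce
      have kH: "k \<in> \<H>" using k base_arcs_H by blast
      define A' where "A' = adj2 A"
      have A': "A' \<in> Gam" "det A' = 1" using A Gam_adj2 by (auto simp: A'_def)
      have A'k: "mobius A' (gline B s) = k" unfolding A(4) A'_def using A kH by (simp add: k_def)
      have "hdelta (mobius A' p) k = hdelta p (gline B s)"
        unfolding A'k[symmetric] using A' pq B by (intro hdelta_mobius) auto
      also have "\<dots> \<le> R" using hdelta_segment(2)[OF pq(1,2) B(2)] pq(3) by simp
      finally have pQ1: "mobius A' p \<in> Q1" using Q1(3)[OF k] A' pq by simp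
      have seg: "mobius A' w \<in> Q2" if w: "w \<in> closed_segment p q" for w
      proof -
        have wH: "w \<in> \<H>" "hdelta p w \<le> R" using hdelta_segment[OF pq(1,2) w] pq(3) by auto
        have "hdelta (mobius A' w) (mobius A' p) = hdelta w p" using A' pq wH by (intro hdelta_mobius) auto
        also have "\<dots> = hdelta p w" by (simp add: hdelta_def norm_minus_commute mult.commute)
        finally show ?thesis using Q2(3)[OF pQ1] A' wH by simp
      qed
      have im: "mobius A' ` range (gline B) = range (gline (A' ** B))" if "B \<in> lifts" for B
        using that A' by (simp add: gline_mult image_image)
      have "(`) (mobius A') ` ?S \<subseteq> ?T"
      proof
        fix L assume "L \<in> (`) (mobius A') ` ?S"
        then obtain B w where B: "B \<in> lifts" "L = mobius A' ` range (gline B)" "w \<in> range (gline B)" "w \<in> closed_segment p q"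
          by (auto simp: walllines_def)
        then have "mobius A' w \<in> L \<inter> Q2" using seg by blast
        moreover have "L \<in> walllines" unfolding B(2) im[OF B(1)] walllines_def using lifts_mult[OF A'(1) B(1)] by blast
        ultimately show "L \<in> ?T" by blast
      qed
      moreover have "inj_on ((`) (mobius A')) ?S"
      proof (rule inj_on_inverseI[of _ "(`) (mobius A)"])
        fix L assume "L \<in> ?S"
        then have "L \<subseteq> \<H>" by (auto simp: walllines_def)
        then have "mobius A (mobius A' z) = z" if "z \<in> L" for z using that A by (auto simp: A'_def)
        then show "mobius A ` mobius A' ` L = L" by (simp add: image_image)
      qed
      ultimately show ?thesis using finS finT card_inj_on_le by blast
    next
      case True
      show ?thesis unfolding True by simp
    qed
  qed
qed

end

section \<open>Counting crossings\<close>

abbreviation pt :: "complex \<times> complex \<Rightarrow> real \<Rightarrow> complex" where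
  "pt v t \<equiv> fst (gflow t v)"

lemma pt_in_H: "v \<in> T1H \<Longrightarrow> pt v t \<in> \<H>"
  using gflow_in[of v t] by (auto simp: T1H_def)

lemma pt_gflow: "v \<in> T1H \<Longrightarrow> pt (gflow s v) t = pt v (t + s)"
  by (simp add: gflow_add)

lemma continuous_pt: "v \<in> T1H \<Longrightarrow> continuous_on X (pt v)"
  using isCont_gflow_point by (simp add: continuous_at_imp_continuous_on)

lemma connected_sign_change:
  fixes f :: "'a :: topological_space \<Rightarrow> real"
  assumes "connected S" "continuous_on S f" "x \<in> S" "y \<in> S" "f x * f y \<le> 0"
  shows "\<exists>z\<in>S. f z = 0"
proof -
  have c: "connected (f ` S)" using assms connected_continuous_image by blast
  have "f x \<le> 0 \<and> 0 \<le> f y \<or> f y \<le> 0 \<and> 0 \<le> f x" using assms(5) by (auto simp: mult_le_0_iff)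
  then have "0 \<in> f ` S" using connectedD_interval[OF c, of "f x" "f y" 0] connectedD_interval[OF c, of "f y" "f x" 0] assms by auto
  then show ?thesis by auto
qed

lemma measurable_nn_integral_count_space:
  fixes f :: "'i \<Rightarrow> 'a \<Rightarrow> ennreal"
  assumes I: "countable I" and f: "\<And>i. i \<in> I \<Longrightarrow> f i \<in> borel_measurable N"
  shows "(\<lambda>v. \<integral>\<^sup>+i. f i v \<partial>count_space I) \<in> borel_measurable N"
proof (cases "finite I")
  case True
  then show ?thesis using f by (simp add: nn_integral_count_space_finite)
next
  case False
  have b: "bij_betw (from_nat_into I) UNIV I" using bij_betw_from_nat_into[OF I False] .
  have "(\<integral>\<^sup>+i. f i v \<partial>count_space I) = (\<Sum>k. f (from_nat_into I k) v)" for v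
    unfolding nn_integral_bij_count_space[OF b, symmetric] by (rule nn_integral_count_space_nat)
  moreover have "(\<lambda>v. f (from_nat_into I k) v) \<in> borel_measurable N" for k
    using f from_nat_into[of I k] False by auto
  ultimately show ?thesis by simp
qed

context subsurface
begin

text \<open>The geodesics contained in no lift, that is, those meeting each lift at most
  once.\<close>

definition good :: "(complex \<times> complex) set" where
  "good = {v \<in> T1H. \<forall>B\<in>lifts. \<exists>t. gside B (pt v t) \<noteq> 0}"

lemma good_T1H: "v \<in> good \<Longrightarrow> v \<in> T1H" by (simp add: good_def)

definition cross :: "complex \<times> complex \<Rightarrow> real set \<Rightarrow> real set" where
  "cross v I = {t \<in> I. pt v t \<in> walls}"

lemma good_crossing:
  assumes "v \<in> good" "B \<in> lifts" "pt v t0 \<in> range (gline B)"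
  obtains k and D :: "real \<Rightarrow> real" where "k \<noteq> 0" "\<And>t. D t > 0" "\<And>t. gside B (pt v t) = k * sinh (t - t0) / D t"
proof -
  have "gside B (pt v t0) = 0" using gside_zero_iff[of B "pt v t0"] assms pt_in_H[OF good_T1H[OF assms(1)]] by simp
  from gside_crossing[OF lifts_det[OF assms(2)] good_T1H[OF assms(1)] this]
  have "\<exists>k D. k \<noteq> 0 \<and> (\<forall>t. D t > 0) \<and> (\<forall>t. gside B (pt v t) = k * sinh (t - t0) / (D t :: real))"
    using assms(1,2) by (auto simp: good_def)
  then obtain k and D :: "real \<Rightarrow> real" where "k \<noteq> 0" "\<forall>t. D t > 0" "\<forall>t. gside B (pt v t) = k * sinh (t - t0) / D t" by blast
  then show ?thesis using that by blast
qed

lemma good_line_once: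
  assumes v: "v \<in> good" and L: "L \<in> walllines" and st: "pt v s \<in> L" "pt v t \<in> L"
  shows "s = t"
proof -
  obtain B where B: "B \<in> lifts" "L = range (gline B)" using L by (auto simp: walllines_def)
  obtain k and D :: "real \<Rightarrow> real" where kD: "k \<noteq> 0" "\<And>t. D t > 0" "\<And>r. gside B (pt v r) = k * sinh (r - s) / D r"
    using good_crossing[OF v B(1), of s] st(1) unfolding B(2) by metis
  have "gside B (pt v t) = 0" using gside_zero_iff[of B "pt v t"] st(2) B pt_in_H[OF good_T1H[OF v]] by simp
  then have "sinh (t - s) = 0" using kD(1,3) kD(2)[of t] by simp
  then show ?thesis by simp
qed

lemma good_gflow: "v \<in> good \<Longrightarrow> gflow s v \<in> good"
  unfolding good_def
proof (intro CollectI conjI ballI)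
  fix B assume v: "v \<in> {v \<in> T1H. \<forall>B\<in>lifts. \<exists>t. gside B (pt v t) \<noteq> 0}" "B \<in> lifts"
  then obtain t where "gside B (pt v t) \<noteq> 0" by blast
  then have "gside B (pt (gflow s v) (t - s)) \<noteq> 0" using v by (simp add: gflow_add)
  then show "\<exists>t. gside B (pt (gflow s v) t) \<noteq> 0" by blast
qed simp

lemma good_flip: "v \<in> good \<Longrightarrow> flip v \<in> good"
  unfolding good_def
proof (intro CollectI conjI ballI)
  fix B assume v: "v \<in> {v \<in> T1H. \<forall>B\<in>lifts. \<exists>t. gside B (pt v t) \<noteq> 0}" "B \<in> lifts"
  then obtain t where "gside B (pt v t) \<noteq> 0" by blast
  then have "gside B (pt (flip v) (- t)) \<noteq> 0" by (simp add: gflow_flip)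
  then show "\<exists>t. gside B (pt (flip v) t) \<noteq> 0" by blast
qed simp

lemma walls_line: "z \<in> walls \<longleftrightarrow> (\<exists>L\<in>walllines. z \<in> L)"
  by (auto simp: walls_lift walllines_def)

lemma walllines_unique: "L \<in> walllines \<Longrightarrow> L' \<in> walllines \<Longrightarrow> z \<in> L \<Longrightarrow> z \<in> L' \<Longrightarrow> L = L'"
  using wall_unique unfolding walllines_def by blast

definition lines_hit :: "complex \<times> complex \<Rightarrow> real set \<Rightarrow> complex set set" where
  "lines_hit v I = {L \<in> walllines. \<exists>t\<in>I. pt v t \<in> L}"

text \<open>A wall point lies on a unique line and a good geodesic meets a line at most once, so
  crossing times correspond to lines. Lines, unlike times, can be compared between two
  geodesics.\<close>

lemma cross_lines_hit:
  assumes v: "v \<in> good"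
  shows "card (cross v I) = card (lines_hit v I)" "finite (cross v I) \<longleftrightarrow> finite (lines_hit v I)"
proof -
  define f where "f t = (SOME L. L \<in> walllines \<and> pt v t \<in> L)" for t
  have f: "f t \<in> walllines \<and> pt v t \<in> f t" if "t \<in> cross v I" for t
    unfolding f_def by (rule someI_ex) (use that walls_line in \<open>auto simp: cross_def\<close>)
  have "bij_betw f (cross v I) (lines_hit v I)"
    unfolding bij_betw_def
  proof (intro conjI inj_onI equalityI subsetI)
    fix s t assume "s \<in> cross v I" "t \<in> cross v I" "f s = f t"
    then show "s = t" using good_line_once[OF v, of "f s" s t] f by metis
  next
    fix L assume "L \<in> f ` cross v I"
    then show "L \<in> lines_hit v I" using f by (auto simp: lines_hit_def cross_def)
  next
    fix L assume "L \<in> lines_hit v I"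
    then obtain t where t: "L \<in> walllines" "t \<in> I" "pt v t \<in> L" by (auto simp: lines_hit_def)
    then have tc: "t \<in> cross v I" using walls_line by (auto simp: cross_def)
    have "f t = L" using walllines_unique[of "f t" L] f[OF tc] t by blast
    then show "L \<in> f ` cross v I" using tc by blast
  qed
  then show "card (cross v I) = card (lines_hit v I)" "finite (cross v I) \<longleftrightarrow> finite (lines_hit v I)"
    by (rule bij_betw_same_card, rule bij_betw_finite)
qed

lemma finite_cross_Icc:
  assumes v: "v \<in> good" shows "finite (cross v {a..b})"
proof -
  have "compact (pt v ` {a..b})" by (intro compact_continuous_image continuous_pt good_T1H v) simp
  moreover have "pt v ` {a..b} \<subseteq> \<H>" using pt_in_H[OF good_T1H[OF v]] by auto
  ultimately have "finite {L \<in> walllines. L \<inter> pt v ` {a..b} \<noteq> {}}" by (rule finite_walllines)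
  moreover have "lines_hit v {a..b} \<subseteq> {L \<in> walllines. L \<inter> pt v ` {a..b} \<noteq> {}}" by (auto simp: lines_hit_def)
  ultimately show ?thesis using cross_lines_hit(2)[OF v] finite_subset by blast
qed

lemma finite_cross: "v \<in> good \<Longrightarrow> I \<subseteq> {a..b} \<Longrightarrow> finite (cross v I)"
  by (rule finite_subset[OF _ finite_cross_Icc[of v a b]]) (auto simp: cross_def)

abbreviation flux :: "nat \<Rightarrow> (complex \<times> complex) set" where
  "flux i \<equiv> flux_set (gline (Cm i)) (l i)"

lemma flux_lam: "i < n \<Longrightarrow> flux i \<in> sets lam"
  using Cm(1) by (intro flux_set_measurable continuous_gline) auto

text \<open>Twice the number of crossings in unit time, since \<open>A\<close> and \<open>- A\<close> act alike.\<close>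

definition crossings2 :: "complex \<times> complex \<Rightarrow> ennreal" where
  "crossings2 v = (\<integral>\<^sup>+A. (\<Sum>i<n. indicator (flux i) (mobius_T1 A v)) \<partial>count_space Gam)"

text \<open>The pairs of an index and a matrix counted by \<open>crossings2\<close> are sorted by
  crossing time. At one time disjointness of the geodesics determines the index, injectivity on a
  period determines the point of the arc, and \<open>wall_stabilizer\<close> determines the matrix
  up to sign. No pair occurs at two times, because its lift is met only once.\<close>

lemma crossings2_good:
  assumes v: "v \<in> good"
  shows "crossings2 v = of_nat (2 * card (cross v {0..<1}))"
proof -
  let ?Z = "cross v {0..<1}"
  have vT: "v \<in> T1H" using good_T1H[OF v] .
  define P where "P t = {(i, A). i < n \<and> A \<in> Gam \<and> mobius A (pt v t) \<in> gline (Cm i) ` {0..<l i}}" for t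
  have Z: "finite ?Z" by (rule finite_cross[OF v, of _ 0 1]) auto
  have wallbase: "gline (Cm i) r \<in> walls" if "i < n" for i r
    using that Cm[OF that] by (auto simp: walls_def)
  have mem: "mobius_T1 A v \<in> flux i \<longleftrightarrow> (\<exists>t\<in>?Z. (i, A) \<in> P t)" if "i < n" "A \<in> Gam" for i A
  proof -
    have "mobius_T1 A v \<in> flux i \<longleftrightarrow> (\<exists>t\<in>{0..<1}. mobius A (pt v t) \<in> gline (Cm i) ` {0..<l i})"
      using that vT by (auto simp: flux_set_def gflow_mobius mobius_T1_fst)
    also have "\<dots> \<longleftrightarrow> (\<exists>t\<in>?Z. mobius A (pt v t) \<in> gline (Cm i) ` {0..<l i})"
    proof -
      have "pt v t \<in> walls" if w: "mobius A (pt v t) \<in> gline (Cm i) ` {0..<l i}" for t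
      proof -
        obtain r where "mobius A (pt v t) = gline (Cm i) r" using w by blast
        then have "mobius A (pt v t) \<in> walls" using wallbase[OF \<open>i < n\<close>] by simp
        then show ?thesis using walls_mobius[OF \<open>A \<in> Gam\<close> pt_in_H[OF vT]] by simp
      qed
      then show ?thesis unfolding cross_def by blast
    qed
    finally show ?thesis using that by (auto simp: P_def)
  qed
  have P2: "finite (P t) \<and> card (P t) = 2" if t: "t \<in> ?Z" for t
  proof -
    obtain B s where B: "B \<in> lifts" "pt v t = gline B s" using t walls_lift by (auto simp: cross_def)
    obtain A0 i r where A0: "A0 \<in> Gam" "i < n" "r \<in> {0..<l i}" "gline B s = mobius A0 (gline (Cm i) r)"
      using wall_point_base[OF B(1), of s] by metis
    have cH: "gline (Cm i) r \<in> \<H>" using Cm(1)[OF A0(2)] by simp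
    have base: "mobius (adj2 A0) (pt v t) = gline (Cm i) r" unfolding B(2) A0(4) using A0(1) cH by simp
    have "(j, A) \<in> P t \<longleftrightarrow> (j, A) \<in> {(i, adj2 A0), (i, - adj2 A0)}" for j A
    proof
      assume "(j, A) \<in> P t"
      then obtain q where q: "j < n" "A \<in> Gam" "q \<in> {0..<l j}" "mobius A (pt v t) = gline (Cm j) q" by (auto simp: P_def)
      have "\<gamma> j q = orbit G (mobius A (pt v t))" using q Cm(2)[OF q(1)] by simp
      also have "\<dots> = orbit G (mobius (adj2 A0) (pt v t))"
        using q(2) A0(1) pt_in_H[OF vT] Gam_adj2 by (simp add: orbit_mobius)
      also have "\<dots> = \<gamma> i r" using base Cm(2)[OF A0(2)] by simp
      finally have g: "\<gamma> j q = \<gamma> i r" .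
      have ji: "j = i"
      proof (rule ccontr)
        assume "j \<noteq> i"
        then have "range (\<gamma> j) \<inter> range (\<gamma> i) = {}" using disj q(1) A0(2) by (auto simp: disjoint_family_on_def)
        then show False using g by (metis disjoint_iff rangeI)
      qed
      have "inj_on (\<gamma> i) {0..<l i}" using scg[OF A0(2)] by (simp add: simple_closed_geodesic_def)
      then have "q = r" using g q A0 unfolding ji by (auto dest: inj_onD)
      then have "mobius A (pt v t) = gline (Cm i) r" using q ji by simp
      then have "mobius (A0 ** A) (gline B s) = gline B s"
        using A0 q(2) pt_in_H[OF vT, of t] by (simp add: mobius_mult B(2)[symmetric])
      then have "A0 ** A \<in> Zpm" using wall_stabilizer[OF B(1) Gam_mult[OF A0(1) q(2)]] by blast
      then have "adj2 A0 ** (A0 ** A) \<in> {adj2 A0, - adj2 A0}" by (auto simp: uminus_mult_2)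
      then have "A \<in> {adj2 A0, - adj2 A0}" using adj2_mult(1)[OF Gam_det[OF A0(1)]] by (simp add: matrix_mul_assoc)
      then show "(j, A) \<in> {(i, adj2 A0), (i, - adj2 A0)}" using ji by auto
    next
      assume "(j, A) \<in> {(i, adj2 A0), (i, - adj2 A0)}"
      then show "(j, A) \<in> P t" using A0 base Gam_adj2[OF A0(1)] Gam_uminus by (auto simp: P_def)
    qed
    then have "P t = {(i, adj2 A0), (i, - adj2 A0)}" by auto
    then show ?thesis using Gam_ne_uminus[OF Gam_adj2[OF A0(1)]] by simp
  qed
  have disjP: "P s \<inter> P t = {}" if "s \<noteq> t" for s t
  proof (rule ccontr)
    assume "P s \<inter> P t \<noteq> {}"
    then obtain i A where iA: "i < n" "A \<in> Gam" "mobius A (pt v s) \<in> range (gline (Cm i))" "mobius A (pt v t) \<in> range (gline (Cm i))"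
      by (auto simp: P_def)
    have L: "pt v q \<in> range (gline (adj2 A ** Cm i))" if "mobius A (pt v q) \<in> range (gline (Cm i))" for q
    proof -
      obtain r where "mobius A (pt v q) = gline (Cm i) r" using \<open>mobius A (pt v q) \<in> range (gline (Cm i))\<close> by blast
      then have "pt v q = mobius (adj2 A) (gline (Cm i) r)" using iA(2) pt_in_H[OF vT] by (metis Gam_det mobius_adj2(1))
      also have "\<dots> = gline (adj2 A ** Cm i) r" using iA Cm(1) by (simp add: gline_mult)
      finally show ?thesis by blast
    qed
    have "range (gline (adj2 A ** Cm i)) \<in> walllines" unfolding walllines_def lifts_def using iA Gam_adj2 by blast
    then have "s = t" using good_line_once[OF v] L iA by blast
    then show False using that by simp
  qed
  define S where "S = (\<Union>t\<in>?Z. P t)"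
  have S: "finite S" "card S = 2 * card ?Z"
  proof -
    show "finite S" unfolding S_def using Z P2 by auto
    have "card S = (\<Sum>t\<in>?Z. card (P t))" unfolding S_def using Z P2 disjP by (intro card_UN_disjoint) auto
    then show "card S = 2 * card ?Z" using P2 by simp
  qed
  have "crossings2 v = (\<integral>\<^sup>+A. (\<Sum>i<n. indicator S (i, A)) \<partial>count_space Gam)"
    unfolding crossings2_def using mem by (intro nn_integral_cong sum.cong) (auto simp: indicator_def S_def)
  also have "\<dots> = (\<Sum>i<n. \<integral>\<^sup>+A. indicator S (i, A) \<partial>count_space Gam)"
    by (rule nn_integral_sum) simp
  also have "\<dots> = (\<Sum>i<n. of_nat (card {A. (i, A) \<in> S}))"
  proof (rule sum.cong[OF refl])
    fix i assume "i \<in> {..<n}"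
    have sub: "{A. (i, A) \<in> S} \<subseteq> Gam" by (auto simp: S_def P_def)
    have fin: "finite {A. (i, A) \<in> S}"
      by (rule finite_subset[OF _ finite_imageI[OF S(1), of snd]]) force
    have "(\<integral>\<^sup>+A. indicator S (i, A) \<partial>count_space Gam) = (\<integral>\<^sup>+A. indicator {A. (i, A) \<in> S} A \<partial>count_space Gam)"
      by (intro nn_integral_cong) (auto simp: indicator_def)
    also have "\<dots> = emeasure (count_space Gam) {A. (i, A) \<in> S}" using sub by (intro nn_integral_indicator) auto
    also have "\<dots> = of_nat (card {A. (i, A) \<in> S})" using sub fin by (rule emeasure_count_space_finite)
    finally show "(\<integral>\<^sup>+A. indicator S (i, A) \<partial>count_space Gam) = of_nat (card {A. (i, A) \<in> S})" .
  qed
  also have "\<dots> = of_nat (\<Sum>i<n. card {A. (i, A) \<in> S})" by simp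
  also have "(\<Sum>i<n. card {A. (i, A) \<in> S}) = card S"
  proof -
    have "S = Sigma {..<n} (\<lambda>i. {A. (i, A) \<in> S})" by (auto simp: S_def P_def)
    moreover have "finite {A. (i, A) \<in> S}" for i
      by (rule finite_subset[OF _ finite_imageI[OF S(1), of snd]]) force
    ultimately show ?thesis by (metis (no_types, lifting) card_SigmaI finite_lessThan sum.cong)
  qed
  finally show ?thesis by (simp add: S(2))
qed

lemma measurable_flux_sum: "(\<lambda>v. \<Sum>i<n. indicator (flux i) v :: ennreal) \<in> borel_measurable lam"
  using flux_lam by (intro borel_measurable_sum borel_measurable_indicator) auto

lemma crossings2_nu: "crossings2 \<in> borel_measurable nu"
proof (rule measurable_nuI)
  show "crossings2 \<in> borel_measurable lam"
    unfolding crossings2_def[abs_def]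
    by (rule measurable_nn_integral_count_space[OF countable_Gam])
       (use measurable_compose[OF measurable_mobius_T1 measurable_flux_sum] in simp)
  fix C v assume C: "C \<in> Gam" "v \<in> T1H"
  have "bij_betw (\<lambda>A. A ** C) Gam Gam"
  proof (rule bij_betw_byWitness[of _ "\<lambda>A. A ** adj2 C"])
    show "\<forall>A\<in>Gam. A ** C ** adj2 C = A" "\<forall>A\<in>Gam. A ** adj2 C ** C = A"
      using adj2_mult[OF Gam_det[OF C(1)]] by (simp_all flip: matrix_mul_assoc)
  qed (use C Gam_mult Gam_adj2 in auto)
  from nn_integral_bij_count_space[OF this, of "\<lambda>A. \<Sum>i<n. indicator (flux i) (mobius_T1 A v)"]
  have "(\<integral>\<^sup>+A. (\<Sum>i<n. indicator (flux i) (mobius_T1 (A ** C) v)) \<partial>count_space Gam) = crossings2 v"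
    by (simp add: crossings2_def)
  moreover have "(\<integral>\<^sup>+A. (\<Sum>i<n. indicator (flux i) (mobius_T1 (A ** C) v)) \<partial>count_space Gam) = crossings2 (mobius_T1 C v)"
    unfolding crossings2_def using C by (intro nn_integral_cong sum.cong) (simp_all add: mobius_T1_mult)
  ultimately show "crossings2 (mobius_T1 C v) = crossings2 v" by simp
qed

text \<open>The 8 is the factor 2 of unfolding times the flux 4 per unit length.\<close>

lemma integral_crossings2: "(\<integral>\<^sup>+v. crossings2 v \<partial>nu) = ennreal (8 * (\<Sum>i<n. l i))"
proof -
  have "(\<integral>\<^sup>+v. crossings2 v \<partial>nu) = 2 * (\<integral>\<^sup>+v. (\<Sum>i<n. indicator (flux i) v) \<partial>lam)"
    unfolding nn_integral_nu[OF crossings2_nu] unfolding crossings2_def by (rule unfolding_lam[OF measurable_flux_sum])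
  also have "(\<integral>\<^sup>+v. (\<Sum>i<n. indicator (flux i) v) \<partial>lam) = (\<Sum>i<n. emeasure lam (flux i))"
    using flux_lam by (subst nn_integral_sum) auto
  also have "\<dots> = (\<Sum>i<n. ennreal (4 * l i))"
    using Cm(1) l_pos emeasure_flux_set by (intro sum.cong) auto
  also have "\<dots> = ennreal (\<Sum>i<n. 4 * l i)" using l_pos by (intro sum_ennreal) (auto intro: less_imp_le)
  also have "2 * ennreal (\<Sum>i<n. 4 * l i) = ennreal 2 * ennreal (\<Sum>i<n. 4 * l i)" by simp
  also have "\<dots> = ennreal (2 * (\<Sum>i<n. 4 * l i))"
    using l_pos by (intro ennreal_mult[symmetric] sum_nonneg) (auto intro: less_imp_le)
  also have "2 * (\<Sum>i<n. 4 * l i) = 8 * (\<Sum>i<n. l i)" by (simp add: sum_distrib_left[symmetric])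
  finally show ?thesis .
qed

definition crossings :: "complex \<times> complex \<Rightarrow> real" where
  "crossings v = enn2real (crossings2 v) / 2"

lemma crossings_good: "v \<in> good \<Longrightarrow> crossings v = real (card (cross v {0..<1}))"
  by (simp only: crossings_def crossings2_good ennreal_of_nat_eq_real_of_nat enn2real_ennreal of_nat_0_le_iff of_nat_mult of_nat_numeral nonzero_mult_div_cancel_left zero_neq_numeral not_False_eq_True)

lemma integrable_crossings: "integrable nu crossings"
  and integral_crossings: "(\<integral>v. crossings v \<partial>nu) = 4 * (\<Sum>i<n. l i)"
proof -
  have m: "(\<lambda>v. enn2real (crossings2 v)) \<in> borel_measurable nu" using crossings2_nu by measurable
  have fin: "(\<integral>\<^sup>+v. crossings2 v \<partial>nu) \<noteq> \<infinity>" using integral_crossings2 by simp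
  have "AE v in nu. crossings2 v \<noteq> \<infinity>" by (rule nn_integral_PInf_AE[OF crossings2_nu fin])
  then have "(\<integral>\<^sup>+v. ennreal (enn2real (crossings2 v)) \<partial>nu) = (\<integral>\<^sup>+v. crossings2 v \<partial>nu)"
    by (intro nn_integral_cong_AE) (auto elim!: eventually_mono simp: less_top)
  also have "\<dots> = ennreal (8 * (\<Sum>i<n. l i))" by (rule integral_crossings2)
  finally have e: "(\<integral>\<^sup>+v. ennreal (enn2real (crossings2 v)) \<partial>nu) = ennreal (8 * (\<Sum>i<n. l i))" .
  have "(\<Sum>i<n. l i) \<ge> 0" using l_pos by (intro sum_nonneg) (auto intro: less_imp_le)
  then have "has_bochner_integral nu (\<lambda>v. enn2real (crossings2 v)) (8 * (\<Sum>i<n. l i))"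
    using m e by (intro has_bochner_integral_nn_integral) auto
  then have "has_bochner_integral nu (\<lambda>v. enn2real (crossings2 v) / 2) (8 * (\<Sum>i<n. l i) / 2)"
    by (intro has_bochner_integral_divide) auto
  then show "integrable nu crossings" "(\<integral>v. crossings v \<partial>nu) = 4 * (\<Sum>i<n. l i)"
    unfolding crossings_def[abs_def] by (auto simp: has_bochner_integral_iff)
qed

lemma gflow_funpow: "v \<in> T1H \<Longrightarrow> (gflow t ^^ k) v = gflow (real k * t) v"
proof (induction k)
  case (Suc k)
  then show ?case by (simp add: gflow_add algebra_simps)
qed simp

lemma cross_shift: "v \<in> T1H \<Longrightarrow> card (cross (gflow s v) {a..<b}) = card (cross v {a + s..<b + s})"
proof -
  assume v: "v \<in> T1H"
  have "cross v {a + s..<b + s} = (\<lambda>t. t + s) ` cross (gflow s v) {a..<b}"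
  proof (intro equalityI subsetI)
    fix t assume "t \<in> cross v {a + s..<b + s}"
    then show "t \<in> (\<lambda>t. t + s) ` cross (gflow s v) {a..<b}"
      by (intro image_eqI[of _ _ "t - s"]) (auto simp: cross_def pt_gflow[OF v])
  qed (auto simp: cross_def pt_gflow[OF v])
  then show ?thesis by (simp add: card_image)
qed

lemma cross_split:
  assumes "v \<in> good" "a \<le> b" "b \<le> c"
  shows "card (cross v {a..<c}) = card (cross v {a..<b}) + card (cross v {b..<c})"
proof -
  have "cross v {a..<c} = cross v {a..<b} \<union> cross v {b..<c}" using assms by (auto simp: cross_def)
  moreover have "cross v {a..<b} \<inter> cross v {b..<c} = {}" by (auto simp: cross_def)
  moreover have "finite (cross v {a..<b})" "finite (cross v {b..<c})"
    by (rule finite_cross[OF assms(1), of _ a b], auto, rule finite_cross[OF assms(1), of _ b c], auto)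
  ultimately show ?thesis by (simp add: card_Un_disjoint)
qed

lemma birkhoff_crossings:
  assumes v: "v \<in> good"
  shows "(\<Sum>k<N. crossings ((gflow 1 ^^ k) v)) = real (card (cross v {0..<real N}))"
proof (induction N)
  case (Suc N)
  have "crossings ((gflow 1 ^^ N) v) = real (card (cross (gflow (real N) v) {0..<1}))"
    using v good_T1H[OF v] good_gflow by (simp add: gflow_funpow crossings_good)
  also have "\<dots> = real (card (cross v {real N..<real (Suc N)}))"
    using cross_shift[OF good_T1H[OF v], of "real N" 0 1] by (simp add: add.commute)
  finally show ?case using Suc cross_split[OF v, of 0 "real N" "real (Suc N)"] by simp
qed (simp add: cross_def)

text \<open>The term \<open>k\<close> counts the crossings in the unit interval that ends at
  \<open>- k\<close>, so the backward sums share no crossing with the forward ones.\<close>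

lemma birkhoff_crossings_backward:
  assumes v: "v \<in> good"
  shows "(\<Sum>k<N. crossings ((gflow (- 1) ^^ Suc k) v)) = real (card (cross v {- real N..<0}))"
proof (induction N)
  case (Suc N)
  have "crossings ((gflow (- 1) ^^ Suc N) v) = real (card (cross (gflow (- real (Suc N)) v) {0..<1}))"
    using v good_T1H[OF v] good_gflow by (simp add: gflow_funpow crossings_good del: funpow.simps)
  also have "\<dots> = real (card (cross v {- real (Suc N)..<- real N}))"
    using cross_shift[OF good_T1H[OF v], of "- real (Suc N)" 0 1] by simp
  finally show ?case using Suc cross_split[OF v, of "- real (Suc N)" "- real N" 0] by (simp del: funpow.simps)
qed (simp add: cross_def)

text \<open>Reversal turns the interval closed on the left into one closed on the right, so a
  crossing at one of the two ends may be gained or lost.\<close>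

lemma cross_flip:
  assumes v: "v \<in> good"
  shows "\<bar>real (card (cross v {- real N..<0})) - real (card (cross (flip v) {0..<real N}))\<bar> \<le> 1"
proof -
  have fin: "finite (cross v {- real N..0})" by (rule finite_cross_Icc[OF v])
  have "cross (flip v) {0..<real N} = uminus ` cross v {- real N<..0}"
  proof (intro equalityI subsetI)
    fix t assume "t \<in> cross (flip v) {0..<real N}"
    then show "t \<in> uminus ` cross v {- real N<..0}"
      by (intro image_eqI[of _ _ "- t"]) (auto simp: cross_def gflow_flip)
  qed (auto simp: cross_def gflow_flip)
  then have c: "card (cross (flip v) {0..<real N}) = card (cross v {- real N<..0})" by (simp add: card_image)
  have le: "card X \<le> Suc (card Y)" if "X \<subseteq> insert a Y" "finite Y" for X Y :: "real set" and a
  proof -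
    have "card X \<le> card (insert a Y)" using that by (intro card_mono) auto
    also have "\<dots> \<le> Suc (card Y)" using that(2) by (simp add: card_insert_if)
    finally show ?thesis .
  qed
  have 1: "card (cross v {- real N..<0}) \<le> Suc (card (cross v {- real N<..0}))"
    by (rule le[of _ "- real N"], force simp: cross_def, rule finite_subset[OF _ fin], force simp: cross_def)
  have 2: "card (cross v {- real N<..0}) \<le> Suc (card (cross v {- real N..<0}))"
    by (rule le[of _ 0], force simp: cross_def, rule finite_subset[OF _ fin], force simp: cross_def)
  show ?thesis using 1 2 unfolding c by linarith
qed

section \<open>The crossing rate depends only on the endpoint\<close>

text \<open>The endpoints of the line of \<open>B\<close> are the images of infinity and 0,
  \<open>a / c\<close> and \<open>b / d\<close>; the products express that \<open>y\<close> differs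
  from both even if one is infinite.\<close>

definition good_end :: "real \<Rightarrow> bool" where
  "good_end y \<longleftrightarrow> (\<forall>B\<in>lifts. B$2$1 * y - B$1$1 \<noteq> 0 \<and> B$2$2 * y - B$1$2 \<noteq> 0)"

lemma countable_bad_ends: "countable {y. \<not> good_end y}"
proof -
  have "{y. \<not> good_end y} \<subseteq> (\<Union>B\<in>lifts. {B$1$1 / B$2$1, B$1$2 / B$2$2})"
  proof
    fix y assume "y \<in> {y. \<not> good_end y}"
    then obtain B where B: "B \<in> lifts" "B$2$1 * y - B$1$1 = 0 \<or> B$2$2 * y - B$1$2 = 0" by (auto simp: good_end_def)
    have d: "B$1$1 * B$2$2 - B$1$2 * B$2$1 = 1" using lifts_det[OF B(1)] by (simp add: det_2)
    from B(2) have "y = B$1$1 / B$2$1 \<or> y = B$1$2 / B$2$2"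
    proof
      assume "B$2$1 * y - B$1$1 = 0"
      moreover from this have "B$2$1 \<noteq> 0" using d by auto
      ultimately show ?thesis by (simp add: field_simps)
    next
      assume "B$2$2 * y - B$1$2 = 0"
      moreover from this have "B$2$2 \<noteq> 0" using d by auto
      ultimately show ?thesis by (simp add: field_simps)
    qed
    then show "y \<in> (\<Union>B\<in>lifts. {B$1$1 / B$2$1, B$1$2 / B$2$2})" using B(1) by blast
  qed
  moreover have "countable (\<Union>B\<in>lifts. {B$1$1 / B$2$1, B$1$2 / B$2$2})" using countable_lifts by auto
  ultimately show ?thesis by (rule countable_subset)
qed

lemma AE_good_end: "AE y in lborel. good_end y"
proof -
  have "{y. \<not> good_end y} \<in> null_sets lborel" by (rule countable_imp_null_set_lborel[OF countable_bad_ends])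
  then have "AE y in lborel. y \<notin> {y. \<not> good_end y}" by (rule AE_not_in)
  then show ?thesis by simp
qed

text \<open>A geodesic inside a lift of \<open>\<Gamma>\<close> ends at one of the two endpoints of the lift.\<close>

lemma good_psi:
  assumes y: "good_end y" shows "psi y x s \<in> good"
proof (rule ccontr)
  assume "psi y x s \<notin> good"
  then obtain B where B: "B \<in> lifts" "\<And>t. gside B (pt (psi y x s) t) = 0" by (auto simp: good_def)
  define a b c d where "a = B$1$1" and "b = B$1$2" and "c = B$2$1" and "d = B$2$2"
  \<comment> \<open>\<open>F X Y = 0\<close> is the equation of the line of \<open>B\<close>, with
    the denominator cleared. Along the geodesic the point tends to the real number \<open>y\<close>,
    so the equation passes to the limit \<open>F y 0 = 0\<close>.\<close>
  define F where "F X Y = (d * X - b) * (- c * X + a) - d * c * Y\<^sup>2" for X Y :: real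
  have "F (y - x / (x\<^sup>2 + exp (2 * (s + t)))) (exp (s + t) / (x\<^sup>2 + exp (2 * (s + t)))) = 0" for t
  proof -
    define z where "z = pt (psi y x s) t"
    have zH: "z \<in> \<H>" unfolding z_def by (intro pt_in_H) simp
    have e: "mden (adj2 B) z \<noteq> 0" using mden_nonzero[of "adj2 B" z] B zH by simp
    have "Re (mobius (adj2 B) z) = 0" using B(2)[of t] by (simp add: gside_def z_def)
    moreover have "mobius (adj2 B) z = ((of_real d * z - of_real b) * cnj (of_real (- c) * z + of_real a)) / of_real ((cmod (mden (adj2 B) z))\<^sup>2)"
      using complex_div_cnj[of "of_real d * z - of_real b" "mden (adj2 B) z"]
      by (simp add: mobius_eq mden_def adj2_def a_def b_def c_def d_def)
    ultimately have "Re ((of_real d * z - of_real b) * cnj (of_real (- c) * z + of_real a)) = 0"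
      using e by (simp only: Re_divide_of_real) (simp del: complex_cnj_add complex_cnj_mult)
    then have "F (Re z) (Im z) = 0" by (simp add: F_def power2_eq_square algebra_simps)
    then show ?thesis by (simp add: z_def gflow_psi) (simp add: psi_def)
  qed
  moreover have "((\<lambda>t. F (y - x / (x\<^sup>2 + exp (2 * (s + t)))) (exp (s + t) / (x\<^sup>2 + exp (2 * (s + t))))) \<longlongrightarrow> F (y - 0) 0) at_top"
    unfolding F_def
    by (intro tendsto_intros) (real_asymp)+
  ultimately have "F y 0 = 0" using tendsto_unique[OF trivial_limit_at_top_linorder tendsto_const, of 0 "F (y - 0) 0"] by simp
  then have "(d * y - b) * (- c * y + a) = 0" by (simp add: F_def)
  moreover have "c * y - a \<noteq> 0" "d * y - b \<noteq> 0" using y B(1) by (auto simp: good_end_def a_def b_def c_def d_def)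
  ultimately show False by auto
qed

text \<open>The ends of the first geodesic lie on different sides of \<open>L\<close> or on it,
  while those of the second, which does not meet \<open>L\<close> before time \<open>N\<close>, lie
  weakly on one side. Hence the product of the signs over the four corners is not positive, and one
  of the joining segments meets \<open>L\<close>.\<close>

lemma lines_hit_compare:
  assumes v: "v \<in> good" and w: "w \<in> good" and N: "N \<ge> 0"
  shows "lines_hit v {0..<N} - lines_hit w {0..<N}
    \<subseteq> {L \<in> walllines. L \<inter> closed_segment (pt v 0) (pt w 0) \<noteq> {}} \<union> {L \<in> walllines. L \<inter> closed_segment (pt v N) (pt w N) \<noteq> {}}"
proof
  fix L assume L: "L \<in> lines_hit v {0..<N} - lines_hit w {0..<N}"
  then obtain t0 where t0: "L \<in> walllines" "t0 \<in> {0..<N}" "pt v t0 \<in> L" by (auto simp: lines_hit_def)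
  obtain B where B: "B \<in> lifts" "L = range (gline B)" using t0(1) by (auto simp: walllines_def)
  have dB: "det B = 1" using B by simp
  note vT = good_T1H[OF v] and wT = good_T1H[OF w]
  obtain k and D :: "real \<Rightarrow> real" where kD: "k \<noteq> 0" "\<And>t. D t > 0" "\<And>t. gside B (pt v t) = k * sinh (t - t0) / D t"
    using good_crossing[OF v B(1), of t0] t0(3) B(2) by metis
  have "gside B (pt v 0) * gside B (pt v N) = k\<^sup>2 * (sinh (- t0) * sinh (N - t0)) / (D 0 * D N)"
    unfolding kD(3) by (simp add: power2_eq_square)
  moreover have "sinh (- t0) * sinh (N - t0) \<le> 0" using t0(2) by (simp add: mult_le_0_iff)
  ultimately have hv: "gside B (pt v 0) * gside B (pt v N) \<le> 0"
    using kD(2)[of 0] kD(2)[of N] by (simp add: divide_le_0_iff mult_le_0_iff)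
  have nz: "gside B (pt w t) \<noteq> 0" if "t \<in> {0..<N}" for t
  proof
    assume "gside B (pt w t) = 0"
    then have "pt w t \<in> L" using gside_zero_iff[OF dB pt_in_H[OF wT]] B(2) by simp
    then show False using L that t0(1) by (auto simp: lines_hit_def)
  qed
  have cw: "continuous_on {0..N} (\<lambda>t. gside B (pt w t))"
    by (rule continuous_on_compose2[OF continuous_on_gside[OF dB] continuous_pt[OF wT]]) (use pt_in_H[OF wT] in auto)
  have hw: "gside B (pt w 0) * gside B (pt w N) \<ge> 0"
  proof (rule ccontr)
    assume neg: "\<not> gside B (pt w 0) * gside B (pt w N) \<ge> 0"
    then obtain t where "t \<in> {0..N}" "gside B (pt w t) = 0"
      using connected_sign_change[OF connected_Icc cw, of 0 N] N by auto
    moreover have "t \<noteq> N" using neg \<open>gside B (pt w t) = 0\<close> by auto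
    ultimately show False using nz[of t] by auto
  qed
  have seg: "L \<inter> closed_segment (pt v t) (pt w t) \<noteq> {}" if le: "gside B (pt v t) * gside B (pt w t) \<le> 0" for t
  proof -
    have H: "closed_segment (pt v t) (pt w t) \<subseteq> \<H>" using hdelta_segment(1) pt_in_H vT wT by blast
    obtain z where "z \<in> closed_segment (pt v t) (pt w t)" "gside B z = 0"
      using connected_sign_change[OF connected_segment(1) continuous_on_subset[OF continuous_on_gside[OF dB] H], of "pt v t" "pt w t"] le
      by auto
    then show ?thesis using gside_zero_iff[OF dB] H B(2) by blast
  qed
  have "gside B (pt v 0) * gside B (pt w 0) \<le> 0 \<or> gside B (pt v N) * gside B (pt w N) \<le> 0"
  proof (rule ccontr)
    assume "\<not> ?thesis"
    then have "0 < (gside B (pt v 0) * gside B (pt w 0)) * (gside B (pt v N) * gside B (pt w N))" by simp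
    also have "\<dots> = (gside B (pt v 0) * gside B (pt v N)) * (gside B (pt w 0) * gside B (pt w N))" by simp
    also have "\<dots> \<le> 0" using hv hw by (rule mult_nonpos_nonneg)
    finally show False by simp
  qed
  then show "L \<in> {L \<in> walllines. L \<inter> closed_segment (pt v 0) (pt w 0) \<noteq> {}} \<union> {L \<in> walllines. L \<inter> closed_segment (pt v N) (pt w N) \<noteq> {}}"
    using seg t0(1) by blast
qed

text \<open>By \<open>hdelta_psi_flow\<close> both joining segments stay as short as the first one
  for every \<open>N\<close>, so \<open>uniform_walllines\<close> bounds the lines hit by just one
  geodesic by twice the same \<open>K\<close>.\<close>

lemma cross_compare:
  assumes y: "good_end y"
  shows "\<exists>K. \<forall>N::nat. \<bar>real (card (cross (psi y x s) {0..<real N})) - real (card (cross (psi y x' s') {0..<real N}))\<bar> \<le> K"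
proof -
  define R where "R = hdelta (fst (psi y x s)) (fst (psi y x' s'))"
  have sym: "hdelta z w = hdelta w z" for z w by (simp add: hdelta_def norm_minus_commute mult.commute)
  obtain K where K: "\<And>p q. p \<in> \<H> \<Longrightarrow> q \<in> \<H> \<Longrightarrow> hdelta p q \<le> R \<Longrightarrow>
    finite {L \<in> walllines. L \<inter> closed_segment p q \<noteq> {}} \<and> card {L \<in> walllines. L \<inter> closed_segment p q \<noteq> {}} \<le> K"
    using uniform_walllines[of R] by blast
  have aux: "card (cross v {0..<real N}) \<le> card (cross w {0..<real N}) + 2 * K"
    if v: "v \<in> good" and w: "w \<in> good" and d: "\<And>t. t \<ge> 0 \<Longrightarrow> hdelta (pt v t) (pt w t) \<le> R" for v w and N :: nat
  proof -
    let ?S = "\<lambda>t. {L \<in> walllines. L \<inter> closed_segment (pt v t) (pt w t) \<noteq> {}}"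
    have S: "finite (?S t) \<and> card (?S t) \<le> K" if "t \<ge> 0" for t
      using K[OF pt_in_H[OF good_T1H[OF v]] pt_in_H[OF good_T1H[OF w]] d[OF that]] .
    have "finite (cross w {0..<real N})" by (rule finite_cross[OF w, of _ 0 "real N"]) auto
    then have finw: "finite (lines_hit w {0..<real N})" using cross_lines_hit(2)[OF w] by blast
    have "lines_hit v {0..<real N} \<subseteq> lines_hit w {0..<real N} \<union> (?S 0 \<union> ?S (real N))"
      using lines_hit_compare[OF v w, of "real N"] by auto
    then have "card (lines_hit v {0..<real N}) \<le> card (lines_hit w {0..<real N} \<union> (?S 0 \<union> ?S (real N)))"
      using finw S[of 0] S[of "real N"] by (intro card_mono) auto
    also have "\<dots> \<le> card (lines_hit w {0..<real N}) + card (?S 0 \<union> ?S (real N))" by (rule card_Un_le)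
    also have "card (?S 0 \<union> ?S (real N)) \<le> card (?S 0) + card (?S (real N))" by (rule card_Un_le)
    also have "card (?S 0) + card (?S (real N)) \<le> K + K" using S[of 0] S[of "real N"] by (intro add_mono) auto
    finally show ?thesis unfolding cross_lines_hit(1)[OF v] cross_lines_hit(1)[OF w] by simp
  qed
  note g = good_psi[OF y, of x s] good_psi[OF y, of x' s']
  have "card (cross (psi y x s) {0..<real N}) \<le> card (cross (psi y x' s') {0..<real N}) + 2 * K" for N
    by (rule aux[OF g]) (use hdelta_psi_flow[of _ y x s x' s'] in \<open>simp add: R_def\<close>)
  moreover have "card (cross (psi y x' s') {0..<real N}) \<le> card (cross (psi y x s) {0..<real N}) + 2 * K" for N
    by (rule aux[OF g(2,1)]) (use hdelta_psi_flow[of _ y x s x' s'] sym in \<open>simp add: R_def\<close>)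
  moreover have "\<bar>real i - real j\<bar> \<le> real (2 * K)" if "i \<le> j + 2 * K" "j \<le> i + 2 * K" for i j using that by linarith
  ultimately have "\<bar>real (card (cross (psi y x s) {0..<real N})) - real (card (cross (psi y x' s') {0..<real N}))\<bar> \<le> real (2 * K)" for N
    by metis
  then show ?thesis by blast
qed

end

section \<open>Limits of rates and exceptional endpoints\<close>

lemma AE_const_lborel: "(AE x in (lborel :: real measure). P) \<longleftrightarrow> P"
  by (auto simp: eventually_const_iff ae_filter_eq_bot_iff)

text \<open>The lower limit is at most the upper one; passing from \<open>a\<close> to
  \<open>a'\<close> provides the strict inequality.\<close>

lemma freq_above_of_not_below:
  assumes "\<not> freq_above (\<lambda>n. - s n) (- a)" "a' < a"
  shows "freq_above s a'"
proof (rule freq_aboveI[of a' "(a + a') / 2"])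
  have "\<forall>\<^sub>F n in sequentially. - s n < - ((a + a') / 2) * real n"
    using assms by (intro not_freq_above) auto
  then obtain N where N: "\<And>n. n \<ge> N \<Longrightarrow> - s n < - ((a + a') / 2) * real n" by (auto simp: eventually_sequentially)
  fix m
  have "s (max m N) \<ge> (a + a') / 2 * real (max m N)" using N[of "max m N"] by simp
  then show "\<exists>n\<ge>m. s n \<ge> (a + a') / 2 * real n" by (intro exI[of _ "max m N"]) auto
qed (use assms in simp)

lemma tendsto_rate:
  assumes up: "\<And>k::nat. \<not> freq_above s (c + 1 / Suc k)" and lo: "\<And>k::nat. \<not> freq_above (\<lambda>n. - s n) (- (c - 1 / Suc k))"
  shows "(\<lambda>n. s n / real n) \<longlonglongrightarrow> c"
proof (rule tendstoI)
  fix e :: real assume e: "e > 0"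
  obtain k where k: "1 / real (Suc k) < e / 2" using nat_approx_posE[of "e / 2"] e by auto
  have "\<forall>\<^sub>F n in sequentially. s n < (c + e / 2) * real n"
    by (rule not_freq_above[OF up[of k]]) (use k in linarith)
  moreover have "\<forall>\<^sub>F n in sequentially. - s n < (- (c - e / 2)) * real n"
    by (rule not_freq_above[OF lo[of k]]) (use k in linarith)
  ultimately show "\<forall>\<^sub>F n in sequentially. dist (s n / real n) c < e"
    using eventually_gt_at_top[of 0]
  proof eventually_elim
    case (elim n)
    then have n: "real n > 0" by simp
    have "s n / real n < c + e / 2" using elim(1) n by (simp add: pos_divide_less_eq)
    moreover have "s n / real n > c - e / 2" using elim(2) n by (simp only: pos_less_divide_eq minus_mult_left)
    ultimately show ?case using e unfolding dist_real_def by linarith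
  qed
qed

text \<open>For fixed \<open>y\<close> the coordinate \<open>x\<close> and the backward endpoint are
  related by a diffeomorphism off single points, under which null sets correspond.\<close>

lemma AE_backward_endpoint:
  fixes y :: real
  assumes [measurable]: "Measurable.pred borel Q" and ae: "AE x in lborel. \<not> Q (y - 1 / x)"
  shows "AE w in lborel. \<not> Q w"
proof -
  let ?I = "\<lambda>w. indicator {w. Q w} w :: ennreal"
  have Qs: "{w. Q w} \<in> sets borel" using assms(1) by (simp add: pred_def)
  have [measurable]: "?I \<in> borel_measurable borel" using Qs by simp
  have "(\<integral>\<^sup>+w. ?I w * indicator (UNIV - {y}) w \<partial>lborel)
    = (\<integral>\<^sup>+x. ?I (y - 1 / x) * ennreal \<bar>1 / x\<^sup>2\<bar> * indicator (UNIV - {0}) x \<partial>lborel)"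
  proof (rule nn_integral_substitution_inj[symmetric])
    show "(\<lambda>x. y - 1 / x) ` (UNIV - {0}) = UNIV - {y}"
    proof (intro equalityI subsetI)
      fix w assume "w \<in> UNIV - {y}"
      then show "w \<in> (\<lambda>x. y - 1 / x) ` (UNIV - {0})" by (intro image_eqI[of _ _ "1 / (y - w)"]) auto
    qed auto
    show "((\<lambda>x. y - 1 / x) has_field_derivative 1 / x\<^sup>2) (at x)" if "x \<in> UNIV - {0}" for x
      using that by (auto intro!: derivative_eq_intros simp: power2_eq_square)
    show "inj_on (\<lambda>x. y - 1 / x) (UNIV - {0})" by (auto simp: inj_on_def)
  qed measurable
  also have "\<dots> = (\<integral>\<^sup>+x. 0 \<partial>(lborel :: real measure))"
    using ae by (intro nn_integral_cong_AE) (auto elim!: eventually_mono)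
  finally have "(\<integral>\<^sup>+w. ?I w * indicator (UNIV - {y}) w \<partial>lborel) = 0" by simp
  then have "AE w in lborel. ?I w * indicator (UNIV - {y}) w = 0"
    by (subst (asm) nn_integral_0_iff_AE) auto
  then show ?thesis using AE_lborel_singleton[of y]
    by eventually_elim (auto simp: indicator_def split: if_splits)
qed

text \<open>Between consecutive integers a monotone function is enclosed by its values there, and
  \<open>r\<close> is asymptotic to both integers.\<close>

lemma tendsto_mono_real:
  fixes g :: "real \<Rightarrow> real"
  assumes mono: "\<And>x y. 0 \<le> x \<Longrightarrow> x \<le> y \<Longrightarrow> g x \<le> g y" and lim: "(\<lambda>N::nat. g (real N) / real N) \<longlonglongrightarrow> c"
  shows "((\<lambda>r. g r / r) \<longlongrightarrow> c) at_top"
proof -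
  have fl: "filterlim (\<lambda>r::real. nat \<lfloor>r\<rfloor>) sequentially at_top"
    unfolding filterlim_at_top
  proof
    fix K :: nat
    show "\<forall>\<^sub>F r::real in at_top. K \<le> nat \<lfloor>r\<rfloor>"
      using eventually_ge_at_top[of "real K"] by eventually_elim (simp add: le_nat_iff le_floor_iff)
  qed
  have fl': "filterlim (\<lambda>r::real. Suc (nat \<lfloor>r\<rfloor>)) sequentially at_top"
    using filterlim_compose[OF filterlim_Suc fl] by simp
  have 1: "((\<lambda>r::real. real_of_int \<lfloor>r\<rfloor> / r) \<longlongrightarrow> 1) at_top" by real_asymp
  have 2: "((\<lambda>r::real. (real_of_int \<lfloor>r\<rfloor> + 1) / r) \<longlongrightarrow> 1) at_top" by real_asymp
  have lo: "((\<lambda>r. g (real (nat \<lfloor>r\<rfloor>)) / real (nat \<lfloor>r\<rfloor>) * (real_of_int \<lfloor>r\<rfloor> / r)) \<longlongrightarrow> c * 1) at_top"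
    by (intro tendsto_mult filterlim_compose[OF lim fl] 1)
  have hi: "((\<lambda>r. g (real (Suc (nat \<lfloor>r\<rfloor>))) / real (Suc (nat \<lfloor>r\<rfloor>)) * ((real_of_int \<lfloor>r\<rfloor> + 1) / r)) \<longlongrightarrow> c * 1) at_top"
    by (intro tendsto_mult filterlim_compose[OF lim fl'] 2)
  show ?thesis
  proof (rule tendsto_sandwich)
    show "\<forall>\<^sub>F r in at_top. g (real (nat \<lfloor>r\<rfloor>)) / real (nat \<lfloor>r\<rfloor>) * (real_of_int \<lfloor>r\<rfloor> / r) \<le> g r / r"
      using eventually_ge_at_top[of 1]
    proof eventually_elim
      case (elim r)
      then have f: "1 \<le> \<lfloor>r\<rfloor>" by (simp only: le_floor_iff of_int_1)
      then have p: "real (nat \<lfloor>r\<rfloor>) = of_int \<lfloor>r\<rfloor>" "of_int \<lfloor>r\<rfloor> \<noteq> (0::real)" "(of_int \<lfloor>r\<rfloor> :: real) \<le> r" "0 \<le> (of_int \<lfloor>r\<rfloor> :: real)"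
        by linarith+
      have "g (of_int \<lfloor>r\<rfloor>) / r \<le> g r / r" using mono[OF p(4,3)] elim by (intro divide_right_mono) auto
      then show ?case unfolding p(1) using p(2) by simp
    qed
    show "\<forall>\<^sub>F r in at_top. g r / r \<le> g (real (Suc (nat \<lfloor>r\<rfloor>))) / real (Suc (nat \<lfloor>r\<rfloor>)) * ((real_of_int \<lfloor>r\<rfloor> + 1) / r)"
      using eventually_ge_at_top[of 1]
    proof eventually_elim
      case (elim r)
      then have f: "1 \<le> \<lfloor>r\<rfloor>" by (simp only: le_floor_iff of_int_1)
      then have p: "real (Suc (nat \<lfloor>r\<rfloor>)) = of_int \<lfloor>r\<rfloor> + 1" "of_int \<lfloor>r\<rfloor> + 1 \<noteq> (0::real)" "r \<le> of_int \<lfloor>r\<rfloor> + 1"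
        by linarith+
      have "g r / r \<le> g (of_int \<lfloor>r\<rfloor> + 1) / r" using mono[of r "of_int \<lfloor>r\<rfloor> + 1"] p(3) elim by (intro divide_right_mono) auto
      then show ?case unfolding p(1) using p(2) by simp
    qed
  qed (use lo hi in simp_all)
qed

context subsurface
begin

section \<open>The Hopf argument\<close>

lemma emeasure_nu: "emeasure nu T1H = emeasure lam Fdom"
proof -
  have "T1H \<in> sets nu" using sets.top[of nu] by simp
  then have "emeasure nu T1H = (\<integral>\<^sup>+v. indicator T1H v \<partial>nu)" by simp
  also have "\<dots> = (\<integral>\<^sup>+v. indicator T1H v * indicator Fdom v \<partial>lam)"
    using \<open>T1H \<in> sets nu\<close> by (intro nn_integral_nu borel_measurable_indicator)
  also have "\<dots> = (\<integral>\<^sup>+v. indicator Fdom v \<partial>lam)" by (intro nn_integral_cong) auto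
  finally show ?thesis using Fdom_lam by simp
qed

lemma nu_total: "emeasure nu T1H < \<infinity>" "measure nu T1H = 2 * pi * orbifold_area G"
proof -
  have e: "emeasure nu T1H = emeasure hyp_measure fdom * ennreal (2 * pi)"
    by (simp add: emeasure_nu emeasure_lam_Fdom)
  have "emeasure hyp_measure fdom < \<infinity>" using fin_area emeasure_area by (simp add: finite_area_def)
  then show "emeasure nu T1H < \<infinity>" unfolding e by (simp add: ennreal_mult_less_top)
  have "orbifold_area G = enn2real (emeasure hyp_measure fdom)"
    by (simp add: orbifold_area_def measure_def emeasure_area)
  then show "measure nu T1H = 2 * pi * orbifold_area G"
    unfolding measure_def e by (simp add: enn2real_mult)
qed

sublocale finite_measure nu
  by (rule finite_measureI) (use nu_total(1) in simp)

sublocale invertible_mpt nu "gflow 1" "gflow (- 1)"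
  by unfold_locales (simp_all add: gflow_measurable_nu distr_nu_gflow gflow_add)

lemma crossings_nu [measurable]: "crossings \<in> borel_measurable nu"
  using integrable_crossings by simp

abbreviation S :: "complex \<times> complex \<Rightarrow> nat \<Rightarrow> real" where
  "S v N \<equiv> (\<Sum>k<N. crossings ((gflow 1 ^^ k) v))"

lemma S_nu: "(\<lambda>v. S v N) \<in> borel_measurable nu" by measurable

lemma S_psi [measurable]: "(\<lambda>y. S (psi y 0 0) N) \<in> borel_measurable borel"
  by (rule measurable_compose[OF psi_measurable_lam nu_measurable_lam[OF S_nu]]) simp_all

lemma rate_forward:
  assumes "good_end y"
  shows "freq_above (S (psi y x s)) b \<longleftrightarrow> freq_above (S (psi y 0 0)) b"
    and "freq_above (\<lambda>N. - S (psi y x s) N) b \<longleftrightarrow> freq_above (\<lambda>N. - S (psi y 0 0) N) b"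
proof -
  obtain K where K: "\<And>N. \<bar>S (psi y x s) N - S (psi y 0 0) (N + 0)\<bar> \<le> K"
    using cross_compare[OF assms, of x s 0 0] birkhoff_crossings[OF good_psi[OF assms]] by auto
  show "freq_above (S (psi y x s)) b \<longleftrightarrow> freq_above (S (psi y 0 0)) b"
    "freq_above (\<lambda>N. - S (psi y x s) N) b \<longleftrightarrow> freq_above (\<lambda>N. - S (psi y 0 0) N) b"
    by (rule freq_above_cong[where k = 0 and K = K], rule K, rule freq_above_uminus_cong[where k = 0 and K = K], rule K)
qed

lemma rate_backward:
  assumes "good_end y" "x \<noteq> 0" "good_end (y - 1 / x)"
  shows "freq_above (\<lambda>N. - (\<Sum>k<N. crossings ((gflow (- 1) ^^ Suc k) (psi y x s)))) b
    \<longleftrightarrow> freq_above (\<lambda>N. - S (psi (y - 1 / x) 0 0) N) b"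
proof -
  note g = good_psi[OF assms(1), of x s]
  have "\<bar>(\<Sum>k<N. crossings ((gflow (- 1) ^^ Suc k) (psi y x s))) - S (flip (psi y x s)) (N + 0)\<bar> \<le> 1" for N
    unfolding birkhoff_crossings_backward[OF g] using birkhoff_crossings[OF good_flip[OF g], of N] cross_flip[OF g, of N] by simp
  then have "freq_above (\<lambda>N. - (\<Sum>k<N. crossings ((gflow (- 1) ^^ Suc k) (psi y x s)))) b
    \<longleftrightarrow> freq_above (\<lambda>N. - S (flip (psi y x s)) N) b"
    by (rule freq_above_uminus_cong)
  then show ?thesis using rate_forward(2)[OF assms(3)] by (simp add: flip_psi[OF assms(2)])
qed

text \<open>The null set of \<open>two_sided_null\<close> becomes a condition \<open>P\<close> on
  the forward endpoint together with a condition \<open>Q\<close> on the backward endpoint. Since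
  the endpoints are independent coordinates, a product condition can be null only if one factor is.
  Here \<open>P\<close> says that the upper rate exceeds \<open>b\<close>, and \<open>Q\<close> that
  the lower rate is below \<open>a\<close>.\<close>

lemma rate_dichotomy:
  assumes ab: "a < b"
  shows "(AE y in lborel. \<not> freq_above (S (psi y 0 0)) b) \<or> (AE y in lborel. \<not> freq_above (\<lambda>N. - S (psi y 0 0) N) (- a))"
proof -
  let ?P = "\<lambda>y. freq_above (S (psi y 0 0)) b" and ?Q = "\<lambda>y. freq_above (\<lambda>N. - S (psi y 0 0) N) (- a)"
  let ?R = "\<lambda>v. \<not> (freq_above (S v) b \<and> freq_above (\<lambda>N. - (\<Sum>k<N. crossings ((gflow (- 1) ^^ Suc k) v))) (- a))"
  have "{v \<in> space nu. ?R v} \<in> sets nu" by measurable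
  then have m: "{v \<in> T1H. ?R v} \<in> sets nu" by simp
  have "AE v in lam. ?R v"
    by (rule null_nu_imp_null_lam[OF two_sided_null[OF integrable_crossings ab] m])
  moreover have "{v \<in> T1H. ?R v} \<in> sets lam" using m by (simp add: sets_nu inv_sets_def)
  ultimately have "AE y in lborel. AE x in lborel. AE s in lborel. ?R (psi y x s)" by (simp only: AE_lam_iff)
  then have "AE y in lborel. AE x in lborel. \<not> (?P y \<and> ?Q (y - 1 / x))"
    using AE_good_end
  proof eventually_elim
    case (elim y)
    \<comment> \<open>The backward endpoint must be good as well for its rate to be defined by the
      endpoint alone; only countably many \<open>x\<close> fail.\<close>
    have "countable {x. x \<noteq> 0 \<and> \<not> good_end (y - 1 / x)}"
    proof (rule countable_image_inj_on[of "\<lambda>x. y - 1 / x"])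
      show "countable ((\<lambda>x. y - 1 / x) ` {x. x \<noteq> 0 \<and> \<not> good_end (y - 1 / x)})"
        by (rule countable_subset[OF _ countable_bad_ends]) auto
    qed (auto simp: inj_on_def)
    then have "{x. x \<noteq> 0 \<and> \<not> good_end (y - 1 / x)} \<in> null_sets lborel" by (rule countable_imp_null_set_lborel)
    then have "AE x in lborel. x \<notin> {x. x \<noteq> 0 \<and> \<not> good_end (y - 1 / x)}" by (rule AE_not_in)
    then show ?case using elim(1) AE_lborel_singleton[of 0]
    proof eventually_elim
      case (elim x)
      then have ends: "good_end (y - 1 / x)" by auto
      have eq: "?R (psi y x s) \<longleftrightarrow> \<not> (?P y \<and> ?Q (y - 1 / x))" for s
        by (simp only: rate_forward(1)[OF \<open>good_end y\<close>, of x] rate_backward[OF \<open>good_end y\<close> \<open>x \<noteq> 0\<close> ends])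
      show ?case using \<open>AE s in lborel. ?R (psi y x s)\<close> unfolding eq AE_const_lborel .
    qed
  qed
  then have ae: "AE y in lborel. AE x in lborel. \<not> (?P y \<and> ?Q (y - 1 / x))" .
  show ?thesis
  proof (cases "AE y in lborel. \<not> ?P y")
    case False
    \<comment> \<open>If \<open>P\<close> is not almost nowhere true, some \<open>y\<close> has
      \<open>P y\<close> and also belongs to the set of full measure, and for this single
      \<open>y\<close> almost every backward endpoint violates \<open>Q\<close>.\<close>
    then have "\<exists>y. ?P y \<and> (AE x in lborel. \<not> (?P y \<and> ?Q (y - 1 / x)))"
      using eventually_mono[OF ae, of "\<lambda>y. \<not> ?P y"] by blast
    then obtain y where "?P y" "AE x in lborel. \<not> (?P y \<and> ?Q (y - 1 / x))" by blast
    then have q: "AE x in lborel. \<not> ?Q (y - 1 / x)" by simp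
    have "Measurable.pred borel ?Q" by (rule measurable_freq_above) measurable
    then show ?thesis using AE_backward_endpoint[OF _ q] by blast
  qed simp
qed

lemma AE_lam_of_ends:
  assumes "AE y in lborel. \<not> freq_above (\<lambda>N. \<sigma> * S (psi y 0 0) N) b" "\<sigma> \<in> {1, - 1}"
  shows "AE v in lam. \<not> freq_above (\<lambda>N. \<sigma> * S v N) b"
proof -
  have "{v \<in> space nu. \<not> freq_above (\<lambda>N. \<sigma> * S v N) b} \<in> sets nu" by measurable
  then have "{v \<in> T1H. \<not> freq_above (\<lambda>N. \<sigma> * S v N) b} \<in> sets lam" by (simp add: sets_nu inv_sets_def)
  moreover have "AE y in lborel. AE x in lborel. AE s in lborel. \<not> freq_above (\<lambda>N. \<sigma> * S (psi y x s) N) b"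
    using assms(1) AE_good_end
  proof eventually_elim
    case (elim y)
    have "\<not> freq_above (\<lambda>N. \<sigma> * S (psi y x s) N) b" for x s
      using elim(1) rate_forward[OF elim(2), of x s b] assms(2) by auto
    then show ?case by simp
  qed
  ultimately show ?thesis by (simp only: AE_lam_iff)
qed

lemma AE_nu_of_lam:
  assumes "AE v in lam. freq_above (\<lambda>N. \<sigma> * S v N) b"
  shows "AE v in nu. freq_above (\<lambda>N. \<sigma> * S v N) b"
proof (rule AE_lam_imp_nu[OF assms])
  have "{v \<in> space nu. freq_above (\<lambda>N. \<sigma> * S v N) b} \<in> sets nu" by measurable
  then show "{v \<in> T1H. freq_above (\<lambda>N. \<sigma> * S v N) b} \<in> sets nu" by simp
qed

text \<open>The mean of \<open>crossings\<close> with respect to the normalized measure, by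
  \<open>integral_crossings\<close>.\<close>

definition rate :: real where "rate = 4 * (\<Sum>i<n. l i) / measure nu T1H"

text \<open>A zero measure would make the integral of the crossings vanish, but it is four times the
  positive total length.\<close>

lemma nu_pos: "measure nu T1H > 0" and sum_l_pos: "(\<Sum>i<n. l i) > 0"
proof -
  show s: "(\<Sum>i<n. l i) > 0" using l_pos n1 by (intro sum_pos) (auto simp: lessThan_empty_iff)
  have "measure nu T1H \<noteq> 0"
  proof
    assume "measure nu T1H = 0"
    then have "space nu \<in> null_sets nu" by (intro null_setsI) (simp_all only: emeasure_eq_measure space_nu ennreal_0 sets.top[of nu, unfolded space_nu])
    then have "AE v in nu. v \<notin> space nu" by (rule AE_not_in)
    with AE_space have "AE v in nu. crossings v = 0" by eventually_elim simp
    then have "(\<integral>v. crossings v \<partial>nu) = 0" by (rule integral_eq_zero_AE)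
    then show False using integral_crossings s by simp
  qed
  then show "measure nu T1H > 0" by (simp add: zero_less_measure_iff)
qed

text \<open>If the claim failed, the dichotomy at the midpoint \<open>a\<close> of
  \<open>rate\<close> and \<open>b\<close> would make the lower rate at least \<open>a\<close>
  almost everywhere. By \<open>mean_ge\<close> the mean would then be at least
  \<open>(rate + a) / 2\<close>, which exceeds \<open>rate\<close>.\<close>

lemma rate_upper:
  assumes "b > rate" shows "AE v in lam. \<not> freq_above (S v) b"
proof -
  have "AE y in lborel. \<not> freq_above (S (psi y 0 0)) b"
  proof (rule ccontr)
    define a where "a = (rate + b) / 2"
    assume "\<not> ?thesis"
    then have "AE y in lborel. \<not> freq_above (\<lambda>N. (- 1) * S (psi y 0 0) N) (- a)"
      using rate_dichotomy[of a b] assms by (simp add: a_def)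
    then have "AE v in lam. \<not> freq_above (\<lambda>N. (- 1) * S v N) (- a)" by (rule AE_lam_of_ends) simp
    then have "AE v in lam. freq_above (\<lambda>N. 1 * S v N) ((rate + a) / 2)"
    proof eventually_elim
      case (elim v)
      then show ?case using freq_above_of_not_below[of "S v" a "(rate + a) / 2"] assms by (simp add: a_def)
    qed
    then have "AE v in nu. freq_above (\<lambda>N. 1 * S v N) ((rate + a) / 2)" by (rule AE_nu_of_lam)
    then have "(rate + a) / 2 * measure nu (space nu) \<le> (\<integral>v. crossings v \<partial>nu)"
      by (intro mean_ge[OF integrable_crossings]) simp
    then have "(rate + a) / 2 * measure nu T1H \<le> rate * measure nu T1H" using nu_pos by (simp add: integral_crossings rate_def)
    then have "(rate + a) / 2 \<le> rate" using nu_pos by simp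
    then show False using assms by (simp add: a_def)
  qed
  then show ?thesis using AE_lam_of_ends[of 1 b] by simp
qed

lemma rate_lower:
  assumes "a < rate" shows "AE v in lam. \<not> freq_above (\<lambda>N. - S v N) (- a)"
proof -
  have "AE y in lborel. \<not> freq_above (\<lambda>N. - S (psi y 0 0) N) (- a)"
  proof (rule ccontr)
    define b where "b = (rate + a) / 2"
    assume "\<not> ?thesis"
    then have "AE y in lborel. \<not> freq_above (\<lambda>N. 1 * S (psi y 0 0) N) b"
      using rate_dichotomy[of a b] assms by (simp add: b_def)
    then have "AE v in lam. \<not> freq_above (\<lambda>N. 1 * S v N) b" by (rule AE_lam_of_ends) simp
    then have "AE v in lam. freq_above (\<lambda>N. (- 1) * S v N) (- ((rate + b) / 2))"
    proof eventually_elim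
      case (elim v)
      then show ?case using freq_above_of_not_below[of "\<lambda>N. - S v N" "- b" "- ((rate + b) / 2)"] assms by (simp add: b_def)
    qed
    then have "AE v in nu. freq_above (\<lambda>N. (- 1) * S v N) (- ((rate + b) / 2))" by (rule AE_nu_of_lam)
    then have "- ((rate + b) / 2) * measure nu (space nu) \<le> (\<integral>v. - crossings v \<partial>nu)"
      by (intro mean_ge) (use integrable_crossings in \<open>simp_all add: sum_negf\<close>)
    then have "rate * measure nu T1H \<le> (rate + b) / 2 * measure nu T1H" using nu_pos by (simp add: integral_crossings rate_def)
    then have "rate \<le> (rate + b) / 2" using nu_pos by simp
    then show False using assms by (simp add: b_def)
  qed
  then show ?thesis using AE_lam_of_ends[of "- 1" "- a"] by simp
qed

lemma AE_rate: "AE v in lam. (\<lambda>N. S v N / real N) \<longlonglongrightarrow> rate"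
proof -
  have "AE v in lam. \<forall>k::nat. \<not> freq_above (S v) (rate + 1 / Suc k) \<and> \<not> freq_above (\<lambda>N. - S v N) (- (rate - 1 / Suc k))"
    unfolding AE_all_countable
  proof
    fix k :: nat
    have "1 / real (Suc k) > 0" by simp
    then show "AE v in lam. \<not> freq_above (S v) (rate + 1 / Suc k) \<and> \<not> freq_above (\<lambda>N. - S v N) (- (rate - 1 / Suc k))"
      using rate_upper[of "rate + 1 / Suc k"] rate_lower[of "rate - 1 / Suc k"] by (intro AE_conjI) linarith+
  qed
  then show ?thesis by eventually_elim (intro tendsto_rate, auto)
qed

lemma gside_pt_measurable [measurable]: "(\<lambda>v. gside B (pt v t)) \<in> borel_measurable lam"
proof -
  have "(\<lambda>v. mobius (adj2 B) (pt v t)) \<in> borel_measurable lam"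
    by (rule measurable_compose[OF measurable_compose[OF measurable_gflow measurable_fst_lam] mobius_borel])
  then show ?thesis unfolding gside_def by measurable
qed

lemma AE_generic: "AE v in lam. v \<in> good \<and> fst v \<notin> walls"
proof -
  \<comment> \<open>A geodesic with two points on a lift lies in it, so \<open>good\<close> can be
    tested at times 0 and 1. This turns it into countably many measurable conditions.\<close>
  have g: "v \<in> good \<longleftrightarrow> (\<forall>B\<in>lifts. gside B (pt v 0) \<noteq> 0 \<or> gside B (pt v 1) \<noteq> 0)" if v: "v \<in> T1H" for v
  proof
    assume vg: "v \<in> good"
    show "\<forall>B\<in>lifts. gside B (pt v 0) \<noteq> 0 \<or> gside B (pt v 1) \<noteq> 0"
    proof (rule ballI, rule ccontr)
      fix B assume B: "B \<in> lifts" "\<not> (gside B (pt v 0) \<noteq> 0 \<or> gside B (pt v 1) \<noteq> 0)"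
      then have "pt v 0 \<in> range (gline B)" "pt v 1 \<in> range (gline B)"
        using gside_zero_iff[OF lifts_det[OF B(1)] pt_in_H[OF v], of 0] gside_zero_iff[OF lifts_det[OF B(1)] pt_in_H[OF v], of 1] by auto
      then have "(0::real) = 1" using good_line_once[OF vg, of "range (gline B)"] B(1) unfolding walllines_def by blast
      then show False by simp
    qed
  next
    assume "\<forall>B\<in>lifts. gside B (pt v 0) \<noteq> 0 \<or> gside B (pt v 1) \<noteq> 0"
    then have "\<forall>B\<in>lifts. \<exists>t. gside B (pt v t) \<noteq> 0" by blast
    then show "v \<in> good" using v by (simp add: good_def)
  qed
  have w: "fst v \<notin> walls \<longleftrightarrow> (\<forall>B\<in>lifts. gside B (pt v 0) \<noteq> 0)" if v: "v \<in> T1H" for v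
    using gside_zero_iff[OF lifts_det pt_in_H[OF v, of 0]] by (auto simp: walls_lift)
  have ne: "{v \<in> space lam. gside B (pt v t) \<noteq> 0} \<in> sets lam" for B t
    by (rule borel_measurable_neq[OF gside_pt_measurable borel_measurable_const])
  have "{v \<in> space lam. \<forall>B\<in>lifts. gside B (pt v 0) \<noteq> 0 \<or> gside B (pt v 1) \<noteq> 0} \<in> sets lam"
    "{v \<in> space lam. \<forall>B\<in>lifts. gside B (pt v 0) \<noteq> 0} \<in> sets lam"
    by (rule sets.sets_Collect_countable_All'[OF _ countable_lifts], rule sets.sets_Collect_disj[OF ne ne],
        rule sets.sets_Collect_countable_All'[OF _ countable_lifts], rule ne)
  then have "{v \<in> space lam. \<forall>B\<in>lifts. gside B (pt v 0) \<noteq> 0 \<or> gside B (pt v 1) \<noteq> 0} \<inter> {v \<in> space lam. \<forall>B\<in>lifts. gside B (pt v 0) \<noteq> 0} \<in> sets lam"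
    by (rule sets.Int)
  also have "{v \<in> space lam. \<forall>B\<in>lifts. gside B (pt v 0) \<noteq> 0 \<or> gside B (pt v 1) \<noteq> 0} \<inter> {v \<in> space lam. \<forall>B\<in>lifts. gside B (pt v 0) \<noteq> 0}
    = {v \<in> T1H. v \<in> good \<and> fst v \<notin> walls}"
    unfolding space_lam using g w by blast
  finally have m: "{v \<in> T1H. v \<in> good \<and> fst v \<notin> walls} \<in> sets lam" .
  have "AE y in lborel. AE x in lborel. AE s in lborel. psi y x s \<in> good \<and> fst (psi y x s) \<notin> walls"
    using AE_good_end
  proof eventually_elim
    case (elim y)
    have "AE s in lborel. psi y x s \<in> good \<and> fst (psi y x s) \<notin> walls" for x
    proof -
      \<comment> \<open>Along one good geodesic the base points on walls occur exactly at its
        crossing times, which are countably many values of \<open>s\<close>.\<close>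
      have gx: "psi y x 0 \<in> good" by (rule good_psi[OF elim])
      have "cross (psi y x 0) UNIV = (\<Union>k::nat. cross (psi y x 0) {- real k..real k})"
      proof (intro equalityI subsetI)
        fix t assume t: "t \<in> cross (psi y x 0) UNIV"
        obtain k :: nat where "\<bar>t\<bar> \<le> real k" using real_arch_simple by blast
        then have "t \<in> {- real k..real k}" by auto
        then show "t \<in> (\<Union>k::nat. cross (psi y x 0) {- real k..real k})" using t unfolding cross_def by blast
      qed (auto simp: cross_def)
      then have "countable (cross (psi y x 0) UNIV)"
        using finite_cross_Icc[OF gx] by (simp add: countable_finite)
      then have "cross (psi y x 0) UNIV \<in> null_sets lborel" by (rule countable_imp_null_set_lborel)
      then have "AE s in lborel. s \<notin> cross (psi y x 0) UNIV" by (rule AE_not_in)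
      then show ?thesis by eventually_elim (use good_psi[OF elim] in \<open>auto simp: cross_def gflow_psi\<close>)
    qed
    then show ?case by simp
  qed
  then show ?thesis using AE_lam_iff[OF m] by simp
qed

end

section \<open>Excursions\<close>

text \<open>The combinatorics of one geodesic: \<open>P\<close> will be membership of the point at
  time \<open>t\<close> in \<open>Mt\<close>, and \<open>C\<close> the set of crossing times. At a
  crossing \<open>P\<close> holds at the point itself and on exactly one side of it.\<close>

locale switching =
  fixes P :: "real \<Rightarrow> bool" and C :: "real set"
  assumes C_fin: "\<And>a b. finite (C \<inter> {a..b})"
    and C_0: "0 \<notin> C"
    and switch: "\<And>c. c \<in> C \<Longrightarrow> \<exists>\<delta>>0. \<exists>\<kappa>\<in>{1, - 1}. \<forall>t. \<bar>t - c\<bar> < \<delta> \<longrightarrow> (P t \<longleftrightarrow> \<kappa> * (t - c) \<ge> 0)"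
    and const: "\<And>a b. a \<le> b \<Longrightarrow> C \<inter> {a..b} = {} \<Longrightarrow> P a \<longleftrightarrow> P b"
begin

lemma P_C: "c \<in> C \<Longrightarrow> P c"
  using switch[of c] by force

lemma switch_points:
  assumes "c \<in> C" "a < c" "c < b"
  obtains x y where "a < x" "x < c" "c < y" "y < b" "P x \<longleftrightarrow> \<not> P y"
proof -
  obtain \<delta> \<kappa> where d: "\<delta> > 0" "\<kappa> \<in> {1, - 1}" "\<And>t. \<bar>t - c\<bar> < \<delta> \<Longrightarrow> P t \<longleftrightarrow> \<kappa> * (t - c) \<ge> 0"
    using switch[OF assms(1)] by blast
  obtain x where x: "max a (c - \<delta>) < x" "x < c" using dense[of "max a (c - \<delta>)" c] assms d(1) by auto
  obtain y where y: "c < y" "y < min b (c + \<delta>)" using dense[of c "min b (c + \<delta>)"] assms d(1) by auto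
  have "P x \<longleftrightarrow> \<kappa> * (x - c) \<ge> 0" "P y \<longleftrightarrow> \<kappa> * (y - c) \<ge> 0" using x y by (auto intro!: d(3))
  then have "P x \<longleftrightarrow> \<not> P y" using d(2) x(2) y(1) by auto
  then show ?thesis using that x y by auto
qed

lemma C_isolated:
  obtains d where "d > 0" "\<And>c. c \<in> C \<Longrightarrow> \<bar>c - r\<bar> \<le> d \<Longrightarrow> c = r"
proof -
  have "finite (C \<inter> {r - 1..r + 1} - {r})" using C_fin by blast
  then obtain d where d: "d > 0" "\<And>c. c \<in> C \<inter> {r - 1..r + 1} - {r} \<Longrightarrow> d \<le> dist r c"
    using finite_set_avoid[of "C \<inter> {r - 1..r + 1} - {r}" r] by auto
  show ?thesis
  proof (rule that[of "min 1 (d / 2)"])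
    fix c assume c: "c \<in> C" "\<bar>c - r\<bar> \<le> min 1 (d / 2)"
    show "c = r"
    proof (rule ccontr)
      assume "c \<noteq> r"
      then have "d \<le> dist r c" using c by (intro d(2)) auto
      then have "d \<le> \<bar>c - r\<bar>" by (simp add: dist_real_def abs_minus_commute)
      then show False using c(2) d(1) by simp
    qed
  qed (use d(1) in auto)
qed

lemma P_near:
  assumes "r \<notin> C" obtains d where "d > 0" "\<And>x. \<bar>x - r\<bar> \<le> d \<Longrightarrow> P x \<longleftrightarrow> P r"
proof -
  obtain d where d: "d > 0" "\<And>c. c \<in> C \<Longrightarrow> \<bar>c - r\<bar> \<le> d \<Longrightarrow> c = r" by (rule C_isolated[where r = r]) blast
  show ?thesis
  proof (rule that[OF d(1)])
    fix x assume x: "\<bar>x - r\<bar> \<le> d"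
    have "C \<inter> {min x r..max x r} = {}"
    proof (rule ccontr)
      assume "C \<inter> {min x r..max x r} \<noteq> {}"
      then obtain c where c: "c \<in> C" "min x r \<le> c" "c \<le> max x r" by auto
      then have "\<bar>c - r\<bar> \<le> d" using x by (auto simp: min_def max_def split: if_splits)
      then show False using d(2)[OF c(1)] c(1) assms by simp
    qed
    then have "P (min x r) \<longleftrightarrow> P (max x r)" by (intro const) auto
    then show "P x \<longleftrightarrow> P r" by (auto simp: min_def max_def split: if_splits)
  qed
qed

context
  fixes t s :: "nat \<Rightarrow> real"
  assumes t0: "0 \<le> t 0" and ts: "\<And>i. t i < s i" and st: "\<And>i. s i < t (Suc i)"
    and exc: "{r. 0 \<le> r \<and> P r} = (\<Union>i. {t i..s i})"
begin

lemma t_mono: "strict_mono t"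
  by (rule strict_mono_Suc_iff[THEN iffD2]) (use ts st less_trans in blast)

lemma s_mono: "strict_mono s"
  by (rule strict_mono_Suc_iff[THEN iffD2]) (use ts st less_trans in blast)

lemma t_nonneg: "0 \<le> t i"
  using t0 strict_mono_less_eq[OF t_mono, of 0 i] by simp

lemma not_P_gap:
  assumes "s i < x" "x < t (Suc i)" shows "\<not> P x"
proof
  assume "P x"
  then have "x \<in> {r. 0 \<le> r \<and> P r}" using assms(1) ts[of i] t_nonneg[of i] by simp
  then obtain j where j: "t j \<le> x" "x \<le> s j" unfolding exc by auto
  have "\<not> j \<le> i" using j(2) assms(1) strict_mono_less_eq[OF s_mono, of j i] by linarith
  then have "Suc i \<le> j" by simp
  then have "t (Suc i) \<le> t j" using strict_mono_less_eq[OF t_mono] by blast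
  then show False using j(1) assms(2) by linarith
qed

lemma not_P_before: 
  assumes "0 \<le> x" "x < t 0" shows "\<not> P x"
proof
  assume "P x"
  then have "x \<in> {r. 0 \<le> r \<and> P r}" using assms(1) by simp
  then obtain j where j: "t j \<le> x" "x \<le> s j" unfolding exc by auto
  then show False using strict_mono_less_eq[OF t_mono, of 0 j] assms(2) by simp
qed

lemma P_exc: "t i \<le> x \<Longrightarrow> x \<le> s i \<Longrightarrow> P x"
  using exc by fastforce

text \<open>Inside an excursion \<open>P\<close> holds on both sides, which a crossing forbids; at
  an endpoint \<open>P\<close> is not locally constant, which only a crossing allows. Time 0 is left
  out because a ray starting in \<open>M\<close> begins an excursion without crossing.\<close>

lemma C_endpoints:
  assumes r: "r > 0" shows "r \<in> C \<longleftrightarrow> r \<in> range t \<union> range s"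
proof
  assume c: "r \<in> C"
  then have "r \<in> {r. 0 \<le> r \<and> P r}" using P_C r by simp
  then obtain i where i: "t i \<le> r" "r \<le> s i" unfolding exc by auto
  have "r = t i \<or> r = s i"
  proof (rule ccontr)
    assume "\<not> ?thesis"
    then have "t i < r" "r < s i" using i by auto
    then obtain x y where "t i < x" "x < r" "r < y" "y < s i" "P x \<longleftrightarrow> \<not> P y"
      using switch_points[OF c] by blast
    then show False using P_exc[of i x] P_exc[of i y] by simp
  qed
  then show "r \<in> range t \<union> range s" by blast
next
  assume e: "r \<in> range t \<union> range s"
  show "r \<in> C"
  proof (rule ccontr)
    assume "r \<notin> C"
    then obtain d where d: "d > 0" "\<And>x. \<bar>x - r\<bar> \<le> d \<Longrightarrow> P x \<longleftrightarrow> P r" by (rule P_near) blast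
    from e obtain i where "r = t i \<or> r = s i" by blast
    then show False
    proof
      assume ri: "r = s i"
      obtain x where x: "r < x" "x < min (t (Suc i)) (r + d)"
        using dense[of r "min (t (Suc i)) (r + d)"] d(1) st[of i] ri by auto
      have "\<bar>x - r\<bar> \<le> d" using x by auto
      then show False using d(2)[of x] not_P_gap[of i x] P_exc[of i r] x ri ts[of i] by simp
    next
      assume ri: "r = t i"
      have Pr: "P r" using P_exc[of i r] ts[of i] ri by simp
      define a where "a = (case i of 0 \<Rightarrow> 0 | Suc j \<Rightarrow> s j)"
      have a: "a < r" using r ri st by (cases i) (auto simp: a_def)
      have np: "\<not> P x" if "a < x" "x < r" for x
        using that ri not_P_before[of x] not_P_gap[of _ x] by (cases i) (auto simp: a_def)
      obtain x where x: "max a (r - d) < x" "x < r" using dense[of "max a (r - d)" r] d(1) a by auto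
      have "\<bar>x - r\<bar> \<le> d" using x by auto
      then show False using d(2)[of x] np[of x] Pr x by simp
    qed
  qed
qed

text \<open>Before time \<open>r\<close> the crossings are the positive starts and the ends of
  excursions. Either number falls short of the number of starts by at most one: the first start may
  be 0, and the last excursion may be unfinished.\<close>

lemma excursion_count:
  shows "\<bar>2 * real (card {i. t i < r}) - real (card (C \<inter> {0..<r}))\<bar> \<le> 2"
proof -
  let ?A = "{i. t i < r}" and ?A' = "{i. 0 < t i \<and> t i < r}" and ?B = "{i. s i < r}"
  have s0: "s i > 0" for i using ts[of i] t_nonneg[of i] by simp
  have CI: "C \<inter> {0..<r} = t ` ?A' \<union> s ` ?B"
  proof (intro equalityI subsetI)
    fix x assume x: "x \<in> C \<inter> {0..<r}"
    then have "x > 0" using C_0 by (cases "x = 0") auto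
    then show "x \<in> t ` ?A' \<union> s ` ?B" using C_endpoints[of x] x by auto
  next
    fix x assume x: "x \<in> t ` ?A' \<union> s ` ?B"
    then have "x > 0" "x \<in> range t \<union> range s" "x < r" using s0 by auto
    then show "x \<in> C \<inter> {0..<r}" using C_endpoints[of x] by auto
  qed
  have inj: "inj t" "inj s" using t_mono s_mono by (auto intro: strict_mono_imp_inj_on)
  have "finite (C \<inter> {0..<r})" by (rule finite_subset[OF _ C_fin[of 0 r]]) auto
  then have "finite (t ` ?A')" "finite (s ` ?B)" unfolding CI by auto
  then have fA': "finite ?A'" and fB: "finite ?B"
    using inj by (auto dest!: finite_imageD intro: inj_on_subset)
  have At: "?A \<subseteq> insert 0 ?A'"
  proof
    fix i assume i: "i \<in> ?A"
    have "i = 0 \<or> 0 < t i" using t0 strict_mono_less[OF t_mono, of 0 i] by linarith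
    then show "i \<in> insert 0 ?A'" using i by auto
  qed
  then have fA: "finite ?A" using fA' finite_subset by blast
  have "card ?A \<le> card (insert 0 ?A')" using At fA' by (intro card_mono) auto
  also have "\<dots> \<le> Suc (card ?A')" by (rule card_insert_le_m1) auto
  finally have 1: "card ?A \<le> Suc (card ?A')" .
  have 2: "card ?A' \<le> card ?A" using fA by (intro card_mono) auto
  have 3: "card ?B \<le> card ?A" using fA ts by (intro card_mono) (auto intro: less_trans)
  have "?A \<subseteq> insert 0 (Suc ` ?B)"
  proof
    fix i assume "i \<in> ?A"
    then show "i \<in> insert 0 (Suc ` ?B)" using st by (cases i) (auto intro: less_trans)
  qed
  then have "card ?A \<le> card (insert 0 (Suc ` ?B))" using fB by (intro card_mono) auto
  also have "\<dots> \<le> Suc (card ?B)" using card_insert_le_m1[of "Suc (card ?B)" "Suc ` ?B" 0] card_image_le[OF fB, of Suc] by simp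
  finally have 4: "card ?A \<le> Suc (card ?B)" .
  have "t i \<noteq> s j" for i j
  proof
    assume e: "t i = s j"
    show False
    proof (cases "i \<le> j")
      case True
      then have "t i \<le> t j" using strict_mono_less_eq[OF t_mono] by blast
      then show False using e ts[of j] by simp
    next
      case False
      then have "t (Suc j) \<le> t i" using strict_mono_less_eq[OF t_mono] by (simp add: Suc_le_eq)
      then show False using e st[of j] by simp
    qed
  qed
  then have "t ` ?A' \<inter> s ` ?B = {}" by auto
  then have "card (C \<inter> {0..<r}) = card ?A' + card ?B"
    unfolding CI using fA' fB inj
    by (subst card_Un_disjoint) (auto simp: card_image[OF inj_on_subset[OF _ subset_UNIV]])
  then show ?thesis using 1 2 3 4 by linarith
qed

lemma excursion_rate:
  assumes lim: "((\<lambda>r. real (card (C \<inter> {0..<r})) / r) \<longlongrightarrow> c) at_top"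
  shows "((\<lambda>r. 1 / r * real (card {i. t i < r})) \<longlongrightarrow> c / 2) at_top"
proof -
  have z: "((\<lambda>r. real (card {i. t i < r}) / r - real (card (C \<inter> {0..<r})) / r / 2) \<longlongrightarrow> 0) at_top"
  proof (rule Lim_null_comparison)
    show "\<forall>\<^sub>F r in at_top. norm (real (card {i. t i < r}) / r - real (card (C \<inter> {0..<r})) / r / 2) \<le> 1 / r"
      using eventually_gt_at_top[of 0]
    proof eventually_elim
      case (elim r)
      have "real (card {i. t i < r}) / r - real (card (C \<inter> {0..<r})) / r / 2
        = (2 * real (card {i. t i < r}) - real (card (C \<inter> {0..<r}))) / (2 * r)" using elim by (simp add: field_simps)
      then have "norm (real (card {i. t i < r}) / r - real (card (C \<inter> {0..<r})) / r / 2)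
        = \<bar>2 * real (card {i. t i < r}) - real (card (C \<inter> {0..<r}))\<bar> / (2 * r)" using elim by (simp add: abs_divide)
      also have "\<dots> \<le> 2 / (2 * r)" using elim by (intro divide_right_mono excursion_count) auto
      finally show ?case by simp
    qed
    show "((\<lambda>r::real. 1 / r) \<longlongrightarrow> 0) at_top" by real_asymp
  qed
  have "((\<lambda>r. (real (card {i. t i < r}) / r - real (card (C \<inter> {0..<r})) / r / 2) + real (card (C \<inter> {0..<r})) / r / 2) \<longlongrightarrow> 0 + c / 2) at_top"
    by (rule tendsto_add[OF z tendsto_divide[OF lim tendsto_const]]) simp
  then show ?thesis by simp
qed

end

text \<open>Time 0 and the positive crossing times, listed in increasing order, cut the half-line
  into gaps on which \<open>P\<close> is constant and alternates. The excursions are every second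
  gap, closed up.\<close>

lemma excursions_exist:
  assumes inf: "infinite (C \<inter> {0<..})"
  shows "\<exists>t s. 0 \<le> t 0 \<and> (\<forall>i. t i < s i \<and> s i < t (Suc i)) \<and> {r. 0 \<le> r \<and> P r} = (\<Union>i::nat. {t i..s i})"
proof -
  have nxt: "\<exists>c. (0 \<le> c) \<and> (c \<in> C \<and> x < c \<and> C \<inter> {x<..<c} = {})" if x: "0 \<le> x" for x
  proof -
    have "\<exists>c0\<in>C. x < c0"
    proof (rule ccontr)
      assume "\<not> ?thesis"
      then have "C \<inter> {0<..} \<subseteq> C \<inter> {0..x}" by force
      then show False using inf C_fin finite_subset by blast
    qed
    then obtain c0 where c0: "c0 \<in> C" "x < c0" by blast
    define c where "c = Min (C \<inter> {x<..c0})"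
    have fin: "finite (C \<inter> {x<..c0})" by (rule finite_subset[OF _ C_fin[of x c0]]) auto
    have "c \<in> C \<inter> {x<..c0}" unfolding c_def using c0 by (intro Min_in fin) auto
    moreover have "C \<inter> {x<..<c} = {}"
    proof (rule ccontr)
      assume "C \<inter> {x<..<c} \<noteq> {}"
      then obtain c' where c': "c' \<in> C" "x < c'" "c' < c" by auto
      then have "c' \<in> C \<inter> {x<..c0}" using \<open>c \<in> C \<inter> {x<..c0}\<close> by auto
      then have "c \<le> c'" unfolding c_def by (intro Min_le fin)
      then show False using c' by simp
    qed
    ultimately show ?thesis using x by (intro exI[of _ c]) auto
  qed
  \<comment> \<open>Index 0 is reserved for the time 0, which is no crossing; crossings begin at
    index 1.\<close>
  obtain e :: "nat \<Rightarrow> real" where e0: "e 0 = 0" and e: "\<And>k. e (Suc k) \<in> C \<and> e k < e (Suc k) \<and> C \<inter> {e k<..<e (Suc k)} = {}"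
  proof -
    have "\<exists>f. \<forall>k::nat. (0 \<le> f k \<and> (k = 0 \<longrightarrow> f k = (0::real))) \<and> (f (Suc k) \<in> C \<and> f k < f (Suc k) \<and> C \<inter> {f k<..<f (Suc k)} = {})"
    proof (rule dependent_nat_choice)
      fix x :: real and k :: nat
      assume "0 \<le> x \<and> (k = 0 \<longrightarrow> x = 0)"
      then show "\<exists>y. (0 \<le> y \<and> (Suc k = 0 \<longrightarrow> y = 0)) \<and> (y \<in> C \<and> x < y \<and> C \<inter> {x<..<y} = {})"
        using nxt[of x] by simp
    qed auto
    then show ?thesis using that by blast
  qed
  have mono: "strict_mono e" by (rule strict_mono_Suc_iff[THEN iffD2]) (use e in blast)
  have locate: "\<exists>k. e k \<le> r \<and> r < e (Suc k)" if r: "0 \<le> r" for r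
  proof -
    have "\<exists>k. r < e (Suc k)"
    proof (rule ccontr)
      assume "\<not> ?thesis"
      then have "range (\<lambda>k. e (Suc k)) \<subseteq> C \<inter> {e 0..r}"
        using e strict_mono_less_eq[OF mono] by (force simp: not_less)
      then have "finite (range (\<lambda>k. e (Suc k)))" using C_fin finite_subset by blast
      moreover have "inj (\<lambda>k. e (Suc k))" using strict_mono_eq[OF mono] by (auto simp: inj_on_def)
      ultimately show False using finite_imageD by fastforce
    qed
    then have "r < e (Suc (LEAST k. r < e (Suc k)))" (is "r < e (Suc ?k)") by (rule LeastI_ex)
    moreover have "e ?k \<le> r"
    proof (cases ?k)
      case (Suc j)
      then have "\<not> r < e (Suc j)" by (intro not_less_Least) simp
      then show ?thesis using Suc by simp
    qed (use e0 r in simp)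
    ultimately show ?thesis by blast
  qed
  define Q where "Q k = P ((e k + e (Suc k)) / 2)" for k
  have PQ: "P x \<longleftrightarrow> Q k" if x: "e k < x" "x < e (Suc k)" for x k
  proof -
    let ?m = "(e k + e (Suc k)) / 2"
    have m: "e k < ?m" "?m < e (Suc k)" using e[of k] by auto
    have "e k < min x ?m" "max x ?m < e (Suc k)" using x m by (auto simp: min_def max_def)
    then have "{min x ?m..max x ?m} \<subseteq> {e k<..<e (Suc k)}"
      by (meson atLeastAtMost_iff greaterThanLessThan_iff less_le_trans le_less_trans subsetI)
    then have "C \<inter> {min x ?m..max x ?m} = {}" using e[of k] by blast
    then have "P (min x ?m) \<longleftrightarrow> P (max x ?m)" by (intro const) auto
    then show ?thesis unfolding Q_def by (auto simp: min_def max_def split: if_splits)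
  qed
  have P0: "P 0 \<longleftrightarrow> Q 0"
  proof -
    let ?m = "(e 0 + e (Suc 0)) / 2"
    have m: "0 < ?m" "?m < e (Suc 0)" using e[of 0] e0 by auto
    have "C \<inter> {0..?m} = {}"
    proof (rule ccontr)
      assume "C \<inter> {0..?m} \<noteq> {}"
      then obtain c where c: "c \<in> C" "0 \<le> c" "c \<le> ?m" by auto
      then have "c \<in> C \<inter> {e 0<..<e (Suc 0)}" using C_0 e0 m by (cases "c = 0") auto
      then show False using e[of 0] by blast
    qed
    then show ?thesis unfolding Q_def using m(1) by (intro const) auto
  qed
  have alt: "Q (Suc k) \<longleftrightarrow> \<not> Q k" for k
  proof -
    obtain x y where "e k < x" "x < e (Suc k)" "e (Suc k) < y" "y < e (Suc (Suc k))" "P x \<longleftrightarrow> \<not> P y"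
      using switch_points[of "e (Suc k)" "e k" "e (Suc (Suc k))"] e[of k] e[of "Suc k"] by blast
    then show ?thesis using PQ[of k x] PQ[of "Suc k" y] by blast
  qed
  have par: "Q k \<longleftrightarrow> (even k \<longleftrightarrow> Q 0)" for k by (induction k) (auto simp: alt)
  have PS: "P (e (Suc k))" for k using P_C e by blast
  have Pk: "P x" if "Q k" "e k \<le> x" "x \<le> e (Suc k)" for x k
  proof (cases "x = e k \<or> x = e (Suc k)")
    case True
    then show ?thesis using PS P0 e0 that(1) by (cases k) auto
  next
    case False
    then show ?thesis using PQ[of k x] that by auto
  qed
  \<comment> \<open>The offset is the index of the first gap in which \<open>P\<close> holds: 0 if
    the ray starts in \<open>M\<close>, and 1 otherwise.\<close>
  define d :: nat where "d = (if Q 0 then 0 else 1)"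
  have Qd: "Q (2 * i + d)" for i using par[of "2 * i + d"] by (auto simp: d_def)
  have dQ: "\<exists>i. k = 2 * i + d" if "Q k" for k using that par[of k] by (auto simp: d_def elim!: evenE oddE)
  let ?t = "\<lambda>i. e (2 * i + d)" and ?s = "\<lambda>i. e (Suc (2 * i + d))"
  have "{r. 0 \<le> r \<and> P r} = (\<Union>i. {?t i..?s i})"
  proof (intro equalityI subsetI)
    fix r assume "r \<in> {r. 0 \<le> r \<and> P r}"
    then have r: "0 \<le> r" "P r" by auto
    obtain k where k: "e k \<le> r" "r < e (Suc k)" using locate[OF r(1)] by blast
    show "r \<in> (\<Union>i. {?t i..?s i})"
    proof (cases "Q k")
      case True
      then show ?thesis using dQ[of k] k by force
    next
      case False
      then have rk: "r = e k" using PQ[of k r] k r(2) by fastforce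
      then have "k \<noteq> 0" using P0 r(2) e0 False by (cases k) auto
      then obtain j where j: "k = Suc j" by (cases k) auto
      then have "Q j" using alt False by blast
      then obtain i where "j = 2 * i + d" using dQ by blast
      then show ?thesis using rk j e[of j] by force
    qed
  next
    fix r assume "r \<in> (\<Union>i. {?t i..?s i})"
    then obtain i where "e (2 * i + d) \<le> r" "r \<le> e (Suc (2 * i + d))" by auto
    moreover have "0 \<le> e (2 * i + d)" using strict_mono_less_eq[OF mono, of 0 "2 * i + d"] e0 by simp
    ultimately show "r \<in> {r. 0 \<le> r \<and> P r}" using Pk[OF Qd] by auto
  qed
  moreover have "0 \<le> ?t 0" using strict_mono_less_eq[OF mono, of 0 "2 * 0 + d"] e0 by simp
  moreover have "?t i < ?s i \<and> ?s i < ?t (Suc i)" for i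
    using e[of "2 * i + d"] e[of "Suc (2 * i + d)"] by simp
  ultimately show ?thesis by (intro exI[of _ ?t] exI[of _ ?s]) blast
qed

end

section \<open>Excursions of a generic geodesic ray\<close>

context subsurface
begin

lemma geodesic_ray_eq:
  assumes v: "v \<in> T1H" shows "geodesic_ray (orbit_T1 G v) r = orbit G (pt v r)"
proof -
  have "fst (geodesic_flow r (mobius_T1 A v)) = mobius A (pt v r)" if "A \<in> Gam" for A
    using that v by (simp add: geodesic_flow_eq mobius_T1_in gflow_mobius mobius_T1_fst)
  then show ?thesis unfolding geodesic_ray_def orbit_T1_def orbit_Gam Gam_def[symmetric] by force
qed

text \<open>Near the crossing, membership in \<open>Mt\<close> is decided by the sign of
  \<open>\<sigma> * gside B\<close>, and along the geodesic \<open>gside B\<close> is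
  \<open>k * sinh (t - z)\<close> up to a positive factor with \<open>k\<close> nonzero. The
  direction of the switch is thus the sign of \<open>\<sigma> * k\<close>.\<close>

lemma crossing_switch:
  assumes v: "v \<in> good" and z: "z \<in> cross v UNIV"
  shows "\<exists>\<delta>>0. \<exists>\<kappa>\<in>{1, - 1 :: real}. \<forall>t. \<bar>t - z\<bar> < \<delta> \<longrightarrow> (pt v t \<in> Mt \<longleftrightarrow> \<kappa> * (t - z) \<ge> 0)"
proof -
  note vT = good_T1H[OF v]
  obtain B where B: "B \<in> lifts" "pt v z \<in> range (gline B)" using z by (auto simp: cross_def walls_lift)
  then obtain t0 where t0: "pt v z = gline B t0" by blast
  obtain \<sigma> e where s: "\<sigma> \<in> {1, - 1}" "e > 0"
    "\<And>w. w \<in> \<H> \<inter> ball (gline B t0) e \<Longrightarrow> w \<in> Mt \<longleftrightarrow> \<sigma> * gside B w \<ge> 0"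
    using local_side[OF B(1), of t0] by blast
  obtain k and D :: "real \<Rightarrow> real" where k: "k \<noteq> 0" "\<And>t. D t > 0" "\<And>t. gside B (pt v t) = k * sinh (t - z) / D t"
    using good_crossing[OF v B] by metis
  obtain \<delta> where d: "\<delta> > 0" "\<And>t. \<bar>t - z\<bar> < \<delta> \<Longrightarrow> dist (pt v t) (pt v z) < e"
    using isCont_gflow_point[OF vT, of z] s(2) unfolding continuous_at_eps_delta by (metis dist_real_def)
  have "pt v t \<in> Mt \<longleftrightarrow> sgn (\<sigma> * k) * (t - z) \<ge> 0" if t: "\<bar>t - z\<bar> < \<delta>" for t
  proof -
    have "pt v t \<in> Mt \<longleftrightarrow> \<sigma> * gside B (pt v t) \<ge> 0"
      using d(2)[OF t] t0 pt_in_H[OF vT] by (intro s(3)) (simp add: dist_commute)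
    also have "\<sigma> * gside B (pt v t) = \<sigma> * k * sinh (t - z) / D t" by (simp add: k(3))
    also have "\<dots> \<ge> 0 \<longleftrightarrow> \<sigma> * k * sinh (t - z) \<ge> 0" using k(2)[of t] by (simp add: zero_le_divide_iff)
    also have "\<dots> \<longleftrightarrow> sgn (\<sigma> * k) * (t - z) \<ge> 0"
    proof -
      define m where "m = \<sigma> * k"
      consider "m > 0" | "m < 0" using s(1) k(1) by (fastforce simp: m_def)
      then show ?thesis unfolding m_def[symmetric] by cases (simp_all add: zero_le_mult_iff)
    qed
    finally show ?thesis .
  qed
  moreover have "sgn (\<sigma> * k) \<in> {1, - 1}" using s(1) k(1) by (auto simp: sgn_if)
  ultimately show ?thesis using d(1) by blast
qed

text \<open>Away from the walls, the preimage of the frontier of \<open>M\<close>, a path runs in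
  the union of two disjoint open sets, the preimages of the interior and of the complement of
  \<open>M\<close>; being connected, it stays in one of them.\<close>

lemma Mt_constant:
  assumes v: "v \<in> T1H" and ab: "a \<le> b" and nc: "cross v UNIV \<inter> {a..b} = {}"
  shows "pt v a \<in> Mt \<longleftrightarrow> pt v b \<in> Mt"
proof (rule ccontr)
  assume ne: "\<not> ?thesis"
  let ?X = "orbifold G"
  define A1 where "A1 = {z \<in> \<H>. orbit G z \<in> ?X interior_of M}"
  define A2 where "A2 = {z \<in> \<H>. orbit G z \<in> topspace ?X - M}"
  have op: "openin (top_of_set \<H>) {z \<in> \<H>. orbit G z \<in> U}" if "openin ?X U" for U
    using that by (simp add: orbifold_def openin_quotient_topology)
  have cl: "closedin ?X M" and fr: "?X frontier_of M = (\<Union>i<n. range (\<gamma> i))" using bound by (auto simp: bound_subsurface_def)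
  have oA: "open A1" "open A2" 
    using op[of "?X interior_of M"] op[of "topspace ?X - M"] cl open_H
    by (auto simp: A1_def A2_def openin_open_eq closedin_def)
  have cov: "pt v ` {a..b} \<subseteq> A1 \<union> A2"
  proof
    fix z assume z: "z \<in> pt v ` {a..b}"
    then have zH: "z \<in> \<H>" and zw: "z \<notin> walls" using nc pt_in_H[OF v] by (auto simp: cross_def)
    then have "orbit G z \<notin> ?X frontier_of M" by (simp add: walls_def fr)
    moreover have "orbit G z \<in> topspace ?X" using zH topspace_orbifold by blast
    moreover have "?X frontier_of M = M - ?X interior_of M" using cl by (simp add: frontier_of_def closure_of_closedin)
    ultimately show "z \<in> A1 \<union> A2" using zH by (auto simp: A1_def A2_def)
  qed
  have sub: "A1 \<subseteq> Mt" using interior_of_subset[of ?X M] by (auto simp: A1_def Mt_def)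
  have dis: "A2 \<inter> Mt = {}" by (auto simp: A2_def Mt_def)
  have "connected (pt v ` {a..b})" using continuous_pt[OF v] by (intro connected_continuous_image) auto
  moreover have "A1 \<inter> A2 \<inter> pt v ` {a..b} = {}" using sub dis by blast
  ultimately have "A1 \<inter> pt v ` {a..b} = {} \<or> A2 \<inter> pt v ` {a..b} = {}"
    using oA cov connectedD by blast
  moreover have "pt v a \<in> pt v ` {a..b}" "pt v b \<in> pt v ` {a..b}" using ab by auto
  ultimately show False using ne cov sub dis by blast
qed

lemma switching_cross:
  assumes v: "v \<in> good" and w: "fst v \<notin> walls"
  shows "switching (\<lambda>t. pt v t \<in> Mt) (cross v UNIV)"
proof
  show "finite (cross v UNIV \<inter> {a..b})" for a b
    using finite_cross_Icc[OF v, of a b] by (rule finite_subset[rotated]) (auto simp: cross_def)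
  show "0 \<notin> cross v UNIV" using w gflow_0 good_T1H[OF v] by (simp add: cross_def)
qed (use crossing_switch[OF v] Mt_constant[OF good_T1H[OF v]] in blast)+

lemma excursions:
  assumes v: "v \<in> good" and w: "fst v \<notin> walls" and lim: "(\<lambda>N. S v N / real N) \<longlonglongrightarrow> rate"
  defines "V \<equiv> orbit_T1 G v"
  shows "(\<exists>t s. excursion_parameters M V t s) \<and>
    (\<forall>t s. excursion_parameters M V t s \<longrightarrow>
      ((\<lambda>r. 1 / r * real (card {i. t i < r})) \<longlongrightarrow> (\<Sum>i<n. l i) / (pi * orbifold_area G)) at_top)"
proof -
  interpret switching "\<lambda>t. pt v t \<in> Mt" "cross v UNIV" by (rule switching_cross[OF v w])
  have I: "cross v UNIV \<inter> J = cross v J" for J by (auto simp: cross_def)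
  have lim': "((\<lambda>r. real (card (cross v UNIV \<inter> {0..<r})) / r) \<longlongrightarrow> rate) at_top"
  proof (rule tendsto_mono_real)
    fix x y :: real assume "x \<le> y"
    then show "real (card (cross v UNIV \<inter> {0..<x})) \<le> real (card (cross v UNIV \<inter> {0..<y}))"
      unfolding I by (intro of_nat_mono card_mono finite_cross[OF v, of _ 0 y]) (auto simp: cross_def)
  next
    show "(\<lambda>N. real (card (cross v UNIV \<inter> {0..<real N})) / real N) \<longlonglongrightarrow> rate"
      using lim unfolding birkhoff_crossings[OF v] I .
  qed
  \<comment> \<open>Two crossings per excursion halve the rate
    \<open>4 * l(\<Gamma>) / (2 * pi * area(S))\<close>.\<close>
  have rate: "rate / 2 = (\<Sum>i<n. l i) / (pi * orbifold_area G)" by (simp add: rate_def nu_total(2))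
  have ep: "excursion_parameters M V t s \<longleftrightarrow> 0 \<le> t 0 \<and> (\<forall>i. t i < s i \<and> s i < t (Suc i)) \<and>
     {r. 0 \<le> r \<and> pt v r \<in> Mt} = (\<Union>i. {t i..s i})" for t s
    using pt_in_H[OF good_T1H[OF v]] by (simp add: excursion_parameters_def V_def geodesic_ray_eq[OF good_T1H[OF v]] Mt_def)
  \<comment> \<open>Finitely many crossings would give the rate 0, but the rate is positive; so the
    ray returns forever and the excursions form an infinite sequence.\<close>
  have "infinite (cross v UNIV \<inter> {0<..})"
  proof
    assume fin: "finite (cross v UNIV \<inter> {0<..})"
    let ?K = "real (card (cross v UNIV \<inter> {0<..}))"
    have "card (cross v UNIV \<inter> {0..<r}) \<le> card (cross v UNIV \<inter> {0<..})" for r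
      using C_0 by (intro card_mono fin) (force simp: le_less)
    then have "\<forall>\<^sub>F r in at_top. norm (real (card (cross v UNIV \<inter> {0..<r})) / r) \<le> ?K / r"
      by (intro eventually_mono[OF eventually_gt_at_top[of 0]]) (auto intro!: divide_right_mono)
    moreover have "((\<lambda>r. ?K / r) \<longlongrightarrow> 0) at_top" by (rule tendsto_divide_0[OF tendsto_const filterlim_at_top_imp_at_infinity[OF filterlim_ident]])
    ultimately have "((\<lambda>r. real (card (cross v UNIV \<inter> {0..<r})) / r) \<longlongrightarrow> 0) at_top"
      by (rule Lim_null_comparison)
    then have "rate = 0" using lim' tendsto_unique trivial_limit_at_top_linorder by blast
    then show False using nu_pos sum_l_pos by (simp add: rate_def)
  qed
  then have "\<exists>t s. excursion_parameters M V t s" unfolding ep by (rule excursions_exist)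
  moreover have "((\<lambda>r. 1 / r * real (card {i. t i < r})) \<longlongrightarrow> (\<Sum>i<n. l i) / (pi * orbifold_area G)) at_top"
    if "excursion_parameters M V t s" for t s
    using that unfolding ep rate[symmetric] by (intro excursion_rate[OF _ _ _ _ lim']) auto
  ultimately show ?thesis by blast
qed

end

theorem theorem1:
  fixes G :: "(real^2^2) set set"
    and n :: nat
    and \<gamma> :: "nat \<Rightarrow> real \<Rightarrow> complex set"
    and l :: "nat \<Rightarrow> real"
    and M :: "complex set set"
  assumes "fuchsian_group G"
    and "finite_area G"
    and "n \<ge> 1"
    and "\<And>i. i < n \<Longrightarrow> simple_closed_geodesic G (\<gamma> i) (l i)"
    and "disjoint_family_on (\<lambda>i. range (\<gamma> i)) {..<n}"
    and "bound_subsurface G n \<gamma> M"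
  shows "AE V in liouville G.
    (\<exists>t s. excursion_parameters M V t s) \<and>
    (\<forall>t s. excursion_parameters M V t s \<longrightarrow>
      ((\<lambda>r. 1 / r * real (card {i. t i < r})) \<longlongrightarrow>
        (\<Sum>i<n. l i) / (pi * orbifold_area G)) at_top)"
proof -
  interpret subsurface G n \<gamma> l M using assms by unfold_locales
  show ?thesis
    by (rule AE_liouvilleI, rule AE_mp[OF AE_generic], rule AE_mp[OF AE_rate], rule AE_I2) (use excursions in blast)
qed

end
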